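(* Let $N\ge 3$, let $\Omega\subset\mathbb{R}^N$ be a bounded domain with smooth boundary, let $a:(0,\infty)\to\mathbb{R}$ satisfy the standing assumptions (with $\varphi,\Phi,\Phi_\star,p_0$ defined from $a$ as in the context), and let $q:\overline\Omega\to(0,\infty)$ be continuous, with $q^+=\sup_{x\in\Omega}q(x)$. Assume that $$\lim_{t\to 0}\int_t^1\frac{\Phi^{-1}(s)}{s^{(N+1)/N}}\,ds<\infty\quad\text{and}\quad \lim_{t\to\infty}\int_1^t\frac{\Phi^{-1}(s)}{s^{(N+1)/N}}\,ds=\infty,$$ that $$1<\inf_{x\in\Omega}q(x)<p_0,$$ and that $$\lim_{t\to\infty}\frac{|t|^{q^+}}{\Phi_\star(kt)}=0\quad\text{for all } k>0.$$ Then there exists $\lambda^\star>0$ such that every $\lambda\in(0,\lambda^\star)$ is an eigenvalue of the problem $$-\mathrm{div}(a(|\nabla u|)\nabla u)=\lambda|u|^{q(x)-2}u \ \text{ in }\Omega,\qquad u=0\ \text{ on }\partial\Omega.$$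
   Context: Standing assumptions on $a$. The function $\varphi:\mathbb{R}\to\mathbb{R}$ given by $\varphi(t)=a(|t|)t$ for $t\ne0$ and $\varphi(0)=0$ is an odd, increasing homeomorphism from $\mathbb{R}$ onto $\mathbb{R}$. Put $\Phi(t)=\int_0^t\varphi(s)\,ds$ and $\Phi^\star(t)=\int_0^t\varphi^{-1}(s)\,ds$. It is assumed that $$1<\liminf_{t\to\infty}\frac{t\varphi(t)}{\Phi(t)}\le\sup_{t>0}\frac{t\varphi(t)}{\Phi(t)}<\infty$$ (so $\Phi$ and $\Phi^\star$ satisfy the $\Delta_2$-condition at infinity). Define $p_0=\inf_{t>0}\frac{t\varphi(t)}{\Phi(t)}$ and $p^0=\sup_{t>0}\frac{t\varphi(t)}{\Phi(t)}$. $\Phi^{-1}$ denotes the inverse of $\Phi$ restricted to $[0,\infty)$. The Orlicz-Sobolev conjugate $\Phi_\star$ of $\Phi$ (not to be confused with $\Phi^\star$) is defined on $[0,\infty)$ by $\Phi_\star^{-1}(t)=\int_0^t\frac{\Phi^{-1}(s)}{s^{(N+1)/N}}\,ds$. Spaces. $L_\Phi(\Omega)$ is the Orlicz space of measurable $u:\Omega\to\mathbb{R}$ with $\|u\|_{L_\Phi}=\sup\{\int_\Omega uv\,dx:\int_\Omega\Phi^\star(|v|)\,dx\le1\}<\infty$; an equivalent norm is the Luxemburg norm $\|u\|_\Phi=\inf\{k>0:\int_\Omega\Phi(u(x)/k)\,dx\le1\}$. $W_0^1L_\Phi(\Omega)$ is the corresponding Orlicz-Sobolev space (the closure of $C_0^\infty(\Omega)$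 in the space of $u\in L_\Phi(\Omega)$ whose weak first derivatives lie in $L_\Phi(\Omega)$), with norm $\|u\|=\||\nabla u|\|_\Phi$. Eigenvalues. $\lambda\in\mathbb{R}$ is an eigenvalue of the problem if there exists $u\in W_0^1L_\Phi(\Omega)\setminus\{0\}$ such that $\int_\Omega a(|\nabla u|)\nabla u\cdot\nabla v\,dx-\lambda\int_\Omega|u|^{q(x)-2}uv\,dx=0$ for all $v\in W_0^1L_\Phi(\Omega)$. Here $a(|\nabla u|)\nabla u$ is read as $0$ where $\nabla u=0$, and $|u|^{q(x)-2}u$ as $0$ where $u=0$. *)

theory Defs
  imports "HOL-Analysis.Analysis"
begin

definition partial_deriv :: "'n::finite \<Rightarrow> (real^'n \<Rightarrow> real) \<Rightarrow> real^'n \<Rightarrow> real" where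
  "partial_deriv i f x = frechet_derivative f (at x) (axis i 1)"

primrec C_k :: "nat \<Rightarrow> (real^'n::finite \<Rightarrow> real) \<Rightarrow> bool" where
  "C_k 0 f \<longleftrightarrow> continuous_on UNIV f"
| "C_k (Suc k) f \<longleftrightarrow> f differentiable_on UNIV \<and> (\<forall>i. C_k k (partial_deriv i f))"

definition C_infinity :: "(real^'n::finite \<Rightarrow> real) \<Rightarrow> bool" where
  "C_infinity f \<longleftrightarrow> (\<forall>k. C_k k f)"

definition test_function :: "(real^'n::finite) set \<Rightarrow> (real^'n \<Rightarrow> real) \<Rightarrow> bool" where
  "test_function \<Omega> \<psi> \<longleftrightarrow>
     C_infinity \<psi> \<and> compact (closure {x. \<psi> x \<noteq> 0}) \<and> closure {x. \<psi> x \<noteq> 0} \<subseteq> \<Omega>"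

text \<open>
  Near each boundary point the domain lies, after relabelling and reflecting the coordinate
  axes, strictly above the graph of a smooth function of the remaining coordinates.  A function
  of these coordinates is encoded as a function on the whole space that does not depend on the
  distinguished coordinate \<open>i\<close>; the sign \<open>\<sigma>\<close> is the reflection.
\<close>

definition smooth_boundary :: "(real^'n::finite) set \<Rightarrow> bool" where
  "smooth_boundary \<Omega> \<longleftrightarrow>
     (\<forall>x0 \<in> frontier \<Omega>. \<exists>r>0. \<exists>i. \<exists>\<sigma>\<in>{1, -1}. \<exists>\<gamma>.
        C_infinity \<gamma> \<and> (\<forall>x y. (\<forall>j. j \<noteq> i \<longrightarrow> x $ j = y $ j) \<longrightarrow> \<gamma> x = \<gamma> y) \<and>
        \<Omega> \<inter> ball x0 r = {x \<in> ball x0 r. \<sigma> * x $ i > \<gamma> x})"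

text \<open>
  The coefficient \<open>a\<close> is given on the positive reals only: the value \<open>a 0\<close>
  and the values at negative arguments never matter below.
\<close>

definition phi :: "(real \<Rightarrow> real) \<Rightarrow> real \<Rightarrow> real" where
  "phi a t = (if t = 0 then 0 else a \<bar>t\<bar> * t)"

definition Phi :: "(real \<Rightarrow> real) \<Rightarrow> real \<Rightarrow> real" where
  "Phi a t = (LBINT s=ereal 0..ereal t. phi a s)"

definition Phi_compl :: "(real \<Rightarrow> real) \<Rightarrow> real \<Rightarrow> real" where
  "Phi_compl a t = (LBINT s=ereal 0..ereal t. inv (phi a) s)"

definition standing_assumptions :: "(real \<Rightarrow> real) \<Rightarrow> bool" where
  "standing_assumptions a \<longleftrightarrow>
     (\<forall>t. phi a (- t) = - phi a t) \<and> strict_mono (phi a) \<and>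
     (\<exists>\<psi>. homeomorphism UNIV UNIV (phi a) \<psi>) \<and>
     1 < Liminf at_top (\<lambda>t. ereal (t * phi a t / Phi a t)) \<and>
     Liminf at_top (\<lambda>t. ereal (t * phi a t / Phi a t))
       \<le> (SUP t\<in>{0<..}. ereal (t * phi a t / Phi a t)) \<and>
     (SUP t\<in>{0<..}. ereal (t * phi a t / Phi a t)) < \<infinity>"

definition p_lower :: "(real \<Rightarrow> real) \<Rightarrow> real" where
  "p_lower a = (INF t\<in>{0<..}. t * phi a t / Phi a t)"

definition Phi_inv :: "(real \<Rightarrow> real) \<Rightarrow> real \<Rightarrow> real" where
  "Phi_inv a = inv_into {0..} (Phi a)"

definition sobolev_integrand :: "nat \<Rightarrow> (real \<Rightarrow> real) \<Rightarrow> real \<Rightarrow> real" where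
  "sobolev_integrand N a s = Phi_inv a s / s powr ((real N + 1) / real N)"

text \<open>
  \<open>Phi_star N a\<close>, the Orlicz-Sobolev conjugate in dimension \<open>N\<close>, is the inverse on
  \<open>[0,\<infinity>)\<close> of the primitive of \<open>sobolev_integrand N a\<close> that vanishes at 0;
  it is not to be confused with the complementary function \<open>Phi_compl a\<close>.
\<close>

definition Phi_star :: "nat \<Rightarrow> (real \<Rightarrow> real) \<Rightarrow> real \<Rightarrow> real" where
  "Phi_star N a = inv_into {0..} (\<lambda>t. LBINT s=ereal 0..ereal t. sobolev_integrand N a s)"

text \<open>
  Elements of the function spaces are represented by functions on the whole space whose values
  outside \<open>\<Omega>\<close> are irrelevant.  In the Orlicz norm only those \<open>v\<close> are admitted for
  which the integral of \<open>u v\<close> exists; truncating \<open>v\<close> shows that the supremum is the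
  same (possibly infinite) number as that of the integrals of \<open>\<bar>u v\<bar>\<close> over all
  \<open>v\<close> in the modular unit ball.
\<close>

definition orlicz_norm :: "(real \<Rightarrow> real) \<Rightarrow> (real^'n::finite) set \<Rightarrow> (real^'n \<Rightarrow> real) \<Rightarrow> ereal" where
  "orlicz_norm a \<Omega> u =
     (SUP v \<in> {v \<in> borel_measurable (lebesgue_on \<Omega>).
                 (\<integral>\<^sup>+x. ennreal (Phi_compl a \<bar>v x\<bar>) \<partial>lebesgue_on \<Omega>) \<le> 1 \<and>
                 integrable (lebesgue_on \<Omega>) (\<lambda>x. u x * v x)}.
        ereal (LINT x|lebesgue_on \<Omega>. u x * v x))"

definition orlicz_space :: "(real \<Rightarrow> real) \<Rightarrow> (real^'n::finite) set \<Rightarrow> (real^'n \<Rightarrow> real) set" where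
  "orlicz_space a \<Omega> = {u \<in> borel_measurable (lebesgue_on \<Omega>). orlicz_norm a \<Omega> u < \<infinity>}"

definition luxemburg_norm :: "(real \<Rightarrow> real) \<Rightarrow> (real^'n::finite) set \<Rightarrow> (real^'n \<Rightarrow> real) \<Rightarrow> ereal" where
  "luxemburg_norm a \<Omega> u =
     (INF k \<in> {k. 0 < k \<and> (\<integral>\<^sup>+x. ennreal (Phi a (u x / k)) \<partial>lebesgue_on \<Omega>) \<le> 1}. ereal k)"

definition has_weak_gradient ::
  "(real^'n::finite) set \<Rightarrow> (real^'n \<Rightarrow> real) \<Rightarrow> (real^'n \<Rightarrow> real^'n) \<Rightarrow> bool" where
  "has_weak_gradient \<Omega> u g \<longleftrightarrow>
     (\<forall>K. compact K \<and> K \<subseteq> \<Omega> \<longrightarrow> integrable (lebesgue_on K) u \<and> integrable (lebesgue_on K) g) \<and>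
     (\<forall>\<psi> i. test_function \<Omega> \<psi> \<longrightarrow>
        (LINT x|lebesgue_on \<Omega>. u x * partial_deriv i \<psi> x) =
        - (LINT x|lebesgue_on \<Omega>. g x $ i * \<psi> x))"

text \<open>Weak gradients are unique up to null sets, so the choice made here is immaterial below.\<close>

definition weak_gradient :: "(real^'n::finite) set \<Rightarrow> (real^'n \<Rightarrow> real) \<Rightarrow> real^'n \<Rightarrow> real^'n" where
  "weak_gradient \<Omega> u = (SOME g. has_weak_gradient \<Omega> u g)"

definition W1_space :: "(real \<Rightarrow> real) \<Rightarrow> (real^'n::finite) set \<Rightarrow> (real^'n \<Rightarrow> real) set" where
  "W1_space a \<Omega> =
     {u \<in> orlicz_space a \<Omega>. (\<exists>g. has_weak_gradient \<Omega> u g) \<and>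
        (\<forall>i. (\<lambda>x. weak_gradient \<Omega> u x $ i) \<in> orlicz_space a \<Omega>)}"

definition W1_norm :: "(real \<Rightarrow> real) \<Rightarrow> (real^'n::finite) set \<Rightarrow> (real^'n \<Rightarrow> real) \<Rightarrow> ereal" where
  "W1_norm a \<Omega> u =
     luxemburg_norm a \<Omega> u + luxemburg_norm a \<Omega> (\<lambda>x. norm (weak_gradient \<Omega> u x))"

definition W01_space :: "(real \<Rightarrow> real) \<Rightarrow> (real^'n::finite) set \<Rightarrow> (real^'n \<Rightarrow> real) set" where
  "W01_space a \<Omega> =
     {u \<in> W1_space a \<Omega>. \<forall>\<epsilon>>0. \<exists>\<psi>. test_function \<Omega> \<psi> \<and>
        W1_norm a \<Omega> (\<lambda>x. u x - \<psi> x) < ereal \<epsilon>}"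

text \<open>
  The library conventions yield the required value 0 of \<open>a (norm \<xi>) *\<^sub>R \<xi>\<close> at
  \<open>\<xi> = 0\<close> and of \<open>\<bar>s\<bar> powr (q x - 2) * s\<close> at \<open>s = 0\<close>.  A Bochner integral
  is 0 by convention if the integrand is not integrable, hence the explicit integrability
  conditions.
\<close>

definition is_eigenvalue ::
  "(real \<Rightarrow> real) \<Rightarrow> (real^'n::finite \<Rightarrow> real) \<Rightarrow> (real^'n) set \<Rightarrow> real \<Rightarrow> bool" where
  "is_eigenvalue a q \<Omega> \<mu> \<longleftrightarrow>
     (\<exists>u \<in> W01_space a \<Omega>. \<not> (AE x in lebesgue_on \<Omega>. u x = 0) \<and>
        (\<forall>v \<in> W01_space a \<Omega>.
           integrable (lebesgue_on \<Omega>)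
             (\<lambda>x. (a (norm (weak_gradient \<Omega> u x)) *\<^sub>R weak_gradient \<Omega> u x) \<bullet> weak_gradient \<Omega> v x) \<and>
           integrable (lebesgue_on \<Omega>) (\<lambda>x. \<bar>u x\<bar> powr (q x - 2) * u x * v x) \<and>
           (LINT x|lebesgue_on \<Omega>.
              (a (norm (weak_gradient \<Omega> u x)) *\<^sub>R weak_gradient \<Omega> u x) \<bullet> weak_gradient \<Omega> v x)
           - \<mu> * (LINT x|lebesgue_on \<Omega>. \<bar>u x\<bar> powr (q x - 2) * u x * v x) = 0))"

end

(* Every step is a convex minimisation, and neither an embedding theorem for Orlicz-Sobolev spaces nor
   reflexivity is needed. On Omega, contained in the ball of radius R, the function
   w(x) = 1 + integral over (-R, x_i) of phi^(-1)(R - s) ds is bounded by some m and satisfies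
   -div(a(|grad w|) grad w) = 1. Truncate the power |u|^(q(x)-2) u at |u| = m; for small mu it stays below
   1/mu, the energy J(u) = integral of Phi(|grad u|) - mu G(x, u) is coercive, and comparing a minimiser u with
   u - h(u - w), where h is a smooth increasing function that vanishes on the negative axis, gives u <= w.
   By symmetry |u| <= m, so the truncation is inactive and u solves the original equation. Since q < p_0
   somewhere, J(t psi) < 0 for a bump psi and small t, so u is not 0.
   A minimising sequence converges in L1 after passing to a subsequence (Rellich). To obtain convergence
   of gradients, choose among the functions that are L1-close to the limit and have almost minimal
   energy those that almost minimise the energy of a uniformly convex Young function equivalent to Phi. *)
theory Submission
  imports Defs "HOL-Complex_Analysis.Great_Picard" "HOL-Library.Diagonal_Subsequence"
    "HOL-Computational_Algebra.Polynomial"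
begin

section \<open>Smooth functions\<close>

text \<open>The barrier alone limits the size of \<open>\<mu>\<close>: it solves an equation with
  right-hand side 1, so \<open>\<mu>\<close> times the truncated power has to stay below 1. The
  energy is not convex, since the convex G enters with a minus sign. Minimisation still works
  because G is Lipschitz in u, so that its integral is continuous in L1; once the L1 limit of a
  minimising sequence is fixed, a convex condition on gradients remains. Pairs that satisfy it need
  not have Cauchy gradients, as \<open>\<Phi>\<close> may be almost affine on long stretches. The
  companion \<open>\<Psi>\<close> has the same growth and a quantitative midpoint gap, and near
  minimality for \<open>\<Psi>\<close> makes gradients Cauchy. Membership in the space means
  approximability by smooth functions of compact support. Hence the cut uses a smooth h instead of a
  positive part, and the barrier, which is only C1 because the inverse of \<open>\<phi>\<close> is
  merely continuous, is itself approximated by polynomials.\<close>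

lemma partial_deriv_eq:
  assumes "(f has_derivative f') (at x)"
  shows "partial_deriv i f x = f' (axis i 1)"
  unfolding partial_deriv_def using frechet_derivative_at[OF assms] by simp

lemma C_k_weaken: "C_k (Suc k) f \<Longrightarrow> C_k k f"
proof (induction k arbitrary: f)
  case 0
  then show ?case by (auto simp: differentiable_imp_continuous_on)
qed auto

lemma C_k_SucI:
  assumes "\<And>x. (f has_derivative (\<lambda>h. \<Sum>i\<in>UNIV. h $ i * d i x)) (at x)"
    and "\<And>i. C_k k (d i)"
  shows "C_k (Suc k) f"
proof -
  have "partial_deriv i f = d i" for i
    using assms(1)[THEN partial_deriv_eq, of i]
    by (auto simp: fun_eq_iff axis_def if_distrib[of "\<lambda>x. x * _"] cong: if_cong)
  moreover have "f differentiable_on UNIV"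
    using assms(1) unfolding differentiable_on_def differentiable_def by blast
  ultimately show ?thesis
    using assms(2) by simp
qed

lemma C_k_SucD:
  fixes f :: "real^'n::finite \<Rightarrow> real"
  assumes "C_k (Suc k) f"
  shows "(f has_derivative (\<lambda>h. \<Sum>i\<in>UNIV. h $ i * partial_deriv i f x)) (at x)"
    and "C_k k (partial_deriv i f)"
proof -
  have "f differentiable (at x)"
    using assms by (auto simp: differentiable_on_def)
  then have d: "(f has_derivative frechet_derivative f (at x)) (at x)"
    by (simp add: frechet_derivative_works)
  interpret bounded_linear "frechet_derivative f (at x)"
    using d has_derivative_bounded_linear by blast
  have "frechet_derivative f (at x) = (\<lambda>h. \<Sum>i\<in>UNIV. h $ i * partial_deriv i f x)"
  proof
    fix h :: "real^'n"
    have "(\<Sum>i\<in>UNIV. h $ i *\<^sub>R axis i 1) = h"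
      using basis_expansion[of h] unfolding scalar_mult_eq_scaleR .
    then have "frechet_derivative f (at x) h = frechet_derivative f (at x) (\<Sum>i\<in>UNIV. h $ i *\<^sub>R axis i 1)"
      by (rule arg_cong[OF sym])
    then show "frechet_derivative f (at x) h = (\<Sum>i\<in>UNIV. h $ i * partial_deriv i f x)"
      by (simp only: sum scaleR partial_deriv_def real_scaleR_def)
  qed
  with d show "(f has_derivative (\<lambda>h. \<Sum>i\<in>UNIV. h $ i * partial_deriv i f x)) (at x)"
    by (simp only:)
  show "C_k k (partial_deriv i f)" using assms by simp
qed

lemma C_k_const: "C_k k (\<lambda>x :: real^'n::finite. c)"
proof (induction k arbitrary: c)
  case (Suc k)
  show ?case
  proof (rule C_k_SucI[where d="\<lambda>_ _. 0"])
    show "((\<lambda>x. c) has_derivative (\<lambda>h. \<Sum>i\<in>UNIV. h $ i * 0)) (at x)" for x :: "real^'n"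
      by simp
    show "C_k k (\<lambda>x :: real^'n. 0)" by (rule Suc.IH)
  qed
qed simp

lemma C_k_component: "C_k k (\<lambda>x :: real^'n::finite. x $ i)"
proof (cases k)
  case (Suc k)
  show ?thesis unfolding Suc
  proof (rule C_k_SucI[where d="\<lambda>j x. if j = i then 1 else 0"])
    have "(\<lambda>h :: real^'n. \<Sum>j\<in>UNIV. h $ j * (if j = i then 1 else 0)) = (\<lambda>h. h $ i)"
      by (simp add: if_distrib cong: if_cong)
    then show "((\<lambda>x. x $ i) has_derivative (\<lambda>h. \<Sum>j\<in>UNIV. h $ j * (if j = i then 1 else 0))) (at x)" for x :: "real^'n"
      by (simp only:) (intro bounded_linear_imp_has_derivative bounded_linear_vec_nth)
  qed (rule C_k_const)
qed (simp add: continuous_on_component)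

lemma C_k_add:
  fixes f g :: "real^'n::finite \<Rightarrow> real"
  shows "C_k k f \<Longrightarrow> C_k k g \<Longrightarrow> C_k k (\<lambda>x. f x + g x)"
proof (induction k arbitrary: f g)
  case (Suc k)
  show ?case
  proof (rule C_k_SucI[where d="\<lambda>i x. partial_deriv i f x + partial_deriv i g x"])
    show "((\<lambda>x. f x + g x) has_derivative
        (\<lambda>h. \<Sum>i\<in>UNIV. h $ i * (partial_deriv i f x + partial_deriv i g x))) (at x)" for x
      unfolding distrib_left sum.distrib
      by (intro has_derivative_add C_k_SucD(1)[OF Suc.prems(1)] C_k_SucD(1)[OF Suc.prems(2)])
    show "C_k k (\<lambda>x. partial_deriv i f x + partial_deriv i g x)" for i
      by (intro Suc.IH C_k_SucD(2) Suc.prems)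
  qed
qed (simp add: continuous_on_add)

lemma C_k_mult:
  fixes f g :: "real^'n::finite \<Rightarrow> real"
  shows "C_k k f \<Longrightarrow> C_k k g \<Longrightarrow> C_k k (\<lambda>x. f x * g x)"
proof (induction k arbitrary: f g)
  case (Suc k)
  show ?case
  proof (rule C_k_SucI[where d="\<lambda>i x. f x * partial_deriv i g x + partial_deriv i f x * g x"])
    fix x
    have "(\<lambda>h :: real^'n. \<Sum>i\<in>UNIV. h $ i * (f x * partial_deriv i g x + partial_deriv i f x * g x)) =
      (\<lambda>h. f x * (\<Sum>i\<in>UNIV. h $ i * partial_deriv i g x) + (\<Sum>i\<in>UNIV. h $ i * partial_deriv i f x) * g x)"
      by (simp add: fun_eq_iff distrib_left sum.distrib sum_distrib_left sum_distrib_right mult_ac)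
    then show "((\<lambda>x. f x * g x) has_derivative
        (\<lambda>h. \<Sum>i\<in>UNIV. h $ i * (f x * partial_deriv i g x + partial_deriv i f x * g x))) (at x)"
      by (simp only:) (intro has_derivative_mult C_k_SucD(1)[OF Suc.prems(1)] C_k_SucD(1)[OF Suc.prems(2)])
    show "C_k k (\<lambda>x. f x * partial_deriv i g x + partial_deriv i f x * g x)" for i
      by (intro C_k_add Suc.IH C_k_SucD(2)[OF Suc.prems(1)] C_k_SucD(2)[OF Suc.prems(2)]
          C_k_weaken[OF Suc.prems(1)] C_k_weaken[OF Suc.prems(2)])
  qed
qed (simp add: continuous_on_mult)

text \<open>By the chain rule the partial derivatives are \<open>H (Suc n) (f x)\<close> times those
  of f, so a composition of the same kind reappears with n raised by one. Hence the whole sequence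
  \<open>H\<close> of derivatives is carried along and n is left general in the induction on
  k.\<close>

lemma C_k_compose:
  assumes "\<And>n t. (H n has_real_derivative H (Suc n) t) (at t)"
  shows "C_k k f \<Longrightarrow> C_k k (\<lambda>x. H n (f x))"
proof (induction k arbitrary: n)
  case 0
  have "continuous_on UNIV (H n)"
    using assms by (meson DERIV_isCont continuous_at_imp_continuous_on)
  then show ?case using 0 by (auto intro: continuous_on_compose2)
next
  case (Suc k)
  have "((\<lambda>x. H n (f x)) has_derivative (\<lambda>h. (\<Sum>i\<in>UNIV. h $ i * partial_deriv i f x) * H (Suc n) (f x))) (at x)" for x
    using has_derivative_compose[OF C_k_SucD(1)[OF Suc.prems] assms[unfolded has_field_derivative_def]]
    by (simp add: mult.commute)
  then show ?case
    by (intro C_k_SucI[where d="\<lambda>i x. H (Suc n) (f x) * partial_deriv i f x"]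
          C_k_mult Suc.IH C_k_weaken[OF Suc.prems] C_k_SucD(2)[OF Suc.prems])
       (simp add: sum_distrib_left sum_distrib_right mult_ac)
qed

section \<open>Smooth functions of one real variable: the flat exponential and the cutoff\<close>

definition smooth_real :: "(real \<Rightarrow> real) \<Rightarrow> bool" where
  "smooth_real h \<longleftrightarrow> (\<exists>H. H 0 = h \<and> (\<forall>n t. (H n has_real_derivative H (Suc n) t) (at t)))"

lemma C_infinity_compose: "smooth_real h \<Longrightarrow> C_infinity f \<Longrightarrow> C_infinity (\<lambda>x. h (f x))"
  unfolding C_infinity_def smooth_real_def using C_k_compose[where n=0] by blast

lemma C_infinity_intros:
  "C_infinity (\<lambda>x. c)" "C_infinity (\<lambda>x. x $ i)"
  "C_infinity f \<Longrightarrow> C_infinity g \<Longrightarrow> C_infinity (\<lambda>x. f x + g x)"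
  "C_infinity f \<Longrightarrow> C_infinity g \<Longrightarrow> C_infinity (\<lambda>x. f x * g x)"
  unfolding C_infinity_def by (blast intro: C_k_const C_k_component C_k_add C_k_mult)+

lemma C_infinity_scale: "C_infinity f \<Longrightarrow> C_infinity (\<lambda>x. c * f x)"
  by (intro C_infinity_intros)

lemma C_infinity_diff: "C_infinity f \<Longrightarrow> C_infinity g \<Longrightarrow> C_infinity (\<lambda>x. f x - g x)"
  using C_infinity_intros(3)[OF _ C_infinity_scale[where c="-1"], of f g] by simp

lemma C_infinity_prod: "(\<And>i. i \<in> I \<Longrightarrow> C_infinity (f i)) \<Longrightarrow> C_infinity (\<lambda>x. \<Prod>i\<in>I. f i x)"
  by (induction I rule: infinite_finite_induct) (auto intro: C_infinity_intros)

lemma smooth_real_poly: "smooth_real (poly p)"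
  unfolding smooth_real_def
  by (rule exI[where x="\<lambda>n. poly ((pderiv ^^ n) p)"]) (auto intro: poly_DERIV)

text \<open>Differentiating p(1/t) exp(-1/t) gives (1/t)^2 (p - p')(1/t) exp(-1/t). So flat
  functions of this form are closed under differentiation, and this is the induced operation on
  p.\<close>

definition bump_op :: "real poly \<Rightarrow> real poly" where
  "bump_op p = [:0, 0, 1:] * (p - pderiv p)"

definition bump_fun :: "real poly \<Rightarrow> real \<Rightarrow> real" where
  "bump_fun p t = (if t > 0 then poly p (1 / t) * exp (- (1 / t)) else 0)"

lemma poly_exp_tendsto_0: "((\<lambda>s::real. poly p s * exp (- s)) \<longlongrightarrow> 0) at_top"
proof -
  have "((\<lambda>s::real. (\<Sum>i\<le>degree p. coeff p i * (s ^ i / exp s))) \<longlongrightarrow> (\<Sum>i\<le>degree p. coeff p i * 0)) at_top"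
    by (intro tendsto_intros tendsto_power_div_exp_0)
  then show ?thesis
    by (simp add: poly_altdef exp_minus divide_inverse sum_distrib_right mult.assoc)
qed

lemma bump_fun_has_derivative: "(bump_fun p has_real_derivative bump_fun (bump_op p) t) (at t)"
proof -
  consider "t > 0" | "t < 0" | "t = 0" by linarith
  then show ?thesis
  proof cases
    case 1
    have "((\<lambda>t. poly p (1 / t) * exp (- (1 / t))) has_real_derivative bump_fun (bump_op p) t) (at t)"
      using 1 by (auto intro!: derivative_eq_intros DERIV_chain2[OF poly_DERIV]
          simp: bump_fun_def bump_op_def field_simps power2_eq_square)
    then show ?thesis
      by (rule has_field_derivative_transform_within_open[where S="{0<..}"]) (use 1 in \<open>auto simp: bump_fun_def\<close>)
  next
    case 2
    have "((\<lambda>t. 0) has_real_derivative bump_fun (bump_op p) t) (at t)"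
      using 2 by (auto simp: bump_fun_def)
    then show ?thesis
      by (rule has_field_derivative_transform_within_open[where S="{..<0}"]) (use 2 in \<open>auto simp: bump_fun_def\<close>)
  next
    case 3
    have r: "((\<lambda>h. bump_fun p h / h) \<longlongrightarrow> 0) (at_right 0)"
    proof -
      \<comment> \<open>Dividing by h multiplies the polynomial in 1/h by its variable, which is
        \<open>pCons 0 p\<close>.\<close>
      have "((\<lambda>s::real. poly (pCons 0 p) s * exp (- s)) \<longlongrightarrow> 0) at_top"
        by (rule poly_exp_tendsto_0)
      then have "((\<lambda>h. poly (pCons 0 p) (inverse h) * exp (- inverse h)) \<longlongrightarrow> 0) (at_right (0::real))"
        by (rule filterlim_compose) (rule filterlim_inverse_at_top_right)
      then show ?thesis
        by (rule tendsto_cong[THEN iffD1, rotated])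
           (auto simp: eventually_at_right_field bump_fun_def field_simps intro!: exI[of _ 1])
    qed
    have l: "((\<lambda>h. bump_fun p h / h) \<longlongrightarrow> 0) (at_left 0)"
      by (rule tendsto_cong[THEN iffD1, OF _ tendsto_const])
         (auto simp: eventually_at_left_field bump_fun_def intro!: exI[of _ "-1"])
    have "((\<lambda>h. bump_fun p h / h) \<longlongrightarrow> 0) (at 0)"
      using l r by (simp add: filterlim_at_split)
    then show ?thesis
      using 3 by (simp add: DERIV_def bump_fun_def)
  qed
qed

lemma smooth_real_bump_fun: "smooth_real (bump_fun p)"
  unfolding smooth_real_def
  by (rule exI[where x="\<lambda>n. bump_fun ((bump_op ^^ n) p)"]) (auto intro: bump_fun_has_derivative)

text \<open>The factor \<open>1 / 4\<close> makes the derivative at most 1.\<close>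

definition cutoff :: "real \<Rightarrow> real" where
  "cutoff t = (if t > 0 then exp (- (1 / t)) / 4 else 0)"

definition cutoff' :: "real \<Rightarrow> real" where
  "cutoff' t = (if t > 0 then (1 / t)\<^sup>2 * exp (- (1 / t)) / 4 else 0)"

lemma cutoff_eq: "cutoff = bump_fun [:1/4:]" "cutoff' = bump_fun (bump_op [:1/4:])"
  by (auto simp: cutoff_def cutoff'_def bump_fun_def bump_op_def fun_eq_iff power2_eq_square)

lemma smooth_real_cutoff: "smooth_real cutoff"
  unfolding cutoff_eq by (rule smooth_real_bump_fun)

lemma cutoff_has_derivative: "(cutoff has_real_derivative cutoff' t) (at t)"
  unfolding cutoff_eq by (rule bump_fun_has_derivative)

lemma continuous_cutoff': "continuous_on UNIV cutoff'"
  unfolding cutoff_eq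
  by (meson DERIV_isCont bump_fun_has_derivative continuous_at_imp_continuous_on)

text \<open>Values in [0, 1] let \<open>cutoff'\<close> act as the weight of a convex combination of
  two gradients, and the bound 1 makes \<open>cutoff\<close> a contraction. With s = 1/t the upper
  bound is (s/2)^2 \<le> exp s.\<close>

lemma cutoff'_range: "0 \<le> cutoff' t" "cutoff' t \<le> 1"
proof -
  have "s\<^sup>2 * exp (- s) / 4 \<le> 1" if "s > 0" for s :: real
  proof -
    have "s/2 \<le> exp (s/2)"
      using exp_ge_add_one_self[of "s/2"] by linarith
    then have "(s/2)\<^sup>2 \<le> (exp (s/2))\<^sup>2"
      using that by (intro power_mono) auto
    also have "\<dots> = exp s" by (simp flip: exp_double)
    finally show ?thesis by (simp add: exp_minus field_simps)
  qed
  from this[of "1/t"] show "cutoff' t \<le> 1" by (auto simp: cutoff'_def)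
qed (auto simp: cutoff'_def)

lemma cutoff_props: "0 \<le> cutoff t" "t \<le> 0 \<Longrightarrow> cutoff t = 0" "t > 0 \<Longrightarrow> cutoff t > 0"
  by (auto simp: cutoff_def)

lemma cutoff_lipschitz: "\<bar>cutoff s - cutoff t\<bar> \<le> \<bar>s - t\<bar>"
proof -
  have "norm (cutoff s - cutoff t) \<le> 1 * norm (s - t)"
    by (rule field_differentiable_bound[where S=UNIV])
       (auto intro: has_field_derivative_at_within cutoff_has_derivative simp: cutoff'_range)
  then show ?thesis by simp
qed

section \<open>Continuously differentiable functions and their gradients\<close>

definition gradient :: "(real^'n::finite \<Rightarrow> real) \<Rightarrow> real^'n \<Rightarrow> real^'n" where
  "gradient f x = (\<chi> i. partial_deriv i f x)"

definition C1 :: "(real^'n::finite \<Rightarrow> real) \<Rightarrow> bool" where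
  "C1 f \<longleftrightarrow> (\<forall>x. (f has_derivative (\<lambda>h. gradient f x \<bullet> h)) (at x)) \<and> continuous_on UNIV (gradient f)"

lemma gradient_eqI:
  assumes "(f has_derivative (\<lambda>h. g \<bullet> h)) (at x)"
  shows "gradient f x = g"
  using partial_deriv_eq[OF assms] by (auto simp: gradient_def vec_eq_iff inner_axis)

lemma C1I:
  assumes "\<And>x. (f has_derivative (\<lambda>h. g x \<bullet> h)) (at x)" "continuous_on UNIV g"
  shows "C1 f" "gradient f = g"
proof -
  show g: "gradient f = g" using gradient_eqI[OF assms(1)] by blast
  show "C1 f" unfolding C1_def g using assms by auto
qed

lemma C_infinity_imp_C1:
  assumes "C_infinity f" shows "C1 f"
proof -
  have 1: "C_k (Suc 0) f" using assms by (simp add: C_infinity_def del: C_k.simps)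
  have "(f has_derivative (\<lambda>h. gradient f x \<bullet> h)) (at x)" for x
    using C_k_SucD(1)[OF 1, of x] by (simp add: gradient_def inner_vec_def mult.commute)
  moreover have "continuous_on UNIV (gradient f)"
    using C_k_SucD(2)[OF 1] unfolding gradient_def by (auto intro: continuous_on_vec_lambda)
  ultimately show ?thesis by (auto simp: C1_def)
qed

lemma C1_continuous: "C1 f \<Longrightarrow> continuous_on S f"
  unfolding C1_def by (meson continuous_at_imp_continuous_on has_derivative_continuous)

lemma C1_mult:
  assumes "C1 f" "C1 g"
  shows "C1 (\<lambda>x. f x * g x)" "gradient (\<lambda>x. f x * g x) = (\<lambda>x. f x *\<^sub>R gradient g x + g x *\<^sub>R gradient f x)"
proof -
  have d: "((\<lambda>x. f x * g x) has_derivative (\<lambda>h. (f x *\<^sub>R gradient g x + g x *\<^sub>R gradient f x) \<bullet> h)) (at x)" for x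
    using assms unfolding C1_def by (auto intro!: derivative_eq_intros simp: inner_add_left algebra_simps)
  have c: "continuous_on UNIV (\<lambda>x. f x *\<^sub>R gradient g x + g x *\<^sub>R gradient f x)"
    using assms C1_continuous[OF assms(1)] C1_continuous[OF assms(2)] unfolding C1_def
    by (auto intro!: continuous_intros)
  show "C1 (\<lambda>x. f x * g x)" "gradient (\<lambda>x. f x * g x) = (\<lambda>x. f x *\<^sub>R gradient g x + g x *\<^sub>R gradient f x)"
    by (rule C1I[OF d c])+
qed

lemma C1_linear_comb:
  assumes "C1 f" "C1 g"
  shows "C1 (\<lambda>x. a * f x + b * g x)" "gradient (\<lambda>x. a * f x + b * g x) = (\<lambda>x. a *\<^sub>R gradient f x + b *\<^sub>R gradient g x)"
proof -
  have d: "((\<lambda>x. a * f x + b * g x) has_derivative (\<lambda>h. (a *\<^sub>R gradient f x + b *\<^sub>R gradient g x) \<bullet> h)) (at x)" for x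
    using assms unfolding C1_def by (auto intro!: derivative_eq_intros simp: inner_add_left algebra_simps)
  have c: "continuous_on UNIV (\<lambda>x. a *\<^sub>R gradient f x + b *\<^sub>R gradient g x)"
    using assms unfolding C1_def by (auto intro!: continuous_intros)
  show "C1 (\<lambda>x. a * f x + b * g x)" "gradient (\<lambda>x. a * f x + b * g x) = (\<lambda>x. a *\<^sub>R gradient f x + b *\<^sub>R gradient g x)"
    by (rule C1I[OF d c])+
qed

lemma C1_compose:
  assumes "C1 f" "\<And>t. (h has_real_derivative h' t) (at t)" "continuous_on UNIV h'"
  shows "C1 (\<lambda>x. h (f x))" "gradient (\<lambda>x. h (f x)) = (\<lambda>x. h' (f x) *\<^sub>R gradient f x)"
proof -
  have d: "((\<lambda>x. h (f x)) has_derivative (\<lambda>v. (h' (f x) *\<^sub>R gradient f x) \<bullet> v)) (at x)" for x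
    using has_derivative_compose[of f _ x UNIV h "(*) (h' (f x))"] assms(1) assms(2)[of "f x"]
    unfolding C1_def has_field_derivative_def by auto
  have c: "continuous_on UNIV (\<lambda>x. h' (f x) *\<^sub>R gradient f x)"
    using assms C1_continuous[OF assms(1)] unfolding C1_def
    by (auto intro!: continuous_intros continuous_on_compose2[OF assms(3)])
  show "C1 (\<lambda>x. h (f x))" "gradient (\<lambda>x. h (f x)) = (\<lambda>x. h' (f x) *\<^sub>R gradient f x)"
    by (rule C1I[OF d c])+
qed

lemma C1_component: "C1 (\<lambda>x. x $ i)" "gradient (\<lambda>x. x $ i) = (\<lambda>x. axis i 1)"
proof -
  have "((\<lambda>x. x $ i) has_derivative (\<lambda>h. axis i 1 \<bullet> h)) (at x)" for x :: "real^'a"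
    by (simp add: inner_axis' bounded_linear_imp_has_derivative bounded_linear_vec_nth)
  then show "C1 (\<lambda>x. x $ i)" "gradient (\<lambda>x. x $ i) = (\<lambda>x. axis i 1)"
    by (auto intro!: C1I)
qed

section \<open>Test functions\<close>

lemma test_functionD:
  assumes "test_function \<Omega> \<psi>"
  shows "C1 \<psi>" "x \<notin> \<Omega> \<Longrightarrow> \<psi> x = 0" "x \<notin> \<Omega> \<Longrightarrow> gradient \<psi> x = 0"
proof -
  let ?K = "closure {x. \<psi> x \<noteq> 0}"
  show c1: "C1 \<psi>" using assms by (simp add: test_function_def C_infinity_imp_C1)
  have K: "?K \<subseteq> \<Omega>" using assms by (simp add: test_function_def)
  show "x \<notin> \<Omega> \<Longrightarrow> \<psi> x = 0"
    using K closure_subset[of "{x. \<psi> x \<noteq> 0}"] by auto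
  show "gradient \<psi> x = 0" if "x \<notin> \<Omega>"
  proof (rule gradient_eqI)
    have "((\<lambda>x. 0) has_derivative (\<lambda>h. 0 \<bullet> h)) (at x)" by simp
    then show "(\<psi> has_derivative (\<lambda>h. 0 \<bullet> h)) (at x)"
      by (rule has_derivative_transform_within_open[where s="- ?K"])
         (use K that closure_subset[of "{x. \<psi> x \<noteq> 0}"] in auto)
  qed
qed

lemma test_functionI:
  assumes "C_infinity \<psi>" "compact K" "K \<subseteq> \<Omega>" "\<And>x. x \<notin> K \<Longrightarrow> \<psi> x = 0"
  shows "test_function \<Omega> \<psi>"
proof -
  have "closure {x. \<psi> x \<noteq> 0} \<subseteq> K"
    using assms by (intro closure_minimal) (auto simp: compact_imp_closed)
  then show ?thesis
    using assms compact_Int_closed[OF assms(2) closed_closure[of "{x. \<psi> x \<noteq> 0}"]]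
    by (auto simp: test_function_def Int_absorb1)
qed

lemma test_function_support:
  assumes "test_function \<Omega> \<psi>"
  obtains K where "compact K" "K \<subseteq> \<Omega>" "\<And>x. x \<notin> K \<Longrightarrow> \<psi> x = 0" "\<And>x. x \<notin> K \<Longrightarrow> gradient \<psi> x = 0"
proof
  let ?K = "closure {x. \<psi> x \<noteq> 0}"
  show "compact ?K" "?K \<subseteq> \<Omega>" using assms by (auto simp: test_function_def)
  have "test_function ?K \<psi>" using assms by (auto simp: test_function_def)
  then show "\<And>x. x \<notin> ?K \<Longrightarrow> \<psi> x = 0" "\<And>x. x \<notin> ?K \<Longrightarrow> gradient \<psi> x = 0"
    using test_functionD by blast+
qed

lemma test_function_linear_comb:
  assumes "test_function \<Omega> f" "test_function \<Omega> g"
  shows "test_function \<Omega> (\<lambda>x. a * f x + b * g x)"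
proof -
  obtain K where K: "compact K" "K \<subseteq> \<Omega>" "\<And>x. x \<notin> K \<Longrightarrow> f x = 0"
    by (rule test_function_support[OF assms(1)]) blast
  obtain L where L: "compact L" "L \<subseteq> \<Omega>" "\<And>x. x \<notin> L \<Longrightarrow> g x = 0"
    by (rule test_function_support[OF assms(2)]) blast
  show ?thesis
    by (rule test_functionI[where K="K \<union> L"])
       (use assms K L in \<open>auto simp: test_function_def intro!: C_infinity_intros\<close>)
qed

lemma test_function_zero: "test_function \<Omega> (\<lambda>x. 0)"
  by (rule test_functionI[where K="{}"]) (auto intro: C_infinity_intros)

lemma test_function_bounded:
  assumes "test_function \<Omega> \<psi>"
  obtains B where "\<And>x. \<bar>\<psi> x\<bar> \<le> B" "\<And>x. norm (gradient \<psi> x) \<le> B"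
proof -
  obtain K where K: "compact K" "\<And>x. x \<notin> K \<Longrightarrow> \<psi> x = 0" "\<And>x. x \<notin> K \<Longrightarrow> gradient \<psi> x = 0"
    by (rule test_function_support[OF assms]) blast
  have "continuous_on K \<psi>" "continuous_on K (gradient \<psi>)"
    using test_functionD(1)[OF assms] C1_continuous[of \<psi> K] unfolding C1_def
    by (auto intro: continuous_on_subset)
  then have "bounded (\<psi> ` K)" "bounded (gradient \<psi> ` K)"
    using K(1) by (auto intro!: compact_imp_bounded compact_continuous_image)
  then obtain B1 B2 where B: "\<And>x. x \<in> K \<Longrightarrow> norm (\<psi> x) \<le> B1" "\<And>x. x \<in> K \<Longrightarrow> norm (gradient \<psi> x) \<le> B2"
    unfolding bounded_iff by (metis imageI)
  show ?thesis
  proof (rule that[of "max 0 (max B1 B2)"])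
    show "\<bar>\<psi> x\<bar> \<le> max 0 (max B1 B2)" for x
      using B(1)[of x] K(2)[of x] by (cases "x \<in> K") auto
    show "norm (gradient \<psi> x) \<le> max 0 (max B1 B2)" for x
      using B(2)[of x] K(3)[of x] by (cases "x \<in> K") auto
  qed
qed

section \<open>Integrals of continuously differentiable functions\<close>

lemma integrable_continuous_compact_support:
  fixes f :: "real^'n::finite \<Rightarrow> 'b::euclidean_space"
  assumes "continuous_on UNIV f" "compact K" "\<And>x. x \<notin> K \<Longrightarrow> f x = 0"
  shows "integrable lborel f"
proof -
  have "integrable lborel (\<lambda>x. indicator K x *\<^sub>R f x)"
    by (rule borel_integrable_compact[OF assms(2) continuous_on_subset[OF assms(1)]]) auto
  moreover have "(\<lambda>x. indicator K x *\<^sub>R f x) = f"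
    using assms(3) by (auto simp: fun_eq_iff indicator_def)
  ultimately show ?thesis by simp
qed

lemma integral_translation:
  fixes f :: "real^'n::finite \<Rightarrow> 'b::euclidean_space"
  assumes [measurable]: "f \<in> borel_measurable borel"
  shows "(LINT x|lborel. f (x + y)) = (LINT x|lborel. f x)"
    and "integrable lborel (\<lambda>x. f (x + y)) \<longleftrightarrow> integrable lborel f"
proof -
  have d: "distr lborel borel ((+) y) = (lborel :: (real^'n) measure)"
    by (rule lborel_distr_plus)
  have "(LINT x|distr lborel borel ((+) y). f x) = (LINT x|lborel. f (y + x))"
    by (rule integral_distr) auto
  then show "(LINT x|lborel. f (x + y)) = (LINT x|lborel. f x)"
    by (simp add: d add.commute)
  have "integrable (distr lborel borel ((+) y)) f \<longleftrightarrow> integrable lborel (\<lambda>x. f (y + x))"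
    by (rule integrable_distr_eq) auto
  then show "integrable lborel (\<lambda>x. f (x + y)) \<longleftrightarrow> integrable lborel f"
    by (simp add: d add.commute)
qed

lemma nn_integral_translation:
  fixes f :: "real^'n::finite \<Rightarrow> ennreal"
  assumes [measurable]: "f \<in> borel_measurable borel"
  shows "(\<integral>\<^sup>+x. f (x + y) \<partial>lborel) = (\<integral>\<^sup>+x. f x \<partial>lborel)"
proof -
  have "(\<integral>\<^sup>+x. f x \<partial>distr lborel borel ((+) y)) = (\<integral>\<^sup>+x. f (y + x) \<partial>lborel)"
    by (rule nn_integral_distr) auto
  then show ?thesis
    by (simp add: lborel_distr_plus add.commute)
qed

lemma C1_gradient_zero_outside:
  assumes "C1 F" "closed K" "\<And>x. x \<notin> K \<Longrightarrow> F x = 0" "x \<notin> K"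
  shows "gradient F x = 0"
proof (rule gradient_eqI)
  have "((\<lambda>x. 0) has_derivative (\<lambda>h. 0 \<bullet> h)) (at x)" by simp
  then show "(F has_derivative (\<lambda>h. 0 \<bullet> h)) (at x)"
    by (rule has_derivative_transform_within_open[where s="- K"]) (use assms in auto)
qed

lemma C1_lipschitz:
  fixes F :: "real^'n::finite \<Rightarrow> real"
  assumes "C1 F" "\<And>x. norm (gradient F x) \<le> B"
  shows "\<bar>F x - F y\<bar> \<le> B * norm (x - y)"
proof -
  have "norm (F x - F y) \<le> B * norm (x - y)"
  proof (rule differentiable_bound[where S=UNIV and f'="\<lambda>x h. gradient F x \<bullet> h"])
    show "(F has_derivative (\<lambda>h. gradient F x \<bullet> h)) (at x within UNIV)" for x
      using assms(1) by (auto simp: C1_def)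
    show "onorm (\<lambda>h. gradient F x \<bullet> h) \<le> B" for x
    proof (rule onorm_le)
      fix h
      have "norm (gradient F x \<bullet> h) \<le> norm (gradient F x) * norm h"
        by (simp add: Cauchy_Schwarz_ineq2)
      also have "\<dots> \<le> B * norm h" using assms(2) by (simp add: mult_right_mono)
      finally show "norm (gradient F x \<bullet> h) \<le> B * norm h" .
    qed
  qed auto
  then show ?thesis by simp
qed

lemma C1_along_line:
  assumes "C1 F"
  shows "((\<lambda>t. F (x + t *\<^sub>R y)) has_real_derivative gradient F (x + t *\<^sub>R y) \<bullet> y) (at t)"
proof -
  have "((\<lambda>t. x + t *\<^sub>R y) has_derivative (\<lambda>s. s *\<^sub>R y)) (at t)"
    by (auto intro!: derivative_eq_intros)
  moreover have "(F has_derivative (\<lambda>h. gradient F (x + t *\<^sub>R y) \<bullet> h)) (at (x + t *\<^sub>R y))"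
    using assms by (simp add: C1_def)
  ultimately have "((\<lambda>t. F (x + t *\<^sub>R y)) has_derivative (\<lambda>s. gradient F (x + t *\<^sub>R y) \<bullet> (s *\<^sub>R y))) (at t)"
    by (rule has_derivative_compose)
  then show ?thesis
    by (simp add: has_field_derivative_def mult.commute[of _ "gradient _ _ \<bullet> _"] mult_commute_abs)
qed

text \<open>The translates of \<open>F\<close> all have the same integral, so the difference quotients integrate to 0.\<close>

lemma integral_partial_zero:
  fixes F :: "real^'n::finite \<Rightarrow> real"
  assumes F: "C1 F" and K: "compact K" and 0: "\<And>x. x \<notin> K \<Longrightarrow> F x = 0"
  shows "(LINT x|lborel. gradient F x $ i) = 0"
proof -
  obtain R where R: "K \<subseteq> cball 0 R"
    using compact_imp_bounded[OF K] bounded_subset_ballD[of K 0] ball_subset_cball by (metis subset_trans)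
  have cg: "continuous_on UNIV (gradient F)" and cF: "continuous_on UNIV F"
    using F C1_continuous[OF F] by (auto simp: C1_def)
  have gK: "gradient F x = 0" if "x \<notin> K" for x
    using C1_gradient_zero_outside[OF F compact_imp_closed[OF K] 0 that] by blast
  have "bounded (gradient F ` K)"
    by (intro compact_imp_bounded compact_continuous_image continuous_on_subset[OF cg] K) auto
  then obtain B' where B': "\<And>x. x \<in> K \<Longrightarrow> norm (gradient F x) \<le> B'"
    unfolding bounded_iff by (metis imageI)
  define B where "B = max 0 B'"
  have B: "norm (gradient F x) \<le> B" for x
    using B'[of x] gK[of x] by (cases "x \<in> K") (auto simp: B_def)
  have [measurable]: "F \<in> borel_measurable borel" "gradient F \<in> borel_measurable borel"
    using cF cg by (auto intro: borel_measurable_continuous_onI)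
  have [measurable]: "(\<lambda>x. gradient F x $ i) \<in> borel_measurable borel"
    by (intro borel_measurable_continuous_onI continuous_on_component cg)
  let ?e = "axis i 1 :: real^'n"
  define s where "s n x = (F (x + (1 / real (Suc n)) *\<^sub>R ?e) - F x) * real (Suc n)" for n x
  have "(\<lambda>n. LINT x|lborel. s n x) \<longlonglongrightarrow> (LINT x|lborel. gradient F x $ i)"
  \<comment> \<open>The steps 1/(n+1) have length at most 1, so all quotients vanish outside the
    ball enlarged by 1; the Lipschitz constant B bounds them there.\<close>
  proof (rule integral_dominated_convergence[where w="\<lambda>x. B * indicator (cball 0 (R + 1)) x"])
    show "AE x in lborel. (\<lambda>n. s n x) \<longlonglongrightarrow> gradient F x $ i"
    proof (rule AE_I2)
      fix x
      have "((\<lambda>h. (F (x + h *\<^sub>R ?e) - F x) / h) \<longlongrightarrow> gradient F x $ i) (at 0)"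
        using C1_along_line[OF F, of x ?e 0] by (simp add: DERIV_def inner_axis)
      moreover have "filterlim (\<lambda>n. 1 / real (Suc n)) (at 0) sequentially"
        unfolding filterlim_at using LIMSEQ_inverse_real_of_nat
        by (auto simp: inverse_eq_divide)
      ultimately have "(\<lambda>n. (F (x + (1 / real (Suc n)) *\<^sub>R ?e) - F x) / (1 / real (Suc n))) \<longlonglongrightarrow> gradient F x $ i"
        by (rule filterlim_compose)
      then show "(\<lambda>n. s n x) \<longlonglongrightarrow> gradient F x $ i"
        by (simp add: s_def)
    qed
    show "integrable lborel (\<lambda>x. B * indicator (cball 0 (R + 1)) (x::real^'n))"
      by (intro integrable_mult_right integrable_real_indicator) (use emeasure_bounded_finite[OF bounded_cball[of "0::real^'n" "R + 1"]] in auto)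
    show "AE x in lborel. norm (s n x) \<le> B * indicator (cball 0 (R + 1)) x" for n
    proof (rule AE_I2)
      fix x :: "real^'n"
      let ?t = "(1 / real (Suc n)) *\<^sub>R ?e"
      have nt: "norm ?t = 1 / real (Suc n)" by (simp add: norm_axis_1)
      show "norm (s n x) \<le> B * indicator (cball 0 (R + 1)) x"
      proof (cases "x \<in> cball 0 (R + 1)")
        case True
        have "\<bar>F (x + ?t) - F x\<bar> \<le> B * (1 / real (Suc n))"
          using C1_lipschitz[OF F B, of "x + ?t" x] nt by simp
        then have "\<bar>F (x + ?t) - F x\<bar> * real (Suc n) \<le> B * (1 / real (Suc n)) * real (Suc n)"
          by (rule mult_right_mono) simp
        also have "\<dots> = B" by simp
        finally show ?thesis using True by (simp only: s_def real_norm_def abs_mult abs_of_nat indicator_simps mult_1_right)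
      next
        case False
        have "norm x - norm ?t \<le> norm (x + ?t)" by (rule norm_diff_ineq)
        moreover have "norm ?t \<le> 1" unfolding nt by simp
        moreover have "R + 1 < norm x" using False by simp
        ultimately have "R < norm (x + ?t)" "R < norm x" by linarith+
        then have "x + ?t \<notin> K" "x \<notin> K" using R mem_cball_0 by (metis not_le subsetD)+
        then show ?thesis using 0 False by (simp add: s_def)
      qed
    qed
  qed (simp_all add: s_def)
  moreover have "(LINT x|lborel. s n x) = 0" for n
  proof -
    have i: "integrable lborel F"
      using integrable_continuous_compact_support[OF cF K 0] .
    have "integrable lborel (\<lambda>x. F (x + (1 / real (Suc n)) *\<^sub>R ?e))"
      using i by (simp add: integral_translation(2))
    then show ?thesis
      using i integral_translation(1)[of F "(1 / real (Suc n)) *\<^sub>R ?e"] by (simp add: s_def)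
  qed
  ultimately show ?thesis
    by (simp add: LIMSEQ_const_iff)
qed

section \<open>Translation estimates and the Poincare inequality for convex weights\<close>

definition convex_weight :: "(real \<Rightarrow> real) \<Rightarrow> bool" where
  "convex_weight \<Theta> \<longleftrightarrow> continuous_on UNIV \<Theta> \<and> (\<forall>s t. 0 \<le> s \<longrightarrow> s \<le> t \<longrightarrow> \<Theta> s \<le> \<Theta> t) \<and>
     \<Theta> 0 = 0 \<and> (\<forall>s\<ge>0. \<exists>c\<ge>0. \<forall>t\<ge>0. \<Theta> s + c * (t - s) \<le> \<Theta> t)"

lemma convex_weightD:
  assumes "convex_weight \<Theta>"
  shows "continuous_on UNIV \<Theta>" "0 \<le> s \<Longrightarrow> s \<le> t \<Longrightarrow> \<Theta> s \<le> \<Theta> t" "\<Theta> 0 = 0"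
    "0 \<le> s \<Longrightarrow> 0 \<le> \<Theta> s" "\<Theta> \<in> borel_measurable borel"
  using assms unfolding convex_weight_def
  by (auto intro: borel_measurable_continuous_onI)

lemma convex_weight_abs: "convex_weight abs"
  unfolding convex_weight_def by (auto intro!: continuous_intros exI[of _ 1])

text \<open>Jensen's inequality on the segment from x to x + y: the increment of F is the mean of
  \<nabla>F(x + t y) \<bullet> y over t in [0, 1]. It is obtained by integrating the supporting line
  of \<open>\<Theta>\<close> at the modulus of this mean; \<open>convex_weight\<close> provides such
  lines with a slope c \<ge> 0.\<close>

lemma translation_pointwise:
  fixes F :: "real^'n::finite \<Rightarrow> real"
  assumes \<Theta>: "convex_weight \<Theta>" and F: "C1 F"
  shows "ennreal (\<Theta> \<bar>F (x + y) - F x\<bar>) \<le>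
    (\<integral>\<^sup>+t. ennreal (\<Theta> (norm y * norm (gradient F (x + t *\<^sub>R y)))) * indicator {0..1} t \<partial>lborel)"
proof -
  define g where "g t = gradient F (x + t *\<^sub>R y) \<bullet> y" for t
  define G where "G = F (x + y) - F x"
  have cg: "continuous_on UNIV (gradient F)"
    using F by (auto simp: C1_def)
  have cg': "continuous_on UNIV (\<lambda>t. gradient F (x + t *\<^sub>R y))"
    by (intro continuous_on_compose2[OF cg] continuous_intros) auto
  have cont: "continuous_on UNIV g"
    unfolding g_def by (intro continuous_intros cg')
  have "(LINT t|lborel. g t * indicator {0..1} t) = F (x + 1 *\<^sub>R y) - F (x + 0 *\<^sub>R y)"
    using cont C1_along_line[OF F, of x y] unfolding g_def
    by (intro integral_FTC_Icc_real) (auto simp: continuous_on_eq_continuous_at)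
  then have G: "(LINT t|lborel. g t * indicator {0..1} t) = G"
    by (simp add: G_def)
  have int: "integrable lborel (\<lambda>t. f t * indicator {0..1} t)" if "continuous_on UNIV f" for f :: "real \<Rightarrow> real"
    using borel_integrable_atLeastAtMost'[OF continuous_on_subset[OF that, of "{0..1}"]]
    unfolding set_integrable_def by (simp add: mult.commute)
  have c\<Theta>: "continuous_on UNIV (\<lambda>t. \<Theta> \<bar>g t\<bar>)"
    by (intro continuous_on_compose2[OF convex_weightD(1)[OF \<Theta>]] continuous_intros cont) auto
  obtain c where c: "c \<ge> 0" "\<And>t. t \<ge> 0 \<Longrightarrow> \<Theta> \<bar>G\<bar> + c * (t - \<bar>G\<bar>) \<le> \<Theta> t"
    using \<Theta> unfolding convex_weight_def by (metis abs_ge_zero)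
  \<comment> \<open>Multiplication by \<open>sgn G\<close> turns the mean of g into \<bar>G\<bar>,
    so the linear term integrates to zero.\<close>
  have le: "\<Theta> \<bar>G\<bar> + c * (sgn G * g t - \<bar>G\<bar>) \<le> \<Theta> \<bar>g t\<bar>" for t
  proof -
    have "sgn G * g t \<le> \<bar>g t\<bar>" by (auto simp: sgn_if)
    then show ?thesis using c(2)[of "\<bar>g t\<bar>"] c(1) mult_left_mono[of "sgn G * g t - \<bar>G\<bar>" "\<bar>g t\<bar> - \<bar>G\<bar>" c] by auto
  qed
  have "\<Theta> \<bar>G\<bar> = (LINT t|lborel. (\<Theta> \<bar>G\<bar> - c * \<bar>G\<bar>) * indicator {0..1} t + c * sgn G * (g t * indicator {0..1} t))"
    using int[OF cont] int[of "\<lambda>t. 1"] G by (simp add: abs_sgn mult.commute)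
  also have "\<dots> \<le> (LINT t|lborel. \<Theta> \<bar>g t\<bar> * indicator {0..1} t)"
    using int[OF cont] int[of "\<lambda>t. 1"] int[OF c\<Theta>] le
    by (intro integral_mono) (auto simp: indicator_def algebra_simps)
  finally have "ennreal (\<Theta> \<bar>G\<bar>) \<le> ennreal (LINT t|lborel. \<Theta> \<bar>g t\<bar> * indicator {0..1} t)"
    by (rule ennreal_leI)
  also have "\<dots> = (\<integral>\<^sup>+t. ennreal (\<Theta> \<bar>g t\<bar> * indicator {0..1} t) \<partial>lborel)"
    using int[OF c\<Theta>] convex_weightD(4)[OF \<Theta>] by (intro nn_integral_eq_integral[symmetric]) auto
  also have "\<dots> \<le> (\<integral>\<^sup>+t. ennreal (\<Theta> (norm y * norm (gradient F (x + t *\<^sub>R y)))) * indicator {0..1} t \<partial>lborel)"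
  proof (rule nn_integral_mono)
    fix t
    have "\<bar>g t\<bar> \<le> norm y * norm (gradient F (x + t *\<^sub>R y))"
      unfolding g_def using Cauchy_Schwarz_ineq2[of "gradient F (x + t *\<^sub>R y)" y] by (simp add: mult.commute)
    then have "\<Theta> \<bar>g t\<bar> \<le> \<Theta> (norm y * norm (gradient F (x + t *\<^sub>R y)))"
      using convex_weightD(2)[OF \<Theta>] by auto
    then show "ennreal (\<Theta> \<bar>g t\<bar> * indicator {0..1} t) \<le>
        ennreal (\<Theta> (norm y * norm (gradient F (x + t *\<^sub>R y)))) * indicator {0..1} t"
      by (auto simp: indicator_def intro: ennreal_leI)
  qed
  finally show ?thesis by (simp add: G_def)
qed

text \<open>After the pointwise bound is integrated in x, Fubini and translation invariance make the
  inner integral the same for every t in [0, 1].\<close>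

lemma translation_estimate:
  fixes F :: "real^'n::finite \<Rightarrow> real"
  assumes \<Theta>: "convex_weight \<Theta>" and F: "C1 F"
  shows "(\<integral>\<^sup>+x. ennreal (\<Theta> \<bar>F (x + y) - F x\<bar>) \<partial>lborel) \<le> (\<integral>\<^sup>+x. ennreal (\<Theta> (norm y * norm (gradient F x))) \<partial>lborel)"
proof -
  have cg: "continuous_on UNIV (gradient F)"
    using F by (auto simp: C1_def)
  have "continuous_on UNIV (\<lambda>x. \<Theta> (norm y * norm (gradient F x)))"
    by (intro continuous_on_compose2[OF convex_weightD(1)[OF \<Theta>]] continuous_intros cg) auto
  then have m1: "(\<lambda>x. \<Theta> (norm y * norm (gradient F x))) \<in> borel_measurable borel"
    by (rule borel_measurable_continuous_onI)
  have "continuous_on UNIV (\<lambda>z. \<Theta> (norm y * norm (gradient F (fst z + snd z *\<^sub>R y))))"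
    by (intro continuous_on_compose2[OF convex_weightD(1)[OF \<Theta>]] continuous_on_compose2[OF cg] continuous_intros) auto
  then have "(\<lambda>z. \<Theta> (norm y * norm (gradient F (fst z + snd z *\<^sub>R y)))) \<in> borel_measurable (borel \<Otimes>\<^sub>M borel)"
    unfolding borel_prod by (rule borel_measurable_continuous_onI)
  then have m: "(\<lambda>z. ennreal (\<Theta> (norm y * norm (gradient F (fst z + snd z *\<^sub>R y)))) * indicator {0..1} (snd z))
      \<in> borel_measurable (lborel \<Otimes>\<^sub>M lborel)"
    by measurable
  have "(\<integral>\<^sup>+x. ennreal (\<Theta> \<bar>F (x + y) - F x\<bar>) \<partial>lborel) \<le>
      (\<integral>\<^sup>+x. \<integral>\<^sup>+t. ennreal (\<Theta> (norm y * norm (gradient F (x + t *\<^sub>R y)))) * indicator {0..1} t \<partial>lborel \<partial>lborel)"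
    by (intro nn_integral_mono translation_pointwise assms)
  also have "\<dots> = (\<integral>\<^sup>+t. \<integral>\<^sup>+x. ennreal (\<Theta> (norm y * norm (gradient F (x + t *\<^sub>R y)))) * indicator {0..1} t \<partial>lborel \<partial>lborel)"
    using lborel_pair.Fubini'[of "\<lambda>x t. ennreal (\<Theta> (norm y * norm (gradient F (x + t *\<^sub>R y)))) * indicator {0..1} t"] m
    by (simp add: case_prod_beta)
  also have "\<dots> = (\<integral>\<^sup>+t. (\<integral>\<^sup>+x. ennreal (\<Theta> (norm y * norm (gradient F x))) \<partial>lborel) * indicator {0..1} (t::real) \<partial>lborel)"
  proof (rule nn_integral_cong)
    fix t :: real
    have "(\<lambda>x. ennreal (\<Theta> (norm y * norm (gradient F (x + t *\<^sub>R y))))) \<in> borel_measurable borel"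
      using measurable_compose[OF _ m1, of "\<lambda>x. x + t *\<^sub>R y" borel] by simp
    then show "(\<integral>\<^sup>+x. ennreal (\<Theta> (norm y * norm (gradient F (x + t *\<^sub>R y)))) * indicator {0..1} t \<partial>lborel) =
      (\<integral>\<^sup>+x. ennreal (\<Theta> (norm y * norm (gradient F x))) \<partial>lborel) * indicator {0..1} t"
      using nn_integral_translation[of "\<lambda>x. ennreal (\<Theta> (norm y * norm (gradient F x)))" "t *\<^sub>R y"] m1
      by (simp add: nn_integral_multc)
  qed
  also have "\<dots> = (\<integral>\<^sup>+x. ennreal (\<Theta> (norm y * norm (gradient F x))) \<partial>lborel)"
    by (simp add: nn_integral_cmult_indicator)
  finally show ?thesis .
qed

lemma poincare_lborel:
  fixes F :: "real^'n::finite \<Rightarrow> real"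
  assumes \<Theta>: "convex_weight \<Theta>" and F: "C1 F" and R: "R > 0" "\<And>x. x \<notin> ball 0 R \<Longrightarrow> F x = 0"
  shows "(\<integral>\<^sup>+x. ennreal (\<Theta> \<bar>F x\<bar>) \<partial>lborel) \<le> (\<integral>\<^sup>+x. ennreal (\<Theta> (2 * R * norm (gradient F x))) \<partial>lborel)"
proof -
  \<comment> \<open>A shift of length 2R moves the ball off itself, so on the ball F(x + y) = 0. Any
    coordinate direction will do.\<close>
  define y where "y = (2 * R) *\<^sub>R (axis undefined 1 :: real^'n)"
  have ny: "norm y = 2 * R" using R by (simp add: y_def norm_axis_1)
  have "(\<integral>\<^sup>+x. ennreal (\<Theta> \<bar>F x\<bar>) \<partial>lborel) \<le> (\<integral>\<^sup>+x. ennreal (\<Theta> \<bar>F (x + y) - F x\<bar>) \<partial>lborel)"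
  proof (rule nn_integral_mono)
    fix x :: "real^'n"
    show "ennreal (\<Theta> \<bar>F x\<bar>) \<le> ennreal (\<Theta> \<bar>F (x + y) - F x\<bar>)"
    proof (cases "x \<in> ball 0 R")
      case True
      have "norm y \<le> norm (x + y) + norm x" using norm_triangle_ineq4[of "x + y" x] by simp
      then have "F (x + y) = 0" using True ny by (intro R) auto
      then show ?thesis by simp
    next
      case False
      then show ?thesis using R(2) convex_weightD(3)[OF \<Theta>] by simp
    qed
  qed
  also have "\<dots> \<le> (\<integral>\<^sup>+x. ennreal (\<Theta> (2 * R * norm (gradient F x))) \<partial>lborel)"
    using translation_estimate[OF \<Theta> F, of y] by (simp add: ny)
  finally show ?thesis .
qed

section \<open>The fundamental lemma of the calculus of variations\<close>

text \<open>\<open>bump_fun 1\<close> is exp(-1/t) for t > 0. Dilated by n it tends to the indicator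
  of the positive half-line, so the product over all faces tends to the indicator of the open
  box.\<close>

lemma box_approximation:
  fixes a b :: "real^'n::finite"
  assumes "cbox a b \<subseteq> \<Omega>"
  obtains \<psi> where "\<And>n. test_function \<Omega> (\<psi> n)" "\<And>n x. 0 \<le> \<psi> n x" "\<And>n x. \<psi> n x \<le> 1"
    "\<And>n x. x \<notin> cbox a b \<Longrightarrow> \<psi> n x = 0" "\<And>x. (\<lambda>n. \<psi> n x) \<longlonglongrightarrow> indicator (box a b) x"
proof -
  let ?\<beta> = "bump_fun 1"
  have \<beta>: "0 \<le> ?\<beta> t" "?\<beta> t \<le> 1" "t \<le> 0 \<Longrightarrow> ?\<beta> t = 0" for t
    by (auto simp: bump_fun_def)
  have lim: "(\<lambda>n. ?\<beta> (real n * t)) \<longlonglongrightarrow> (if t > 0 then 1 else 0)" for t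
  proof (cases "t > 0")
    case True
    have "(\<lambda>n. exp (- ((1 / t) * inverse (real n)))) \<longlonglongrightarrow> exp (- ((1 / t) * 0))"
      by (intro tendsto_intros lim_inverse_n)
    moreover have "eventually (\<lambda>n. exp (- ((1 / t) * inverse (real n))) = ?\<beta> (real n * t)) sequentially"
      using eventually_gt_at_top[of 0] by eventually_elim (use True in \<open>auto simp: bump_fun_def field_simps\<close>)
    ultimately show ?thesis using True by (auto intro: Lim_transform_eventually)
  next
    case False
    then have "?\<beta> (real n * t) = 0" for n by (intro \<beta>) (simp add: mult_nonneg_nonpos)
    then show ?thesis using False by simp
  qed
  define \<psi> where "\<psi> n x = (\<Prod>i\<in>UNIV. ?\<beta> (real n * (x $ i - a $ i)) * ?\<beta> (real n * (b $ i - x $ i)))" for n and x :: "real^'n"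
  have out: "\<psi> n x = 0" if "x $ i \<le> a $ i \<or> b $ i \<le> x $ i" for n x i
  proof -
    have "?\<beta> (real n * (x $ i - a $ i)) * ?\<beta> (real n * (b $ i - x $ i)) = 0"
      using that \<beta>(3) by (auto simp: mult_nonneg_nonpos)
    then show ?thesis unfolding \<psi>_def by (meson UNIV_I finite prod_zero)
  qed
  show ?thesis
  proof
    have "C_infinity (\<lambda>x :: real^'n. ?\<beta> (real n * (x $ i - a $ i)))" "C_infinity (\<lambda>x :: real^'n. ?\<beta> (real n * (b $ i - x $ i)))" for n i
      by (rule C_infinity_compose[OF smooth_real_bump_fun],
          rule C_infinity_scale, rule C_infinity_diff, rule C_infinity_intros, rule C_infinity_intros)+
    then have "C_infinity (\<psi> n)" for n
      unfolding \<psi>_def by (intro C_infinity_prod C_infinity_intros(4))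
    moreover show "\<psi> n x = 0" if x: "x \<notin> cbox a b" for n x
    proof -
      obtain i where "\<not> (a $ i \<le> x $ i \<and> x $ i \<le> b $ i)"
        using x unfolding mem_box_cart by blast
      then have "x $ i \<le> a $ i \<or> b $ i \<le> x $ i" by linarith
      then show ?thesis by (rule out)
    qed
    ultimately show "test_function \<Omega> (\<psi> n)" for n
      using assms by (intro test_functionI[where K="cbox a b"]) auto
    show "0 \<le> \<psi> n x" for n x
      unfolding \<psi>_def by (intro prod_nonneg ballI mult_nonneg_nonneg \<beta>)
    show "\<psi> n x \<le> 1" for n x
      unfolding \<psi>_def by (intro prod_le_1 conjI mult_nonneg_nonneg mult_le_one \<beta>)
    show "(\<lambda>n. \<psi> n x) \<longlonglongrightarrow> indicator (box a b) x" for x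
    proof -
      have "(\<lambda>n. \<psi> n x) \<longlonglongrightarrow> (\<Prod>i\<in>UNIV. (if x $ i - a $ i > 0 then 1 else 0) * (if b $ i - x $ i > 0 then 1 else 0))"
        unfolding \<psi>_def by (intro tendsto_prod tendsto_mult lim)
      also have "(\<Prod>i\<in>UNIV. (if x $ i - a $ i > 0 then 1 else 0) * (if b $ i - x $ i > 0 then 1 else 0)) = (indicator (box a b) x :: real)"
      proof (cases "x \<in> box a b")
        case False
        then obtain i where "\<not> (a $ i < x $ i \<and> x $ i < b $ i)" by (auto simp: mem_box_cart)
        then have "(\<Prod>i\<in>UNIV. (if x $ i - a $ i > 0 then 1 else 0) * (if b $ i - x $ i > 0 then 1 else 0)) = (0::real)"
          by (intro prod_zero) (auto intro!: bexI[of _ i])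
        then show ?thesis using False by simp
      qed (simp add: mem_box_cart)
      finally show ?thesis .
    qed
  qed
qed

text \<open>The positive and the negative part of f define two finite measures that agree on open
  boxes, an intersection-stable generator of the Borel sets. Hence the two parts agree almost
  everywhere.\<close>

lemma AE_zero_if_box_integrals_zero:
  fixes f :: "real^'n::finite \<Rightarrow> real"
  assumes f: "integrable lebesgue f" and 0: "\<And>l u. (LINT x|lebesgue. f x * indicator (box l u) x) = 0"
  shows "AE x in lebesgue. f x = 0"
proof -
  \<comment> \<open>The comparison of measures takes place on Borel sets, so the Lebesgue measurable
    f is first replaced by a Borel function.\<close>
  obtain h where h[measurable]: "h \<in> borel_measurable lborel" and fh: "AE x in lborel. f x = h x"
    using completion_ex_borel_measurable_real[of f lborel] f by auto
  have fh': "AE x in lebesgue. f x = h x"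
    using fh by (rule AE_completion)
  have [measurable]: "h \<in> borel_measurable lebesgue"
    using h by (rule measurable_completion)
  have "integrable lebesgue h"
    using f fh' by (subst integrable_cong_AE[of h _ f]) auto
  then have ih: "integrable lborel h" by (simp add: integrable_completion)
  have h0: "(LINT x|lborel. h x * indicator X x) = 0" if "X \<in> range (\<lambda>(l, u). box l u)" for X
  proof -
    from that obtain l u where X: "X = box l u" by auto
    have "(LINT x|lborel. h x * indicator X x) = (LINT x|lebesgue. h x * indicator X x)"
      unfolding X by (subst integral_completion) auto
    also have "\<dots> = (LINT x|lebesgue. f x * indicator X x)"
    proof (rule integral_cong_AE)
      have mf: "f \<in> borel_measurable lebesgue" using f by auto
      have X': "X \<in> sets lebesgue" unfolding X by simp
      show "(\<lambda>x. h x * indicator X x) \<in> borel_measurable lebesgue" "(\<lambda>x. f x * indicator X x) \<in> borel_measurable lebesgue"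
        using mf X' \<open>h \<in> borel_measurable lebesgue\<close>
        by (auto intro!: borel_measurable_times borel_measurable_indicator)
      show "AE x in lebesgue. h x * indicator X x = f x * indicator X x"
        using fh' by eventually_elim simp
    qed
    finally show ?thesis using 0 X by simp
  qed
  \<comment> \<open>\<open>ennreal\<close> sends negative numbers to 0, so the two densities are the
    positive and the negative part of h.\<close>
  let ?M = "density lborel (\<lambda>x. ennreal (h x))" and ?N = "density lborel (\<lambda>x. ennreal (- h x))"
  have fin: "emeasure ?M X \<noteq> \<infinity>" for X
  proof -
    have "emeasure ?M X \<le> emeasure ?M (space ?M)"
      by (rule emeasure_space)
    also have "\<dots> = (\<integral>\<^sup>+x. ennreal (h x) \<partial>lborel)" by (simp add: emeasure_density)
    also have "\<dots> < \<infinity>" using ih by (simp add: real_integrable_def less_top)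
    finally show ?thesis by simp
  qed
  have "?M = ?N"
  proof (rule measure_eqI_generator_eq)
    let ?E = "range (\<lambda>(a, b). box a b :: (real^'n) set)"
    show "Int_stable ?E" by (auto simp: Int_stable_def box_Int_box)
    show "?E \<subseteq> Pow UNIV" "sets ?M = sigma_sets UNIV ?E" "sets ?N = sigma_sets UNIV ?E"
      by (simp_all add: borel_eq_box)
    let ?A = "\<lambda>n::nat. box (- (real n *\<^sub>R One)) (real n *\<^sub>R One) :: (real^'n) set"
    show "range ?A \<subseteq> ?E" "(\<Union>i. ?A i) = UNIV"
      unfolding UN_box_eq_UNIV by auto
    show "emeasure ?M (?A i) \<noteq> \<infinity>" for i by (rule fin)
    fix X assume X: "X \<in> ?E"
    then have [measurable]: "X \<in> sets borel" by auto
    have i: "integrable lborel (\<lambda>x. h x * indicator X x)"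
      using ih by (rule integrable_mult_indicator[of X, where f=h, unfolded real_scaleR_def mult.commute[of "indicator X _"], rotated]) simp
    have "(\<integral>\<^sup>+x. ennreal (h x) * indicator X x \<partial>lborel) = (\<integral>\<^sup>+x. ennreal (h x * indicator X x) \<partial>lborel)"
      "(\<integral>\<^sup>+x. ennreal (- h x) * indicator X x \<partial>lborel) = (\<integral>\<^sup>+x. ennreal (- (h x * indicator X x)) \<partial>lborel)"
      by (auto intro!: nn_integral_cong simp: indicator_def)
    moreover have "(\<integral>\<^sup>+x. ennreal (h x * indicator X x) \<partial>lborel) = (\<integral>\<^sup>+x. ennreal (- (h x * indicator X x)) \<partial>lborel)"
    proof -
      let ?p = "\<integral>\<^sup>+x. ennreal (h x * indicator X x) \<partial>lborel" and ?n = "\<integral>\<^sup>+x. ennreal (- (h x * indicator X x)) \<partial>lborel"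
      have p: "?p < top" and n: "?n < top" using i by (auto simp: real_integrable_def less_top)
      note pn = ennreal_enn2real[OF p] ennreal_enn2real[OF n]
      have "enn2real ?p - enn2real ?n = 0"
        using real_lebesgue_integral_def[OF i] unfolding h0[OF X] by (rule sym)
      then have "enn2real ?p = enn2real ?n" by (rule right_minus_eq[THEN iffD1])
      then have "ennreal (enn2real ?p) = ennreal (enn2real ?n)" by (rule arg_cong)
      then show ?thesis unfolding pn .
    qed
    ultimately show "emeasure ?M X = emeasure ?N X"
      by (simp add: emeasure_density)
  qed
  then have "AE x in lborel. ennreal (h x) = ennreal (- h x)"
    by (subst (asm) sigma_finite_measure.density_unique_iff[OF lborel.sigma_finite_measure_axioms]) auto
  then have "AE x in lborel. h x = 0"
    by eventually_elim (smt (verit) ennreal_eq_0_iff ennreal_inj)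
  then have "AE x in lborel. f x = 0" using fh by eventually_elim simp
  then show ?thesis by (rule AE_completion)
qed

text \<open>Indicators of boxes whose closure lies in \<open>\<Omega>\<close> are bounded pointwise
  limits of test functions, so g integrates to zero over all of them. Countably many closed boxes
  cover \<open>\<Omega>\<close>.\<close>

lemma du_bois_reymond:
  fixes g :: "real^'n::finite \<Rightarrow> real"
  assumes \<Omega>: "open \<Omega>"
    and int: "\<And>K. compact K \<Longrightarrow> K \<subseteq> \<Omega> \<Longrightarrow> integrable (lebesgue_on K) g"
    and 0: "\<And>\<psi>. test_function \<Omega> \<psi> \<Longrightarrow> (LINT x|lebesgue_on \<Omega>. g x * \<psi> x) = 0"
  shows "AE x in lebesgue_on \<Omega>. g x = 0"
proof -
  have \<Omega>s: "\<Omega> \<in> sets lebesgue" using \<Omega> by (simp add: borel_open)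
  have box0: "(LINT x|lebesgue. g x * indicator (box a b) x) = 0"
    and ibox: "integrable lebesgue (\<lambda>x. g x * indicator (box a b) x)" if ab: "cbox a b \<subseteq> \<Omega>" for a b
  proof -
    obtain \<psi> where \<psi>: "\<And>n. test_function \<Omega> (\<psi> n)" "\<And>n x. 0 \<le> \<psi> n x" "\<And>n x. \<psi> n x \<le> 1"
      "\<And>n x. x \<notin> cbox a b \<Longrightarrow> \<psi> n x = 0" "\<And>x. (\<lambda>n. \<psi> n x) \<longlonglongrightarrow> indicator (box a b) x"
      using box_approximation[OF ab] by metis
    have i: "integrable lebesgue (\<lambda>x. g x * indicator (cbox a b) x)"
      using int[OF compact_cbox ab] by (simp add: integrable_restrict_space mult.commute)
    have m\<psi>: "\<psi> n \<in> borel_measurable lebesgue" for n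
      using borel_measurable_continuous_onI[OF C1_continuous[OF test_functionD(1)[OF \<psi>(1)]]]
      by (intro measurable_completion) simp
    have mg: "(\<lambda>x. g x * indicator (cbox a b) x) \<in> borel_measurable lebesgue" using i by auto
    have eq: "g x * indicator (box a b) x = (g x * indicator (cbox a b) x) * indicator (box a b) x" for x
      using box_subset_cbox[of a b] by (auto simp: indicator_def)
    show ib: "integrable lebesgue (\<lambda>x. g x * indicator (box a b) x)"
      unfolding eq by (rule integrable_mult_indicator[OF _ i, of "box a b", unfolded real_scaleR_def mult.commute[of "indicator (box a b) _"]]) simp
    have "(\<lambda>n. LINT x|lebesgue. g x * \<psi> n x) \<longlonglongrightarrow> (LINT x|lebesgue. g x * indicator (box a b) x)"
    proof (rule integral_dominated_convergence[where w="\<lambda>x. \<bar>g x * indicator (cbox a b) x\<bar>"])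
      have eq2: "g x * \<psi> n x = (g x * indicator (cbox a b) x) * \<psi> n x" for n x
        using \<psi>(4) by (auto simp: indicator_def)
      show "(\<lambda>x. g x * \<psi> n x) \<in> borel_measurable lebesgue" for n
        unfolding eq2 using mg m\<psi> by measurable
      show "AE x in lebesgue. norm (g x * \<psi> n x) \<le> \<bar>g x * indicator (cbox a b) x\<bar>" for n
        unfolding eq2 using \<psi>(2,3)[of n] by (intro AE_I2) (auto simp: abs_mult intro!: mult_left_le)
      show "AE x in lebesgue. (\<lambda>n. g x * \<psi> n x) \<longlonglongrightarrow> g x * indicator (box a b) x"
        by (intro AE_I2 tendsto_intros \<psi>)
    qed (use i ib in auto)
    moreover have "(LINT x|lebesgue. g x * \<psi> n x) = 0" for n
    proof -
      have "(LINT x|lebesgue_on \<Omega>. g x * \<psi> n x) = (LINT x|lebesgue. indicator \<Omega> x *\<^sub>R (g x * \<psi> n x))"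
        using \<Omega>s by (intro integral_restrict_space) simp
      also have "\<dots> = (LINT x|lebesgue. g x * \<psi> n x)"
        using test_functionD(2)[OF \<psi>(1)] by (intro Bochner_Integration.integral_cong) (auto simp: indicator_def)
      finally show ?thesis using 0[OF \<psi>(1)] by simp
    qed
    ultimately show "(LINT x|lebesgue. g x * indicator (box a b) x) = 0"
      by (simp add: LIMSEQ_const_iff)
  qed
  have AEbox: "AE x in lebesgue. x \<in> cbox a b \<longrightarrow> g x = 0" if ab: "cbox a b \<subseteq> \<Omega>" for a b
  proof -
    have "AE x in lebesgue. g x * indicator (box a b) x = 0"
    proof (rule AE_zero_if_box_integrals_zero[OF ibox[OF ab]])
      fix l u
      obtain c d where cd: "box a b \<inter> box l u = box c d" by (rule that[OF box_Int_box])
      show "(LINT x|lebesgue. g x * indicator (box a b) x * indicator (box l u) x) = 0"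
      \<comment> \<open>If the open box is empty, the closed box \<open>cbox c d\<close> may still
        be nonempty and need not lie in \<open>\<Omega>\<close>.\<close>
      proof (cases "box c d = {}")
        case True
        then have "(\<lambda>x. g x * indicator (box a b) x * indicator (box l u) x) = (\<lambda>x. 0)"
          using cd by (auto simp: indicator_def fun_eq_iff)
        then show ?thesis by (simp only:) simp
      next
        case False
        moreover from this have "box a b \<noteq> {}" using cd by blast
        ultimately have "closure (box c d) = cbox c d" "closure (box a b) = cbox a b"
          using closure_box by blast+
        moreover have "closure (box c d) \<subseteq> closure (box a b)" using cd by (intro closure_mono) blast
        ultimately have "cbox c d \<subseteq> cbox a b" by simp
        then have "(LINT x|lebesgue. g x * indicator (box c d) x) = 0"
          using ab by (intro box0) blast
        moreover have "(\<lambda>x. g x * indicator (box a b) x * indicator (box l u) x) = (\<lambda>x. g x * indicator (box c d) x)"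
          using cd by (auto simp: indicator_def fun_eq_iff)
        ultimately show ?thesis by (simp only:)
      qed
    qed
    moreover have "AE x in lebesgue. x \<notin> cbox a b - box a b"
      using negligible_frontier_interval[of a b] unfolding negligible_iff_null_sets by (rule AE_not_in)
    ultimately show ?thesis by eventually_elim (auto simp: indicator_def)
  qed
  obtain D where D: "countable D" "D \<subseteq> Pow \<Omega>" "\<And>X. X \<in> D \<Longrightarrow> \<exists>a b. X = cbox a b" "\<Union>D = \<Omega>"
    using open_countable_Union_open_cbox[OF \<Omega>] by metis
  have "AE x in lebesgue. \<forall>X\<in>D. x \<in> X \<longrightarrow> g x = 0"
    using D AEbox by (subst AE_ball_countable) (auto, blast)
  then have "AE x in lebesgue. x \<in> \<Omega> \<longrightarrow> g x = 0"
    by eventually_elim (use D(4) in blast)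
  then show ?thesis using \<Omega>s by (subst AE_restrict_space_iff) auto
qed

section \<open>Compactness in L1\<close>

text \<open>Mollification with the normalised indicator of a ball. Lipschitz continuity, which the
  L1 estimate for translations yields, is enough for Arzela-Ascoli.\<close>

definition ball_average :: "real \<Rightarrow> (real^'n::finite \<Rightarrow> real) \<Rightarrow> real^'n \<Rightarrow> real" where
  "ball_average h F x = (LINT y|lborel. indicator (cball 0 h) y * F (x + y)) / measure lborel (cball (0::real^'n) h)"

context
  fixes h :: real and F :: "real^'n::finite \<Rightarrow> real" and K B
  assumes h: "h > 0" and F: "C1 F" and K: "compact K" and F0: "\<And>x. x \<notin> K \<Longrightarrow> F x = 0"
    and B: "(\<integral>\<^sup>+x. ennreal (norm (gradient F x)) \<partial>lborel) \<le> ennreal B" "B \<ge> 0"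
begin

private abbreviation "Q \<equiv> cball (0::real^'n) h"

private lemma Q: "emeasure lborel Q = ennreal (measure lborel Q)" "0 < measure lborel Q"
  using h emeasure_bounded_finite[OF bounded_cball[of "0::real^'n" h]]
  by (auto simp: emeasure_eq_ennreal_measure content_cball_pos)

private lemma borel_F: "F \<in> borel_measurable borel"
  by (intro borel_measurable_continuous_onI C1_continuous[OF F])

private lemma integrable_F: "integrable lborel F"
  by (rule integrable_continuous_compact_support[OF C1_continuous[OF F] K F0])

private lemma integrable_shift: "integrable lborel (\<lambda>y. F (x + y))"
  using integral_translation(2)[OF borel_F, of x] integrable_F by (simp add: add.commute)

private lemma integrable_shift_Q: "integrable lborel (\<lambda>y. indicator Q y * F (x + y))"
  using integrable_mult_indicator[OF _ integrable_shift, of Q x] by simp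

private lemma integrable_Q: "integrable lborel (\<lambda>y::real^'n. indicator Q y * (c::real))"
  using Q by (intro integrable_mult_left integrable_real_indicator) auto

private lemma L1_translation: "(LINT x|lborel. \<bar>F (x + y) - F x\<bar>) \<le> norm y * B"
  and L1_translation_nn: "(\<integral>\<^sup>+x. ennreal \<bar>F (x + y) - F x\<bar> \<partial>lborel) \<le> ennreal (norm y * B)"
proof -
  have "(\<integral>\<^sup>+x. ennreal \<bar>F (x + y) - F x\<bar> \<partial>lborel) \<le> (\<integral>\<^sup>+x. ennreal \<bar>norm y * norm (gradient F x)\<bar> \<partial>lborel)"
    using translation_estimate[OF convex_weight_abs F, of y] unfolding abs_abs .
  also have "\<dots> = ennreal (norm y) * (\<integral>\<^sup>+x. ennreal (norm (gradient F x)) \<partial>lborel)"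
  proof -
    have "gradient F \<in> borel_measurable borel"
      using F by (auto simp: C1_def intro: borel_measurable_continuous_onI)
    then show ?thesis
      by (subst nn_integral_cmult[symmetric]) (auto simp: ennreal_mult' abs_mult)
  qed
  also have "\<dots> \<le> ennreal (norm y) * ennreal B"
    by (intro mult_left_mono B) simp
  finally show nn: "(\<integral>\<^sup>+x. ennreal \<bar>F (x + y) - F x\<bar> \<partial>lborel) \<le> ennreal (norm y * B)"
    by (simp add: ennreal_mult')
  have "integrable lborel (\<lambda>x. \<bar>F (x + y) - F x\<bar>)"
    using integrable_shift[of y] integrable_F by (simp add: add.commute)
  then have "ennreal (LINT x|lborel. \<bar>F (x + y) - F x\<bar>) \<le> ennreal (norm y * B)"
    using nn by (subst (asm) nn_integral_eq_integral) auto
  then show "(LINT x|lborel. \<bar>F (x + y) - F x\<bar>) \<le> norm y * B"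
    using B by (simp add: ennreal_le_iff)
qed

text \<open>The difference of two averages is at most the L1 distance of two translates of F, which
  the gradient bound B controls. The constant involves F only through B.\<close>

lemma ball_average_lipschitz:
  "\<bar>ball_average h F x - ball_average h F x'\<bar> \<le> norm (x - x') * (B / measure lborel Q)"
proof -
  have "\<bar>(LINT y|lborel. indicator Q y * F (x + y)) - (LINT y|lborel. indicator Q y * F (x' + y))\<bar> =
      \<bar>LINT y|lborel. indicator Q y * F (x + y) - indicator Q y * F (x' + y)\<bar>"
    by (subst Bochner_Integration.integral_diff) (auto intro: integrable_shift_Q)
  also have "\<dots> \<le> (LINT y|lborel. \<bar>F (x + y) - F (x' + y)\<bar>)"
  proof (rule integral_abs_bound[THEN order_trans], rule integral_mono)
    show "integrable lborel (\<lambda>y. \<bar>indicator Q y * F (x + y) - indicator Q y * F (x' + y)\<bar>)"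
      "integrable lborel (\<lambda>y. \<bar>F (x + y) - F (x' + y)\<bar>)"
      by (intro integrable_abs Bochner_Integration.integrable_diff integrable_shift_Q integrable_shift)+
  qed (simp add: indicator_def)
  also have "\<dots> = (LINT y|lborel. \<bar>F ((y + x') + (x - x')) - F (y + x')\<bar>)"
    by (simp add: add.commute)
  also have "\<dots> = (LINT y|lborel. \<bar>F (y + (x - x')) - F y\<bar>)"
  proof (rule integral_translation(1))
    show "(\<lambda>y. \<bar>F (y + (x - x')) - F y\<bar>) \<in> borel_measurable borel"
      using borel_F by measurable
  qed
  also have "\<dots> \<le> norm (x - x') * B" by (rule L1_translation)
  finally show ?thesis
    using Q(2) by (simp add: ball_average_def diff_divide_distrib[symmetric] abs_div field_simps)
qed

lemma ball_average_bound:
  "\<bar>ball_average h F x\<bar> \<le> (LINT y|lborel. \<bar>F y\<bar>) / measure lborel Q"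
proof -
  have "\<bar>LINT y|lborel. indicator Q y * F (x + y)\<bar> \<le> (LINT y|lborel. \<bar>F (x + y)\<bar>)"
  proof (rule integral_abs_bound[THEN order_trans], rule integral_mono)
    show "integrable lborel (\<lambda>y. \<bar>indicator Q y * F (x + y)\<bar>)" "integrable lborel (\<lambda>y. \<bar>F (x + y)\<bar>)"
      by (intro integrable_abs integrable_shift_Q integrable_shift)+
  qed (simp add: indicator_def)
  also have "\<dots> = (LINT y|lborel. \<bar>F y\<bar>)"
    using integral_translation(1)[of "\<lambda>y. \<bar>F y\<bar>" x] borel_F by (simp add: add.commute)
  finally show ?thesis
    using Q(2) by (simp add: ball_average_def divide_right_mono)
qed

text \<open>The error is an average of F(x + y) - F(x) over y in the ball. Integrated in x first,
  each y costs at most \<bar>y\<bar> B \<le> h B.\<close>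

lemma ball_average_close:
  "(\<integral>\<^sup>+x. ennreal \<bar>ball_average h F x - F x\<bar> \<partial>lborel) \<le> ennreal (h * B)"
proof -
  let ?q = "measure lborel Q"
  have pt: "ennreal \<bar>ball_average h F x - F x\<bar> \<le>
      ennreal (1 / ?q) * (\<integral>\<^sup>+y. indicator Q y * ennreal \<bar>F (x + y) - F x\<bar> \<partial>lborel)" for x
  proof -
    have i: "integrable lborel (\<lambda>y. indicator Q y * (F (x + y) - F x))"
      using integrable_shift_Q[of x] integrable_Q[of "F x"] by (simp add: right_diff_distrib)
    have "ball_average h F x - F x = (LINT y|lborel. indicator Q y * (F (x + y) - F x)) / ?q"
    proof -
      have "(LINT y|lborel. indicator Q y * (F (x + y) - F x)) =
          (LINT y|lborel. indicator Q y * F (x + y)) - ?q * F x"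
        using integrable_shift_Q[of x] integrable_Q[of "F x"] by (simp add: right_diff_distrib)
      then show ?thesis using Q(2) by (simp add: ball_average_def field_simps)
    qed
    then have "\<bar>ball_average h F x - F x\<bar> = (1 / ?q) * \<bar>LINT y|lborel. indicator Q y * (F (x + y) - F x)\<bar>"
      using Q(2) by (simp add: abs_div)
    also have "\<dots> \<le> (1 / ?q) * (LINT y|lborel. indicator Q y * \<bar>F (x + y) - F x\<bar>)"
      using Q(2) integral_abs_bound[of lborel "\<lambda>y. indicator Q y * (F (x + y) - F x)"]
      by (intro mult_left_mono) (auto simp: abs_mult)
    finally have "ennreal \<bar>ball_average h F x - F x\<bar> \<le> ennreal (1 / ?q) * ennreal (LINT y|lborel. indicator Q y * \<bar>F (x + y) - F x\<bar>)"
      using Q(2) by (simp add: ennreal_mult'[symmetric] ennreal_leI)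
    also have "ennreal (LINT y|lborel. indicator Q y * \<bar>F (x + y) - F x\<bar>) =
        (\<integral>\<^sup>+y. ennreal (indicator Q y * \<bar>F (x + y) - F x\<bar>) \<partial>lborel)"
      using integrable_abs[OF i] by (intro nn_integral_eq_integral[symmetric]) (auto simp: abs_mult)
    also have "\<dots> = (\<integral>\<^sup>+y. indicator Q y * ennreal \<bar>F (x + y) - F x\<bar> \<partial>lborel)"
      by (intro nn_integral_cong) (auto simp: indicator_def)
    finally show ?thesis .
  qed
  have m: "(\<lambda>z. indicator Q (snd z) * ennreal \<bar>F (fst z + snd z) - F (fst z)\<bar>) \<in> borel_measurable (lborel \<Otimes>\<^sub>M lborel)"
  proof -
    have cF: "continuous_on UNIV F" by (rule C1_continuous[OF F])
    have "continuous_on UNIV (\<lambda>z. \<bar>F (fst z + snd z) - F (fst z)\<bar>)"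
      by (intro continuous_intros continuous_on_compose2[OF cF]) auto
    then have "(\<lambda>z. \<bar>F (fst z + snd z) - F (fst z)\<bar>) \<in> borel_measurable (borel \<Otimes>\<^sub>M borel)"
      unfolding borel_prod by (rule borel_measurable_continuous_onI)
    then have "(\<lambda>z. ennreal \<bar>F (fst z + snd z) - F (fst z)\<bar>) \<in> borel_measurable (lborel \<Otimes>\<^sub>M lborel)"
      by measurable
    moreover have "(\<lambda>z. indicator Q (snd z) :: ennreal) \<in> borel_measurable (lborel \<Otimes>\<^sub>M lborel)"
      by (rule measurable_compose[OF measurable_snd borel_measurable_indicator]) simp
    ultimately show ?thesis by (rule borel_measurable_times_ennreal[rotated])
  qed
  have "(\<integral>\<^sup>+x. ennreal \<bar>ball_average h F x - F x\<bar> \<partial>lborel) \<le>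
      (\<integral>\<^sup>+x. ennreal (1 / ?q) * (\<integral>\<^sup>+y. indicator Q y * ennreal \<bar>F (x + y) - F x\<bar> \<partial>lborel) \<partial>lborel)"
    by (intro nn_integral_mono pt)
  also have "\<dots> = ennreal (1 / ?q) * (\<integral>\<^sup>+x. \<integral>\<^sup>+y. indicator Q y * ennreal \<bar>F (x + y) - F x\<bar> \<partial>lborel \<partial>lborel)"
    using lborel.borel_measurable_nn_integral_fst[OF m] by (intro nn_integral_cmult) simp
  also have "(\<integral>\<^sup>+x. \<integral>\<^sup>+y. indicator Q y * ennreal \<bar>F (x + y) - F x\<bar> \<partial>lborel \<partial>lborel) =
      (\<integral>\<^sup>+y. \<integral>\<^sup>+x. indicator Q y * ennreal \<bar>F (x + y) - F x\<bar> \<partial>lborel \<partial>lborel)"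
    using lborel_pair.Fubini'[of "\<lambda>x y. indicator Q y * ennreal \<bar>F (x + y) - F x\<bar>"] m
    by (simp add: case_prod_beta)
  also have "\<dots> \<le> (\<integral>\<^sup>+y. ennreal (h * B) * indicator Q y \<partial>lborel)"
  proof (rule nn_integral_mono)
    fix y
    show "(\<integral>\<^sup>+x. indicator Q y * ennreal \<bar>F (x + y) - F x\<bar> \<partial>lborel) \<le> ennreal (h * B) * indicator Q y"
    proof (cases "y \<in> Q")
      case True
      then have "norm y * B \<le> h * B" using B(2) by (intro mult_right_mono) auto
      then show ?thesis using L1_translation_nn[of y] True by (simp add: order_trans[OF _ ennreal_leI])
    qed simp
  qed
  also have "\<dots> = ennreal (h * B) * ennreal ?q"
    using Q(1) by (simp add: nn_integral_cmult_indicator)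
  finally have "(\<integral>\<^sup>+x. ennreal \<bar>ball_average h F x - F x\<bar> \<partial>lborel) \<le> ennreal (1 / ?q) * (ennreal (h * B) * ennreal ?q)"
    by (simp add: mult_left_mono)
  also have "\<dots> = ennreal (h * B)"
    using Q(2) h B(2) by (simp add: ennreal_mult'[symmetric] mult.commute)
  finally show ?thesis .
qed

end

text \<open>At one fixed scale h the averages are equi-Lipschitz and uniformly bounded, so
  Arzela-Ascoli makes a subsequence of them uniformly close. The scale is small enough for the
  averages to be L1-close to the functions.\<close>

lemma rellich_step:
  fixes \<psi> :: "nat \<Rightarrow> real^'n::finite \<Rightarrow> real"
  assumes \<psi>: "\<And>n. C1 (\<psi> n)" and R: "R > 0" "\<And>n x. x \<notin> ball 0 R \<Longrightarrow> \<psi> n x = 0"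
    and B: "\<And>n. (\<integral>\<^sup>+x. ennreal (norm (gradient (\<psi> n) x)) \<partial>lborel) \<le> ennreal B" "B \<ge> 0"
    and \<delta>: "\<delta> > 0"
  shows "\<exists>r::nat\<Rightarrow>nat. strict_mono r \<and> (\<forall>m n. (\<integral>\<^sup>+x. ennreal \<bar>\<psi> (r m) x - \<psi> (r n) x\<bar> \<partial>lborel) \<le> ennreal \<delta>)"
proof -
  \<comment> \<open>The budget: two averaging errors h B of at most \<delta>/4 each, and further
    below a uniform error 2e over the ball of volume \<open>\<mu>\<close>, worth at most \<delta>/2.
    The summands 1 keep the denominators positive.\<close>
  define h where "h = \<delta> / (4 * (B + 1))"
  have h: "h > 0" "h * B \<le> \<delta> / 4"
    using \<delta> B(2) by (auto simp: h_def field_simps)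
  let ?S = "cball (0::real^'n) R"
  have K: "compact ?S" "\<And>n x. x \<notin> ?S \<Longrightarrow> \<psi> n x = 0" using R(2) by auto
  let ?V = "\<lambda>n. ball_average h (\<psi> n)"
  define q where "q = measure lborel (cball (0::real^'n) h)"
  have q: "q > 0" using h by (simp add: q_def content_cball_pos)
  have L1: "(LINT y|lborel. \<bar>\<psi> n y\<bar>) \<le> 2 * R * B" for n
  proof -
    have i: "integrable lborel (\<psi> n)"
      by (rule integrable_continuous_compact_support[OF C1_continuous[OF \<psi>] K(1) K(2)])
    have "(\<integral>\<^sup>+x. ennreal \<bar>\<psi> n x\<bar> \<partial>lborel) \<le> (\<integral>\<^sup>+x. ennreal \<bar>2 * R * norm (gradient (\<psi> n) x)\<bar> \<partial>lborel)"
      using poincare_lborel[OF convex_weight_abs \<psi> R] unfolding abs_abs .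
    also have "\<dots> = ennreal (2 * R) * (\<integral>\<^sup>+x. ennreal (norm (gradient (\<psi> n) x)) \<partial>lborel)"
    proof -
      have "gradient (\<psi> n) \<in> borel_measurable borel"
        using \<psi>[of n] by (auto simp: C1_def intro: borel_measurable_continuous_onI)
      then show ?thesis
        using R(1) by (subst nn_integral_cmult[symmetric]) (auto simp: ennreal_mult'[symmetric] abs_mult)
    qed
    also have "\<dots> \<le> ennreal (2 * R) * ennreal B" by (intro mult_left_mono B) simp
    also have "\<dots> = ennreal (2 * R * B)" using R(1) by (simp add: ennreal_mult')
    finally have "ennreal (LINT y|lborel. \<bar>\<psi> n y\<bar>) \<le> ennreal (2 * R * B)"
      using i by (subst (asm) nn_integral_eq_integral) auto
    then show ?thesis using R(1) B(2) by (simp add: ennreal_le_iff)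
  qed
  have lip: "\<bar>?V n x - ?V n x'\<bar> \<le> norm (x - x') * (B / q)" for n x x'
    unfolding q_def by (rule ball_average_lipschitz[OF h(1) \<psi> K(1) K(2) B])
  have bnd: "\<bar>?V n x\<bar> \<le> 2 * R * B / q" for n x
  proof -
    have "\<bar>?V n x\<bar> \<le> (LINT y|lborel. \<bar>\<psi> n y\<bar>) / q"
      unfolding q_def by (rule ball_average_bound[OF h(1) \<psi> K(1) K(2) B])
    also have "\<dots> \<le> 2 * R * B / q" using L1[of n] q by (intro divide_right_mono) auto
    finally show ?thesis .
  qed
  obtain g and k :: "nat \<Rightarrow> nat" where k: "strict_mono k"
    and g: "\<And>e. 0 < e \<Longrightarrow> \<exists>N. \<forall>n x. n \<ge> N \<and> x \<in> ?S \<longrightarrow> norm (?V (k n) x - g x) < e"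
  proof (rule Arzela_Ascoli[of ?S ?V "2 * R * B / q"])
    show "compact ?S" by simp
    show "norm (?V n x) \<le> 2 * R * B / q" for n x using bnd by simp
    show "\<exists>d>0. \<forall>n y. y \<in> ?S \<and> norm (x - y) < d \<longrightarrow> norm (?V n x - ?V n y) < e"
      if "e > 0" for x e
    proof (intro exI conjI allI impI)
      show "e / (B / q + 1) > 0" using that B(2) q by (intro divide_pos_pos add_nonneg_pos) auto
      fix n y assume "y \<in> ?S \<and> norm (x - y) < e / (B / q + 1)"
      then have "norm (x - y) * (B / q + 1) < e"
        using B(2) q by (simp add: pos_less_divide_eq add_nonneg_pos)
      moreover have "norm (x - y) * (B / q) \<le> norm (x - y) * (B / q + 1)" by (intro mult_left_mono) auto
      ultimately show "norm (?V n x - ?V n y) < e" using lip[of n x y] by simp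
    qed
  qed blast
  define \<mu> where "\<mu> = measure lborel ?S"
  have \<mu>: "emeasure lborel ?S = ennreal \<mu>" "\<mu> \<ge> 0"
    using emeasure_bounded_finite[OF bounded_cball[of "0::real^'n" R]]
    by (auto simp: \<mu>_def emeasure_eq_ennreal_measure)
  define e where "e = \<delta> / (4 * (\<mu> + 1))"
  have e: "e > 0" "2 * e * \<mu> \<le> \<delta> / 2" using \<delta> \<mu> by (auto simp: e_def field_simps)
  obtain N where N: "\<And>n x. n \<ge> N \<Longrightarrow> x \<in> ?S \<Longrightarrow> norm (?V (k n) x - g x) < e"
    using g[OF e(1)] by blast
  define r where "r n = k (n + N)" for n
  have "strict_mono r" using k by (auto simp: r_def strict_mono_def)
  moreover have "(\<integral>\<^sup>+x. ennreal \<bar>\<psi> (r m) x - \<psi> (r n) x\<bar> \<partial>lborel) \<le> ennreal \<delta>" for m n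
  proof -
    have cV: "continuous_on UNIV (?V n)" for n
    proof (rule continuous_on_subset[OF _ subset_UNIV])
      have "(B / q)-lipschitz_on UNIV (?V n)"
        using lip B(2) q by (intro lipschitz_onI) (auto simp: dist_norm mult.commute)
      then show "continuous_on UNIV (?V n)" by (rule lipschitz_on_continuous_on)
    qed
    have [measurable]: "?V n \<in> borel_measurable borel" "\<psi> n \<in> borel_measurable borel" for n
      by (intro borel_measurable_continuous_onI cV C1_continuous \<psi>)+
    have "(\<integral>\<^sup>+x. ennreal \<bar>\<psi> (r m) x - \<psi> (r n) x\<bar> \<partial>lborel) \<le>
      (\<integral>\<^sup>+x. (ennreal \<bar>?V (r m) x - \<psi> (r m) x\<bar> + ennreal \<bar>?V (r n) x - \<psi> (r n) x\<bar>) + ennreal (2 * e) * indicator ?S x \<partial>lborel)"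
    proof (rule nn_integral_mono)
      fix x
      show "ennreal \<bar>\<psi> (r m) x - \<psi> (r n) x\<bar> \<le>
        (ennreal \<bar>?V (r m) x - \<psi> (r m) x\<bar> + ennreal \<bar>?V (r n) x - \<psi> (r n) x\<bar>) + ennreal (2 * e) * indicator ?S x"
      proof (cases "x \<in> ?S")
        case True
        have "\<bar>?V (r m) x - g x\<bar> < e" "\<bar>?V (r n) x - g x\<bar> < e"
          using N[of "m + N" x] N[of "n + N" x] True by (auto simp: r_def)
        then have "\<bar>\<psi> (r m) x - \<psi> (r n) x\<bar> \<le> (\<bar>?V (r m) x - \<psi> (r m) x\<bar> + \<bar>?V (r n) x - \<psi> (r n) x\<bar>) + 2 * e"
          by linarith
        then have "ennreal \<bar>\<psi> (r m) x - \<psi> (r n) x\<bar> \<le> ennreal ((\<bar>?V (r m) x - \<psi> (r m) x\<bar> + \<bar>?V (r n) x - \<psi> (r n) x\<bar>) + 2 * e)"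
          by (rule ennreal_leI)
        then show ?thesis using True e(1) by (simp add: ennreal_plus)
      qed (simp add: K)
    qed
    also have "\<dots> = (\<integral>\<^sup>+x. ennreal \<bar>?V (r m) x - \<psi> (r m) x\<bar> \<partial>lborel) + (\<integral>\<^sup>+x. ennreal \<bar>?V (r n) x - \<psi> (r n) x\<bar> \<partial>lborel)
        + ennreal (2 * e) * ennreal \<mu>"
    proof -
      have m1: "(\<lambda>x. ennreal \<bar>?V (r n) x - \<psi> (r n) x\<bar>) \<in> borel_measurable lborel" for n by measurable
      have m2: "(\<lambda>x. ennreal (2 * e) * indicator ?S x) \<in> borel_measurable lborel"
        by (intro borel_measurable_times_ennreal borel_measurable_const borel_measurable_indicator) simp
      have "(\<integral>\<^sup>+x. ennreal (2 * e) * indicator ?S x \<partial>lborel) = ennreal (2 * e) * ennreal \<mu>"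
        unfolding \<mu>(1)[symmetric] by (rule nn_integral_cmult_indicator) simp
      then show ?thesis
        unfolding nn_integral_add[OF borel_measurable_add[OF m1 m1] m2] nn_integral_add[OF m1 m1] by (simp only:)
    qed
    also have "\<dots> \<le> ennreal (h * B) + ennreal (h * B) + ennreal (2 * e) * ennreal \<mu>"
      by (intro add_mono order_refl ball_average_close[OF h(1) \<psi> K(1) K(2) B])
    also have "\<dots> = ennreal (h * B + h * B + 2 * e * \<mu>)"
    proof -
      have nn: "0 \<le> h * B" "0 \<le> 2 * e" "0 \<le> 2 * e * \<mu>" "0 \<le> h * B + h * B" using h e \<mu>(2) B(2) by auto
      show ?thesis
        unfolding ennreal_plus[OF nn(4) nn(3)] ennreal_plus[OF nn(1) nn(1)] ennreal_mult'[OF nn(2)] by (rule refl)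
    qed
    also have "\<dots> \<le> ennreal \<delta>" using h e by (intro ennreal_leI) linarith
    finally show ?thesis .
  qed
  ultimately show ?thesis by blast
qed

lemma rellich_C1:
  fixes \<psi> :: "nat \<Rightarrow> real^'n::finite \<Rightarrow> real"
  assumes \<psi>: "\<And>n. C1 (\<psi> n)" and R: "R > 0" "\<And>n x. x \<notin> ball 0 R \<Longrightarrow> \<psi> n x = 0"
    and B: "\<And>n. (\<integral>\<^sup>+x. ennreal (norm (gradient (\<psi> n) x)) \<partial>lborel) \<le> ennreal B" "B \<ge> 0"
  obtains r :: "nat \<Rightarrow> nat" where "strict_mono r"
    "\<And>e. e > 0 \<Longrightarrow> \<exists>N. \<forall>m\<ge>N. \<forall>n\<ge>N. (\<integral>\<^sup>+x. ennreal \<bar>\<psi> (r m) x - \<psi> (r n) x\<bar> \<partial>lborel) < ennreal e"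
proof -
  let ?P = "\<lambda>k (s :: nat \<Rightarrow> nat). \<forall>m n. (\<integral>\<^sup>+x. ennreal \<bar>\<psi> (s m) x - \<psi> (s n) x\<bar> \<partial>lborel) \<le> ennreal (1 / real (Suc k))"
  interpret subseqs ?P
  proof
    fix k and s :: "nat \<Rightarrow> nat" assume "strict_mono s"
    show "\<exists>r. strict_mono r \<and> ?P k (s \<circ> r)"
      using rellich_step[of "\<lambda>n. \<psi> (s n)" R B "1 / real (Suc k)"] \<psi> R B by auto
  qed
  show ?thesis
  proof
    show "strict_mono diagseq" by (rule subseq_diagseq)
    fix e :: real assume "e > 0"
    then obtain k where k: "1 / real (Suc k) < e" using nat_approx_posE by blast
    \<comment> \<open>The diagonal sequence has property k only from index k + 1 on, hence the
      shift.\<close>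
    have P: "?P k (diagseq \<circ> ((+) (Suc k)))" by (rule diagseq_holds) auto
    show "\<exists>N. \<forall>m\<ge>N. \<forall>n\<ge>N. (\<integral>\<^sup>+x. ennreal \<bar>\<psi> (diagseq m) x - \<psi> (diagseq n) x\<bar> \<partial>lborel) < ennreal e"
    proof (intro exI allI impI)
      fix m n assume m: "Suc k \<le> m" and n: "Suc k \<le> n"
      have "(\<integral>\<^sup>+x. ennreal \<bar>\<psi> (diagseq m) x - \<psi> (diagseq n) x\<bar> \<partial>lborel) \<le> ennreal (1 / real (Suc k))"
        using P[rule_format, of "m - Suc k" "n - Suc k", unfolded comp_apply le_add_diff_inverse[OF m] le_add_diff_inverse[OF n]] .
      also have "\<dots> < ennreal e" using k by (intro ennreal_lessI) (auto intro: le_less_trans[rotated])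
      finally show "(\<integral>\<^sup>+x. ennreal \<bar>\<psi> (diagseq m) x - \<psi> (diagseq n) x\<bar> \<partial>lborel) < ennreal e" .
    qed
  qed
qed

section \<open>Young functions\<close>

text \<open>Serves the convexity and comparison inequalities below: the difference of the two sides
  decreases up to the point of contact s and increases after it. Derivatives are asked for at t > 0,
  where powers and quotients by t are harmless; continuity covers the endpoint.\<close>

lemma minimum_by_derivative_sign:
  fixes H :: "real \<Rightarrow> real"
  assumes c: "continuous_on {0..} H" and d: "\<And>t. t > 0 \<Longrightarrow> (H has_real_derivative H' t) (at t)"
    and up: "\<And>t. t > s \<Longrightarrow> H' t \<ge> 0" and dn: "\<And>t. 0 < t \<Longrightarrow> t < s \<Longrightarrow> H' t \<le> 0"
    and s: "s \<ge> 0" and t: "t \<ge> 0"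
  shows "H s \<le> H t"
proof (cases "s \<le> t")
  case True
  show ?thesis
  proof (rule DERIV_nonneg_imp_increasing_open[OF True])
    show "\<exists>y. (H has_real_derivative y) (at x) \<and> 0 \<le> y" if "s < x" "x < t" for x
      using d[of x] up[of x] that s by auto
    show "continuous_on {s..t} H" using s by (intro continuous_on_subset[OF c]) auto
  qed
next
  case False
  show ?thesis
  proof (rule DERIV_nonpos_imp_decreasing_open[of t s])
    show "t \<le> s" using False by simp
    show "\<exists>y. (H has_real_derivative y) (at x) \<and> y \<le> 0" if "t < x" "x < s" for x
      using d[of x] dn[of x] that t by auto
    show "continuous_on {t..s} H" using t by (intro continuous_on_subset[OF c]) auto
  qed
qed

lemma powr_above_tangent:
  fixes p s t :: real
  assumes "p > 1" "s > 0" "t \<ge> 0"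
  shows "s powr p + p * s powr (p - 1) * (t - s) \<le> t powr p"
proof -
  let ?H = "\<lambda>t. t powr p - p * s powr (p - 1) * t"
  have "?H s \<le> ?H t"
  proof (rule minimum_by_derivative_sign[where H="?H" and s=s and t=t and H'="\<lambda>t. p * t powr (p - 1) - p * s powr (p - 1)"])
    show "continuous_on {0..} ?H" using assms by (intro continuous_on_diff continuous_on_powr' continuous_on_mult continuous_on_const continuous_on_id) auto
    show "(?H has_real_derivative p * t powr (p - 1) - p * s powr (p - 1)) (at t)" if "t > 0" for t
      using that by (auto intro!: derivative_eq_intros)
    show "p * t powr (p - 1) - p * s powr (p - 1) \<ge> 0" if "t > s" for t
      using that assms by (simp add: powr_mono2)
    show "p * t powr (p - 1) - p * s powr (p - 1) \<le> 0" if "0 < t" "t < s" for t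
      using that assms by (simp add: powr_mono2)
  qed (use assms in auto)
  then show ?thesis by (simp add: algebra_simps)
qed

text \<open>The index bounds p \<le> t \<phi>(t)/\<Phi>(t) \<le> P in a form free of quotients. The
  lower one, with p > 1, gives superlinear growth; the upper one gives the Delta_2
  condition.\<close>

locale young =
  fixes \<phi> \<Phi> :: "real \<Rightarrow> real" and p P :: real
  assumes \<Phi>_deriv: "(\<Phi> has_real_derivative \<phi> t) (at t)"
    and \<phi>_cont: "continuous_on UNIV \<phi>" and \<phi>_mono: "s \<le> t \<Longrightarrow> \<phi> s \<le> \<phi> t"
    and \<phi>_0[simp]: "\<phi> 0 = 0" and \<Phi>_0[simp]: "\<Phi> 0 = 0"
    and \<phi>_pos: "t > 0 \<Longrightarrow> \<phi> t > 0"
    and p: "p > 1" and p_le: "t > 0 \<Longrightarrow> p * \<Phi> t \<le> t * \<phi> t" and P_ge: "t > 0 \<Longrightarrow> t * \<phi> t \<le> P * \<Phi> t"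
begin

lemma \<Phi>_cont: "continuous_on S \<Phi>"
  by (meson DERIV_isCont \<Phi>_deriv continuous_at_imp_continuous_on)

lemma \<phi>_nonneg: "t \<ge> 0 \<Longrightarrow> \<phi> t \<ge> 0"
  using \<phi>_mono[of 0 t] by simp

lemma \<Phi>_tangent:
  assumes "s \<ge> 0" "t \<ge> 0" shows "\<Phi> s + \<phi> s * (t - s) \<le> \<Phi> t"
proof -
  let ?H = "\<lambda>t. \<Phi> t - \<phi> s * t"
  have "?H s \<le> ?H t"
  proof (rule minimum_by_derivative_sign[where H="?H" and s=s and t=t and H'="\<lambda>t. \<phi> t - \<phi> s"])
    show "continuous_on {0..} ?H" by (intro continuous_intros \<Phi>_cont)
    show "(?H has_real_derivative \<phi> t - \<phi> s) (at t)" for t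
      by (auto intro!: derivative_eq_intros \<Phi>_deriv)
  qed (use assms \<phi>_mono[of s] \<phi>_mono[of _ s] in auto)
  then show ?thesis by (simp add: algebra_simps)
qed

lemma \<Phi>_mono: assumes "0 \<le> s" "s \<le> t" shows "\<Phi> s \<le> \<Phi> t"
proof -
  have "0 \<le> \<phi> s * (t - s)" using assms \<phi>_nonneg[of s] by simp
  then show ?thesis using \<Phi>_tangent[of s t] assms by simp
qed

lemma \<Phi>_nonneg: "t \<ge> 0 \<Longrightarrow> \<Phi> t \<ge> 0"
  using \<Phi>_mono[of 0 t] by simp

lemma \<Phi>_pos: assumes "t > 0" shows "\<Phi> t > 0"
proof -
  have "0 < \<phi> (t/2) * (t - t/2)" using assms \<phi>_pos[of "t/2"] by simp
  then show ?thesis using \<Phi>_tangent[of "t/2" t] \<Phi>_nonneg[of "t/2"] assms by linarith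
qed

lemma \<Phi>_le: assumes "t \<ge> 0" shows "\<Phi> t \<le> t * \<phi> t"
  using \<Phi>_tangent[of t 0] assms by (simp add: algebra_simps)

lemma \<Phi>_convex_weight: "convex_weight \<Phi>"
  unfolding convex_weight_def
  using \<Phi>_cont \<Phi>_mono \<Phi>_tangent \<phi>_nonneg by (metis \<Phi>_0)

lemma P_gt: "P > 1"
proof -
  have "p * \<Phi> 1 \<le> P * \<Phi> 1" using p_le[of 1] P_ge[of 1] by simp
  then show ?thesis using \<Phi>_pos[of 1] p by simp
qed

text \<open>s^(-P) \<Phi>(s t) is nonincreasing in s, as its derivative is a positive multiple of s
  t \<phi>(s t) - P \<Phi>(s t). The lower estimate is the same computation with p.\<close>

lemma \<Phi>_upper: assumes "s \<ge> 1" "t \<ge> 0" shows "\<Phi> (s * t) \<le> s powr P * \<Phi> t"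
proof (cases "t = 0")
  case False
  then have t: "t > 0" using assms by simp
  let ?f = "\<lambda>s. \<Phi> (s * t) * s powr (- P)"
  have "?f s \<le> ?f 1"
  proof (rule DERIV_nonpos_imp_nonincreasing[OF assms(1)])
    fix x assume x: "1 \<le> x" "x \<le> s"
    have "(?f has_real_derivative (\<phi> (x * t) * t * x powr (- P) + \<Phi> (x * t) * (- P * x powr (- P - 1)))) (at x)"
      using x by (auto intro!: derivative_eq_intros DERIV_chain2[OF \<Phi>_deriv])
    moreover have "\<phi> (x * t) * t * x powr (- P) + \<Phi> (x * t) * (- P * x powr (- P - 1)) =
        x powr (- P - 1) * (x * t * \<phi> (x * t) - P * \<Phi> (x * t))"
      using x by (simp add: powr_diff field_simps)
    moreover have "\<dots> \<le> 0"
      using x t P_ge[of "x * t"] by (intro mult_nonneg_nonpos) auto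
    ultimately show "\<exists>y. (?f has_real_derivative y) (at x) \<and> y \<le> 0" by auto
  qed
  then show ?thesis using assms by (simp add: powr_minus field_simps)
qed simp

lemma \<Phi>_lower: assumes "s \<ge> 1" "t \<ge> 0" shows "s powr p * \<Phi> t \<le> \<Phi> (s * t)"
proof (cases "t = 0")
  case False
  then have t: "t > 0" using assms by simp
  let ?f = "\<lambda>s. \<Phi> (s * t) * s powr (- p)"
  have "?f 1 \<le> ?f s"
  proof (rule DERIV_nonneg_imp_nondecreasing[OF assms(1)])
    fix x assume x: "1 \<le> x" "x \<le> s"
    have "(?f has_real_derivative (\<phi> (x * t) * t * x powr (- p) + \<Phi> (x * t) * (- p * x powr (- p - 1)))) (at x)"
      using x by (auto intro!: derivative_eq_intros DERIV_chain2[OF \<Phi>_deriv])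
    moreover have "\<phi> (x * t) * t * x powr (- p) + \<Phi> (x * t) * (- p * x powr (- p - 1)) =
        x powr (- p - 1) * (x * t * \<phi> (x * t) - p * \<Phi> (x * t))"
      using x by (simp add: powr_diff field_simps)
    moreover have "\<dots> \<ge> 0"
      using x t p_le[of "x * t"] by (intro mult_nonneg_nonneg) auto
    ultimately show "\<exists>y. (?f has_real_derivative y) (at x) \<and> 0 \<le> y" by auto
  qed
  then show ?thesis using assms by (simp add: powr_minus field_simps)
qed simp

lemma \<Phi>_small: assumes "0 < s" "s \<le> 1" "t \<ge> 0" shows "\<Phi> (s * t) \<le> s powr p * \<Phi> t"
proof -
  have "(1 / s) powr p * \<Phi> (s * t) \<le> \<Phi> ((1 / s) * (s * t))"
    using assms by (intro \<Phi>_lower) auto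
  then show ?thesis using assms by (simp add: powr_divide field_simps)
qed

lemma \<Phi>_contract: assumes "0 \<le> s" "s \<le> 1" "t \<ge> 0" shows "\<Phi> (s * t) \<le> s * \<Phi> t"
proof (cases "s = 0")
  case False
  have "s powr p \<le> s powr 1" using assms p by (intro powr_mono') auto
  then have "s powr p * \<Phi> t \<le> s * \<Phi> t" using assms \<Phi>_nonneg by (intro mult_right_mono) auto
  then show ?thesis using \<Phi>_small[of s t] assms False by simp
qed (use assms in simp)

lemma \<Phi>_scale: assumes "c \<ge> 0" "t \<ge> 0" shows "\<Phi> (c * t) \<le> (max 1 c) powr P * \<Phi> t"
proof -
  have "\<Phi> (c * t) \<le> \<Phi> (max 1 c * t)" using assms by (intro \<Phi>_mono mult_right_mono) auto
  also have "\<dots> \<le> (max 1 c) powr P * \<Phi> t" using assms by (intro \<Phi>_upper) auto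
  finally show ?thesis .
qed

lemma \<Phi>_add: assumes "s \<ge> 0" "t \<ge> 0" shows "\<Phi> (s + t) \<le> 2 powr P * (\<Phi> s + \<Phi> t)"
proof -
  have "\<Phi> (s + t) \<le> \<Phi> (2 * max s t)" using assms by (intro \<Phi>_mono) auto
  also have "\<dots> \<le> 2 powr P * \<Phi> (max s t)" using assms by (intro \<Phi>_upper) auto
  also have "\<Phi> (max s t) \<le> \<Phi> s + \<Phi> t" using assms \<Phi>_nonneg[of s] \<Phi>_nonneg[of t] by (auto simp: max_def)
  finally show ?thesis by simp
qed

lemma \<Phi>_norm_add: "\<Phi> (norm (x + y)) \<le> 2 powr P * (\<Phi> (norm x) + \<Phi> (norm y))"
  using \<Phi>_mono[OF norm_ge_zero norm_triangle_ineq[of x y]] \<Phi>_add[of "norm x" "norm y"] by simp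

text \<open>The free \<open>\<delta>\<close> is what turns small modulars into small L1 norms: first
  the constant term is made small, then the modular.\<close>

lemma \<Phi>_bound_linear: assumes "\<delta> > 0" "t \<ge> 0" shows "t \<le> \<delta> + \<delta> / \<Phi> \<delta> * \<Phi> t"
proof (cases "t \<le> \<delta>")
  case True
  then show ?thesis using assms \<Phi>_pos[of \<delta>] \<Phi>_nonneg[of t] by (simp add: add_increasing2)
next
  case False
  then have "\<Phi> (\<delta> / t * t) \<le> \<delta> / t * \<Phi> t" using assms by (intro \<Phi>_contract) auto
  then have "t * \<Phi> \<delta> \<le> \<delta> * \<Phi> t" using assms False by (simp add: field_simps)
  then have "t \<le> \<delta> / \<Phi> \<delta> * \<Phi> t" using \<Phi>_pos[OF assms(1)] by (simp add: field_simps)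
  then show ?thesis using assms by simp
qed

text \<open>The coefficient 1/2 leaves half of the modular over when a linear term has to be
  absorbed.\<close>

lemma \<Phi>_superlinear: assumes "c \<ge> 0" obtains C where "C \<ge> 0" "\<And>t. t \<ge> 0 \<Longrightarrow> c * t \<le> \<Phi> t / 2 + C"
proof -
  \<comment> \<open>Chosen so that 2c \<le> T^(p-1) \<Phi>(1). Beyond T the lower growth t^p
    \<Phi>(1) \<le> \<Phi>(t) takes over.\<close>
  define T where "T = max 1 ((2 * c / \<Phi> 1) powr (1 / (p - 1)))"
  have T: "T \<ge> 1" by (simp add: T_def)
  have "2 * c / \<Phi> 1 \<le> T powr (p - 1)"
  proof (cases "c = 0")
    case False
    then have "2 * c / \<Phi> 1 = ((2 * c / \<Phi> 1) powr (1 / (p - 1))) powr (p - 1)"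
      using assms \<Phi>_pos[of 1] p by (simp add: powr_powr)
    also have "\<dots> \<le> T powr (p - 1)" using p by (intro powr_mono2) (auto simp: T_def)
    finally show ?thesis .
  qed simp
  then have Tp: "2 * c \<le> T powr (p - 1) * \<Phi> 1" using \<Phi>_pos[of 1] by (simp add: field_simps)
  show ?thesis
  proof
    show "c * T \<ge> 0" using assms T by simp
    fix t :: real assume t: "t \<ge> 0"
    show "c * t \<le> \<Phi> t / 2 + c * T"
    proof (cases "t \<le> T")
      case True
      then show ?thesis using assms t \<Phi>_nonneg[of t] mult_left_mono[of t T c] by simp
    next
      case False
      have "2 * c * t \<le> T powr (p - 1) * \<Phi> 1 * t" using Tp t by (intro mult_right_mono) auto
      also have "\<dots> \<le> t powr (p - 1) * \<Phi> 1 * t"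
        using False T p \<Phi>_pos[of 1] t by (intro mult_right_mono powr_mono2) auto
      also have "\<dots> = t powr p * \<Phi> 1" using False T by (simp add: powr_diff)
      also have "\<dots> \<le> \<Phi> t" using \<Phi>_lower[of t 1] False T by simp
      finally have "2 * c * t \<le> \<Phi> t" .
      moreover have "0 \<le> c * T" using assms T by simp
      ultimately show ?thesis by linarith
    qed
  qed
qed

section \<open>A uniformly convex Young function equivalent to \<open>\<Phi>\<close>\<close>

text \<open>\<open>\<Psi>\<close> is equivalent to \<open>\<Phi>\<close>, but uniformly convex: \<open>t \<mapsto> \<Psi>' t / t\<^sup>p\<^sup>-\<^sup>1\<close> is nondecreasing.\<close>

definition \<Psi> :: "real \<Rightarrow> real" where "\<Psi> t = integral {0..t} (\<lambda>s. \<Phi> s / s)"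

lemma \<Psi>_integrand_cont: "continuous_on {0..} (\<lambda>s. \<Phi> s / s)"
proof -
  have lim0: "((\<lambda>s. \<Phi> s / s) \<longlongrightarrow> 0) (at 0 within {0..})"
  proof (rule tendsto_sandwich)
    show "\<forall>\<^sub>F s in at 0 within {0..}. 0 \<le> \<Phi> s / s"
      unfolding eventually_at by (intro exI[of _ 1]) (auto intro!: divide_nonneg_nonneg \<Phi>_nonneg)
    show "\<forall>\<^sub>F s in at 0 within {0..}. \<Phi> s / s \<le> \<phi> s"
      unfolding eventually_at using \<Phi>_le by (intro exI[of _ 1]) (auto simp: field_simps)
    have "isCont \<phi> 0" using \<phi>_cont by (simp add: continuous_on_eq_continuous_at)
    then show "(\<phi> \<longlongrightarrow> 0) (at 0 within {0..})"
      unfolding isCont_def \<phi>_0 by (rule tendsto_mono[OF at_le[OF subset_UNIV]])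
  qed auto
  have cont: "continuous (at s within {0..}) (\<lambda>s. \<Phi> s / s)" for s
  proof (cases "s = 0")
    case True
    \<comment> \<open>With x / 0 = 0 the integrand already takes its limit value 0 at the
      origin.\<close>
    have "((\<lambda>s. \<Phi> s / s) \<longlongrightarrow> \<Phi> 0 / 0) (at 0 within {0..})"
      unfolding div_by_0 by (rule lim0)
    then show ?thesis unfolding True continuous_within .
  next
    case False
    have "isCont \<Phi> s" by (rule DERIV_isCont[OF \<Phi>_deriv])
    then have "isCont (\<lambda>s. \<Phi> s / s) s" by (rule isCont_divide[OF _ continuous_ident False])
    then show ?thesis by (rule continuous_at_imp_continuous_within)
  qed
  show ?thesis unfolding continuous_on_eq_continuous_within using cont by blast
qed

lemma \<Psi>_0[simp]: "\<Psi> 0 = 0"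
  by (simp add: \<Psi>_def)

lemma \<Psi>_deriv: assumes "t > 0" shows "(\<Psi> has_real_derivative \<Phi> t / t) (at t)"
proof -
  have "((\<lambda>x. integral {0..x} (\<lambda>s. \<Phi> s / s)) has_real_derivative \<Phi> t / t) (at t within {0..t+1})"
    using assms by (intro integral_has_real_derivative continuous_on_subset[OF \<Psi>_integrand_cont]) auto
  moreover have "at t within {0..t+1} = at t"
    using assms by (intro at_within_interior) auto
  ultimately show ?thesis by (simp add: \<Psi>_def[abs_def])
qed

lemma \<Psi>_cont: "continuous_on {0..} \<Psi>"
proof -
  have cont: "continuous (at t within {0..}) \<Psi>" if "t \<in> {0..}" for t
  proof (cases "t = 0")
    case True
    have "((\<lambda>x. integral {0..x} (\<lambda>s. \<Phi> s / s)) has_real_derivative \<Phi> 0 / 0) (at 0 within {0..1})"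
      by (intro integral_has_real_derivative continuous_on_subset[OF \<Psi>_integrand_cont]) auto
    then have "continuous (at 0 within {0..1}) (\<lambda>x. integral {0..x} (\<lambda>s. \<Phi> s / s))"
      by (rule DERIV_continuous)
    moreover have "\<Psi> = (\<lambda>x. integral {0..x} (\<lambda>s. \<Phi> s / s))"
      by (simp add: \<Psi>_def fun_eq_iff)
    moreover have "at (0::real) within {0..1} = at 0 within {0..}"
      by (rule at_within_nhd[of _ "{..<1}"]) auto
    ultimately show ?thesis unfolding True by (simp only:)
  next
    case False
    then have "t > 0" using that by simp
    then show ?thesis by (rule continuous_at_imp_continuous_within[OF DERIV_isCont[OF \<Psi>_deriv]])
  qed
  show ?thesis unfolding continuous_on_eq_continuous_within using cont by blast
qed

lemma \<Phi>_div_mono: assumes "0 < s" "s \<le> t" shows "\<Phi> s / s \<le> \<Phi> t / t"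
  using \<Phi>_contract[of "s / t" t] assms by (simp add: field_simps)

lemma \<Psi>_tangent:
  assumes "s > 0" "t \<ge> 0" shows "\<Psi> s + \<Phi> s / s * (t - s) \<le> \<Psi> t"
proof -
  let ?H = "\<lambda>t. \<Psi> t - \<Phi> s / s * t"
  have "?H s \<le> ?H t"
  proof (rule minimum_by_derivative_sign[where H="?H" and s=s and t=t and H'="\<lambda>t. \<Phi> t / t - \<Phi> s / s"])
    show "continuous_on {0..} ?H" by (intro continuous_intros \<Psi>_cont)
    show "(?H has_real_derivative \<Phi> t / t - \<Phi> s / s) (at t)" if "t > 0" for t
      by (rule derivative_eq_intros \<Psi>_deriv that refl)+ simp
  qed (use assms \<Phi>_div_mono[of s] \<Phi>_div_mono[of _ s] in auto)
  then show ?thesis unfolding right_diff_distrib by linarith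
qed

text \<open>At \<open>\<mu>\<close> the function \<open>\<Psi>\<close> touches a multiple of t^p
  plus a constant. As \<Phi>(t)/t^p is nondecreasing, the derivative \<Phi>(t)/t lies below that of
  the power before \<open>\<mu>\<close> and above it afterwards. In this way \<open>\<Psi>\<close>
  inherits the convexity of t^p.\<close>

lemma \<Psi>_power_tangent:
  assumes "\<mu> > 0" "t \<ge> 0" shows "\<Psi> \<mu> + \<Phi> \<mu> / p * ((t / \<mu>) powr p - 1) \<le> \<Psi> t"
proof -
  let ?c = "\<Phi> \<mu> / \<mu> powr p"
  let ?H = "\<lambda>t. \<Psi> t - ?c / p * t powr p"
  have "?H \<mu> \<le> ?H t"
  proof (rule minimum_by_derivative_sign[where H="?H" and s=\<mu> and t=t and H'="\<lambda>t. \<Phi> t / t - ?c * t powr (p - 1)"])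
    show "continuous_on {0..} ?H"
      using p by (intro continuous_on_diff \<Psi>_cont continuous_on_powr' continuous_on_mult continuous_on_const continuous_on_id) auto
    show "(?H has_real_derivative \<Phi> t / t - ?c * t powr (p - 1)) (at t)" if "t > 0" for t
      using that p assms by (auto intro!: derivative_eq_intros \<Psi>_deriv)
    have eq: "\<Phi> t / t - ?c * t powr (p - 1) = (\<Phi> t - (t / \<mu>) powr p * \<Phi> \<mu>) / t" if "t > 0" for t
      using that assms by (simp add: powr_diff powr_divide field_simps)
    show "\<Phi> t / t - ?c * t powr (p - 1) \<ge> 0" if "t > \<mu>" for t
      using that assms \<Phi>_lower[of "t / \<mu>" \<mu>] by (subst eq) (auto intro!: divide_nonneg_nonneg)
    show "\<Phi> t / t - ?c * t powr (p - 1) \<le> 0" if "0 < t" "t < \<mu>" for t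
      using that assms \<Phi>_small[of "t / \<mu>" \<mu>] by (subst eq) (auto intro!: divide_nonpos_pos)
  qed (use assms in auto)
  moreover have "?c / p * \<mu> powr p = \<Phi> \<mu> / p" "?c / p * t powr p = \<Phi> \<mu> / p * (t / \<mu>) powr p"
    using assms by (simp_all add: powr_divide)
  ultimately show ?thesis unfolding right_diff_distrib by linarith
qed

lemma \<Psi>_mono: assumes "0 \<le> s" "s \<le> t" shows "\<Psi> s \<le> \<Psi> t"
proof (rule DERIV_nonneg_imp_increasing_open[OF assms(2)])
  show "\<exists>y. (\<Psi> has_real_derivative y) (at x) \<and> 0 \<le> y" if "s < x" for x
    using \<Psi>_deriv[of x] \<Phi>_nonneg[of x] that assms by (intro exI[of _ "\<Phi> x / x"]) auto
  show "continuous_on {s..t} \<Psi>" using assms by (intro continuous_on_subset[OF \<Psi>_cont]) auto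
qed

lemma \<Psi>_nonneg: "t \<ge> 0 \<Longrightarrow> \<Psi> t \<ge> 0"
  using \<Psi>_mono[of 0 t] by simp

text \<open>Compare derivatives: \<Phi>(t)/t \<le> \<phi>(t) \<le> P \<Phi>(t)/t. The right half
  gives the reverse estimate \<open>\<Phi>_le_\<Psi>\<close>.\<close>

lemma \<Psi>_le_\<Phi>: assumes "t \<ge> 0" shows "\<Psi> t \<le> \<Phi> t"
proof -
  have "\<Phi> 0 - \<Psi> 0 \<le> \<Phi> t - \<Psi> t"
  proof (rule minimum_by_derivative_sign[where H="\<lambda>t. \<Phi> t - \<Psi> t" and s=0 and t=t and H'="\<lambda>t. \<phi> t - \<Phi> t / t"])
    show "((\<lambda>t. \<Phi> t - \<Psi> t) has_real_derivative \<phi> t - \<Phi> t / t) (at t)" if "t > 0" for t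
      by (intro DERIV_diff \<Phi>_deriv \<Psi>_deriv that)
    show "continuous_on {0..} (\<lambda>t. \<Phi> t - \<Psi> t)" by (intro continuous_on_diff \<Phi>_cont \<Psi>_cont)
    show "\<phi> t - \<Phi> t / t \<ge> 0" if "t > 0" for t using \<Phi>_le[of t] that by (simp add: field_simps)
  qed (use assms in auto)
  then show ?thesis by simp
qed

lemma \<Phi>_le_\<Psi>: assumes "t \<ge> 0" shows "\<Phi> t \<le> P * \<Psi> t"
proof -
  have "P * \<Psi> 0 - \<Phi> 0 \<le> P * \<Psi> t - \<Phi> t"
  proof (rule minimum_by_derivative_sign[where H="\<lambda>t. P * \<Psi> t - \<Phi> t" and s=0 and t=t and H'="\<lambda>t. P * (\<Phi> t / t) - \<phi> t"])
    show "((\<lambda>t. P * \<Psi> t - \<Phi> t) has_real_derivative P * (\<Phi> t / t) - \<phi> t) (at t)" if "t > 0" for t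
      by (intro DERIV_diff \<Phi>_deriv DERIV_cmult \<Psi>_deriv that)
    show "continuous_on {0..} (\<lambda>t. P * \<Psi> t - \<Phi> t)"
      by (intro continuous_on_diff continuous_on_mult continuous_on_const \<Phi>_cont \<Psi>_cont)
    show "P * (\<Phi> t / t) - \<phi> t \<ge> 0" if "t > 0" for t using P_ge[of t] that by (simp add: field_simps)
  qed (use assms in auto)
  then show ?thesis by simp
qed

lemma \<Psi>_midpoint: assumes "s \<ge> 0" "t \<ge> 0" shows "\<Psi> ((s + t) / 2) \<le> (\<Psi> s + \<Psi> t) / 2"
proof (cases "s + t = 0")
  case True
  then show ?thesis using assms \<Psi>_nonneg[of s] \<Psi>_nonneg[of t] by simp
next
  case False
  define \<mu> where "\<mu> = (s + t) / 2"
  define c where "c = \<Phi> \<mu> / \<mu>"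
  have "\<mu> > 0" using assms False by (simp add: \<mu>_def)
  then have "\<Psi> \<mu> + c * (s - \<mu>) \<le> \<Psi> s" "\<Psi> \<mu> + c * (t - \<mu>) \<le> \<Psi> t"
    using assms unfolding c_def by (intro \<Psi>_tangent; simp)+
  moreover have "c * (s - \<mu>) + c * (t - \<mu>) = 0"
    unfolding distrib_left[symmetric] by (simp add: \<mu>_def)
  ultimately have "2 * \<Psi> \<mu> \<le> \<Psi> s + \<Psi> t" by linarith
  then show ?thesis by (simp add: \<mu>_def)
qed

text \<open>With s = (1 + \<theta>) \<mu>, t = (1 - \<theta>) \<mu> and \<theta> \<ge> \<tau>,
  \<open>\<Psi>_power_tangent\<close> reduces the claim to a lower bound for (1 + \<theta>)^p + (1 -
  \<theta>)^p - 2 that works for all p > 1.\<close>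

lemma \<Psi>_gap_scalar:
  assumes s: "s \<ge> 0" and t: "t \<ge> 0" and \<mu>: "\<mu> = (s + t) / 2" "\<mu> > 0" and \<tau>: "\<bar>s - t\<bar> \<ge> 2 * \<tau> * \<mu>" "\<tau> > 0"
  shows "\<Psi> \<mu> + \<tau> / 2 * ((1 + \<tau> / 2) powr (p - 1) - 1) * \<Phi> \<mu> / 2 \<le> (\<Psi> s + \<Psi> t) / 2"
proof -
  have *: "\<Psi> \<mu> + \<tau> / 2 * ((1 + \<tau> / 2) powr (p - 1) - 1) * \<Phi> \<mu> / 2 \<le> (\<Psi> s + \<Psi> t) / 2"
    if s: "s \<ge> 0" and t: "t \<ge> 0" and m: "\<mu> = (s + t) / 2" and d: "s - t \<ge> 2 * \<tau> * \<mu>" for s t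
  proof -
    define \<theta> where "\<theta> = s / \<mu> - 1"
    have \<theta>s: "s / \<mu> = 1 + \<theta>" and \<theta>t: "t / \<mu> = 1 - \<theta>" using m \<mu>(2) by (auto simp: \<theta>_def field_simps)
    have "t = 2 * \<mu> - s" using m by simp
    then have "\<mu> + \<tau> * \<mu> \<le> s" using d by simp
    then have \<theta>\<tau>: "\<theta> \<ge> \<tau>" using \<mu>(2) by (simp add: \<theta>_def field_simps)
    have \<theta>1: "1 - \<theta> \<ge> 0" using t \<mu>(2) \<theta>t by (metis divide_nonneg_pos)
    \<comment> \<open>Three tangents to the power function: at h for the argument 1 + \<theta>, at 1
      for h, and at 1 for 1 - \<theta>. With h strictly between 1 and 1 + \<theta> the linear terms
      cancel up to the gain p (h^(p-1) - 1) (\<theta> - \<tau>/2).\<close>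
    let ?h = "1 + \<tau> / 2"
    have 1: "?h powr p + p * ?h powr (p - 1) * ((1 + \<theta>) - ?h) \<le> (1 + \<theta>) powr p"
      using p \<tau> \<theta>\<tau> by (intro powr_above_tangent) auto
    have 2: "1 + p * (\<tau> / 2) \<le> ?h powr p"
      using powr_above_tangent[of p 1 ?h] p \<tau> by simp
    have 3: "1 - p * \<theta> \<le> (1 - \<theta>) powr p"
      using powr_above_tangent[of p 1 "1 - \<theta>"] p \<theta>1 by simp
    have h1: "?h powr (p - 1) \<ge> 1" using \<tau> p by (intro ge_one_powr_ge_zero) auto
    have "(p * ?h powr (p - 1)) * ((1 + \<theta>) - ?h) = p * (\<theta> - \<tau> / 2) + p * (?h powr (p - 1) - 1) * (\<theta> - \<tau> / 2)"
      by (simp add: algebra_simps)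
    moreover have "p * (?h powr (p - 1) - 1) * (\<tau> / 2) \<le> p * (?h powr (p - 1) - 1) * (\<theta> - \<tau> / 2)"
      using p h1 \<theta>\<tau> by (intro mult_left_mono) auto
    ultimately have "2 + p * (?h powr (p - 1) - 1) * (\<tau> / 2) \<le> (1 + \<theta>) powr p + (1 - \<theta>) powr p"
      using 1 2 3 by (simp add: algebra_simps)
    then have "\<Phi> \<mu> / p * (p * (?h powr (p - 1) - 1) * (\<tau> / 2)) \<le> \<Phi> \<mu> / p * (((1 + \<theta>) powr p - 1) + ((1 - \<theta>) powr p - 1))"
      using \<Phi>_pos[OF \<mu>(2)] p by (intro mult_left_mono) auto
    moreover have "\<Psi> \<mu> + \<Phi> \<mu> / p * ((1 + \<theta>) powr p - 1) \<le> \<Psi> s" "\<Psi> \<mu> + \<Phi> \<mu> / p * ((1 - \<theta>) powr p - 1) \<le> \<Psi> t"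
      using \<Psi>_power_tangent[OF \<mu>(2) s] \<Psi>_power_tangent[OF \<mu>(2) t] unfolding \<theta>s \<theta>t by auto
    moreover have "\<Phi> \<mu> / p * (p * (?h powr (p - 1) - 1) * (\<tau> / 2)) = \<tau> / 2 * (?h powr (p - 1) - 1) * \<Phi> \<mu>"
      using p by simp
    moreover have "\<Psi> \<mu> + b / 2 \<le> (\<Psi> s + \<Psi> t) / 2"
      if "b \<le> a1 + a2" "\<Psi> \<mu> + a1 \<le> \<Psi> s" "\<Psi> \<mu> + a2 \<le> \<Psi> t" for a1 a2 b
      using that by simp
    ultimately show ?thesis unfolding distrib_left by metis
  qed
  show ?thesis
  proof (cases "s \<ge> t")
    case True
    then show ?thesis using * [OF s t \<mu>(1)] \<tau> by simp
  next
    case False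
    then have st: "t - s \<ge> 2 * \<tau> * \<mu>" using \<tau>(1) by linarith
    have ts: "\<mu> = (t + s) / 2" using \<mu>(1) by (simp add: add.commute)
    from * [OF t s ts st] show ?thesis by (simp only: add.commute[of "\<Psi> t"])
  qed
qed

text \<open>Vectors that are far apart relative to their lengths either have a midpoint clearly
  shorter than their mean length, or have different lengths. Monotonicity settles the first case and
  \<open>\<Psi>_gap_scalar\<close> the second; the two entries of the minimum belong to these
  cases.\<close>

lemma \<Psi>_gap_norm:
  fixes x y :: "'a::real_inner"
  assumes \<eta>: "0 < \<eta>" "\<eta> \<le> 1" and d: "norm (x - y) > \<eta> * (norm x + norm y)"
  shows "\<Psi> (norm ((1/2) *\<^sub>R (x + y))) + min (\<eta>\<^sup>2 / (4 * P)) (\<eta> / 4 * ((1 + \<eta> / 4) powr (p - 1) - 1) / 2) * \<Phi> ((norm x + norm y) / 2)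
    \<le> (\<Psi> (norm x) + \<Psi> (norm y)) / 2"
proof -
  define \<mu> where "\<mu> = (norm x + norm y) / 2"
  define m where "m = norm ((1/2) *\<^sub>R (x + y))"
  \<comment> \<open>With this choice \<eta>^2 - 2 \<delta> + \<delta>^2 \<ge> \<eta>^2/4, so by the
    parallelogram law the lengths differ by at least \<eta> \<mu> whenever the midpoint is longer
    than (1 - \<delta>) \<mu>.\<close>
  define \<delta> where "\<delta> = \<eta>\<^sup>2 / 4"
  define \<kappa> where "\<kappa> = min (\<eta>\<^sup>2 / (4 * P)) (\<eta> / 4 * ((1 + \<eta> / 4) powr (p - 1) - 1) / 2)"
  have \<mu>0: "\<mu> > 0"
  proof (rule ccontr)
    assume "\<not> \<mu> > 0"
    then have "norm x + norm y \<le> 0" by (simp add: \<mu>_def)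
    then have "x = 0 \<and> y = 0" using norm_ge_zero[of x] norm_ge_zero[of y]
      by (metis add_nonneg_eq_0_iff antisym add_nonneg_nonneg norm_eq_zero)
    then show False using d by simp
  qed
  have \<Phi>\<mu>: "\<Phi> \<mu> > 0" by (rule \<Phi>_pos[OF \<mu>0])
  have m\<mu>: "m \<le> \<mu>" using norm_triangle_ineq[of x y] by (simp add: m_def \<mu>_def)
  have m0: "m \<ge> 0" by (simp add: m_def)
  have \<delta>: "0 < \<delta>" "\<delta> \<le> 1" using \<eta> power_le_one[of \<eta> 2] by (auto simp: \<delta>_def)
  have "\<Psi> m + \<kappa> * \<Phi> \<mu> \<le> (\<Psi> (norm x) + \<Psi> (norm y)) / 2"
  proof (cases "m \<le> (1 - \<delta>) * \<mu>")
    case True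
    \<comment> \<open>Convexity between 0 and \<mu>: the tangent at (1 - \<delta>) \<mu> is
      evaluated at both ends and averaged.\<close>
    have "\<Psi> ((1 - \<delta>) * \<mu>) \<le> (1 - \<delta>) * \<Psi> \<mu>"
    proof (cases "\<delta> = 1")
      case False
      then have d1: "1 - \<delta> > 0" using \<delta> by simp
      define r where "r = (1 - \<delta>) * \<mu>"
      have r: "r > 0" using d1 \<mu>0 by (simp add: r_def)
      have "\<Psi> r + \<Phi> r / r * (\<mu> - r) \<le> \<Psi> \<mu>" "\<Psi> r + \<Phi> r / r * (0 - r) \<le> \<Psi> 0"
        using r \<mu>0 by (intro \<Psi>_tangent; simp)+
      then have "(1 - \<delta>) * (\<Psi> r + \<Phi> r / r * (\<mu> - r)) + \<delta> * (\<Psi> r + \<Phi> r / r * (0 - r)) \<le> (1 - \<delta>) * \<Psi> \<mu> + \<delta> * \<Psi> 0"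
        using d1 \<delta> by (intro add_mono mult_left_mono) auto
      moreover have "(1 - \<delta>) * (A + c * (\<mu> - r)) + \<delta> * (A + c * (0 - r)) = A + c * ((1 - \<delta>) * \<mu> - r)" for A c
        by (simp add: algebra_simps)
      ultimately have "\<Psi> r + \<Phi> r / r * ((1 - \<delta>) * \<mu> - r) \<le> (1 - \<delta>) * \<Psi> \<mu> + \<delta> * \<Psi> 0" by metis
      then show ?thesis by (simp add: r_def)
    qed simp
    moreover have "\<Psi> m \<le> \<Psi> ((1 - \<delta>) * \<mu>)" using True m0 by (intro \<Psi>_mono)
    moreover have "\<Psi> \<mu> \<le> (\<Psi> (norm x) + \<Psi> (norm y)) / 2"
      unfolding \<mu>_def by (rule \<Psi>_midpoint) auto
    moreover have "\<kappa> * \<Phi> \<mu> \<le> \<delta> * \<Psi> \<mu>"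
    proof -
      have "\<kappa> * \<Phi> \<mu> \<le> \<delta> / P * \<Phi> \<mu>"
        using \<Phi>\<mu> by (intro mult_right_mono) (auto simp: \<kappa>_def \<delta>_def)
      also have "\<dots> \<le> \<delta> / P * (P * \<Psi> \<mu>)"
        using \<Phi>_le_\<Psi>[of \<mu>] \<mu>0 \<delta> P_gt by (intro mult_left_mono) auto
      finally show ?thesis using P_gt by simp
    qed
    ultimately show ?thesis by (simp add: algebra_simps)
  next
    case False
    have mm: "m = norm (x + y) / 2" by (simp add: m_def)
    have "(norm (x + y))\<^sup>2 + (norm (x - y))\<^sup>2 = 2 * (norm x)\<^sup>2 + 2 * (norm y)\<^sup>2"
      by (simp add: power2_norm_eq_inner inner_add_left inner_add_right inner_diff_left inner_diff_right inner_commute)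
    then have par: "(norm x)\<^sup>2 + (norm y)\<^sup>2 = 2 * m\<^sup>2 + (norm (x - y))\<^sup>2 / 2"
      unfolding mm power_divide by simp
    have "(\<bar>norm x - norm y\<bar>)\<^sup>2 = 2 * ((norm x)\<^sup>2 + (norm y)\<^sup>2) - 4 * \<mu>\<^sup>2"
      by (simp add: \<mu>_def power2_eq_square algebra_simps field_simps)
    also have "\<dots> = 4 * m\<^sup>2 + (norm (x - y))\<^sup>2 - 4 * \<mu>\<^sup>2" unfolding par by simp
    also have "\<dots> \<ge> 4 * ((1 - \<delta>) * \<mu>)\<^sup>2 + (\<eta> * (2 * \<mu>))\<^sup>2 - 4 * \<mu>\<^sup>2"
    proof -
      have "((1 - \<delta>) * \<mu>)\<^sup>2 \<le> m\<^sup>2" using False \<delta> \<mu>0 by (intro power_mono) auto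
      moreover have "(\<eta> * (2 * \<mu>))\<^sup>2 \<le> (norm (x - y))\<^sup>2"
      proof (rule power_mono)
        have "\<eta> * (2 * \<mu>) = \<eta> * (norm x + norm y)" by (simp add: \<mu>_def)
        then show "\<eta> * (2 * \<mu>) \<le> norm (x - y)" using d by linarith
      qed (use \<eta> \<mu>0 in simp)
      ultimately show ?thesis by linarith
    qed
    moreover have "4 * ((1 - \<delta>) * \<mu>)\<^sup>2 + (\<eta> * (2 * \<mu>))\<^sup>2 - 4 * \<mu>\<^sup>2 = 4 * \<mu>\<^sup>2 * (\<eta>\<^sup>2 - 2 * \<delta> + \<delta>\<^sup>2)"
      by (simp add: power2_eq_square algebra_simps)
    moreover have "4 * \<mu>\<^sup>2 * (\<eta>\<^sup>2 / 4) \<le> 4 * \<mu>\<^sup>2 * (\<eta>\<^sup>2 - 2 * \<delta> + \<delta>\<^sup>2)"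
      by (intro mult_left_mono) (auto simp: \<delta>_def)
    moreover have "4 * \<mu>\<^sup>2 * (\<eta>\<^sup>2 / 4) = (2 * (\<eta> / 2) * \<mu>)\<^sup>2"
      by (simp add: power2_eq_square)
    ultimately have "(2 * (\<eta> / 2) * \<mu>)\<^sup>2 \<le> (\<bar>norm x - norm y\<bar>)\<^sup>2" by linarith
    then have "2 * (\<eta> / 2) * \<mu> \<le> \<bar>norm x - norm y\<bar>"
      using \<eta> \<mu>0 by (simp add: abs_le_square_iff[symmetric] del: power2_abs)
    then have "\<Psi> \<mu> + (\<eta> / 2) / 2 * ((1 + (\<eta> / 2) / 2) powr (p - 1) - 1) * \<Phi> \<mu> / 2 \<le> (\<Psi> (norm x) + \<Psi> (norm y)) / 2"
      using \<eta> by (intro \<Psi>_gap_scalar[OF _ _ \<mu>_def \<mu>0]) auto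
    moreover have "\<Psi> m \<le> \<Psi> \<mu>" using m\<mu> m0 by (intro \<Psi>_mono)
    moreover have "\<kappa> * \<Phi> \<mu> \<le> (\<eta> / 4 * ((1 + \<eta> / 4) powr (p - 1) - 1) / 2) * \<Phi> \<mu>"
      using \<Phi>\<mu> by (intro mult_right_mono) (auto simp: \<kappa>_def)
    moreover have "(\<eta> / 2) / 2 * ((1 + (\<eta> / 2) / 2) powr (p - 1) - 1) * \<Phi> \<mu> / 2 =
        (\<eta> / 4 * ((1 + \<eta> / 4) powr (p - 1) - 1) / 2) * \<Phi> \<mu>" by simp
    ultimately show ?thesis by linarith
  qed
  then show ?thesis by (simp add: m_def \<kappa>_def \<mu>_def)
qed

lemma \<Psi>_norm_midpoint:
  fixes x y :: "'a::real_inner"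
  shows "\<Psi> (norm ((1/2) *\<^sub>R (x + y))) \<le> (\<Psi> (norm x) + \<Psi> (norm y)) / 2"
proof -
  have "\<Psi> (norm ((1/2) *\<^sub>R (x + y))) \<le> \<Psi> ((norm x + norm y) / 2)"
    using norm_triangle_ineq[of x y] by (intro \<Psi>_mono) auto
  also have "\<dots> \<le> (\<Psi> (norm x) + \<Psi> (norm y)) / 2" by (rule \<Psi>_midpoint) auto
  finally show ?thesis .
qed

text \<open>An additive form that can be integrated as it stands. Where x and y are relatively
  close, the \<open>\<epsilon>\<close> term pays by \<open>\<Phi>_contract\<close> and
  \<open>\<Phi>_add\<close>; elsewhere the midpoint defect of \<open>\<Psi>\<close> pays by
  \<open>\<Psi>_gap_norm\<close>.\<close>

lemma uniform_convexity:
  assumes \<epsilon>: "\<epsilon> > 0"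
  obtains C where "C \<ge> 0" "\<And>x y :: 'a::real_inner. \<Phi> (norm (x - y)) \<le> \<epsilon> * (\<Phi> (norm x) + \<Phi> (norm y)) +
    C * ((\<Psi> (norm x) + \<Psi> (norm y)) / 2 - \<Psi> (norm ((1/2) *\<^sub>R (x + y))))"
proof -
  define \<eta> where "\<eta> = min 1 (\<epsilon> / 2 powr P)"
  have \<eta>: "0 < \<eta>" "\<eta> \<le> 1" "\<eta> * 2 powr P \<le> \<epsilon>"
    using \<epsilon> by (auto simp: \<eta>_def min_def field_simps split: if_splits)
  define \<kappa> where "\<kappa> = min (\<eta>\<^sup>2 / (4 * P)) (\<eta> / 4 * ((1 + \<eta> / 4) powr (p - 1) - 1) / 2)"
  have "(1 + \<eta> / 4) powr (p - 1) > 1" using \<eta> p by (intro gr_one_powr) auto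
  then have \<kappa>: "\<kappa> > 0" using \<eta> P_gt by (simp add: \<kappa>_def)
  show ?thesis
  proof
    show "2 powr P / \<kappa> \<ge> 0" using \<kappa> by simp
    fix x y :: 'a
    let ?D = "(\<Psi> (norm x) + \<Psi> (norm y)) / 2 - \<Psi> (norm ((1/2) *\<^sub>R (x + y)))"
    have D: "?D \<ge> 0" using \<Psi>_norm_midpoint[of x y] by simp
    have \<Phi>s: "\<Phi> (norm x) + \<Phi> (norm y) \<ge> 0" by (intro add_nonneg_nonneg \<Phi>_nonneg) auto
    show "\<Phi> (norm (x - y)) \<le> \<epsilon> * (\<Phi> (norm x) + \<Phi> (norm y)) + 2 powr P / \<kappa> * ?D"
    proof (cases "norm (x - y) > \<eta> * (norm x + norm y)")
      case False
      have "\<Phi> (norm (x - y)) \<le> \<Phi> (\<eta> * (norm x + norm y))" using False by (intro \<Phi>_mono) auto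
      also have "\<dots> \<le> \<eta> * \<Phi> (norm x + norm y)" using \<eta> by (intro \<Phi>_contract) auto
      also have "\<dots> \<le> \<eta> * (2 powr P * (\<Phi> (norm x) + \<Phi> (norm y)))" using \<eta> by (intro mult_left_mono \<Phi>_add) auto
      also have "\<dots> \<le> \<epsilon> * (\<Phi> (norm x) + \<Phi> (norm y))"
        using \<eta>(3) \<Phi>s by (simp add: mult.assoc[symmetric] mult_right_mono)
      also have "\<dots> \<le> \<epsilon> * (\<Phi> (norm x) + \<Phi> (norm y)) + 2 powr P / \<kappa> * ?D"
        using D \<kappa> by (simp add: mult_nonneg_nonneg)
      finally show ?thesis .
    next
      case True
      let ?\<mu> = "(norm x + norm y) / 2"
      have "\<kappa> * \<Phi> ?\<mu> \<le> ?D" using \<Psi>_gap_norm[OF \<eta>(1,2) True] unfolding \<kappa>_def by linarith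
      then have "2 powr P / \<kappa> * (\<kappa> * \<Phi> ?\<mu>) \<le> 2 powr P / \<kappa> * ?D" using \<kappa> by (intro mult_left_mono) auto
      moreover have "\<Phi> (norm (x - y)) \<le> \<Phi> (2 * ?\<mu>)" using norm_triangle_ineq4[of x y] by (intro \<Phi>_mono) auto
      moreover have "\<Phi> (2 * ?\<mu>) \<le> 2 powr P * \<Phi> ?\<mu>" by (intro \<Phi>_upper) auto
      moreover have "0 \<le> \<epsilon> * (\<Phi> (norm x) + \<Phi> (norm y))" using \<Phi>s \<epsilon> by simp
      ultimately show ?thesis using \<kappa> by simp
    qed
  qed
qed

end

section \<open>Modular convergence\<close>

lemma fatou_bounded:
  fixes h :: "nat \<Rightarrow> 'a \<Rightarrow> real"
  assumes h: "\<And>k. integrable M (h k)" and h0: "\<And>k x. h k x \<ge> 0" and m: "H \<in> borel_measurable M"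
    and lim: "AE x in M. (\<lambda>k. h k x) \<longlonglongrightarrow> H x"
    and B: "\<forall>\<^sub>F k in sequentially. (LINT x|M. h k x) \<le> B"
  shows "integrable M H" "(LINT x|M. H x) \<le> B"
proof -
  have B0: "B \<ge> 0"
  proof -
    obtain k where "(LINT x|M. h k x) \<le> B" using B by (meson eventually_sequentially order_refl)
    moreover have "0 \<le> (LINT x|M. h k x)" by (rule integral_nonneg_AE) (simp add: h0)
    ultimately show ?thesis by linarith
  qed
  have H0: "AE x in M. H x \<ge> 0"
    using lim by eventually_elim (auto intro: LIMSEQ_le_const h0)
  have m': "h k \<in> borel_measurable M" for k using h by auto
  have "(\<integral>\<^sup>+x. ennreal (H x) \<partial>M) = (\<integral>\<^sup>+x. liminf (\<lambda>k. ennreal (h k x)) \<partial>M)"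
  proof (rule nn_integral_cong_AE)
    show "AE x in M. ennreal (H x) = liminf (\<lambda>k. ennreal (h k x))"
      using lim
    proof eventually_elim
      fix x assume "(\<lambda>k. h k x) \<longlonglongrightarrow> H x"
      then have "(\<lambda>k. ennreal (h k x)) \<longlonglongrightarrow> ennreal (H x)" by (rule tendsto_ennrealI)
      then show "ennreal (H x) = liminf (\<lambda>k. ennreal (h k x))" by (simp add: lim_imp_Liminf)
    qed
  qed
  also have "\<dots> \<le> liminf (\<lambda>k. \<integral>\<^sup>+x. ennreal (h k x) \<partial>M)"
    using m' by (intro nn_integral_liminf) auto
  also have "\<dots> = liminf (\<lambda>k. ennreal (LINT x|M. h k x))"
    using h h0 by (intro arg_cong[where f=liminf] ext nn_integral_eq_integral) auto
  also have "\<dots> \<le> liminf (\<lambda>k. ennreal B)"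
    using B by (intro Liminf_mono) (auto elim!: eventually_mono intro: ennreal_leI)
  also have "\<dots> = ennreal B" by (simp add: Liminf_const)
  finally have le: "(\<integral>\<^sup>+x. ennreal (H x) \<partial>M) \<le> ennreal B" .
  show i: "integrable M H"
  proof (rule integrableI_nonneg[OF m H0])
    show "(\<integral>\<^sup>+x. ennreal (H x) \<partial>M) < \<infinity>" using le by (simp add: le_less_trans[OF _ ennreal_less_top])
  qed
  have "ennreal (LINT x|M. H x) \<le> ennreal B"
    using le nn_integral_eq_integral[OF i H0] by simp
  then show "(LINT x|M. H x) \<le> B" using B0 by (simp add: ennreal_le_iff)
qed

lemma L1_Cauchy_limit:
  fixes f :: "nat \<Rightarrow> 'a \<Rightarrow> 'b::euclidean_space"
  assumes f: "\<And>n. integrable M (f n)"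
    and C: "\<And>e. e > 0 \<Longrightarrow> \<exists>N. \<forall>m\<ge>N. \<forall>n\<ge>N. (LINT x|M. norm (f m x - f n x)) < e"
  obtains F r where "F \<in> borel_measurable M" "strict_mono (r :: nat \<Rightarrow> nat)" "AE x in M. (\<lambda>k. f (r k) x) \<longlonglongrightarrow> F x"
proof -
  obtain r where r: "strict_mono r" "AE x in M. Cauchy (\<lambda>i. f (r i) x)"
    using cauchy_L1_AE_cauchy_subseq[OF f C] by blast
  have "(\<lambda>x. lim (\<lambda>i. f (r i) x)) \<in> borel_measurable M"
    using f by (intro borel_measurable_lim_metric) auto
  moreover have "AE x in M. (\<lambda>k. f (r k) x) \<longlonglongrightarrow> lim (\<lambda>i. f (r i) x)"
    using r(2) by eventually_elim (simp add: Cauchy_convergent convergent_LIMSEQ_iff[symmetric])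
  ultimately show ?thesis using that r(1) by blast
qed

text \<open>Only an almost everywhere limit of a subsequence is constructed. Fatou, applied to norm
  (f n - f (r k)) as k grows, yields integrability of F and convergence of the full sequence at
  once.\<close>

lemma L1_complete:
  fixes f :: "nat \<Rightarrow> 'a \<Rightarrow> 'b::euclidean_space"
  assumes f: "\<And>n. integrable M (f n)"
    and C: "\<And>e. e > 0 \<Longrightarrow> \<exists>N. \<forall>m\<ge>N. \<forall>n\<ge>N. (LINT x|M. norm (f m x - f n x)) < e"
  obtains F where "integrable M F" "(\<lambda>n. LINT x|M. norm (f n x - F x)) \<longlonglongrightarrow> 0"
proof -
  obtain F r where F: "F \<in> borel_measurable M" "strict_mono (r :: nat \<Rightarrow> nat)" "AE x in M. (\<lambda>k. f (r k) x) \<longlonglongrightarrow> F x"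
    using L1_Cauchy_limit[OF f C] by blast
  have *: "\<exists>N. \<forall>n\<ge>N. integrable M (\<lambda>x. norm (f n x - F x)) \<and> (LINT x|M. norm (f n x - F x)) \<le> e" if e: "e > 0" for e
  proof -
    obtain N where N: "\<And>m n. m \<ge> N \<Longrightarrow> n \<ge> N \<Longrightarrow> (LINT x|M. norm (f m x - f n x)) < e" using C[OF e] by blast
    have "integrable M (\<lambda>x. norm (f n x - F x)) \<and> (LINT x|M. norm (f n x - F x)) \<le> e" if n: "n \<ge> N" for n
    proof -
      have 1: "integrable M (\<lambda>x. norm (f n x - f (r k) x))" for k using f by simp
      have 2: "(\<lambda>x. norm (f n x - F x)) \<in> borel_measurable M"
        using F(1) borel_measurable_integrable[OF f[of n]] by simp
      have 3: "AE x in M. (\<lambda>k. norm (f n x - f (r k) x)) \<longlonglongrightarrow> norm (f n x - F x)"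
        using F(3) by eventually_elim (intro tendsto_intros)
      have 4: "\<forall>\<^sub>F k in sequentially. (LINT x|M. norm (f n x - f (r k) x)) \<le> e"
        using eventually_ge_at_top[of N]
      proof eventually_elim
        fix k assume "N \<le> k"
        then have "r k \<ge> N" using seq_suble[OF F(2), of k] by simp
        then show "(LINT x|M. norm (f n x - f (r k) x)) \<le> e" using N[OF n] by (simp add: less_imp_le)
      qed
      show ?thesis using fatou_bounded[OF 1 norm_ge_zero 2 3 4] by blast
    qed
    then show ?thesis by blast
  qed
  have Fi: "integrable M F"
  proof -
    obtain n where "integrable M (\<lambda>x. norm (f n x - F x))" using *[of 1] by auto
    moreover have "(\<lambda>x. f n x - F x) \<in> borel_measurable M" using F(1) borel_measurable_integrable[OF f[of n]] by simp
    ultimately have "integrable M (\<lambda>x. f n x - F x)" by (simp add: integrable_norm_iff)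
    with f[of n] have "integrable M (\<lambda>x. f n x - (f n x - F x))" by (rule Bochner_Integration.integrable_diff)
    moreover have "(\<lambda>x. f n x - (f n x - F x)) = F" by (simp add: fun_eq_iff)
    ultimately show ?thesis by (simp only:)
  qed
  have "(\<lambda>n. LINT x|M. norm (f n x - F x)) \<longlonglongrightarrow> 0"
  proof (rule LIMSEQ_I)
    fix e :: real assume "e > 0"
    then obtain N where "\<And>n. n \<ge> N \<Longrightarrow> (LINT x|M. norm (f n x - F x)) \<le> e / 2" using *[of "e / 2"] by auto
    moreover have "0 \<le> (LINT x|M. norm (f n x - F x))" for n by simp
    ultimately show "\<exists>N. \<forall>n\<ge>N. norm ((LINT x|M. norm (f n x - F x)) - 0) < e"
      using \<open>e > 0\<close> by (intro exI[of _ N]) (force intro: le_less_trans)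
  qed
  then show ?thesis using that Fi by blast
qed

section \<open>The modular on a bounded open set\<close>

locale orlicz_domain = young +
  fixes \<Omega> :: "(real^'n::finite) set"
  assumes \<Omega>_open: "open \<Omega>" and \<Omega>_bounded: "bounded \<Omega>"
begin

abbreviation "M \<equiv> lebesgue_on \<Omega>"

lemma \<Omega>_sets[simp]: "\<Omega> \<in> sets lebesgue"
  using \<Omega>_open by (simp add: borel_open)

lemma space_M[simp]: "space M = \<Omega>"
  by (simp add: space_restrict_space)

lemma finite_M: "finite_measure M"
proof
  have "emeasure M \<Omega> = emeasure lebesgue \<Omega>" by (simp add: emeasure_restrict_space)
  also have "\<dots> = emeasure lborel \<Omega>" using \<Omega>_open by (simp add: borel_open)
  also have "\<dots> < \<infinity>" using \<Omega>_bounded by (rule emeasure_bounded_finite)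
  finally show "emeasure M (space M) \<noteq> \<infinity>" by simp
qed

sublocale M: finite_measure M by (rule finite_M)

lemma measurable_M_continuous:
  fixes f :: "real^'n \<Rightarrow> 'b::euclidean_space"
  assumes "continuous_on \<Omega> f" shows "f \<in> borel_measurable M"
  by (rule continuous_imp_measurable_on_sets_lebesgue[OF assms]) simp

lemma nn_integral_M:
  assumes "f \<in> borel_measurable borel" "\<And>x. x \<notin> \<Omega> \<Longrightarrow> f x = (0::ennreal)"
  shows "(\<integral>\<^sup>+x. f x \<partial>M) = (\<integral>\<^sup>+x. f x \<partial>lborel)"
proof -
  have "(\<integral>\<^sup>+x. f x \<partial>M) = (\<integral>\<^sup>+x. f x * indicator \<Omega> x \<partial>lebesgue)"
    by (rule nn_integral_restrict_space) simp
  also have "\<dots> = (\<integral>\<^sup>+x. f x \<partial>lebesgue)"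
    using assms(2) by (intro nn_integral_cong) (auto simp: indicator_def)
  also have "\<dots> = (\<integral>\<^sup>+x. f x \<partial>lborel)" by (rule nn_integral_completion)
  finally show ?thesis .
qed

lemma integral_M:
  fixes f :: "real^'n \<Rightarrow> real"
  assumes "f \<in> borel_measurable borel" "\<And>x. x \<notin> \<Omega> \<Longrightarrow> f x = 0"
  shows "(LINT x|M. f x) = (LINT x|lborel. f x)"
proof -
  have "(LINT x|M. f x) = (LINT x|lebesgue. indicator \<Omega> x *\<^sub>R f x)"
    by (rule integral_restrict_space) simp
  also have "\<dots> = (LINT x|lebesgue. f x)"
    using assms(2) by (intro Bochner_Integration.integral_cong) (auto simp: indicator_def)
  also have "\<dots> = (LINT x|lborel. f x)" using assms(1) by (intro integral_completion) simp
  finally show ?thesis .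
qed

lemma integrable_M_bounded:
  fixes f :: "real^'n \<Rightarrow> 'b::euclidean_space"
  assumes "f \<in> borel_measurable M" "\<And>x. x \<in> \<Omega> \<Longrightarrow> norm (f x) \<le> B"
  shows "integrable M f"
  using assms by (intro M.integrable_const_bound[where B=B] AE_I2) auto

text \<open>By \<open>\<Phi>_upper\<close> a finite modular stays finite under scaling, so this is
  already a vector space. Convergence of modulars replaces convergence in norm; the norms of the
  problem return only when \<open>X\<close> is compared with \<open>W01_space\<close>.\<close>

definition OL :: "(real^'n \<Rightarrow> 'b::euclidean_space) \<Rightarrow> bool" where
  "OL f \<longleftrightarrow> f \<in> borel_measurable M \<and> integrable M (\<lambda>x. \<Phi> (norm (f x)))"

definition modular :: "(real^'n \<Rightarrow> 'b::euclidean_space) \<Rightarrow> real" where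
  "modular f = (LINT x|M. \<Phi> (norm (f x)))"

lemma \<Phi>_borel[measurable]: "\<Phi> \<in> borel_measurable borel"
  by (intro borel_measurable_continuous_onI \<Phi>_cont)

lemma \<Phi>_norm_measurable: "f \<in> borel_measurable M \<Longrightarrow> (\<lambda>x. \<Phi> (norm (f x))) \<in> borel_measurable M"
  for f :: "real^'n \<Rightarrow> 'b::euclidean_space"
  by measurable

lemma \<Phi>_norm_nonneg: "0 \<le> \<Phi> (norm x)" for x :: "'b::real_normed_vector"
  by (simp add: \<Phi>_nonneg)

lemma modular_nonneg: "modular f \<ge> 0"
  unfolding modular_def by (simp add: \<Phi>_norm_nonneg)

lemma OL_measurable: "OL f \<Longrightarrow> f \<in> borel_measurable M"
  by (simp add: OL_def)

lemma OL_dominated: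
  fixes f :: "real^'n \<Rightarrow> 'b::euclidean_space"
  assumes "f \<in> borel_measurable M" "integrable M h" "AE x in M. \<Phi> (norm (f x)) \<le> h x"
  shows "OL f" "modular f \<le> (LINT x|M. h x)"
proof -
  have i: "integrable M (\<lambda>x. \<Phi> (norm (f x)))"
    using assms(3) by (intro Bochner_Integration.integrable_bound[OF assms(2) \<Phi>_norm_measurable[OF assms(1)]])
      (auto simp: \<Phi>_norm_nonneg)
  then show "OL f" using assms(1) by (simp add: OL_def)
  show "modular f \<le> (LINT x|M. h x)"
    unfolding modular_def by (rule integral_mono_AE[OF i assms(2,3)])
qed

lemma OL_add:
  fixes f g :: "real^'n \<Rightarrow> 'b::euclidean_space"
  assumes "OL f" "OL g"
  shows "OL (\<lambda>x. f x + g x)" "modular (\<lambda>x. f x + g x) \<le> 2 powr P * (modular f + modular g)"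
proof -
  let ?h = "\<lambda>x. 2 powr P * (\<Phi> (norm (f x)) + \<Phi> (norm (g x)))"
  have i: "integrable M ?h" using assms by (auto simp: OL_def)
  have m: "(\<lambda>x. f x + g x) \<in> borel_measurable M" using assms by (auto simp: OL_def)
  have le: "AE x in M. \<Phi> (norm (f x + g x)) \<le> ?h x" by (simp add: \<Phi>_norm_add)
  show "OL (\<lambda>x. f x + g x)" by (rule OL_dominated(1)[OF m i le])
  have "modular (\<lambda>x. f x + g x) \<le> (LINT x|M. ?h x)" by (rule OL_dominated(2)[OF m i le])
  also have "\<dots> = 2 powr P * (modular f + modular g)"
    using assms by (simp add: modular_def OL_def)
  finally show "modular (\<lambda>x. f x + g x) \<le> 2 powr P * (modular f + modular g)" .
qed

lemma OL_scale:
  fixes f :: "real^'n \<Rightarrow> 'b::euclidean_space"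
  assumes "OL f"
  shows "OL (\<lambda>x. c *\<^sub>R f x)" "modular (\<lambda>x. c *\<^sub>R f x) \<le> (max 1 \<bar>c\<bar>) powr P * modular f"
proof -
  let ?h = "\<lambda>x. (max 1 \<bar>c\<bar>) powr P * \<Phi> (norm (f x))"
  have i: "integrable M ?h" using assms by (auto simp: OL_def)
  have m: "(\<lambda>x. c *\<^sub>R f x) \<in> borel_measurable M" using assms by (auto simp: OL_def)
  have le: "AE x in M. \<Phi> (norm (c *\<^sub>R f x)) \<le> ?h x" by (simp add: \<Phi>_scale)
  show "OL (\<lambda>x. c *\<^sub>R f x)" by (rule OL_dominated(1)[OF m i le])
  have "modular (\<lambda>x. c *\<^sub>R f x) \<le> (LINT x|M. ?h x)" by (rule OL_dominated(2)[OF m i le])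
  then show "modular (\<lambda>x. c *\<^sub>R f x) \<le> (max 1 \<bar>c\<bar>) powr P * modular f"
    by (simp add: modular_def)
qed

lemma OL_mono:
  fixes f :: "real^'n \<Rightarrow> 'b::euclidean_space" and g :: "real^'n \<Rightarrow> 'c::euclidean_space"
  assumes "OL g" "f \<in> borel_measurable M" "\<And>x. x \<in> \<Omega> \<Longrightarrow> norm (f x) \<le> norm (g x)"
  shows "OL f" "modular f \<le> modular g"
proof -
  have le: "AE x in M. \<Phi> (norm (f x)) \<le> \<Phi> (norm (g x))"
    using assms(3) by (intro AE_I2) (auto intro!: \<Phi>_mono)
  have i: "integrable M (\<lambda>x. \<Phi> (norm (g x)))" using assms(1) by (simp add: OL_def)
  show "OL f" "modular f \<le> modular g"
    using OL_dominated[OF assms(2) i le] by (simp_all add: modular_def)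
qed

lemma modular_minus: "modular (\<lambda>x. f x - g x) = modular (\<lambda>x. g x - f x)"
  by (simp add: modular_def norm_minus_commute)

lemma OL_diff:
  fixes f g :: "real^'n \<Rightarrow> 'b::euclidean_space"
  assumes "OL f" "OL g"
  shows "OL (\<lambda>x. f x - g x)"
  using OL_add(1)[OF assms(1) OL_scale(1)[OF assms(2), of "-1"]] by simp

lemma modular_triangle:
  fixes f g h :: "real^'n \<Rightarrow> 'b::euclidean_space"
  assumes "OL f" "OL g" "OL h"
  shows "modular (\<lambda>x. f x - h x) \<le> 2 powr P * (modular (\<lambda>x. f x - g x) + modular (\<lambda>x. g x - h x))"
  using OL_add(2)[OF OL_diff[OF assms(1,2)] OL_diff[OF assms(2,3)]] by simp

lemma OL_bounded:
  fixes f :: "real^'n \<Rightarrow> 'b::euclidean_space"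
  assumes "f \<in> borel_measurable M" "\<And>x. x \<in> \<Omega> \<Longrightarrow> norm (f x) \<le> B"
  shows "OL f"
proof (rule OL_mono(1)[of "\<lambda>x. B"])
  show "OL (\<lambda>x. B)" by (simp add: OL_def)
qed (use assms in force)+

lemma OL_L1:
  fixes f :: "real^'n \<Rightarrow> 'b::euclidean_space"
  assumes "OL f"
  shows "integrable M f" "\<delta> > 0 \<Longrightarrow> (LINT x|M. norm (f x)) \<le> \<delta> * measure M \<Omega> + \<delta> / \<Phi> \<delta> * modular f"
proof -
  have m: "f \<in> borel_measurable M" and i: "integrable M (\<lambda>x. \<Phi> (norm (f x)))" using assms by (auto simp: OL_def)
  have le: "norm (f x) \<le> \<delta> + \<delta> / \<Phi> \<delta> * \<Phi> (norm (f x))" if "\<delta> > 0" for \<delta> x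
    using \<Phi>_bound_linear[OF that] by simp
  have ih: "integrable M (\<lambda>x. \<delta> + \<delta> / \<Phi> \<delta> * \<Phi> (norm (f x)))" for \<delta> using i by simp
  show fi: "integrable M f"
    by (rule Bochner_Integration.integrable_bound[OF ih[of 1] m])
       (use le[of 1] in \<open>auto intro!: AE_I2 order_trans[OF _ abs_ge_self]\<close>)
  show "(LINT x|M. norm (f x)) \<le> \<delta> * measure M \<Omega> + \<delta> / \<Phi> \<delta> * modular f" if "\<delta> > 0"
  proof -
    have "(LINT x|M. norm (f x)) \<le> (LINT x|M. \<delta> + \<delta> / \<Phi> \<delta> * \<Phi> (norm (f x)))"
      using fi ih le[OF that] by (intro integral_mono) auto
    also have "\<dots> = \<delta> * measure M \<Omega> + \<delta> / \<Phi> \<delta> * modular f"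
      using i by (simp add: modular_def mult.commute)
    finally show ?thesis .
  qed
qed

lemma modular_L1_tendsto:
  fixes f :: "nat \<Rightarrow> real^'n \<Rightarrow> 'b::euclidean_space"
  assumes f: "\<And>n. OL (f n)" and lim: "(\<lambda>n. modular (f n)) \<longlonglongrightarrow> 0"
  shows "(\<lambda>n. LINT x|M. norm (f n x)) \<longlonglongrightarrow> 0"
proof (rule LIMSEQ_I)
  fix e :: real assume e: "e > 0"
  \<comment> \<open>The constant term of \<open>OL_L1\<close> takes at most half of e and leaves the
    other half to the modular.\<close>
  define \<delta> where "\<delta> = e / (2 * (measure M \<Omega> + 1))"
  have \<delta>: "\<delta> > 0" "\<delta> * measure M \<Omega> \<le> e / 2"
    using e by (auto simp: \<delta>_def field_simps add_pos_nonneg measure_nonneg)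
  have "(\<lambda>n. \<delta> / \<Phi> \<delta> * modular (f n)) \<longlonglongrightarrow> \<delta> / \<Phi> \<delta> * 0" by (intro tendsto_intros lim)
  then have "\<forall>\<^sub>F n in sequentially. \<delta> / \<Phi> \<delta> * modular (f n) < e / 2"
    using e by (intro order_tendstoD(2)) auto
  then obtain N where N: "\<And>n. n \<ge> N \<Longrightarrow> \<delta> / \<Phi> \<delta> * modular (f n) < e / 2"
    unfolding eventually_sequentially by blast
  have "norm ((LINT x|M. norm (f n x)) - 0) < e" if "n \<ge> N" for n
  proof -
    have "(LINT x|M. norm (f n x)) < e"
      using OL_L1(2)[OF f \<delta>(1), of n] \<delta>(2) N[OF that] by linarith
    then show ?thesis by simp
  qed
  then show "\<exists>N. \<forall>n\<ge>N. norm ((LINT x|M. norm (f n x)) - 0) < e" by blast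
qed

lemma modular_Cauchy_L1:
  fixes f :: "nat \<Rightarrow> real^'n \<Rightarrow> 'b::euclidean_space"
  assumes f: "\<And>n. OL (f n)"
    and C: "\<And>e. e > 0 \<Longrightarrow> \<exists>N. \<forall>m\<ge>N. \<forall>n\<ge>N. modular (\<lambda>x. f m x - f n x) < e"
    and e: "e > 0"
  shows "\<exists>N. \<forall>m\<ge>N. \<forall>n\<ge>N. (LINT x|M. norm (f m x - f n x)) < e"
proof -
  define \<delta> where "\<delta> = e / (2 * (measure M \<Omega> + 1))"
  have \<delta>: "\<delta> > 0" "\<delta> * measure M \<Omega> \<le> e / 2"
    using e by (auto simp: \<delta>_def field_simps add_pos_nonneg measure_nonneg)
  have "e / 2 * \<Phi> \<delta> / \<delta> > 0" using \<delta> e \<Phi>_pos by simp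
  then obtain N where N: "\<And>m n. m \<ge> N \<Longrightarrow> n \<ge> N \<Longrightarrow> modular (\<lambda>x. f m x - f n x) < e / 2 * \<Phi> \<delta> / \<delta>"
    using C by blast
  have "(LINT x|M. norm (f m x - f n x)) < e" if "m \<ge> N" "n \<ge> N" for m n
  proof -
    have "\<delta> / \<Phi> \<delta> * modular (\<lambda>x. f m x - f n x) < \<delta> / \<Phi> \<delta> * (e / 2 * \<Phi> \<delta> / \<delta>)"
      using \<delta>(1) \<Phi>_pos[OF \<delta>(1)] N[OF that] by (intro mult_strict_left_mono) auto
    also have "\<dots> = e / 2" using \<delta>(1) \<Phi>_pos[OF \<delta>(1)] by simp
    finally show ?thesis using OL_L1(2)[OF OL_diff[OF f f] \<delta>(1), of m n] \<delta>(2) by linarith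
  qed
  then show ?thesis by blast
qed

lemma OL_complete:
  fixes f :: "nat \<Rightarrow> real^'n \<Rightarrow> 'b::euclidean_space"
  assumes f: "\<And>n. OL (f n)"
    and C: "\<And>e. e > 0 \<Longrightarrow> \<exists>N. \<forall>m\<ge>N. \<forall>n\<ge>N. modular (\<lambda>x. f m x - f n x) < e"
  obtains F where "OL F" "(\<lambda>n. modular (\<lambda>x. f n x - F x)) \<longlonglongrightarrow> 0"
proof -
  obtain F r where F: "F \<in> borel_measurable M" "strict_mono (r :: nat \<Rightarrow> nat)" "AE x in M. (\<lambda>k. f (r k) x) \<longlonglongrightarrow> F x"
    using L1_Cauchy_limit[OF OL_L1(1)[OF f] modular_Cauchy_L1[OF f C]] by blast
  have *: "\<exists>N. \<forall>n\<ge>N. OL (\<lambda>x. f n x - F x) \<and> modular (\<lambda>x. f n x - F x) \<le> e" if e: "e > 0" for e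
  proof -
    obtain N where N: "\<And>m n. m \<ge> N \<Longrightarrow> n \<ge> N \<Longrightarrow> modular (\<lambda>x. f m x - f n x) < e" using C[OF e] by blast
    have "OL (\<lambda>x. f n x - F x) \<and> modular (\<lambda>x. f n x - F x) \<le> e" if n: "n \<ge> N" for n
    proof -
      have 1: "integrable M (\<lambda>x. \<Phi> (norm (f n x - f (r k) x)))" for k
        using OL_diff[OF f f, of n "r k"] by (simp add: OL_def)
      have 2: "(\<lambda>x. f n x - F x) \<in> borel_measurable M" using F(1) OL_measurable[OF f[of n]] by simp
      have 3: "AE x in M. (\<lambda>k. \<Phi> (norm (f n x - f (r k) x))) \<longlonglongrightarrow> \<Phi> (norm (f n x - F x))"
        using F(3)
      proof eventually_elim
        fix x assume "(\<lambda>k. f (r k) x) \<longlonglongrightarrow> F x"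
        then have "(\<lambda>k. norm (f n x - f (r k) x)) \<longlonglongrightarrow> norm (f n x - F x)" by (intro tendsto_intros)
        then show "(\<lambda>k. \<Phi> (norm (f n x - f (r k) x))) \<longlonglongrightarrow> \<Phi> (norm (f n x - F x))"
          by (rule continuous_on_tendsto_compose[OF \<Phi>_cont[of UNIV]]) auto
      qed
      have 4: "\<forall>\<^sub>F k in sequentially. (LINT x|M. \<Phi> (norm (f n x - f (r k) x))) \<le> e"
        using eventually_ge_at_top[of N]
      proof eventually_elim
        fix k assume "N \<le> k"
        then have "r k \<ge> N" using seq_suble[OF F(2), of k] by simp
        then show "(LINT x|M. \<Phi> (norm (f n x - f (r k) x))) \<le> e"
          using N[OF n, of "r k"] by (simp add: modular_def)
      qed
      show ?thesis
        using fatou_bounded[OF 1 \<Phi>_norm_nonneg \<Phi>_norm_measurable[OF 2] 3 4] 2 by (simp add: OL_def modular_def)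
    qed
    then show ?thesis by blast
  qed
  have "OL F"
  proof -
    obtain n where "OL (\<lambda>x. f n x - F x)" using *[of 1] by auto
    from OL_diff[OF f[of n] this] show ?thesis by simp
  qed
  moreover have "(\<lambda>n. modular (\<lambda>x. f n x - F x)) \<longlonglongrightarrow> 0"
  proof (rule LIMSEQ_I)
    fix e :: real assume e: "e > 0"
    then obtain N where N: "\<And>n. n \<ge> N \<Longrightarrow> modular (\<lambda>x. f n x - F x) \<le> e / 2" using *[of "e / 2"] by auto
    have "norm (modular (\<lambda>x. f n x - F x) - 0) < e" if "n \<ge> N" for n
      using N[OF that] modular_nonneg[of "\<lambda>x. f n x - F x"] e by simp
    then show "\<exists>N. \<forall>n\<ge>N. norm (modular (\<lambda>x. f n x - F x) - 0) < e" by blast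
  qed
  ultimately show ?thesis using that by blast
qed

lemma modular_AE_subseq:
  fixes f :: "nat \<Rightarrow> real^'n \<Rightarrow> 'b::euclidean_space"
  assumes f: "\<And>n. OL (f n)" and lim: "(\<lambda>n. modular (f n)) \<longlonglongrightarrow> 0"
  obtains r where "strict_mono (r :: nat \<Rightarrow> nat)" "AE x in M. (\<lambda>n. f (r n) x) \<longlonglongrightarrow> 0"
  using tendsto_L1_AE_subseq[OF OL_L1(1)[OF f] modular_L1_tendsto[OF f lim]] by blast

section \<open>Functions approximable by test functions\<close>

lemma OL_test:
  assumes "test_function \<Omega> \<psi>"
  shows "OL \<psi>" "OL (gradient \<psi>)"
proof -
  obtain B where B: "\<And>x. \<bar>\<psi> x\<bar> \<le> B" "\<And>x. norm (gradient \<psi> x) \<le> B"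
    using test_function_bounded[OF assms] by blast
  have C1: "C1 \<psi>" by (rule test_functionD(1)[OF assms])
  show "OL \<psi>" by (rule OL_bounded[of _ B]) (use B C1_continuous[OF C1] in \<open>auto intro: measurable_M_continuous\<close>)
  have "continuous_on \<Omega> (gradient \<psi>)" using C1 unfolding C1_def by (auto intro: continuous_on_subset)
  then show "OL (gradient \<psi>)" by (intro OL_bounded[of _ B] B measurable_M_continuous)
qed

definition radius :: real where
  "radius = (SOME R. R > 0 \<and> \<Omega> \<subseteq> ball 0 R)"

lemma radius: "radius > 0" "\<Omega> \<subseteq> ball 0 radius"
proof -
  have "\<exists>R. R > 0 \<and> \<Omega> \<subseteq> ball 0 R" using bounded_subset_ballD[OF \<Omega>_bounded, of 0] by blast
  from someI_ex[OF this] show "radius > 0" "\<Omega> \<subseteq> ball 0 radius" by (auto simp: radius_def)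
qed

lemma poincare_weight:
  assumes \<Theta>: "convex_weight \<Theta>" and \<psi>: "test_function \<Omega> \<psi>"
  shows "(LINT x|M. \<Theta> \<bar>\<psi> x\<bar>) \<le> (LINT x|M. \<Theta> (2 * radius * norm (gradient \<psi> x)))"
proof -
  have C1: "C1 \<psi>" by (rule test_functionD(1)[OF \<psi>])
  have cg: "continuous_on UNIV (gradient \<psi>)" using C1 by (simp add: C1_def)
  have c1: "continuous_on UNIV (\<lambda>x. \<Theta> \<bar>\<psi> x\<bar>)"
    by (intro continuous_on_compose2[OF convex_weightD(1)[OF \<Theta>]] continuous_intros C1_continuous C1) auto
  have c2: "continuous_on UNIV (\<lambda>x. \<Theta> (2 * radius * norm (gradient \<psi> x)))"
    by (intro continuous_on_compose2[OF convex_weightD(1)[OF \<Theta>]] continuous_intros cg) auto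
  obtain B where B: "\<And>x. \<bar>\<psi> x\<bar> \<le> B" "\<And>x. norm (gradient \<psi> x) \<le> B"
    using test_function_bounded[OF \<psi>] by blast
  have i1: "integrable M (\<lambda>x. \<Theta> \<bar>\<psi> x\<bar>)"
  proof (rule integrable_M_bounded[of _ "\<Theta> B"])
    show "(\<lambda>x. \<Theta> \<bar>\<psi> x\<bar>) \<in> borel_measurable M" by (intro measurable_M_continuous continuous_on_subset[OF c1]) auto
    show "norm (\<Theta> \<bar>\<psi> x\<bar>) \<le> \<Theta> B" for x
      using convex_weightD(2,4)[OF \<Theta>, of "\<bar>\<psi> x\<bar>"] B(1)[of x] by simp
  qed
  have i2: "integrable M (\<lambda>x. \<Theta> (2 * radius * norm (gradient \<psi> x)))"
  proof (rule integrable_M_bounded[of _ "\<Theta> (2 * radius * B)"])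
    show "(\<lambda>x. \<Theta> (2 * radius * norm (gradient \<psi> x))) \<in> borel_measurable M"
      by (intro measurable_M_continuous continuous_on_subset[OF c2]) auto
    show "norm (\<Theta> (2 * radius * norm (gradient \<psi> x))) \<le> \<Theta> (2 * radius * B)" for x
      using convex_weightD(2,4)[OF \<Theta>, of "2 * radius * norm (gradient \<psi> x)"] B(2)[of x] radius(1)
      by (simp add: mult_left_mono)
  qed
  have z: "\<Theta> 0 = 0" by (rule convex_weightD(3)[OF \<Theta>])
  have nonneg: "0 \<le> \<Theta> \<bar>\<psi> x\<bar>" "0 \<le> \<Theta> (2 * radius * norm (gradient \<psi> x))" for x
    using convex_weightD(4)[OF \<Theta>] radius(1) by auto
  have "(\<integral>\<^sup>+x. ennreal (\<Theta> \<bar>\<psi> x\<bar>) \<partial>M) = (\<integral>\<^sup>+x. ennreal (\<Theta> \<bar>\<psi> x\<bar>) \<partial>lborel)"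
    using borel_measurable_continuous_onI[OF c1] test_functionD(2)[OF \<psi>] z by (intro nn_integral_M) auto
  also have "\<dots> \<le> (\<integral>\<^sup>+x. ennreal (\<Theta> (2 * radius * norm (gradient \<psi> x))) \<partial>lborel)"
  proof (rule poincare_lborel[OF \<Theta> C1 radius(1)])
    show "\<psi> x = 0" if "x \<notin> ball 0 radius" for x
      using that radius(2) by (intro test_functionD(2)[OF \<psi>]) blast
  qed
  also have "\<dots> = (\<integral>\<^sup>+x. ennreal (\<Theta> (2 * radius * norm (gradient \<psi> x))) \<partial>M)"
    using borel_measurable_continuous_onI[OF c2] test_functionD(3)[OF \<psi>] z by (intro nn_integral_M[symmetric]) auto
  finally have "ennreal (LINT x|M. \<Theta> \<bar>\<psi> x\<bar>) \<le> ennreal (LINT x|M. \<Theta> (2 * radius * norm (gradient \<psi> x)))"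
    using nonneg by (simp add: nn_integral_eq_integral[OF i1] nn_integral_eq_integral[OF i2])
  then show ?thesis using nonneg(2) by (subst (asm) ennreal_le_iff) (auto intro: integral_nonneg_AE)
qed

lemma poincare_modular:
  assumes "test_function \<Omega> \<psi>"
  shows "modular \<psi> \<le> (max 1 (2 * radius)) powr P * modular (gradient \<psi>)"
proof -
  have "modular \<psi> \<le> (LINT x|M. \<Phi> (2 * radius * norm (gradient \<psi> x)))"
    using poincare_weight[OF \<Phi>_convex_weight assms] by (simp add: modular_def)
  also have "\<dots> = modular (\<lambda>x. (2 * radius) *\<^sub>R gradient \<psi> x)" using radius(1) by (simp add: modular_def)
  also have "\<dots> \<le> (max 1 (2 * radius)) powr P * modular (gradient \<psi>)"
    using OL_scale(2)[OF OL_test(2)[OF assms], of "2 * radius"] radius(1) by simp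
  finally show ?thesis .
qed

lemma poincare_L1_test:
  assumes "test_function \<Omega> \<psi>"
  shows "(LINT x|M. \<bar>\<psi> x\<bar>) \<le> 2 * radius * (LINT x|M. norm (gradient \<psi> x))"
  using poincare_weight[OF convex_weight_abs assms] radius(1) by (simp add: abs_mult)

text \<open>\<open>X u g\<close> says that \<open>u\<close> lies in \<open>W\<^sub>0\<^sup>1L\<^sub>\<Phi>\<close> and has weak gradient \<open>g\<close>, see \<open>X_imp_W01\<close> and \<open>W01_imp_X\<close>.\<close>

definition X :: "(real^'n \<Rightarrow> real) \<Rightarrow> (real^'n \<Rightarrow> real^'n) \<Rightarrow> bool" where
  "X u g \<longleftrightarrow> OL u \<and> OL g \<and> (\<exists>\<psi>. (\<forall>n. test_function \<Omega> (\<psi> n)) \<and>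
     (\<lambda>n. modular (\<lambda>x. \<psi> n x - u x)) \<longlonglongrightarrow> 0 \<and> (\<lambda>n. modular (\<lambda>x. gradient (\<psi> n) x - g x)) \<longlonglongrightarrow> 0)"

lemma X_OL: "X u g \<Longrightarrow> OL u" "X u g \<Longrightarrow> OL g"
  by (auto simp: X_def)

lemma X_approx:
  assumes "X u g" "e > 0"
  obtains \<psi> where "test_function \<Omega> \<psi>" "modular (\<lambda>x. \<psi> x - u x) < e" "modular (\<lambda>x. gradient \<psi> x - g x) < e"
proof -
  obtain \<psi> where \<psi>: "\<And>n. test_function \<Omega> (\<psi> n)" "(\<lambda>n. modular (\<lambda>x. \<psi> n x - u x)) \<longlonglongrightarrow> 0"
    "(\<lambda>n. modular (\<lambda>x. gradient (\<psi> n) x - g x)) \<longlonglongrightarrow> 0"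
    using assms(1) by (auto simp: X_def)
  have "\<forall>\<^sub>F n in sequentially. modular (\<lambda>x. \<psi> n x - u x) < e \<and> modular (\<lambda>x. gradient (\<psi> n) x - g x) < e"
    using order_tendstoD(2)[OF \<psi>(2) assms(2)] order_tendstoD(2)[OF \<psi>(3) assms(2)] by (rule eventually_conj)
  from eventually_happens'[OF sequentially_bot this]
  obtain n where "modular (\<lambda>x. \<psi> n x - u x) < e" "modular (\<lambda>x. gradient (\<psi> n) x - g x) < e"
    by blast
  then show ?thesis using that \<psi>(1) by blast
qed

lemma X_test: "test_function \<Omega> \<psi> \<Longrightarrow> X \<psi> (gradient \<psi>)"
proof -
  assume \<psi>: "test_function \<Omega> \<psi>"
  have "modular (\<lambda>x. \<psi> x - \<psi> x) = 0" "modular (\<lambda>x. gradient \<psi> x - gradient \<psi> x) = 0"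
    by (simp_all add: modular_def)
  then have "(\<lambda>n::nat. modular (\<lambda>x. \<psi> x - \<psi> x)) \<longlonglongrightarrow> 0" "(\<lambda>n::nat. modular (\<lambda>x. gradient \<psi> x - gradient \<psi> x)) \<longlonglongrightarrow> 0"
    by (simp_all only: tendsto_const)
  then show "X \<psi> (gradient \<psi>)"
    unfolding X_def using OL_test[OF \<psi>] \<psi> by (intro conjI exI[of _ "\<lambda>_. \<psi>"] allI)
qed

lemma X_linear_comb:
  assumes "X u g" "X v k"
  shows "X (\<lambda>x. a * u x + b * v x) (\<lambda>x. a *\<^sub>R g x + b *\<^sub>R k x)"
proof -
  obtain \<psi> where \<psi>: "\<And>n. test_function \<Omega> (\<psi> n)" "(\<lambda>n. modular (\<lambda>x. \<psi> n x - u x)) \<longlonglongrightarrow> 0"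
    "(\<lambda>n. modular (\<lambda>x. gradient (\<psi> n) x - g x)) \<longlonglongrightarrow> 0" and O: "OL u" "OL g"
    using assms(1) by (auto simp: X_def)
  obtain \<eta> where \<eta>: "\<And>n. test_function \<Omega> (\<eta> n)" "(\<lambda>n. modular (\<lambda>x. \<eta> n x - v x)) \<longlonglongrightarrow> 0"
    "(\<lambda>n. modular (\<lambda>x. gradient (\<eta> n) x - k x)) \<longlonglongrightarrow> 0" and O': "OL v" "OL k"
    using assms(2) by (auto simp: X_def)
  have lim: "(\<lambda>n. modular (\<lambda>x. (a *\<^sub>R F n x + b *\<^sub>R G n x) - (a *\<^sub>R f x + b *\<^sub>R h x))) \<longlonglongrightarrow> 0"
    if F: "\<And>n. OL (F n)" "OL f" "(\<lambda>n. modular (\<lambda>x. F n x - f x)) \<longlonglongrightarrow> 0"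
      and G: "\<And>n. OL (G n)" "OL h" "(\<lambda>n. modular (\<lambda>x. G n x - h x)) \<longlonglongrightarrow> 0"
    for F G :: "nat \<Rightarrow> real^'n \<Rightarrow> 'b::euclidean_space" and f h
  proof (rule tendsto_sandwich[OF _ _ tendsto_const])
    let ?u = "\<lambda>n. 2 powr P * ((max 1 \<bar>a\<bar>) powr P * modular (\<lambda>x. F n x - f x) + (max 1 \<bar>b\<bar>) powr P * modular (\<lambda>x. G n x - h x))"
    have "?u \<longlonglongrightarrow> 2 powr P * ((max 1 \<bar>a\<bar>) powr P * 0 + (max 1 \<bar>b\<bar>) powr P * 0)"
      by (intro tendsto_intros F G)
    then show "?u \<longlonglongrightarrow> 0" by simp
    have "modular (\<lambda>x. (a *\<^sub>R F n x + b *\<^sub>R G n x) - (a *\<^sub>R f x + b *\<^sub>R h x)) \<le> ?u n" for n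
    proof -
      have O1: "OL (\<lambda>x. F n x - f x)" "OL (\<lambda>x. G n x - h x)" using OL_diff F G by blast+
      have "(\<lambda>x. (a *\<^sub>R F n x + b *\<^sub>R G n x) - (a *\<^sub>R f x + b *\<^sub>R h x)) = (\<lambda>x. a *\<^sub>R (F n x - f x) + b *\<^sub>R (G n x - h x))"
        by (simp add: fun_eq_iff algebra_simps)
      then have "modular (\<lambda>x. (a *\<^sub>R F n x + b *\<^sub>R G n x) - (a *\<^sub>R f x + b *\<^sub>R h x)) \<le>
          2 powr P * (modular (\<lambda>x. a *\<^sub>R (F n x - f x)) + modular (\<lambda>x. b *\<^sub>R (G n x - h x)))"
        using OL_add(2)[OF OL_scale(1)[OF O1(1), of a] OL_scale(1)[OF O1(2), of b]] by simp
      also have "\<dots> \<le> ?u n"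
        by (intro mult_left_mono add_mono OL_scale(2) O1) simp
      finally show ?thesis .
    qed
    then show "\<forall>\<^sub>F n in sequentially. modular (\<lambda>x. (a *\<^sub>R F n x + b *\<^sub>R G n x) - (a *\<^sub>R f x + b *\<^sub>R h x)) \<le> ?u n" by simp
  qed (simp add: modular_nonneg)
  have "OL (\<lambda>x. a *\<^sub>R u x + b *\<^sub>R v x)" "OL (\<lambda>x. a *\<^sub>R g x + b *\<^sub>R k x)"
    by (intro OL_add OL_scale O O')+
  moreover have "test_function \<Omega> (\<lambda>x. a * \<psi> n x + b * \<eta> n x)" for n
    by (rule test_function_linear_comb[OF \<psi>(1) \<eta>(1)])
  moreover have "gradient (\<lambda>x. a * \<psi> n x + b * \<eta> n x) = (\<lambda>x. a *\<^sub>R gradient (\<psi> n) x + b *\<^sub>R gradient (\<eta> n) x)" for n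
    by (rule C1_linear_comb(2)[OF test_functionD(1)[OF \<psi>(1)] test_functionD(1)[OF \<eta>(1)]])
  moreover note lim[OF OL_test(1)[OF \<psi>(1)] O(1) \<psi>(2) OL_test(1)[OF \<eta>(1)] O'(1) \<eta>(2)]
    lim[OF OL_test(2)[OF \<psi>(1)] O(2) \<psi>(3) OL_test(2)[OF \<eta>(1)] O'(2) \<eta>(3)]
  ultimately show ?thesis
    unfolding X_def by (auto intro!: exI[of _ "\<lambda>n x. a * \<psi> n x + b * \<eta> n x"])
qed

lemma X_approx_sequence:
  assumes X: "\<And>n. X (z n) (g n)"
  obtains \<psi> where "\<And>n. test_function \<Omega> (\<psi> n)" "\<And>n. modular (\<lambda>x. \<psi> n x - z n x) < 1 / real (Suc n)"
    "\<And>n. modular (\<lambda>x. gradient (\<psi> n) x - g n x) < 1 / real (Suc n)"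
proof -
  have "\<forall>n. \<exists>\<psi>. test_function \<Omega> \<psi> \<and> modular (\<lambda>x. \<psi> x - z n x) < 1 / real (Suc n) \<and>
      modular (\<lambda>x. gradient \<psi> x - g n x) < 1 / real (Suc n)"
  proof
    fix n
    have "1 / real (Suc n) > 0" by simp
    from X_approx[OF X[of n] this] show "\<exists>\<psi>. test_function \<Omega> \<psi> \<and> modular (\<lambda>x. \<psi> x - z n x) < 1 / real (Suc n) \<and>
      modular (\<lambda>x. gradient \<psi> x - g n x) < 1 / real (Suc n)" by blast
  qed
  from choice[OF this] obtain \<psi> where "\<forall>n. test_function \<Omega> (\<psi> n) \<and> modular (\<lambda>x. \<psi> n x - z n x) < 1 / real (Suc n) \<and>
      modular (\<lambda>x. gradient (\<psi> n) x - g n x) < 1 / real (Suc n)"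
    by blast
  then have \<psi>: "\<And>n. test_function \<Omega> (\<psi> n)" "\<And>n. modular (\<lambda>x. \<psi> n x - z n x) < 1 / real (Suc n)"
      "\<And>n. modular (\<lambda>x. gradient (\<psi> n) x - g n x) < 1 / real (Suc n)"
    by blast+
  show ?thesis by (rule that[of \<psi>, OF \<psi>])
qed

text \<open>Test functions within 1/(n+1) of the given pairs have Cauchy gradients, and the Poincare
  inequality for test functions makes the functions themselves Cauchy. The two limits are then
  limits of test functions by construction.\<close>

lemma X_complete:
  assumes X: "\<And>n. X (z n) (g n)"
    and C: "\<And>e. e > 0 \<Longrightarrow> \<exists>N. \<forall>m\<ge>N. \<forall>n\<ge>N. modular (\<lambda>x. g m x - g n x) < e"
  obtains Z G where "X Z G" "(\<lambda>n. modular (\<lambda>x. g n x - G x)) \<longlonglongrightarrow> 0" "(\<lambda>n. modular (\<lambda>x. z n x - Z x)) \<longlonglongrightarrow> 0"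
proof -
  obtain \<psi> where \<psi>: "\<And>n. test_function \<Omega> (\<psi> n)" "\<And>n. modular (\<lambda>x. \<psi> n x - z n x) < 1 / real (Suc n)"
      "\<And>n. modular (\<lambda>x. gradient (\<psi> n) x - g n x) < 1 / real (Suc n)"
    by (rule X_approx_sequence[of z g, OF X]) (rule that)
  have OL\<psi>: "OL (\<psi> n)" "OL (gradient (\<psi> n))" "OL (z n)" "OL (g n)" for n
    using OL_test[OF \<psi>(1)] X_OL[OF X] by blast+
  let ?c = "2 powr P :: real"
  have c: "?c > 0" by simp
  have Cg: "\<exists>N. \<forall>m\<ge>N. \<forall>n\<ge>N. modular (\<lambda>x. gradient (\<psi> m) x - gradient (\<psi> n) x) < e" if e: "e > 0" for e
  proof -
    \<comment> \<open>Two nested uses of \<open>modular_triangle\<close>, each with the factor 2^P,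
      turn three errors d into exactly e.\<close>
    define d where "d = e / (?c * (1 + ?c * 2))"
    have A: "?c * (1 + ?c * 2) > 0" using c by (intro mult_pos_pos add_pos_pos) auto
    have "?c * (d + ?c * (d + d)) = d * (?c * (1 + ?c * 2))" by (simp add: algebra_simps)
    also have "\<dots> = e" unfolding d_def using less_imp_neq[OF A] by (intro nonzero_eq_divide_eq[THEN iffD1]) auto
    finally have d2: "?c * (d + ?c * (d + d)) = e" .
    have d1: "d > 0" unfolding d_def by (rule divide_pos_pos[OF e A])
    note d = d1 d2
    obtain N1 where N1: "\<And>m n. m \<ge> N1 \<Longrightarrow> n \<ge> N1 \<Longrightarrow> modular (\<lambda>x. g m x - g n x) < d" using C[OF d(1)] by blast
    obtain N2 where N2: "1 / real (Suc N2) < d" using nat_approx_posE[OF d(1)] by blast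
    have dn: "modular (\<lambda>x. gradient (\<psi> n) x - g n x) < d" if "n \<ge> N2" for n
    proof -
      have "1 / real (Suc n) \<le> 1 / real (Suc N2)" using that by (simp add: frac_le)
      then show ?thesis using \<psi>(3)[of n] N2 by linarith
    qed
    have "modular (\<lambda>x. gradient (\<psi> m) x - gradient (\<psi> n) x) < e" if mn: "m \<ge> max N1 N2" "n \<ge> max N1 N2" for m n
    proof -
      have a: "modular (\<lambda>x. gradient (\<psi> m) x - gradient (\<psi> n) x) \<le>
          ?c * (modular (\<lambda>x. gradient (\<psi> m) x - g m x) + modular (\<lambda>x. g m x - gradient (\<psi> n) x))"
        by (rule modular_triangle) (rule OL\<psi>)+
      have b: "modular (\<lambda>x. g m x - gradient (\<psi> n) x) \<le> ?c * (modular (\<lambda>x. g m x - g n x) + modular (\<lambda>x. g n x - gradient (\<psi> n) x))"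
        by (rule modular_triangle) (rule OL\<psi>)+
      have "modular (\<lambda>x. g m x - g n x) + modular (\<lambda>x. g n x - gradient (\<psi> n) x) < d + d"
        using N1[of m n] dn[of n] mn modular_minus[of "g n" "gradient (\<psi> n)"] by simp
      then have "?c * (modular (\<lambda>x. g m x - g n x) + modular (\<lambda>x. g n x - gradient (\<psi> n) x)) < ?c * (d + d)"
        using c by (rule mult_strict_left_mono)
      moreover have "modular (\<lambda>x. gradient (\<psi> m) x - g m x) < d" using dn[of m] mn by simp
      ultimately have "modular (\<lambda>x. gradient (\<psi> m) x - g m x) + modular (\<lambda>x. g m x - gradient (\<psi> n) x) < d + ?c * (d + d)"
        using b by linarith
      then have "?c * (modular (\<lambda>x. gradient (\<psi> m) x - g m x) + modular (\<lambda>x. g m x - gradient (\<psi> n) x)) < ?c * (d + ?c * (d + d))"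
        using c by (rule mult_strict_left_mono)
      then show ?thesis using a d(2) by linarith
    qed
    then show ?thesis by blast
  qed
  have C\<psi>: "\<exists>N. \<forall>m\<ge>N. \<forall>n\<ge>N. modular (\<lambda>x. \<psi> m x - \<psi> n x) < e" if e: "e > 0" for e
  proof -
    let ?k = "(max 1 (2 * radius)) powr P"
    have k: "?k > 0" by simp
    then have "e / ?k > 0" using e by simp
    from Cg[OF this] obtain N where N: "\<And>m n. m \<ge> N \<Longrightarrow> n \<ge> N \<Longrightarrow> modular (\<lambda>x. gradient (\<psi> m) x - gradient (\<psi> n) x) < e / ?k" by blast
    have "modular (\<lambda>x. \<psi> m x - \<psi> n x) < e" if "m \<ge> N" "n \<ge> N" for m n
    proof -
      have t: "test_function \<Omega> (\<lambda>x. 1 * \<psi> m x + (-1) * \<psi> n x)" by (rule test_function_linear_comb[OF \<psi>(1) \<psi>(1)])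
      have "gradient (\<lambda>x. 1 * \<psi> m x + (-1) * \<psi> n x) = (\<lambda>x. 1 *\<^sub>R gradient (\<psi> m) x + (-1) *\<^sub>R gradient (\<psi> n) x)"
        by (rule C1_linear_comb(2)[OF test_functionD(1)[OF \<psi>(1)] test_functionD(1)[OF \<psi>(1)]])
      with poincare_modular[OF t] have "modular (\<lambda>x. \<psi> m x - \<psi> n x) \<le> ?k * modular (\<lambda>x. gradient (\<psi> m) x - gradient (\<psi> n) x)"
        by simp
      also have "\<dots> < ?k * (e / ?k)" using k N[OF that] by (intro mult_strict_left_mono)
      finally show ?thesis using k by simp
    qed
    then show ?thesis by blast
  qed
  obtain Z where Z: "OL Z" "(\<lambda>n. modular (\<lambda>x. \<psi> n x - Z x)) \<longlonglongrightarrow> 0"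
    using OL_complete[OF OL\<psi>(1) C\<psi>] by blast
  obtain G where G: "OL G" "(\<lambda>n. modular (\<lambda>x. gradient (\<psi> n) x - G x)) \<longlonglongrightarrow> 0"
    using OL_complete[OF OL\<psi>(2) Cg] by blast
  have "X Z G" unfolding X_def using Z G \<psi>(1) by blast
  moreover have tr: "(\<lambda>n. modular (\<lambda>x. f n x - F x)) \<longlonglongrightarrow> 0"
    if "\<And>n. OL (f n)" "OL F" "\<And>n. OL (h n)" "\<And>n. modular (\<lambda>x. h n x - f n x) < 1 / real (Suc n)"
      "(\<lambda>n. modular (\<lambda>x. h n x - F x)) \<longlonglongrightarrow> 0"
    for f h :: "nat \<Rightarrow> real^'n \<Rightarrow> 'b::euclidean_space" and F
  proof (rule tendsto_sandwich[OF _ _ tendsto_const])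
    let ?u = "\<lambda>n. ?c * (1 / real (Suc n) + modular (\<lambda>x. h n x - F x))"
    have "?u \<longlonglongrightarrow> ?c * (0 + 0)"
      by (intro tendsto_intros that LIMSEQ_Suc lim_1_over_n)
    then show "?u \<longlonglongrightarrow> 0" by simp
    have "modular (\<lambda>x. f n x - F x) \<le> ?u n" for n
    proof -
      have "modular (\<lambda>x. f n x - F x) \<le> ?c * (modular (\<lambda>x. f n x - h n x) + modular (\<lambda>x. h n x - F x))"
        by (intro modular_triangle that)
      also have "\<dots> \<le> ?u n"
        using that(4)[of n] modular_minus[of "f n" "h n"] c by (intro mult_left_mono add_mono) auto
      finally show ?thesis .
    qed
    then show "\<forall>\<^sub>F n in sequentially. modular (\<lambda>x. f n x - F x) \<le> ?u n" by simp
  qed (simp add: modular_nonneg)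
  ultimately show ?thesis
    using that tr[OF OL\<psi>(3) Z(1) OL\<psi>(1) \<psi>(2) Z(2)] tr[OF OL\<psi>(4) G(1) OL\<psi>(2) \<psi>(3) G(2)] by blast
qed

end

text \<open>Weierstrass is applied to the derivative and the polynomial is integrated from the same
  value at 0, so that values and slopes are approximated together. The result is smooth even if
  \<open>\<omega>\<close> is only C1.\<close>

lemma antiderivative_approximation:
  fixes \<omega> \<omega>' :: "real \<Rightarrow> real"
  assumes \<omega>: "\<And>t. (\<omega> has_real_derivative \<omega>' t) (at t)" and c: "continuous_on UNIV \<omega>'" and R: "R > 0" and e: "e > 0"
  obtains q q' where "smooth_real q" "\<And>t. (q has_real_derivative q' t) (at t)" "continuous_on UNIV q'"
    "\<And>t. \<bar>t\<bar> \<le> R \<Longrightarrow> \<bar>q' t - \<omega>' t\<bar> \<le> e" "\<And>t. \<bar>t\<bar> \<le> R \<Longrightarrow> \<bar>q t - \<omega> t\<bar> \<le> e * R"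
proof -
  obtain g where g: "real_polynomial_function g" "\<And>t. t \<in> {-R..R} \<Longrightarrow> \<bar>\<omega>' t - g t\<bar> < e"
    using Stone_Weierstrass_real_polynomial_function[of "{-R..R}" \<omega>' e] continuous_on_subset[OF c] e by blast
  obtain a n where an: "g = (\<lambda>t. \<Sum>i\<le>n. a i * t ^ i)"
    using g(1) unfolding real_polynomial_function_iff_sum by blast
  define Q where "Q = [:\<omega> 0:] + (\<Sum>i\<le>n. monom (a i / real (Suc i)) (Suc i))"
  have Q: "poly Q = (\<lambda>t. \<omega> 0 + (\<Sum>i\<le>n. a i / real (Suc i) * t ^ Suc i))"
    by (simp add: Q_def fun_eq_iff poly_sum poly_monom)
  have d: "(poly Q has_real_derivative g t) (at t)" for t
  proof -
    have "((\<lambda>t. a i / real (Suc i) * t ^ Suc i) has_real_derivative a i * t ^ i) (at t)" for i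
      by (rule derivative_eq_intros refl)+ (simp del: of_nat_Suc)
    then have "((\<lambda>t. \<omega> 0 + (\<Sum>i\<le>n. a i / real (Suc i) * t ^ Suc i)) has_real_derivative 0 + (\<Sum>i\<le>n. a i * t ^ i)) (at t)"
      by (intro DERIV_add DERIV_const DERIV_sum)
    then show ?thesis unfolding Q an by simp
  qed
  have Q0: "poly Q 0 = \<omega> 0" by (simp add: Q_def poly_sum poly_monom)
  have b1: "\<bar>g t - \<omega>' t\<bar> \<le> e" if "\<bar>t\<bar> \<le> R" for t
    using g(2)[of t] that by (auto simp: abs_minus_commute abs_le_iff)
  show ?thesis
  proof
    show "smooth_real (poly Q)" by (rule smooth_real_poly)
    show "(poly Q has_real_derivative g t) (at t)" for t by (rule d)
    show "continuous_on UNIV g" unfolding an by (intro continuous_intros)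
    show "\<bar>g t - \<omega>' t\<bar> \<le> e" if "\<bar>t\<bar> \<le> R" for t using b1[OF that] .
    show "\<bar>poly Q t - \<omega> t\<bar> \<le> e * R" if t: "\<bar>t\<bar> \<le> R" for t
    proof -
      have "norm ((poly Q t - \<omega> t) - (poly Q 0 - \<omega> 0)) \<le> e * norm (t - 0)"
      proof (rule field_differentiable_bound[where S="{-R..R}" and f'="\<lambda>t. g t - \<omega>' t"])
        show "((\<lambda>t. poly Q t - \<omega> t) has_field_derivative g x - \<omega>' x) (at x within {-R..R})" for x
          by (rule has_field_derivative_at_within) (intro DERIV_diff d \<omega>)
        show "norm (g x - \<omega>' x) \<le> e" if "x \<in> {-R..R}" for x
          using b1[of x] that by (auto simp: abs_le_iff)
      qed (use t R in \<open>auto simp: abs_le_iff\<close>)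
      also have "\<dots> \<le> e * R" using t e by (intro mult_left_mono) auto
      finally show ?thesis by (simp add: Q0)
    qed
  qed
qed

section \<open>Integration by parts, compactness and selection in \<open>X\<close>\<close>

context orlicz_domain
begin

lemma X_integrable: "X u g \<Longrightarrow> integrable M u" "X u g \<Longrightarrow> integrable M g"
  using OL_L1(1) X_OL by blast+

lemma X_L1_approx:
  assumes "X u g"
  obtains \<psi> where "\<And>n. test_function \<Omega> (\<psi> n)" "(\<lambda>n. LINT x|M. norm (\<psi> n x - u x)) \<longlonglongrightarrow> 0"
    "(\<lambda>n. LINT x|M. norm (gradient (\<psi> n) x - g x)) \<longlonglongrightarrow> 0"
proof -
  obtain \<psi> where \<psi>: "\<And>n. test_function \<Omega> (\<psi> n)" "(\<lambda>n. modular (\<lambda>x. \<psi> n x - u x)) \<longlonglongrightarrow> 0"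
    "(\<lambda>n. modular (\<lambda>x. gradient (\<psi> n) x - g x)) \<longlonglongrightarrow> 0" and O: "OL u" "OL g"
    using assms by (auto simp: X_def)
  show ?thesis
    by (rule that[of \<psi>, OF \<psi>(1) modular_L1_tendsto[OF OL_diff[OF OL_test(1)[OF \<psi>(1)] O(1)] \<psi>(2)]
          modular_L1_tendsto[OF OL_diff[OF OL_test(2)[OF \<psi>(1)] O(2)] \<psi>(3)]])
qed

lemma L1_norm_tendsto:
  fixes f :: "nat \<Rightarrow> real^'n \<Rightarrow> 'b::euclidean_space"
  assumes f: "\<And>n. integrable M (f n)" "integrable M F" and lim: "(\<lambda>n. LINT x|M. norm (f n x - F x)) \<longlonglongrightarrow> 0"
  shows "(\<lambda>n. LINT x|M. norm (f n x)) \<longlonglongrightarrow> (LINT x|M. norm (F x))"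
proof -
  have "(\<lambda>n. (LINT x|M. norm (f n x)) - (LINT x|M. norm (F x))) \<longlonglongrightarrow> 0"
  proof (rule tendsto_rabs_zero_cancel, rule tendsto_sandwich[OF _ _ tendsto_const lim])
    have "\<bar>(LINT x|M. norm (f n x)) - (LINT x|M. norm (F x))\<bar> \<le> (LINT x|M. norm (f n x - F x))" for n
    proof -
      have "\<bar>(LINT x|M. norm (f n x)) - (LINT x|M. norm (F x))\<bar> = \<bar>LINT x|M. norm (f n x) - norm (F x)\<bar>"
        using f by (subst Bochner_Integration.integral_diff) auto
      also have "\<dots> \<le> (LINT x|M. \<bar>norm (f n x) - norm (F x)\<bar>)" by (rule integral_abs_bound)
      also have "\<dots> \<le> (LINT x|M. norm (f n x - F x))"
        using f by (intro integral_mono) (auto simp: norm_triangle_ineq3)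
      finally show ?thesis .
    qed
    then show "\<forall>\<^sub>F n in sequentially. \<bar>(LINT x|M. norm (f n x)) - (LINT x|M. norm (F x))\<bar> \<le> (LINT x|M. norm (f n x - F x))"
      by simp
  qed simp
  then show ?thesis by (rule LIM_zero_cancel)
qed

lemma X_poincare:
  assumes "X u g" shows "(LINT x|M. \<bar>u x\<bar>) \<le> 2 * radius * (LINT x|M. norm (g x))"
proof -
  obtain \<psi> where \<psi>: "\<And>n. test_function \<Omega> (\<psi> n)" "(\<lambda>n. LINT x|M. norm (\<psi> n x - u x)) \<longlonglongrightarrow> 0"
    "(\<lambda>n. LINT x|M. norm (gradient (\<psi> n) x - g x)) \<longlonglongrightarrow> 0"
    using X_L1_approx[OF assms] by blast
  note i = OL_L1(1)[OF OL_test(1)[OF \<psi>(1)]] OL_L1(1)[OF OL_test(2)[OF \<psi>(1)]]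
  have 1: "(\<lambda>n. LINT x|M. \<bar>\<psi> n x\<bar>) \<longlonglongrightarrow> (LINT x|M. \<bar>u x\<bar>)"
    using L1_norm_tendsto[OF i(1) X_integrable(1)[OF assms] \<psi>(2)] by simp
  have 2: "(\<lambda>n. 2 * radius * (LINT x|M. norm (gradient (\<psi> n) x))) \<longlonglongrightarrow> 2 * radius * (LINT x|M. norm (g x))"
    by (intro tendsto_intros L1_norm_tendsto[OF i(2) X_integrable(2)[OF assms] \<psi>(3)])
  show ?thesis using poincare_L1_test[OF \<psi>(1)] by (intro LIMSEQ_le[OF 1 2]) blast
qed

lemma C1_bounded_on_domain:
  fixes \<eta> :: "real^'n \<Rightarrow> real"
  assumes "C1 \<eta>" obtains B where "B \<ge> 0" "\<And>x. x \<in> \<Omega> \<Longrightarrow> \<bar>\<eta> x\<bar> \<le> B" "\<And>x. x \<in> \<Omega> \<Longrightarrow> norm (gradient \<eta> x) \<le> B"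
proof -
  have K: "compact (closure \<Omega>)" using \<Omega>_bounded by (simp add: compact_closure)
  have c: "continuous_on (closure \<Omega>) \<eta>" "continuous_on (closure \<Omega>) (gradient \<eta>)"
    using assms C1_continuous[OF assms] unfolding C1_def by (auto intro: continuous_on_subset)
  have "bounded (\<eta> ` closure \<Omega>)" "bounded (gradient \<eta> ` closure \<Omega>)"
    using compact_imp_bounded compact_continuous_image[OF c(1) K] compact_continuous_image[OF c(2) K] by auto
  then obtain B1 B2 where B: "\<And>x. x \<in> closure \<Omega> \<Longrightarrow> norm (\<eta> x) \<le> B1" "\<And>x. x \<in> closure \<Omega> \<Longrightarrow> norm (gradient \<eta> x) \<le> B2"
    unfolding bounded_iff by (metis imageI)
  have cl: "x \<in> closure \<Omega>" if "x \<in> \<Omega>" for x using that closure_subset by blast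
  show ?thesis
  proof (rule that[of "max 0 (max B1 B2)"])
    show "\<bar>\<eta> x\<bar> \<le> max 0 (max B1 B2)" if "x \<in> \<Omega>" for x using B(1)[OF cl[OF that]] by simp
    show "norm (gradient \<eta> x) \<le> max 0 (max B1 B2)" if "x \<in> \<Omega>" for x using B(2)[OF cl[OF that]] by simp
  qed simp
qed

lemma integrable_mult_C1:
  fixes f :: "real^'n \<Rightarrow> real" and \<eta> :: "real^'n \<Rightarrow> real"
  assumes f: "integrable M f" and c: "continuous_on UNIV \<eta>" and B: "\<And>x. x \<in> \<Omega> \<Longrightarrow> \<bar>\<eta> x\<bar> \<le> B"
  shows "integrable M (\<lambda>x. f x * \<eta> x)"
proof (rule Bochner_Integration.integrable_bound[of M "\<lambda>x. B * f x"])
  show "integrable M (\<lambda>x. B * f x)" using f by simp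
  show "(\<lambda>x. f x * \<eta> x) \<in> borel_measurable M"
    using f measurable_M_continuous[OF continuous_on_subset[OF c]] by auto
  show "AE x in M. norm (f x * \<eta> x) \<le> norm (B * f x)"
  proof (rule AE_I2)
    fix x assume "x \<in> space M"
    then have "\<bar>\<eta> x\<bar> \<le> \<bar>B\<bar>" using B[of x] by simp
    then show "norm (f x * \<eta> x) \<le> norm (B * f x)" by (simp add: abs_mult mult.commute[of "\<bar>f x\<bar>"] mult_right_mono)
  qed
qed

text \<open>The case of a test function \<open>\<eta>\<close> says that \<open>g\<close> is the weak gradient of \<open>u\<close>.\<close>

lemma X_integration_by_parts:
  assumes X: "X u g" and \<eta>: "C1 \<eta>"
  shows "integrable M (\<lambda>x. u x * gradient \<eta> x $ i)" "integrable M (\<lambda>x. g x $ i * \<eta> x)"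
    "(LINT x|M. u x * gradient \<eta> x $ i) = - (LINT x|M. g x $ i * \<eta> x)"
proof -
  obtain B where B: "B \<ge> 0" "\<And>x. x \<in> \<Omega> \<Longrightarrow> \<bar>\<eta> x\<bar> \<le> B" "\<And>x. x \<in> \<Omega> \<Longrightarrow> norm (gradient \<eta> x) \<le> B"
    using C1_bounded_on_domain[OF \<eta>] by blast
  have B3: "\<bar>gradient \<eta> x $ i\<bar> \<le> B" if "x \<in> \<Omega>" for x
    using B(3)[OF that] component_le_norm_cart[of "gradient \<eta> x" i] by linarith
  have c\<eta>: "continuous_on UNIV \<eta>" by (rule C1_continuous[OF \<eta>])
  have cg: "continuous_on UNIV (\<lambda>x. gradient \<eta> x $ i)" using \<eta> unfolding C1_def by (intro continuous_on_component) auto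
  have comp: "integrable M (\<lambda>x. k x $ i)" if "integrable M k" for k :: "real^'n \<Rightarrow> real^'n"
    using integrable_bounded_linear[OF bounded_linear_vec_nth that] .
  have i1: "integrable M (\<lambda>x. v x * gradient \<eta> x $ i)" if "integrable M v" for v
    by (rule integrable_mult_C1[OF that cg B3])
  have i2: "integrable M (\<lambda>x. k x $ i * \<eta> x)" if "integrable M k" for k :: "real^'n \<Rightarrow> real^'n"
    by (rule integrable_mult_C1[OF comp[OF that] c\<eta> B(2)])
  note iu = X_integrable(1)[OF X] and ig = X_integrable(2)[OF X]
  show "integrable M (\<lambda>x. u x * gradient \<eta> x $ i)" "integrable M (\<lambda>x. g x $ i * \<eta> x)" by (rule i1[OF iu], rule i2[OF ig])
  obtain \<psi> where \<psi>: "\<And>n. test_function \<Omega> (\<psi> n)" "(\<lambda>n. LINT x|M. norm (\<psi> n x - u x)) \<longlonglongrightarrow> 0"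
    "(\<lambda>n. LINT x|M. norm (gradient (\<psi> n) x - g x)) \<longlonglongrightarrow> 0"
    using X_L1_approx[OF X] by blast
  note it = OL_L1(1)[OF OL_test(1)[OF \<psi>(1)]] and ikt = OL_L1(1)[OF OL_test(2)[OF \<psi>(1)]]
  let ?I = "\<lambda>v k. (LINT x|M. v x * gradient \<eta> x $ i) + (LINT x|M. k x $ i * \<eta> x)"
  \<comment> \<open>The product of a test function with \<open>\<eta>\<close> has compact support
    even if \<open>\<eta>\<close> has none, as for the affine \<open>\<eta>\<close> used with the
    barrier.\<close>
  have test: "?I (\<psi> n) (gradient (\<psi> n)) = 0" for n
  proof -
    obtain K where K: "compact K" "K \<subseteq> \<Omega>" "\<And>x. x \<notin> K \<Longrightarrow> \<psi> n x = 0" "\<And>x. x \<notin> K \<Longrightarrow> gradient (\<psi> n) x = 0"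
      by (rule test_function_support[OF \<psi>(1)]) blast
    note C = C1_mult[OF test_functionD(1)[OF \<psi>(1)] \<eta>]
    have z: "(LINT x|lborel. gradient (\<lambda>x. \<psi> n x * \<eta> x) x $ i) = 0"
      by (rule integral_partial_zero[OF C(1) K(1)]) (simp add: K(3))
    have "(LINT x|M. gradient (\<lambda>x. \<psi> n x * \<eta> x) x $ i) = (LINT x|lborel. gradient (\<lambda>x. \<psi> n x * \<eta> x) x $ i)"
    proof (rule integral_M)
      show "(\<lambda>x. gradient (\<lambda>x. \<psi> n x * \<eta> x) x $ i) \<in> borel_measurable borel"
        using C(1) unfolding C1_def by (intro borel_measurable_continuous_onI continuous_on_component) auto
      show "gradient (\<lambda>x. \<psi> n x * \<eta> x) x $ i = 0" if "x \<notin> \<Omega>" for x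
        unfolding C(2) using that test_functionD(2,3)[OF \<psi>(1)] by simp
    qed
    then have "(LINT x|M. gradient (\<lambda>x. \<psi> n x * \<eta> x) x $ i) = 0"
      unfolding z .
    then have "(LINT x|M. \<psi> n x * gradient \<eta> x $ i + gradient (\<psi> n) x $ i * \<eta> x) = 0"
      unfolding C(2) by (simp add: mult.commute)
    then show ?thesis using i1[OF it] i2[OF ikt] by simp
  qed
  have bound: "\<bar>?I u g\<bar> \<le> B * ((LINT x|M. norm (\<psi> n x - u x)) + (LINT x|M. norm (gradient (\<psi> n) x - g x)))" for n
  proof -
    have id: "integrable M (\<lambda>x. norm (\<psi> n x - u x))" "integrable M (\<lambda>x. norm (gradient (\<psi> n) x - g x))"
      using it[of n] iu ikt[of n] ig by auto
    have "?I u g = - (?I (\<psi> n) (gradient (\<psi> n)) - ?I u g)" using test[of n] by simp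
    also have "?I (\<psi> n) (gradient (\<psi> n)) - ?I u g =
        (LINT x|M. (\<psi> n x * gradient \<eta> x $ i - u x * gradient \<eta> x $ i) + (gradient (\<psi> n) x $ i * \<eta> x - g x $ i * \<eta> x))"
      using i1[OF it[of n]] i2[OF ikt[of n]] i1[OF iu] i2[OF ig] by simp
    finally have "\<bar>?I u g\<bar> \<le> (LINT x|M. \<bar>(\<psi> n x * gradient \<eta> x $ i - u x * gradient \<eta> x $ i) + (gradient (\<psi> n) x $ i * \<eta> x - g x $ i * \<eta> x)\<bar>)"
      by (simp only: abs_minus_cancel) (rule integral_abs_bound)
    also have "\<dots> \<le> (LINT x|M. B * norm (\<psi> n x - u x) + B * norm (gradient (\<psi> n) x - g x))"
    proof (rule integral_mono)
      show "integrable M (\<lambda>x. \<bar>(\<psi> n x * gradient \<eta> x $ i - u x * gradient \<eta> x $ i) + (gradient (\<psi> n) x $ i * \<eta> x - g x $ i * \<eta> x)\<bar>)"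
        using i1[OF it[of n]] i2[OF ikt[of n]] i1[OF iu] i2[OF ig] by simp
      show "integrable M (\<lambda>x. B * norm (\<psi> n x - u x) + B * norm (gradient (\<psi> n) x - g x))"
        using id by simp
      fix x assume "x \<in> space M"
      then have x: "x \<in> \<Omega>" by simp
      have "\<bar>(\<psi> n x - u x) * gradient \<eta> x $ i\<bar> \<le> norm (\<psi> n x - u x) * B"
        unfolding abs_mult real_norm_def by (intro mult_left_mono B3 x) simp
      moreover have "\<bar>(gradient (\<psi> n) x - g x) $ i * \<eta> x\<bar> \<le> norm (gradient (\<psi> n) x - g x) * B"
        unfolding abs_mult using B(1,2) x component_le_norm_cart[of "gradient (\<psi> n) x - g x" i] by (intro mult_mono) auto
      ultimately show "\<bar>(\<psi> n x * gradient \<eta> x $ i - u x * gradient \<eta> x $ i) + (gradient (\<psi> n) x $ i * \<eta> x - g x $ i * \<eta> x)\<bar>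
          \<le> B * norm (\<psi> n x - u x) + B * norm (gradient (\<psi> n) x - g x)"
        by (simp add: algebra_simps)
    qed
    also have "\<dots> = B * ((LINT x|M. norm (\<psi> n x - u x)) + (LINT x|M. norm (gradient (\<psi> n) x - g x)))"
      using id by (simp add: distrib_left)
    finally show ?thesis .
  qed
  have "(\<lambda>n. B * ((LINT x|M. norm (\<psi> n x - u x)) + (LINT x|M. norm (gradient (\<psi> n) x - g x)))) \<longlonglongrightarrow> B * (0 + 0)"
    by (intro tendsto_intros \<psi>)
  then have "\<bar>?I u g\<bar> \<le> B * (0 + 0)" using bound by (intro LIMSEQ_le_const) auto
  then show "(LINT x|M. u x * gradient \<eta> x $ i) = - (LINT x|M. g x $ i * \<eta> x)" by simp
qed

text \<open>\<open>rellich_C1\<close> speaks of C1 functions, so the sequence is replaced by test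
  functions at modular distance 1/(n+1), which does not change limits in L1.\<close>

lemma X_compactness:
  assumes X: "\<And>n. X (u n) (g n)" and B: "\<And>n. modular (g n) \<le> B"
  obtains r U where "strict_mono (r :: nat \<Rightarrow> nat)" "integrable M U" "(\<lambda>n. LINT x|M. \<bar>u (r n) x - U x\<bar>) \<longlonglongrightarrow> 0"
proof -
  obtain \<psi> where \<psi>: "\<And>n. test_function \<Omega> (\<psi> n)" "\<And>n. modular (\<lambda>x. \<psi> n x - u n x) < 1 / real (Suc n)"
      "\<And>n. modular (\<lambda>x. gradient (\<psi> n) x - g n x) < 1 / real (Suc n)"
    by (rule X_approx_sequence[of u g, OF X]) (rule that)
  note O = OL_test[OF \<psi>(1)] X_OL[OF X]
  have close: "(\<lambda>n. LINT x|M. norm (\<psi> n x - u n x)) \<longlonglongrightarrow> 0"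
  proof (rule modular_L1_tendsto)
    show "OL (\<lambda>x. \<psi> n x - u n x)" for n by (rule OL_diff[OF O(1) O(3)])
    show "(\<lambda>n. modular (\<lambda>x. \<psi> n x - u n x)) \<longlonglongrightarrow> 0"
    proof (rule tendsto_sandwich[OF _ _ tendsto_const])
      show "(\<lambda>n. 1 / real (Suc n)) \<longlonglongrightarrow> 0" by (rule LIMSEQ_Suc[OF lim_1_over_n])
      show "\<forall>\<^sub>F n in sequentially. modular (\<lambda>x. \<psi> n x - u n x) \<le> 1 / real (Suc n)"
        using \<psi>(2) by (simp add: less_imp_le)
    qed (simp add: modular_nonneg)
  qed
  \<comment> \<open>This is \<open>OL_L1\<close> with \<delta> = 1, where 2^P (1 + B) bounds the
    modulars of the gradients of the approximants.\<close>
  define B' where "B' = measure M \<Omega> + 1 / \<Phi> 1 * (2 powr P * (1 + B))"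
  have B0: "B \<ge> 0" using B[of 0] modular_nonneg[of "g 0"] by linarith
  have gb: "(LINT x|M. norm (gradient (\<psi> n) x)) \<le> B'" for n
  proof -
    have "modular (\<lambda>x. (gradient (\<psi> n) x - g n x) + g n x) \<le> 2 powr P * (modular (\<lambda>x. gradient (\<psi> n) x - g n x) + modular (g n))"
      by (rule OL_add(2)[OF OL_diff[OF O(2) O(4)] O(4)])
    also have "\<dots> \<le> 2 powr P * (1 + B)"
    proof (intro mult_left_mono add_mono B)
      have "1 / real (Suc n) \<le> 1" by simp
      then show "modular (\<lambda>x. gradient (\<psi> n) x - g n x) \<le> 1" using \<psi>(3)[of n] by linarith
    qed simp
    finally have "modular (gradient (\<psi> n)) \<le> 2 powr P * (1 + B)" by simp
    then have "1 / \<Phi> 1 * modular (gradient (\<psi> n)) \<le> 1 / \<Phi> 1 * (2 powr P * (1 + B))"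
      using \<Phi>_pos[of 1] by (intro mult_left_mono) auto
    then show ?thesis using OL_L1(2)[OF O(2), of 1 n] by (simp add: B'_def)
  qed
  have B'0: "B' \<ge> 0" using \<Phi>_pos[of 1] B0 by (simp add: B'_def measure_nonneg)
  have nnM: "(\<integral>\<^sup>+x. ennreal (f x) \<partial>lborel) = ennreal (LINT x|M. f x)"
    if "continuous_on UNIV f" "\<And>x. f x \<ge> 0" "\<And>x. x \<notin> \<Omega> \<Longrightarrow> f x = 0" "integrable M f" for f :: "real^'n \<Rightarrow> real"
  proof -
    have "(\<integral>\<^sup>+x. ennreal (f x) \<partial>lborel) = (\<integral>\<^sup>+x. ennreal (f x) \<partial>M)"
      using borel_measurable_continuous_onI[OF that(1)] that(3) by (intro nn_integral_M[symmetric]) auto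
    also have "\<dots> = ennreal (LINT x|M. f x)" using that by (intro nn_integral_eq_integral) auto
    finally show ?thesis .
  qed
  obtain r :: "nat \<Rightarrow> nat" where r: "strict_mono r"
    "\<And>e. e > 0 \<Longrightarrow> \<exists>N. \<forall>m\<ge>N. \<forall>n\<ge>N. (\<integral>\<^sup>+x. ennreal \<bar>\<psi> (r m) x - \<psi> (r n) x\<bar> \<partial>lborel) < ennreal e"
  proof (rule rellich_C1[of \<psi> radius B'])
    show "C1 (\<psi> n)" for n by (rule test_functionD(1)[OF \<psi>(1)])
    show "\<psi> n x = 0" if "x \<notin> ball 0 radius" for n x
      using that radius(2) by (intro test_functionD(2)[OF \<psi>(1)]) blast
    show "(\<integral>\<^sup>+x. ennreal (norm (gradient (\<psi> n) x)) \<partial>lborel) \<le> ennreal B'" for n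
    proof -
      have "(\<integral>\<^sup>+x. ennreal (norm (gradient (\<psi> n) x)) \<partial>lborel) = ennreal (LINT x|M. norm (gradient (\<psi> n) x))"
        using test_functionD(1)[OF \<psi>(1)[of n]] test_functionD(3)[OF \<psi>(1)] OL_L1(1)[OF O(2)] unfolding C1_def
        by (intro nnM) (auto intro: continuous_on_norm)
      then show ?thesis using gb[of n] by (simp add: ennreal_leI)
    qed
  qed (use radius B'0 in blast)+
  have Cauchy: "\<exists>N. \<forall>m\<ge>N. \<forall>n\<ge>N. (LINT x|M. norm (\<psi> (r m) x - \<psi> (r n) x)) < e" if e: "e > 0" for e
  proof -
    obtain N where N: "\<And>m n. m \<ge> N \<Longrightarrow> n \<ge> N \<Longrightarrow> (\<integral>\<^sup>+x. ennreal \<bar>\<psi> (r m) x - \<psi> (r n) x\<bar> \<partial>lborel) < ennreal e"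
      using r(2)[OF e] by blast
    have "(LINT x|M. norm (\<psi> (r m) x - \<psi> (r n) x)) < e" if "m \<ge> N" "n \<ge> N" for m n
    proof -
      have "(\<integral>\<^sup>+x. ennreal \<bar>\<psi> (r m) x - \<psi> (r n) x\<bar> \<partial>lborel) = ennreal (LINT x|M. \<bar>\<psi> (r m) x - \<psi> (r n) x\<bar>)"
      proof (rule nnM)
        show "continuous_on UNIV (\<lambda>x. \<bar>\<psi> (r m) x - \<psi> (r n) x\<bar>)"
          by (intro continuous_on_rabs continuous_on_diff C1_continuous[OF test_functionD(1)[OF \<psi>(1)]])
        show "integrable M (\<lambda>x. \<bar>\<psi> (r m) x - \<psi> (r n) x\<bar>)"
          by (intro integrable_abs Bochner_Integration.integrable_diff OL_L1(1)[OF O(1)])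
      qed (simp_all add: test_functionD(2)[OF \<psi>(1)])
      then have "ennreal (LINT x|M. \<bar>\<psi> (r m) x - \<psi> (r n) x\<bar>) < ennreal e" using N[OF that] by simp
      then show ?thesis by (subst (asm) ennreal_less_iff) auto
    qed
    then show ?thesis by blast
  qed
  obtain U where U: "integrable M U" "(\<lambda>n. LINT x|M. norm (\<psi> (r n) x - U x)) \<longlonglongrightarrow> 0"
    using L1_complete[OF OL_L1(1)[OF O(1)] Cauchy] by blast
  have "(\<lambda>n. LINT x|M. \<bar>u (r n) x - U x\<bar>) \<longlonglongrightarrow> 0"
  proof (rule tendsto_sandwich[OF _ _ tendsto_const])
    have "(\<lambda>n. LINT x|M. norm (\<psi> (r n) x - u (r n) x)) \<longlonglongrightarrow> 0"
      using LIMSEQ_subseq_LIMSEQ[OF close r(1)] by (simp add: comp_def)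
    from tendsto_add[OF this U(2)]
    show "(\<lambda>n. (LINT x|M. norm (\<psi> (r n) x - u (r n) x)) + (LINT x|M. norm (\<psi> (r n) x - U x))) \<longlonglongrightarrow> 0" by simp
    have "(LINT x|M. \<bar>u (r n) x - U x\<bar>) \<le> (LINT x|M. norm (\<psi> (r n) x - u (r n) x)) + (LINT x|M. norm (\<psi> (r n) x - U x))" for n
    proof -
      have i: "integrable M (\<psi> (r n))" "integrable M (u (r n))" using OL_L1(1) O by blast+
      have "(LINT x|M. \<bar>u (r n) x - U x\<bar>) \<le> (LINT x|M. norm (\<psi> (r n) x - u (r n) x) + norm (\<psi> (r n) x - U x))"
        using i U(1) by (intro integral_mono) auto
      also have "\<dots> = (LINT x|M. norm (\<psi> (r n) x - u (r n) x)) + (LINT x|M. norm (\<psi> (r n) x - U x))"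
        using i U(1) by (intro Bochner_Integration.integral_add) auto
      finally show ?thesis .
    qed
    then show "\<forall>\<^sub>F n in sequentially. (LINT x|M. \<bar>u (r n) x - U x\<bar>) \<le> (LINT x|M. norm (\<psi> (r n) x - u (r n) x)) + (LINT x|M. norm (\<psi> (r n) x - U x))"
      by simp
  qed simp
  then show ?thesis using that r(1) U(1) by blast
qed

definition modular\<Psi> :: "(real^'n \<Rightarrow> real^'n) \<Rightarrow> real" where
  "modular\<Psi> g = (LINT x|M. \<Psi> (norm (g x)))"

lemma \<Psi>_norm_cont: "continuous_on UNIV (\<lambda>x :: 'b::euclidean_space. \<Psi> (norm x))"
  by (rule continuous_on_compose2[OF \<Psi>_cont]) (auto intro!: continuous_intros)

lemma \<Psi>_integrable:
  fixes g :: "real^'n \<Rightarrow> real^'n"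
  assumes "OL g" shows "integrable M (\<lambda>x. \<Psi> (norm (g x)))"
proof (rule Bochner_Integration.integrable_bound)
  show "integrable M (\<lambda>x. \<Phi> (norm (g x)))" using assms by (simp add: OL_def)
  show "(\<lambda>x. \<Psi> (norm (g x))) \<in> borel_measurable M"
    by (rule measurable_compose[OF OL_measurable[OF assms] borel_measurable_continuous_onI[OF \<Psi>_norm_cont]])
  show "AE x in M. norm (\<Psi> (norm (g x))) \<le> norm (\<Phi> (norm (g x)))"
    using \<Psi>_nonneg \<Psi>_le_\<Phi> by (intro AE_I2) (simp add: \<Phi>_norm_nonneg)
qed

text \<open>Elements of \<open>C n\<close> that nearly minimise the energy of the uniformly convex function \<open>\<Psi>\<close> over \<open>C n\<close>
  form a Cauchy sequence. This takes the place of weak compactness and of Mazur's lemma.\<close>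

lemma uniformly_convex_selection:
  assumes CX: "\<And>n u g. C n u g \<Longrightarrow> X u g" and dec: "\<And>m n u g. m \<le> n \<Longrightarrow> C n u g \<Longrightarrow> C m u g"
    and ne: "\<And>n. \<exists>u g. C n u g"
    and mid: "\<And>n u g v k. C n u g \<Longrightarrow> C n v k \<Longrightarrow> C n (\<lambda>x. (1/2) * u x + (1/2) * v x) (\<lambda>x. (1/2) *\<^sub>R g x + (1/2) *\<^sub>R k x)"
    and bd: "\<And>u g. C (0::nat) u g \<Longrightarrow> modular g \<le> B"
  obtains z g Z G where "\<And>n. C n (z n) (g n)" "X Z G" "(\<lambda>n. modular (\<lambda>x. g n x - G x)) \<longlonglongrightarrow> 0"
    "(\<lambda>n. modular (\<lambda>x. z n x - Z x)) \<longlonglongrightarrow> 0"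
proof -
  let ?S = "\<lambda>n. {modular\<Psi> g | u g. C n u g}"
  define e where "e n = Inf (?S n)" for n
  have bb: "bdd_below (?S n)" for n
    by (rule bdd_belowI[of _ 0]) (auto simp: modular\<Psi>_def \<Psi>_nonneg)
  have Sne: "?S n \<noteq> {}" for n using ne[of n] by blast
  have e_le: "e n \<le> modular\<Psi> g" if "C n u g" for n u g
    unfolding e_def using that by (intro cInf_lower bb) blast
  have bd': "modular g \<le> B" if "C n u g" for n u g using bd dec[of 0 n] that by blast
  have e_mono: "e m \<le> e n" if "m \<le> n" for m n
    unfolding e_def using dec[OF that] by (intro cInf_superset_mono Sne bb) blast
  have e_ub: "e n \<le> B" for n
  proof -
    obtain u g where ug: "C n u g" using ne by blast
    have "modular\<Psi> g \<le> modular g"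
      unfolding modular\<Psi>_def modular_def using X_OL(2)[OF CX[OF ug]] \<Psi>_integrable \<Psi>_le_\<Phi>
      by (intro integral_mono) (auto simp: OL_def)
    then show ?thesis using e_le[OF ug] bd'[OF ug] by linarith
  qed
  have "\<forall>n. \<exists>zg. C n (fst zg) (snd zg) \<and> modular\<Psi> (snd zg) < e n + 1 / real (Suc n)"
  proof
    fix n
    have "Inf (?S n) < e n + 1 / real (Suc n)" by (simp add: e_def)
    then obtain y where "y \<in> ?S n" "y < e n + 1 / real (Suc n)" using cInf_lessD[OF Sne] by blast
    then show "\<exists>zg. C n (fst zg) (snd zg) \<and> modular\<Psi> (snd zg) < e n + 1 / real (Suc n)" by force
  qed
  from choice[OF this] obtain zg where zg: "\<And>n. C n (fst (zg n)) (snd (zg n))" "\<And>n. modular\<Psi> (snd (zg n)) < e n + 1 / real (Suc n)"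
    by blast
  define z where "z n = fst (zg n)" for n
  define g where "g n = snd (zg n)" for n
  have zC: "C n (z n) (g n)" and gE: "modular\<Psi> (g n) < e n + 1 / real (Suc n)" for n using zg by (auto simp: z_def g_def)
  have Xz: "X (z n) (g n)" for n by (rule CX[OF zC])
  have "incseq e" using e_mono by (simp add: incseq_def)
  then obtain L where L: "e \<longlonglongrightarrow> L" using incseq_convergent[of e B] e_ub by blast
  have half: "\<exists>N. \<forall>n\<ge>N. \<forall>m\<ge>n. modular (\<lambda>x. g m x - g n x) < \<epsilon>" if \<epsilon>: "\<epsilon> > 0" for \<epsilon>
  proof -
    have B0: "B \<ge> 0" using bd'[OF zC[of 0]] modular_nonneg[of "g 0"] by linarith
    define \<delta> where "\<delta> = \<epsilon> / (4 * (B + 1))"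
    have \<delta>: "\<delta> > 0" "\<delta> * (B + B) \<le> \<epsilon> / 2" using \<epsilon> B0 by (auto simp: \<delta>_def field_simps)
    obtain c where c: "c \<ge> 0" "\<And>x y :: real^'n. \<Phi> (norm (x - y)) \<le> \<delta> * (\<Phi> (norm x) + \<Phi> (norm y)) +
      c * ((\<Psi> (norm x) + \<Psi> (norm y)) / 2 - \<Psi> (norm ((1/2) *\<^sub>R (x + y))))"
      using uniform_convexity[OF \<delta>(1)] by blast
    have est: "modular (\<lambda>x. g m x - g n x) \<le> \<delta> * (B + B) + c * ((e m - e n) / 2 + 1 / real (Suc n))" if mn: "m \<ge> n" for m n
    proof -
      note O = X_OL(2)[OF Xz]
      \<comment> \<open>For m \<ge> n both pairs lie in \<open>C n\<close>, hence so does their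
        midpoint, whose energy is therefore at least e n. The midpoint defect is at most (e m - e
        n)/2 + 1/(n+1), which tends to zero since e increases to a limit.\<close>
      have Cm: "C n (z m) (g m)" by (rule dec[OF mn zC])
      have md: "C n (\<lambda>x. (1/2) * z m x + (1/2) * z n x) (\<lambda>x. (1/2) *\<^sub>R g m x + (1/2) *\<^sub>R g n x)" by (rule mid[OF Cm zC])
      have eq: "(\<lambda>x. (1/2) *\<^sub>R g m x + (1/2) *\<^sub>R g n x) = (\<lambda>x. (1/2) *\<^sub>R (g m x + g n x))" by (simp add: scaleR_add_right)
      have "OL (\<lambda>x. (1/2) *\<^sub>R (g m x + g n x))"
        using X_OL(2)[OF CX[OF md]] unfolding eq .
      note i = \<Psi>_integrable[OF O] \<Psi>_integrable[OF this]
      have i\<Phi>: "integrable M (\<lambda>x. \<Phi> (norm (g n x)))" for n using O by (simp add: OL_def)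
      have "modular (\<lambda>x. g m x - g n x) \<le> (LINT x|M. \<delta> * (\<Phi> (norm (g m x)) + \<Phi> (norm (g n x))) +
          c * ((\<Psi> (norm (g m x)) + \<Psi> (norm (g n x))) / 2 - \<Psi> (norm ((1/2) *\<^sub>R (g m x + g n x)))))"
        unfolding modular_def
      proof (rule integral_mono)
        show "integrable M (\<lambda>x. \<Phi> (norm (g m x - g n x)))" using OL_diff[OF O O] by (simp add: OL_def)
        show "integrable M (\<lambda>x. \<delta> * (\<Phi> (norm (g m x)) + \<Phi> (norm (g n x))) +
          c * ((\<Psi> (norm (g m x)) + \<Psi> (norm (g n x))) / 2 - \<Psi> (norm ((1/2) *\<^sub>R (g m x + g n x)))))"
          by (intro Bochner_Integration.integrable_add integrable_mult_right Bochner_Integration.integrable_diff integrable_divide i i\<Phi>)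
      qed (rule c(2))
      also have "\<dots> = \<delta> * (modular (g m) + modular (g n)) +
          c * ((modular\<Psi> (g m) + modular\<Psi> (g n)) / 2 - modular\<Psi> (\<lambda>x. (1/2) *\<^sub>R (g m x + g n x)))"
      proof -
        have 1: "(LINT x|M. \<delta> * (\<Phi> (norm (g m x)) + \<Phi> (norm (g n x)))) = \<delta> * (modular (g m) + modular (g n))"
          using i\<Phi> by (simp add: modular_def)
        have 2: "(LINT x|M. (\<Psi> (norm (g m x)) + \<Psi> (norm (g n x))) / 2 - \<Psi> (norm ((1/2) *\<^sub>R (g m x + g n x)))) =
            (modular\<Psi> (g m) + modular\<Psi> (g n)) / 2 - modular\<Psi> (\<lambda>x. (1/2) *\<^sub>R (g m x + g n x))"
          unfolding modular\<Psi>_def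
          by (subst Bochner_Integration.integral_diff[OF integrable_divide[OF Bochner_Integration.integrable_add[OF i(1) i(1)]] i(2)],
              subst integral_divide_zero, subst Bochner_Integration.integral_add[OF i(1) i(1)]) (rule refl)
        have j1: "integrable M (\<lambda>x. \<delta> * (\<Phi> (norm (g m x)) + \<Phi> (norm (g n x))))"
          by (intro integrable_mult_right Bochner_Integration.integrable_add i\<Phi>)
        have j2: "integrable M (\<lambda>x. c * ((\<Psi> (norm (g m x)) + \<Psi> (norm (g n x))) / 2 - \<Psi> (norm ((1/2) *\<^sub>R (g m x + g n x)))))"
          by (intro integrable_mult_right Bochner_Integration.integrable_diff integrable_divide Bochner_Integration.integrable_add i)
        show ?thesis unfolding 1[symmetric] 2[symmetric] Bochner_Integration.integral_add[OF j1 j2]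
          by (simp only: integral_mult_right_zero)
      qed
      also have "\<dots> \<le> \<delta> * (B + B) + c * ((e m - e n) / 2 + 1 / real (Suc n))"
      proof (intro add_mono mult_left_mono c(1))
        have "1 / real (Suc m) \<le> 1 / real (Suc n)" using mn by (simp add: frac_le)
        then show "(modular\<Psi> (g m) + modular\<Psi> (g n)) / 2 - modular\<Psi> (\<lambda>x. (1/2) *\<^sub>R (g m x + g n x)) \<le> (e m - e n) / 2 + 1 / real (Suc n)"
          using gE[of m] gE[of n] e_le[OF md] unfolding eq by argo
      qed (use \<delta> bd'[OF zC] in auto)
      finally show ?thesis .
    qed
    have "\<exists>N. \<forall>n\<ge>N. \<forall>m\<ge>n. c * ((e m - e n) / 2 + 1 / real (Suc n)) < \<epsilon> / 2"
    proof -
      have "(\<lambda>n. c * ((L - e n) / 2 + 1 / real (Suc n))) \<longlonglongrightarrow> c * ((L - L) / 2 + 0)"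
        by (intro tendsto_intros L LIMSEQ_Suc lim_1_over_n) auto
      then have "\<forall>\<^sub>F n in sequentially. c * ((L - e n) / 2 + 1 / real (Suc n)) < \<epsilon> / 2"
        using \<epsilon> by (intro order_tendstoD(2)) auto
      then obtain N where N: "\<And>n. n \<ge> N \<Longrightarrow> c * ((L - e n) / 2 + 1 / real (Suc n)) < \<epsilon> / 2"
        unfolding eventually_sequentially by blast
      have "e m \<le> L" for m using incseq_le[OF \<open>incseq e\<close> L] .
      then have "c * ((e m - e n) / 2 + 1 / real (Suc n)) \<le> c * ((L - e n) / 2 + 1 / real (Suc n))" for m n
        using c(1) by (intro mult_left_mono add_right_mono divide_right_mono) auto
      then show ?thesis using N by (meson le_less_trans)
    qed
    then obtain N where N: "\<And>n m. n \<ge> N \<Longrightarrow> m \<ge> n \<Longrightarrow> c * ((e m - e n) / 2 + 1 / real (Suc n)) < \<epsilon> / 2" by blast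
    have "modular (\<lambda>x. g m x - g n x) < \<epsilon>" if "n \<ge> N" "m \<ge> n" for m n
      using est[OF that(2)] N[OF that] \<delta>(2) by linarith
    then show ?thesis by blast
  qed
  have Cauchy: "\<exists>N. \<forall>m\<ge>N. \<forall>n\<ge>N. modular (\<lambda>x. g m x - g n x) < \<epsilon>" if \<epsilon>: "\<epsilon> > 0" for \<epsilon>
  proof -
    obtain N where N: "\<And>n m. n \<ge> N \<Longrightarrow> m \<ge> n \<Longrightarrow> modular (\<lambda>x. g m x - g n x) < \<epsilon>" using half[OF \<epsilon>] by blast
    have "modular (\<lambda>x. g m x - g n x) < \<epsilon>" if "m \<ge> N" "n \<ge> N" for m n
      using N[of n m] N[of m n] that modular_minus[of "g m" "g n"] by (cases "n \<le> m") auto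
    then show ?thesis by blast
  qed
  obtain Z G where "X Z G" "(\<lambda>n. modular (\<lambda>x. g n x - G x)) \<longlonglongrightarrow> 0" "(\<lambda>n. modular (\<lambda>x. z n x - Z x)) \<longlonglongrightarrow> 0"
    by (rule X_complete[of z g, OF Xz Cauchy])
  then show ?thesis using that zC by blast
qed

end

section \<open>Cutting off above a barrier\<close>

context orlicz_domain
begin

lemma component_bound: "x \<in> \<Omega> \<Longrightarrow> \<bar>x $ i\<bar> \<le> radius" for x :: "real^'n"
  using radius(2) component_le_norm_cart[of x i] by (auto simp: subset_iff)

lemma modular_const_tendsto:
  assumes "c \<longlonglongrightarrow> (0::real)"
  shows "(\<lambda>n. modular (\<lambda>x::real^'n. c n)) \<longlonglongrightarrow> 0"
proof -
  have "(\<lambda>n. \<Phi> \<bar>c n\<bar>) \<longlonglongrightarrow> \<Phi> \<bar>0\<bar>"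
    by (rule continuous_on_tendsto_compose[OF \<Phi>_cont[of UNIV] tendsto_rabs[OF assms]]) auto
  then have "(\<lambda>n. measure M \<Omega> * \<Phi> \<bar>c n\<bar>) \<longlonglongrightarrow> measure M \<Omega> * 0"
    by (intro tendsto_mult tendsto_const) simp
  then show ?thesis by (simp add: modular_def)
qed

lemma modular_tendsto_bound:
  fixes f :: "nat \<Rightarrow> real^'n \<Rightarrow> 'b::euclidean_space" and h :: "nat \<Rightarrow> real^'n \<Rightarrow> 'c::euclidean_space"
  assumes f: "\<And>n. f n \<in> borel_measurable M" and h: "\<And>n. OL (h n)" "(\<lambda>n. modular (h n)) \<longlonglongrightarrow> 0"
    and c: "c \<longlonglongrightarrow> 0" "\<And>n. c n \<ge> 0"
    and le: "\<And>n x. x \<in> \<Omega> \<Longrightarrow> norm (f n x) \<le> norm (h n x) + c n"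
  shows "OL (f n)" "(\<lambda>n. modular (f n)) \<longlonglongrightarrow> 0"
proof -
  have O: "OL (\<lambda>x::real^'n. norm (h n x))" "OL (\<lambda>x::real^'n. c n)" for n
    by (rule OL_mono(1)[OF h(1)[of n]], use OL_measurable[OF h(1)] in simp, simp) (simp add: OL_def)
  have s: "norm (f n x) \<le> norm (norm (h n x) + c n)" if "x \<in> \<Omega>" for n x
    using le[OF that, of n] unfolding real_norm_def by linarith
  have O2: "OL (\<lambda>x::real^'n. norm (h n x) + c n)" for n by (rule OL_add(1)[OF O])
  show "OL (f n)" by (rule OL_mono(1)[OF O2 f s])
  show "(\<lambda>n. modular (f n)) \<longlonglongrightarrow> 0"
  proof (rule tendsto_sandwich[OF _ _ tendsto_const])
    show "(\<lambda>n. 2 powr P * (modular (h n) + modular (\<lambda>x::real^'n. c n))) \<longlonglongrightarrow> 0"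
      using tendsto_mult[OF tendsto_const tendsto_add[OF h(2) modular_const_tendsto[OF c(1)]]] by simp
    have "modular (f n) \<le> 2 powr P * (modular (h n) + modular (\<lambda>x::real^'n. c n))" for n
    proof -
      have "modular (f n) \<le> modular (\<lambda>x::real^'n. norm (h n x) + c n)" by (rule OL_mono(2)[OF O2 f s])
      also have "\<dots> \<le> 2 powr P * (modular (\<lambda>x. norm (h n x)) + modular (\<lambda>x::real^'n. c n))" by (rule OL_add(2)[OF O])
      also have "modular (\<lambda>x. norm (h n x)) = modular (h n)" by (simp add: modular_def)
      finally show ?thesis .
    qed
    then show "\<forall>\<^sub>F n in sequentially. modular (f n) \<le> 2 powr P * (modular (h n) + modular (\<lambda>x::real^'n. c n))" by simp
  qed (simp add: modular_nonneg)
qed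

lemma modular_dominated_tendsto:
  fixes f :: "nat \<Rightarrow> real^'n \<Rightarrow> 'b::euclidean_space" and k :: "real^'n \<Rightarrow> 'c::euclidean_space"
  assumes f: "\<And>n. f n \<in> borel_measurable M" and k: "OL k" and lim: "AE x in M. (\<lambda>n. f n x) \<longlonglongrightarrow> 0"
    and le: "\<And>n x. x \<in> \<Omega> \<Longrightarrow> norm (f n x) \<le> norm (k x)"
  shows "(\<lambda>n. modular (f n)) \<longlonglongrightarrow> 0"
proof -
  have "(\<lambda>n. LINT x|M. \<Phi> (norm (f n x))) \<longlonglongrightarrow> (LINT x|M. 0)"
  proof (rule integral_dominated_convergence[where w="\<lambda>x. \<Phi> (norm (k x))"])
    show "integrable M (\<lambda>x. \<Phi> (norm (k x)))" using k by (simp add: OL_def)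
    show "(\<lambda>x. \<Phi> (norm (f n x))) \<in> borel_measurable M" for n by (rule \<Phi>_norm_measurable[OF f])
    show "AE x in M. norm (\<Phi> (norm (f n x))) \<le> \<Phi> (norm (k x))" for n
    proof (rule AE_I2)
      fix x assume "x \<in> space M"
      then have "\<Phi> (norm (f n x)) \<le> \<Phi> (norm (k x))" using le[of x n] by (intro \<Phi>_mono) auto
      then show "norm (\<Phi> (norm (f n x))) \<le> \<Phi> (norm (k x))" using \<Phi>_norm_nonneg[of "f n x"] by simp
    qed
    show "AE x in M. (\<lambda>n. \<Phi> (norm (f n x))) \<longlonglongrightarrow> 0"
      using lim
    proof eventually_elim
      fix x assume "(\<lambda>n. f n x) \<longlonglongrightarrow> 0"
      then have "(\<lambda>n. norm (f n x)) \<longlonglongrightarrow> 0" by (rule tendsto_norm_zero)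
      then have "(\<lambda>n. \<Phi> (norm (f n x))) \<longlonglongrightarrow> \<Phi> 0"
        by (rule continuous_on_tendsto_compose[OF \<Phi>_cont[of UNIV]]) auto
      then show "(\<lambda>n. \<Phi> (norm (f n x))) \<longlonglongrightarrow> 0" by simp
    qed
  qed simp
  then show ?thesis by (simp add: modular_def)
qed

text \<open>The approximating test functions are explicit: the cutoff of an approximant of u minus a
  polynomial approximant of the barrier. As the barrier is at least 1, its approximants stay
  nonnegative on \<open>\<Omega>\<close>, which secures zero boundary values.\<close>

lemma X_cutoff:
  fixes \<omega> \<omega>' :: "real \<Rightarrow> real"
  assumes X: "X u g" and \<omega>: "\<And>t. (\<omega> has_real_derivative \<omega>' t) (at t)" "continuous_on UNIV \<omega>'"
    and \<omega>1: "\<And>t. \<bar>t\<bar> \<le> radius \<Longrightarrow> \<omega> t \<ge> 1"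
  shows "X (\<lambda>x. cutoff (u x - \<omega> (x $ i))) (\<lambda>x. cutoff' (u x - \<omega> (x $ i)) *\<^sub>R (g x - \<omega>' (x $ i) *\<^sub>R axis i 1))"
proof -
  let ?e = "axis i 1 :: real^'n"
  obtain \<psi>0 where \<psi>0: "\<And>n. test_function \<Omega> (\<psi>0 n)" "(\<lambda>n. modular (\<lambda>x. \<psi>0 n x - u x)) \<longlonglongrightarrow> 0"
    "(\<lambda>n. modular (\<lambda>x. gradient (\<psi>0 n) x - g x)) \<longlonglongrightarrow> 0" and O: "OL u" "OL g"
    using X by (auto simp: X_def)
  \<comment> \<open>Pointwise convergence is wanted for the factor \<open>cutoff'\<close>, which is
    later treated by dominated convergence.\<close>
  obtain r where r: "strict_mono (r :: nat \<Rightarrow> nat)" "AE x in M. (\<lambda>n. \<psi>0 (r n) x - u x) \<longlonglongrightarrow> 0"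
    by (rule modular_AE_subseq[OF OL_diff[OF OL_test(1)[OF \<psi>0(1)] O(1)] \<psi>0(2)]) blast
  define \<psi> where "\<psi> n = \<psi>0 (r n)" for n
  have \<psi>: "\<And>n. test_function \<Omega> (\<psi> n)" "(\<lambda>n. modular (\<lambda>x. \<psi> n x - u x)) \<longlonglongrightarrow> 0"
    "(\<lambda>n. modular (\<lambda>x. gradient (\<psi> n) x - g x)) \<longlonglongrightarrow> 0" "AE x in M. (\<lambda>n. \<psi> n x - u x) \<longlonglongrightarrow> 0"
    using \<psi>0(1) LIMSEQ_subseq_LIMSEQ[OF \<psi>0(2) r(1)] LIMSEQ_subseq_LIMSEQ[OF \<psi>0(3) r(1)] r(2)
    by (auto simp: \<psi>_def comp_def)
  note O\<psi> = OL_test[OF \<psi>(1)]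
  \<comment> \<open>The factor 1/(1 + radius) keeps the error of the values,
    \<open>\<epsilon> n * radius\<close>, at most 1, so that \<open>\<omega>\<close> \<ge> 1 yields
    q n \<ge> 0.\<close>
  define \<epsilon> where "\<epsilon> n = 1 / (1 + radius) * (1 / real (Suc n))" for n
  have \<epsilon>0: "\<epsilon> n > 0" for n using radius(1) by (auto simp: \<epsilon>_def)
  have \<epsilon>R: "\<epsilon> n * radius \<le> 1" for n
  proof -
    have "radius \<le> (1 + radius) * real (Suc n)" using radius(1) by (simp add: algebra_simps)
    then show ?thesis using radius(1) by (simp add: \<epsilon>_def divide_le_eq)
  qed
  have \<epsilon>lim: "\<epsilon> \<longlonglongrightarrow> 0"
    unfolding \<epsilon>_def using tendsto_mult[OF tendsto_const LIMSEQ_Suc[OF lim_1_over_n], of "1 / (1 + radius)"] by simp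
  have "\<forall>n. \<exists>qq. smooth_real (fst qq) \<and> (\<forall>t. (fst qq has_real_derivative snd qq t) (at t)) \<and> continuous_on UNIV (snd qq) \<and>
    (\<forall>t. \<bar>t\<bar> \<le> radius \<longrightarrow> \<bar>snd qq t - \<omega>' t\<bar> \<le> \<epsilon> n \<and> \<bar>fst qq t - \<omega> t\<bar> \<le> \<epsilon> n * radius)"
  proof
    fix n
    obtain q q' where "smooth_real q" "\<And>t. (q has_real_derivative q' t) (at t)" "continuous_on UNIV q'"
      "\<And>t. \<bar>t\<bar> \<le> radius \<Longrightarrow> \<bar>q' t - \<omega>' t\<bar> \<le> \<epsilon> n" "\<And>t. \<bar>t\<bar> \<le> radius \<Longrightarrow> \<bar>q t - \<omega> t\<bar> \<le> \<epsilon> n * radius"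
      using antiderivative_approximation[OF \<omega> radius(1) \<epsilon>0[of n]] by blast
    then show "\<exists>qq. smooth_real (fst qq) \<and> (\<forall>t. (fst qq has_real_derivative snd qq t) (at t)) \<and> continuous_on UNIV (snd qq) \<and>
      (\<forall>t. \<bar>t\<bar> \<le> radius \<longrightarrow> \<bar>snd qq t - \<omega>' t\<bar> \<le> \<epsilon> n \<and> \<bar>fst qq t - \<omega> t\<bar> \<le> \<epsilon> n * radius)"
      by (intro exI[of _ "(q, q')"]) simp
  qed
  from choice[OF this] obtain qq where qq: "\<forall>n. smooth_real (fst (qq n)) \<and> (\<forall>t. (fst (qq n) has_real_derivative snd (qq n) t) (at t)) \<and>
    continuous_on UNIV (snd (qq n)) \<and>
    (\<forall>t. \<bar>t\<bar> \<le> radius \<longrightarrow> \<bar>snd (qq n) t - \<omega>' t\<bar> \<le> \<epsilon> n \<and> \<bar>fst (qq n) t - \<omega> t\<bar> \<le> \<epsilon> n * radius)" by blast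
  define q where "q n = fst (qq n)" for n
  define q' where "q' n = snd (qq n)" for n
  have q: "smooth_real (q n)" "(q n has_real_derivative q' n t) (at t)" "continuous_on UNIV (q' n)"
    "\<bar>t\<bar> \<le> radius \<Longrightarrow> \<bar>q' n t - \<omega>' t\<bar> \<le> \<epsilon> n" "\<bar>t\<bar> \<le> radius \<Longrightarrow> \<bar>q n t - \<omega> t\<bar> \<le> \<epsilon> n * radius" for n t
    using qq by (auto simp: q_def q'_def)
  have q0: "q n (x $ i) \<ge> 0" if "x \<in> \<Omega>" for n x
    using q(5)[OF component_bound[OF that, of i], of n] \<omega>1[OF component_bound[OF that, of i]] \<epsilon>R[of n] by linarith
  \<comment> \<open>The subtracted term vanishes on \<open>\<Omega>\<close>, where q n \<ge> 0.
    Outside the support of \<psi> n it cancels the first term, even where the polynomial is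
    negative, so F n has compact support.\<close>
  define F where "F n x = 1 * cutoff (1 * \<psi> n x + (-1) * q n (x $ i)) + (-1) * cutoff ((-1) * q n (x $ i))" for n x
  have Cq: "C1 (\<lambda>x :: real^'n. q n (x $ i))" "gradient (\<lambda>x :: real^'n. q n (x $ i)) = (\<lambda>x. q' n (x $ i) *\<^sub>R ?e)" for n
    using C1_compose[OF C1_component(1) q(2,3)] by (simp_all add: C1_component(2))
  note C\<psi> = test_functionD(1)[OF \<psi>(1)]
  have Cd: "C1 (\<lambda>x. 1 * \<psi> n x + (-1) * q n (x $ i))"
    "gradient (\<lambda>x. 1 * \<psi> n x + (-1) * q n (x $ i)) = (\<lambda>x. 1 *\<^sub>R gradient (\<psi> n) x + (-1) *\<^sub>R gradient (\<lambda>x. q n (x $ i)) x)" for n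
    by (rule C1_linear_comb[OF C\<psi> Cq(1)])+
  have Cm: "C1 (\<lambda>x :: real^'n. (-1) * q n (x $ i))" for n
    using C1_linear_comb(1)[OF Cq(1) Cq(1), of "-1" n 0 n] by simp
  note Cc = C1_compose[OF _ cutoff_has_derivative continuous_cutoff']
  have F_test: "test_function \<Omega> (F n)" for n
  proof -
    obtain K where K: "compact K" "K \<subseteq> \<Omega>" "\<And>x. x \<notin> K \<Longrightarrow> \<psi> n x = 0" "\<And>x. x \<notin> K \<Longrightarrow> gradient (\<psi> n) x = 0"
      by (rule test_function_support[OF \<psi>(1)]) blast
    show ?thesis
    proof (rule test_functionI[OF _ K(1,2)])
      have c\<psi>: "C_infinity (\<psi> n)" using \<psi>(1) by (simp add: test_function_def)
      have cq: "C_infinity (\<lambda>x :: real^'n. q n (x $ i))" by (rule C_infinity_compose[OF q(1) C_infinity_intros(2)])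
      have "C_infinity (\<lambda>x. cutoff (1 * \<psi> n x + (-1) * q n (x $ i)))"
        by (rule C_infinity_compose[OF smooth_real_cutoff]) (intro C_infinity_intros(3) C_infinity_scale c\<psi> cq)
      moreover have "C_infinity (\<lambda>x :: real^'n. cutoff ((-1) * q n (x $ i)))"
        by (rule C_infinity_compose[OF smooth_real_cutoff]) (intro C_infinity_scale cq)
      ultimately show "C_infinity (F n)"
        unfolding F_def[abs_def] by (intro C_infinity_intros(3) C_infinity_scale)
      show "F n x = 0" if "x \<notin> K" for x using K(3)[OF that] by (simp add: F_def)
    qed
  qed
  have F_on: "F n x = cutoff (\<psi> n x - q n (x $ i))" if "x \<in> \<Omega>" for n x
    using q0[OF that, of n] by (simp add: F_def cutoff_props(2))
  have gF: "gradient (F n) x = cutoff' (\<psi> n x - q n (x $ i)) *\<^sub>R (gradient (\<psi> n) x - q' n (x $ i) *\<^sub>R ?e)" if "x \<in> \<Omega>" for n x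
  proof -
    have "gradient (F n) = (\<lambda>x. 1 *\<^sub>R gradient (\<lambda>x. cutoff (1 * \<psi> n x + (-1) * q n (x $ i))) x +
        (-1) *\<^sub>R gradient (\<lambda>x. cutoff ((-1) * q n (x $ i))) x)"
    proof -
      have 1: "C1 (\<lambda>x. cutoff (1 * \<psi> n x + (-1) * q n (x $ i)))" by (rule Cc(1)[OF Cd(1)])
      have 2: "C1 (\<lambda>x :: real^'n. cutoff ((-1) * q n (x $ i)))" by (rule Cc(1)[OF Cm])
      show ?thesis unfolding F_def[abs_def] by (rule C1_linear_comb(2)[OF 1 2])
    qed
    then have "gradient (F n) x = gradient (\<lambda>x. cutoff (1 * \<psi> n x + (-1) * q n (x $ i))) x - gradient (\<lambda>x. cutoff ((-1) * q n (x $ i))) x"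
      by simp
    also have "gradient (\<lambda>x. cutoff ((-1) * q n (x $ i))) x = 0"
      unfolding Cc(2)[OF Cm] using q0[OF that, of n] by (simp add: cutoff'_def)
    also have "gradient (\<lambda>x. cutoff (1 * \<psi> n x + (-1) * q n (x $ i))) x = cutoff' (\<psi> n x - q n (x $ i)) *\<^sub>R (gradient (\<psi> n) x - q' n (x $ i) *\<^sub>R ?e)"
      unfolding Cc(2)[OF Cd(1)] Cd(2) Cq(2) by simp
    finally show ?thesis by simp
  qed
  have c\<omega>: "continuous_on S \<omega>" for S using \<omega>(1) by (meson DERIV_isCont continuous_at_imp_continuous_on)
  have cq: "continuous_on S (q n)" for S n using q(2) by (meson DERIV_isCont continuous_at_imp_continuous_on)
  have mi: "(\<lambda>x :: real^'n. f (x $ i)) \<in> borel_measurable M" if "continuous_on UNIV f" for f :: "real \<Rightarrow> real"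
    by (intro measurable_M_continuous continuous_on_compose2[OF that]) (auto intro!: continuous_intros)
  have mc: "cutoff' \<in> borel_measurable borel" "cutoff \<in> borel_measurable borel"
    using continuous_cutoff' cutoff_has_derivative
    by (auto intro!: borel_measurable_continuous_onI) (meson DERIV_isCont continuous_at_imp_continuous_on)
  note mu = OL_measurable[OF O(1)] and mg = OL_measurable[OF O(2)]
  note m\<psi> = OL_measurable[OF O\<psi>(1)] and m\<psi>' = OL_measurable[OF O\<psi>(2)]
  define \<theta> where "\<theta> x = cutoff' (u x - \<omega> (x $ i))" for x
  define \<theta>n where "\<theta>n n x = cutoff' (\<psi> n x - q n (x $ i))" for n x
  have m\<theta>: "\<theta> \<in> borel_measurable M" "\<theta>n n \<in> borel_measurable M" for n
    unfolding \<theta>_def[abs_def] \<theta>n_def[abs_def]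
    by (intro measurable_compose[OF _ mc(1)] borel_measurable_diff mu m\<psi> mi c\<omega> cq)+
  define k where "k x = g x - \<omega>' (x $ i) *\<^sub>R ?e" for x
  have Ok: "OL k"
  proof -
    have "compact {-radius..radius}" by simp
    then have "bounded (\<omega>' ` {-radius..radius})"
      by (intro compact_imp_bounded compact_continuous_image continuous_on_subset[OF \<omega>(2)]) auto
    then obtain B where "\<And>t. t \<in> {-radius..radius} \<Longrightarrow> norm (\<omega>' t) \<le> B" unfolding bounded_iff by (metis imageI)
    then have "norm (\<omega>' (x $ i) *\<^sub>R ?e) \<le> B" if "x \<in> \<Omega>" for x
      using component_bound[OF that, of i] by (auto simp: abs_le_iff)
    then have "OL (\<lambda>x. \<omega>' (x $ i) *\<^sub>R ?e)"
      by (intro OL_bounded[of _ B] borel_measurable_scaleR mi \<omega>(2) borel_measurable_const)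
    then show ?thesis unfolding k_def[abs_def] by (rule OL_diff[OF O(2)])
  qed
  note mk = OL_measurable[OF Ok]
  have m1: "(\<lambda>x. cutoff (u x - \<omega> (x $ i))) \<in> borel_measurable M"
    by (intro measurable_compose[OF _ mc(2)] borel_measurable_diff mu mi c\<omega>)
  have c\<epsilon>: "(\<lambda>n. \<epsilon> n * radius) \<longlonglongrightarrow> 0" using tendsto_mult[OF \<epsilon>lim tendsto_const[of radius]] by simp
  have c\<epsilon>0: "\<epsilon> n * radius \<ge> 0" for n using \<epsilon>0[of n] radius(1) by simp
  have a: "OL (\<lambda>x. F n x - cutoff (u x - \<omega> (x $ i)))" "(\<lambda>n. modular (\<lambda>x. F n x - cutoff (u x - \<omega> (x $ i)))) \<longlonglongrightarrow> 0" for n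
  proof -
    have le: "norm (F n x - cutoff (u x - \<omega> (x $ i))) \<le> norm (\<psi> n x - u x) + \<epsilon> n * radius" if "x \<in> \<Omega>" for n x
      using cutoff_lipschitz[of "\<psi> n x - q n (x $ i)" "u x - \<omega> (x $ i)"] q(5)[OF component_bound[OF that, of i], of n]
      unfolding F_on[OF that] real_norm_def by linarith
    have m: "(\<lambda>x. F n x - cutoff (u x - \<omega> (x $ i))) \<in> borel_measurable M" for n
      by (intro borel_measurable_diff m1 OL_measurable[OF OL_test(1)[OF F_test]])
    show "OL (\<lambda>x. F n x - cutoff (u x - \<omega> (x $ i)))" "(\<lambda>n. modular (\<lambda>x. F n x - cutoff (u x - \<omega> (x $ i)))) \<longlonglongrightarrow> 0"
      by (rule modular_tendsto_bound[OF m OL_diff[OF O\<psi>(1) O(1)] \<psi>(2) c\<epsilon> c\<epsilon>0 le]; assumption)+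
  qed
  \<comment> \<open>The gradient error is split into A, a bounded factor times a converging
    difference of gradients, and D, a converging factor times the fixed k. The first tends to zero
    by comparison, the second by dominated convergence.\<close>
  define A where "A n x = \<theta>n n x *\<^sub>R ((gradient (\<psi> n) x - g x) - (q' n (x $ i) - \<omega>' (x $ i)) *\<^sub>R ?e)" for n x
  define D where "D n x = (\<theta>n n x - \<theta> x) *\<^sub>R k x" for n x
  have dec: "gradient (F n) x - \<theta> x *\<^sub>R k x = A n x + D n x" if "x \<in> \<Omega>" for n x
    unfolding gF[OF that] A_def D_def k_def \<theta>n_def by (simp add: algebra_simps)
  have \<theta>01: "0 \<le> \<theta> x" "\<theta> x \<le> 1" "0 \<le> \<theta>n n x" "\<theta>n n x \<le> 1" for n x
    by (auto simp: \<theta>_def \<theta>n_def cutoff'_range)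
  have mA: "A n \<in> borel_measurable M" for n
    unfolding A_def[abs_def]
    by (intro borel_measurable_scaleR borel_measurable_diff m\<theta> m\<psi>' mg mi q(3) \<omega>(2) borel_measurable_const)
  have mD: "D n \<in> borel_measurable M" for n
    unfolding D_def[abs_def] by (intro borel_measurable_scaleR borel_measurable_diff m\<theta> mk)
  have Aa: "OL (A n)" "(\<lambda>n. modular (A n)) \<longlonglongrightarrow> 0" for n
  proof -
    have le: "norm (A n x) \<le> norm (gradient (\<psi> n) x - g x) + \<epsilon> n" if "x \<in> \<Omega>" for n x
    proof -
      have "norm (A n x) \<le> 1 * norm ((gradient (\<psi> n) x - g x) - (q' n (x $ i) - \<omega>' (x $ i)) *\<^sub>R ?e)"
        unfolding A_def norm_scaleR using \<theta>01(3,4)[of n x] by (intro mult_right_mono) auto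
      also have "\<dots> \<le> norm (gradient (\<psi> n) x - g x) + norm ((q' n (x $ i) - \<omega>' (x $ i)) *\<^sub>R ?e)"
        by (simp only: mult_1_left norm_triangle_ineq4)
      also have "norm ((q' n (x $ i) - \<omega>' (x $ i)) *\<^sub>R ?e) \<le> \<epsilon> n"
        using q(4)[OF component_bound[OF that, of i], of n] by simp
      finally show ?thesis by simp
    qed
    show "OL (A n)" "(\<lambda>n. modular (A n)) \<longlonglongrightarrow> 0"
      by (rule modular_tendsto_bound[OF mA OL_diff[OF O\<psi>(2) O(2)] \<psi>(3) \<epsilon>lim less_imp_le[OF \<epsilon>0] le]; assumption)+
  qed
  have leD: "norm (D n x) \<le> norm (k x)" for n x
  proof -
    have "\<bar>\<theta>n n x - \<theta> x\<bar> * norm (k x) \<le> 1 * norm (k x)"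
      using \<theta>01(1,2)[of x] \<theta>01(3,4)[of n x] by (intro mult_right_mono) (auto simp: abs_le_iff)
    then show ?thesis by (simp add: D_def)
  qed
  have OD: "OL (D n)" for n by (rule OL_mono(1)[OF Ok mD leD])
  have Dlim: "(\<lambda>n. modular (D n)) \<longlonglongrightarrow> 0"
  proof (rule modular_dominated_tendsto[OF mD Ok _ leD])
    show "AE x in M. (\<lambda>n. D n x) \<longlonglongrightarrow> 0"
      using \<psi>(4) AE_space
    proof eventually_elim
      fix x assume l: "(\<lambda>n. \<psi> n x - u x) \<longlonglongrightarrow> 0" and "x \<in> space M"
      then have x: "x \<in> \<Omega>" by simp
      have "(\<lambda>n. q n (x $ i) - \<omega> (x $ i)) \<longlonglongrightarrow> 0"
        using q(5)[OF component_bound[OF x, of i]] by (intro Lim_null_comparison[OF _ c\<epsilon>]) simp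
      from tendsto_diff[OF l this] have "(\<lambda>n. (\<psi> n x - q n (x $ i)) - (u x - \<omega> (x $ i))) \<longlonglongrightarrow> 0"
        by (simp add: algebra_simps)
      then have "(\<lambda>n. \<psi> n x - q n (x $ i)) \<longlonglongrightarrow> u x - \<omega> (x $ i)" by (rule LIM_zero_cancel)
      then have "(\<lambda>n. \<theta>n n x) \<longlonglongrightarrow> \<theta> x" unfolding \<theta>n_def \<theta>_def
        by (rule continuous_on_tendsto_compose[OF continuous_cutoff']) auto
      then have "(\<lambda>n. (\<theta>n n x - \<theta> x) *\<^sub>R k x) \<longlonglongrightarrow> (\<theta> x - \<theta> x) *\<^sub>R k x" by (intro tendsto_intros)
      then show "(\<lambda>n. D n x) \<longlonglongrightarrow> 0" by (simp add: D_def)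
    qed
  qed
  have b: "(\<lambda>n. modular (\<lambda>x. gradient (F n) x - \<theta> x *\<^sub>R k x)) \<longlonglongrightarrow> 0"
  proof (rule tendsto_sandwich[OF _ _ tendsto_const])
    show "(\<lambda>n. 2 powr P * (modular (A n) + modular (D n))) \<longlonglongrightarrow> 0"
      using tendsto_mult[OF tendsto_const tendsto_add[OF Aa(2) Dlim]] by simp
    have "modular (\<lambda>x. gradient (F n) x - \<theta> x *\<^sub>R k x) \<le> 2 powr P * (modular (A n) + modular (D n))" for n
    proof -
      have "modular (\<lambda>x. gradient (F n) x - \<theta> x *\<^sub>R k x) = modular (\<lambda>x. A n x + D n x)"
        unfolding modular_def by (rule Bochner_Integration.integral_cong) (auto simp: dec)
      also have "\<dots> \<le> 2 powr P * (modular (A n) + modular (D n))" by (rule OL_add(2)[OF Aa(1) OD])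
      finally show ?thesis .
    qed
    then show "\<forall>\<^sub>F n in sequentially. modular (\<lambda>x. gradient (F n) x - \<theta> x *\<^sub>R k x) \<le> 2 powr P * (modular (A n) + modular (D n))" by simp
  qed (simp add: modular_nonneg)
  have O1: "OL (\<lambda>x. cutoff (u x - \<omega> (x $ i)))"
    using OL_diff[OF OL_test(1)[OF F_test[of 0]] a(1)[of 0]] by simp
  have O2: "OL (\<lambda>x. \<theta> x *\<^sub>R k x)"
  proof (rule OL_mono(1)[OF Ok borel_measurable_scaleR[OF m\<theta>(1) mk]])
    show "norm (\<theta> x *\<^sub>R k x) \<le> norm (k x)" for x
      using \<theta>01(1,2)[of x] mult_right_mono[of "\<theta> x" 1 "norm (k x)"] by simp
  qed
  have "X (\<lambda>x. cutoff (u x - \<omega> (x $ i))) (\<lambda>x. \<theta> x *\<^sub>R k x)"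
    unfolding X_def using O1 O2 F_test a(2) b by blast
  then show ?thesis by (simp add: \<theta>_def k_def)
qed

end

section \<open>Minimisers of the energy functional\<close>

context young
begin

text \<open>The gradient of \<xi> \<mapsto> \<Phi>(\<bar>\<xi>\<bar>), which becomes
  a(\<bar>\<xi>\<bar>) \<xi> in the application; division by zero gives the required value 0 at the
  origin.\<close>

definition A :: "'b::real_inner \<Rightarrow> 'b" where
  "A \<xi> = (\<phi> (norm \<xi>) / norm \<xi>) *\<^sub>R \<xi>"

lemma norm_A: "norm (A \<xi>) = \<phi> (norm \<xi>)"
  by (cases "\<xi> = 0") (simp_all add: A_def \<phi>_nonneg)

lemma A_subgradient: "\<Phi> (norm \<xi>) + A \<xi> \<bullet> (\<zeta> - \<xi>) \<le> \<Phi> (norm \<zeta>)"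
proof -
  have "A \<xi> \<bullet> \<xi> = \<phi> (norm \<xi>) * norm \<xi>"
    by (cases "\<xi> = 0") (simp_all add: A_def power2_norm_eq_inner[symmetric] power2_eq_square)
  moreover have "A \<xi> \<bullet> \<zeta> \<le> \<phi> (norm \<xi>) * norm \<zeta>"
    using norm_cauchy_schwarz[of "A \<xi>" \<zeta>] by (simp add: norm_A)
  ultimately have "A \<xi> \<bullet> (\<zeta> - \<xi>) \<le> \<phi> (norm \<xi>) * (norm \<zeta> - norm \<xi>)"
    by (simp add: inner_diff_right algebra_simps)
  then show ?thesis using \<Phi>_tangent[of "norm \<xi>" "norm \<zeta>"] by simp
qed

lemma A_continuous: "continuous_on UNIV (A :: 'b::real_inner \<Rightarrow> 'b)"
proof -
  have "isCont A \<xi>" for \<xi> :: 'b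
  proof (cases "\<xi> = 0")
    case True
    have "isCont \<phi> 0" using \<phi>_cont by (simp add: continuous_on_eq_continuous_at)
    then have "((\<lambda>x. \<phi> (norm x)) \<longlongrightarrow> \<phi> 0) (at (0::'b))"
      by (rule isCont_tendsto_compose) (rule tendsto_norm_zero, rule tendsto_ident_at)
    then have "((\<lambda>x. norm (A x)) \<longlongrightarrow> 0) (at (0::'b))" by (simp add: norm_A)
    then have "(A \<longlongrightarrow> 0) (at (0::'b))" by (rule tendsto_norm_zero_cancel)
    moreover have "A (0::'b) = 0" by (simp add: A_def)
    ultimately show ?thesis unfolding True by (simp add: isCont_def)
  next
    case False
    have c: "isCont \<phi> (norm \<xi>)" using \<phi>_cont by (simp add: continuous_on_eq_continuous_at)
    have "isCont (\<lambda>\<xi>. \<phi> (norm \<xi>)) \<xi>" by (rule isCont_o2[where f=norm and g=\<phi>, OF _ c]) (intro continuous_intros)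
    then have "isCont (\<lambda>\<xi>. (\<phi> (norm \<xi>) / norm \<xi>) *\<^sub>R \<xi>) \<xi>" using False by (intro continuous_intros) auto
    then show ?thesis by (simp add: A_def[abs_def])
  qed
  then show ?thesis by (simp add: continuous_on_eq_continuous_at)
qed

text \<open>Monotonicity of \<open>\<phi>\<close> and the index bound P push both arguments into a
  single \<Phi>. This provides the integrable majorants in place of a Hoelder inequality.\<close>

lemma A_bound: "\<bar>A \<xi> \<bullet> \<zeta>\<bar> \<le> P * \<Phi> (norm \<xi> + norm \<zeta>)"
proof (cases "norm \<xi> + norm \<zeta> > 0")
  case True
  have "\<bar>A \<xi> \<bullet> \<zeta>\<bar> \<le> \<phi> (norm \<xi>) * norm \<zeta>"
    using Cauchy_Schwarz_ineq2[of "A \<xi>" \<zeta>] by (simp add: norm_A)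
  also have "\<dots> \<le> \<phi> (norm \<xi> + norm \<zeta>) * (norm \<xi> + norm \<zeta>)"
    by (intro mult_mono \<phi>_mono \<phi>_nonneg) auto
  also have "\<dots> \<le> P * \<Phi> (norm \<xi> + norm \<zeta>)" using P_ge[OF True] by (simp add: mult.commute)
  finally show ?thesis .
next
  case False
  then have "norm \<zeta> = 0" using norm_ge_zero[of \<xi>] norm_ge_zero[of \<zeta>] by linarith
  then have "A \<xi> \<bullet> \<zeta> = 0" by simp
  then show ?thesis using \<Phi>_nonneg[of "norm \<xi> + norm \<zeta>"] P_gt by simp
qed

end

text \<open>G is convex in its second variable, with subgradient \<open>\<gamma>\<close>. The bound
  c makes G Lipschitz and its integral continuous in L1; the comparison with the barrier will ask
  for c < 1.\<close>

locale nonlinearity = orlicz_domain \<phi> \<Phi> p P \<Omega>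
  for \<phi> \<Phi> :: "real \<Rightarrow> real" and p P :: real and \<Omega> :: "(real^'n::finite) set" +
  fixes G \<gamma> :: "real^'n \<Rightarrow> real \<Rightarrow> real" and c :: real
  assumes G_measurable: "u \<in> borel_measurable M \<Longrightarrow> (\<lambda>x. G x (u x)) \<in> borel_measurable M"
    and \<gamma>_measurable: "u \<in> borel_measurable M \<Longrightarrow> (\<lambda>x. \<gamma> x (u x)) \<in> borel_measurable M"
    and G_subgradient: "x \<in> \<Omega> \<Longrightarrow> G x s + \<gamma> x s * (r - s) \<le> G x r"
    and \<gamma>_bound: "x \<in> \<Omega> \<Longrightarrow> \<bar>\<gamma> x s\<bar> \<le> c"
    and G_0: "x \<in> \<Omega> \<Longrightarrow> G x 0 = 0"
    and c_nonneg: "c \<ge> 0"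
begin

lemma G_lipschitz: assumes x: "x \<in> \<Omega>" shows "\<bar>G x r - G x s\<bar> \<le> c * \<bar>r - s\<bar>"
proof -
  have *: "G x r - G x s \<le> c * \<bar>r - s\<bar>" for r s
  proof -
    have "\<gamma> x r * (r - s) \<le> \<bar>\<gamma> x r\<bar> * \<bar>r - s\<bar>" by (metis abs_ge_self abs_mult)
    also have "\<dots> \<le> c * \<bar>r - s\<bar>" by (intro mult_right_mono \<gamma>_bound[OF x]) simp
    finally show ?thesis using G_subgradient[OF x, of r s] by (simp add: algebra_simps)
  qed
  show ?thesis using *[of r s] *[of s r] by (simp add: abs_le_iff abs_minus_commute)
qed

lemma G_integrable:
  assumes "integrable M u" shows "integrable M (\<lambda>x. G x (u x))"
proof (rule Bochner_Integration.integrable_bound[of M "\<lambda>x. c * u x"])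
  show "AE x in M. norm (G x (u x)) \<le> norm (c * u x)"
    using G_lipschitz[of _ _ 0] c_nonneg by (intro AE_I2) (simp add: G_0 abs_mult)
qed (use assms G_measurable in auto)

lemma G_integral_diff:
  assumes u: "integrable M u" and v: "integrable M v"
  shows "\<bar>(LINT x|M. G x (u x)) - (LINT x|M. G x (v x))\<bar> \<le> c * (LINT x|M. \<bar>u x - v x\<bar>)"
proof -
  have "\<bar>(LINT x|M. G x (u x)) - (LINT x|M. G x (v x))\<bar> = \<bar>LINT x|M. G x (u x) - G x (v x)\<bar>"
    using G_integrable u v by simp
  also have "\<dots> \<le> (LINT x|M. \<bar>G x (u x) - G x (v x)\<bar>)" by (rule integral_abs_bound)
  also have "\<dots> \<le> (LINT x|M. c * \<bar>u x - v x\<bar>)"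
    using G_integrable u v G_lipschitz by (intro integral_mono) auto
  also have "\<dots> = c * (LINT x|M. \<bar>u x - v x\<bar>)" using u v by simp
  finally show ?thesis .
qed

lemma integral_G_0: "(LINT x|M. G x 0) = 0"
  using Bochner_Integration.integral_cong[of M M "\<lambda>x. G x 0" "\<lambda>x. 0"] by (simp add: G_0)

definition J :: "(real^'n \<Rightarrow> real) \<Rightarrow> (real^'n \<Rightarrow> real^'n) \<Rightarrow> real" where
  "J u g = modular g - (LINT x|M. G x (u x))"

text \<open>By the Poincare inequality the G term is at most linear in the gradient, and
  superlinearity of \<open>\<Phi>\<close> absorbs it into half of the modular.\<close>

lemma J_coercive:
  obtains C where "\<And>u g. X u g \<Longrightarrow> modular g / 2 - C \<le> J u g"
proof -
  have "c * (2 * radius) \<ge> 0" using c_nonneg radius(1) by simp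
  then obtain C where C: "C \<ge> 0" "\<And>t. t \<ge> 0 \<Longrightarrow> c * (2 * radius) * t \<le> \<Phi> t / 2 + C"
    using \<Phi>_superlinear by blast
  have "modular g / 2 - C * measure M \<Omega> \<le> J u g" if X: "X u g" for u g
  proof -
    have i: "integrable M (\<lambda>x. \<Phi> (norm (g x)))" using X_OL(2)[OF X] by (simp add: OL_def)
    have "(LINT x|M. G x (u x)) \<le> c * (LINT x|M. \<bar>u x\<bar>)"
      using G_integral_diff[OF X_integrable(1)[OF X], of "\<lambda>x. 0"] by (simp add: integral_G_0)
    also have "\<dots> \<le> c * (2 * radius * (LINT x|M. norm (g x)))"
      by (intro mult_left_mono X_poincare[OF X] c_nonneg)
    also have "\<dots> = (LINT x|M. c * (2 * radius) * norm (g x))" by simp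
    also have "\<dots> \<le> (LINT x|M. \<Phi> (norm (g x)) / 2 + C)"
      using X_integrable(2)[OF X] i C(2) by (intro integral_mono) auto
    also have "\<dots> = modular g / 2 + C * measure M \<Omega>" using i by (simp add: modular_def mult.commute)
    finally show ?thesis by (simp add: J_def)
  qed
  then show ?thesis using that by blast
qed

lemma modular_midpoint:
  fixes g k :: "real^'n \<Rightarrow> real^'n"
  assumes "OL g" "OL k"
  shows "modular (\<lambda>x. (1/2) *\<^sub>R g x + (1/2) *\<^sub>R k x) \<le> (modular g + modular k) / 2"
proof -
  have i: "integrable M (\<lambda>x. \<Phi> (norm (g x)))" "integrable M (\<lambda>x. \<Phi> (norm (k x)))" using assms by (auto simp: OL_def)
  have "modular (\<lambda>x. (1/2) *\<^sub>R g x + (1/2) *\<^sub>R k x) \<le> (LINT x|M. (\<Phi> (norm (g x)) + \<Phi> (norm (k x))) / 2)"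
    unfolding modular_def
  proof (rule integral_mono)
    show "integrable M (\<lambda>x. \<Phi> (norm ((1/2) *\<^sub>R g x + (1/2) *\<^sub>R k x)))"
      using OL_add(1)[OF OL_scale(1)[OF assms(1)] OL_scale(1)[OF assms(2)]] by (simp add: OL_def)
    show "\<Phi> (norm ((1/2) *\<^sub>R g x + (1/2) *\<^sub>R k x)) \<le> (\<Phi> (norm (g x)) + \<Phi> (norm (k x))) / 2" for x
    proof -
      \<comment> \<open>Two subgradient inequalities at the midpoint, whose linear terms
        cancel.\<close>
      let ?m = "(1/2) *\<^sub>R g x + (1/2) *\<^sub>R k x"
      have "(g x - ?m) + (k x - ?m) = 0" by (simp add: vec_eq_iff)
      then have "A ?m \<bullet> (g x - ?m) + A ?m \<bullet> (k x - ?m) = A ?m \<bullet> 0"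
        unfolding inner_add_right[symmetric] by (simp only:)
      then show ?thesis using A_subgradient[of ?m "g x"] A_subgradient[of ?m "k x"] by simp
    qed
  qed (use i in simp)
  also have "\<dots> = (modular g + modular k) / 2" using i by (simp add: modular_def)
  finally show ?thesis .
qed

text \<open>The gradients converge strongly, so lower semicontinuity is Fatou along an almost
  everywhere convergent subsequence.\<close>

lemma modular_lsc:
  fixes g :: "nat \<Rightarrow> real^'n \<Rightarrow> real^'n"
  assumes g: "\<And>n. OL (g n)" and K: "OL K" and lim: "(\<lambda>n. modular (\<lambda>x. g n x - K x)) \<longlonglongrightarrow> 0"
    and le: "\<And>n. modular (g n) \<le> e + d n" and d: "d \<longlonglongrightarrow> 0"
  shows "modular K \<le> e"
proof (rule field_le_epsilon)
  fix \<epsilon> :: real assume \<epsilon>: "\<epsilon> > 0"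
  obtain r where r: "strict_mono (r :: nat \<Rightarrow> nat)" "AE x in M. (\<lambda>n. g (r n) x - K x) \<longlonglongrightarrow> 0"
    by (rule modular_AE_subseq[of "\<lambda>n x. g n x - K x", OF OL_diff[OF g K] lim])
  have d': "(\<lambda>n. d (r n)) \<longlonglongrightarrow> 0" using LIMSEQ_subseq_LIMSEQ[OF d r(1)] by (simp add: comp_def)
  show "modular K \<le> e + \<epsilon>"
    unfolding modular_def
  proof (rule fatou_bounded(2))
    show "integrable M (\<lambda>x. \<Phi> (norm (g (r n) x)))" for n using g by (simp add: OL_def)
    show "(\<lambda>x. \<Phi> (norm (K x))) \<in> borel_measurable M" by (rule \<Phi>_norm_measurable[OF OL_measurable[OF K]])
    show "AE x in M. (\<lambda>n. \<Phi> (norm (g (r n) x))) \<longlonglongrightarrow> \<Phi> (norm (K x))"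
      using r(2)
    proof eventually_elim
      fix x assume "(\<lambda>n. g (r n) x - K x) \<longlonglongrightarrow> 0"
      then have "(\<lambda>n. g (r n) x) \<longlonglongrightarrow> K x" by (rule LIM_zero_cancel)
      then have "(\<lambda>n. norm (g (r n) x)) \<longlonglongrightarrow> norm (K x)" by (rule tendsto_norm)
      then show "(\<lambda>n. \<Phi> (norm (g (r n) x))) \<longlonglongrightarrow> \<Phi> (norm (K x))"
        by (rule continuous_on_tendsto_compose[OF \<Phi>_cont[of UNIV]]) auto
    qed
    show "\<forall>\<^sub>F n in sequentially. (LINT x|M. \<Phi> (norm (g (r n) x))) \<le> e + \<epsilon>"
      using order_tendstoD(2)[OF d' \<epsilon>]
    proof eventually_elim
      fix n assume "d (r n) < \<epsilon>"
      then show "(LINT x|M. \<Phi> (norm (g (r n) x))) \<le> e + \<epsilon>" using le[of "r n"] by (simp add: modular_def)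
    qed
  qed (rule \<Phi>_norm_nonneg)
qed

text \<open>Freezing the L1 limit U of a minimising sequence replaces the nonconvex condition on J
  by two conditions that midpoints preserve: the L1 distance to U and the size of the
  modular.\<close>

lemma minimiser_exists:
  obtains u g where "X u g" "\<And>v k. X v k \<Longrightarrow> J u g \<le> J v k"
proof -
  obtain C where C: "\<And>u g. X u g \<Longrightarrow> modular g / 2 - C \<le> J u g" using J_coercive by blast
  let ?S = "{J u g | u g. X u g}"
  have X0: "X (\<lambda>x. 0) (gradient (\<lambda>x. 0))" by (rule X_test[OF test_function_zero])
  then have Sne: "?S \<noteq> {}" by blast
  have lb: "- C \<le> J u g" if "X u g" for u g using C[OF that] modular_nonneg[of g] by linarith
  then have bb: "bdd_below ?S" by (intro bdd_belowI[of _ "- C"]) auto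
  define m where "m = Inf ?S"
  have m_le: "m \<le> J u g" if "X u g" for u g unfolding m_def using that by (intro cInf_lower bb) blast
  have "\<forall>n. \<exists>ug. X (fst ug) (snd ug) \<and> J (fst ug) (snd ug) < m + 1 / real (Suc n)"
  proof
    fix n
    have "Inf ?S < m + 1 / real (Suc n)" by (simp add: m_def)
    then obtain y where "y \<in> ?S" "y < m + 1 / real (Suc n)" using cInf_lessD[OF Sne] by blast
    then show "\<exists>ug. X (fst ug) (snd ug) \<and> J (fst ug) (snd ug) < m + 1 / real (Suc n)" by force
  qed
  from choice[OF this] obtain ug where ug: "\<And>n. X (fst (ug n)) (snd (ug n))" "\<And>n. J (fst (ug n)) (snd (ug n)) < m + 1 / real (Suc n)"
    by blast
  define u where "u n = fst (ug n)" for n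
  define g where "g n = snd (ug n)" for n
  have Xn: "X (u n) (g n)" and Jn: "J (u n) (g n) < m + 1 / real (Suc n)" for n using ug by (auto simp: u_def g_def)
  have bnd: "modular (g n) \<le> 2 * (m + 1 + C)" for n
  proof -
    have "1 / real (Suc n) \<le> 1" by simp
    then show ?thesis using C[OF Xn[of n]] Jn[of n] by argo
  qed
  obtain r U where r: "strict_mono (r :: nat \<Rightarrow> nat)" and U: "integrable M U" "(\<lambda>n. LINT x|M. \<bar>u (r n) x - U x\<bar>) \<longlonglongrightarrow> 0"
    by (rule X_compactness[of u g, OF Xn bnd]) blast
  \<comment> \<open>The modular that U would need in order to attain the infimum m; so far U is only
    an integrable function without a gradient.\<close>
  define e where "e = m + (LINT x|M. G x (U x))"
  let ?d = "\<lambda>n. 1 / real (Suc n)"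
  have dlim: "?d \<longlonglongrightarrow> 0" by (rule LIMSEQ_Suc[OF lim_1_over_n])
  define Cn where "Cn n v k \<longleftrightarrow> X v k \<and> (LINT x|M. \<bar>v x - U x\<bar>) \<le> ?d n \<and> modular k \<le> e + ?d n" for n v k
  have ne: "\<exists>v k. Cn n v k" for n
  proof -
    \<comment> \<open>One index j is sought for which the L1 distance, the resulting error in the G
      term and the excess of J over m are all below 1/(n+1).\<close>
    have "(\<lambda>j. (LINT x|M. \<bar>u (r j) x - U x\<bar>) + (c * (LINT x|M. \<bar>u (r j) x - U x\<bar>) + ?d j)) \<longlonglongrightarrow> 0 + (c * 0 + 0)"
      by (intro tendsto_intros U dlim)
    then have "\<forall>\<^sub>F j in sequentially. (LINT x|M. \<bar>u (r j) x - U x\<bar>) + (c * (LINT x|M. \<bar>u (r j) x - U x\<bar>) + ?d j) < ?d n"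
      by (intro order_tendstoD(2)) auto
    from eventually_happens'[OF sequentially_bot this]
    obtain j where j: "(LINT x|M. \<bar>u (r j) x - U x\<bar>) + (c * (LINT x|M. \<bar>u (r j) x - U x\<bar>) + ?d j) < ?d n" by blast
    have nn: "0 \<le> (LINT x|M. \<bar>u (r j) x - U x\<bar>)" by simp
    have nn2: "0 \<le> c * (LINT x|M. \<bar>u (r j) x - U x\<bar>)" "0 \<le> ?d j" using nn c_nonneg by simp_all
    have "?d (r j) \<le> ?d j" using seq_suble[OF r, of j] by (simp add: frac_le)
    then have "modular (g (r j)) \<le> m + ?d j + (LINT x|M. G x (u (r j) x))"
      using Jn[of "r j"] unfolding J_def by linarith
    moreover have "(LINT x|M. G x (u (r j) x)) \<le> (LINT x|M. G x (U x)) + c * (LINT x|M. \<bar>u (r j) x - U x\<bar>)"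
      using G_integral_diff[OF X_integrable(1)[OF Xn] U(1), of "r j"] by linarith
    ultimately have "modular (g (r j)) \<le> e + ?d n" using j nn unfolding e_def by linarith
    moreover have "(LINT x|M. \<bar>u (r j) x - U x\<bar>) \<le> ?d n" using j nn2 by linarith
    ultimately have "Cn n (u (r j)) (g (r j))" unfolding Cn_def using Xn by blast
    then show ?thesis by blast
  qed
  have mid: "Cn n (\<lambda>x. (1/2) * v x + (1/2) * v' x) (\<lambda>x. (1/2) *\<^sub>R k x + (1/2) *\<^sub>R k' x)"
    if "Cn n v k" "Cn n v' k'" for n v k v' k'
  proof -
    have X1: "X v k" and X2: "X v' k'" using that by (auto simp: Cn_def)
    note i = X_integrable(1)[OF X1] X_integrable(1)[OF X2]
    have "(LINT x|M. \<bar>(1/2) * v x + (1/2) * v' x - U x\<bar>) \<le> (LINT x|M. (\<bar>v x - U x\<bar> + \<bar>v' x - U x\<bar>) / 2)"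
    proof (rule integral_mono)
      show "integrable M (\<lambda>x. \<bar>(1/2) * v x + (1/2) * v' x - U x\<bar>)" "integrable M (\<lambda>x. (\<bar>v x - U x\<bar> + \<bar>v' x - U x\<bar>) / 2)"
        using i U(1) by simp_all
      show "\<bar>(1/2) * v x + (1/2) * v' x - U x\<bar> \<le> (\<bar>v x - U x\<bar> + \<bar>v' x - U x\<bar>) / 2" for x
        by (simp add: abs_if)
    qed
    also have "\<dots> = ((LINT x|M. \<bar>v x - U x\<bar>) + (LINT x|M. \<bar>v' x - U x\<bar>)) / 2" using i U(1) by simp
    also have "\<dots> \<le> ?d n" using that unfolding Cn_def by argo
    finally have "(LINT x|M. \<bar>(1/2) * v x + (1/2) * v' x - U x\<bar>) \<le> ?d n" .
    moreover have "modular (\<lambda>x. (1/2) *\<^sub>R k x + (1/2) *\<^sub>R k' x) \<le> e + ?d n"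
      using modular_midpoint[OF X_OL(2)[OF X1] X_OL(2)[OF X2]] that unfolding Cn_def by argo
    ultimately show ?thesis unfolding Cn_def using X_linear_comb[OF X1 X2] by blast
  qed
  have dec: "Cn i v k" if "i \<le> n" "Cn n v k" for i n v k
  proof -
    have "?d n \<le> ?d i" using that(1) by (simp add: frac_le)
    then show ?thesis using that(2) unfolding Cn_def by force
  qed
  have CX: "X v k" if "Cn n v k" for n v k using that by (simp add: Cn_def)
  have C0: "modular k \<le> e + 1" if "Cn 0 v k" for v k using that by (simp add: Cn_def)
  have "\<exists>z k Z K. (\<forall>n. Cn n (z n) (k n)) \<and> X Z K \<and> (\<lambda>n. modular (\<lambda>x. k n x - K x)) \<longlonglongrightarrow> 0 \<and>
      (\<lambda>n. modular (\<lambda>x. z n x - Z x)) \<longlonglongrightarrow> 0"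
  proof (rule uniformly_convex_selection[of Cn "e + 1"])
    show "X v k" if "Cn n v k" for n v k using that by (rule CX)
    show "Cn i v k" if "i \<le> n" "Cn n v k" for i n v k using that by (rule dec)
    show "\<exists>v k. Cn n v k" for n by (rule ne)
    show "Cn n (\<lambda>x. (1/2) * v x + (1/2) * v' x) (\<lambda>x. (1/2) *\<^sub>R k x + (1/2) *\<^sub>R k' x)"
      if "Cn n v k" "Cn n v' k'" for n v k v' k' using that by (rule mid)
    show "modular k \<le> e + 1" if "Cn 0 v k" for v k using that by (rule C0)
    fix z k Z K assume "\<And>n. Cn n (z n) (k n)" "X Z K" "(\<lambda>n. modular (\<lambda>x. k n x - K x)) \<longlonglongrightarrow> 0"
      "(\<lambda>n. modular (\<lambda>x. z n x - Z x)) \<longlonglongrightarrow> 0"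
    then show "\<exists>z k Z K. (\<forall>n. Cn n (z n) (k n)) \<and> X Z K \<and> (\<lambda>n. modular (\<lambda>x. k n x - K x)) \<longlonglongrightarrow> 0 \<and>
      (\<lambda>n. modular (\<lambda>x. z n x - Z x)) \<longlonglongrightarrow> 0"
      by (intro exI[of _ z] exI[of _ k] exI[of _ Z] exI[of _ K]) simp
  qed
  then obtain z k Z K where zk: "\<And>n. Cn n (z n) (k n)" and XZ: "X Z K" and Kl: "(\<lambda>n. modular (\<lambda>x. k n x - K x)) \<longlonglongrightarrow> 0"
    and Zl: "(\<lambda>n. modular (\<lambda>x. z n x - Z x)) \<longlonglongrightarrow> 0"
    by blast
  have Xz: "X (z n) (k n)" for n using zk by (simp add: Cn_def)
  have mK: "modular K \<le> e"
  proof (rule modular_lsc[OF X_OL(2)[OF Xz] X_OL(2)[OF XZ] Kl _ dlim])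
    show "modular (k n) \<le> e + ?d n" for n using zk[of n] by (simp add: Cn_def)
  qed
  \<comment> \<open>The strong limit Z coincides with U almost everywhere. Its G term is therefore
    that of U, and its energy is at most e - \<integral>G(x, U) = m.\<close>
  have ZU: "(LINT x|M. \<bar>Z x - U x\<bar>) \<le> 0"
  proof -
    have 1: "(\<lambda>n. LINT x|M. norm (z n x - Z x)) \<longlonglongrightarrow> 0"
      by (rule modular_L1_tendsto[OF OL_diff[OF X_OL(1)[OF Xz] X_OL(1)[OF XZ]] Zl])
    have "(\<lambda>n. (LINT x|M. norm (z n x - Z x)) + ?d n) \<longlonglongrightarrow> 0 + 0" by (intro tendsto_add 1 dlim)
    moreover have "(LINT x|M. \<bar>Z x - U x\<bar>) \<le> (LINT x|M. norm (z n x - Z x)) + ?d n" for n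
    proof -
      note i = X_integrable(1)[OF Xz[of n]] X_integrable(1)[OF XZ] U(1)
      have "(LINT x|M. \<bar>Z x - U x\<bar>) \<le> (LINT x|M. norm (z n x - Z x) + \<bar>z n x - U x\<bar>)"
        using i by (intro integral_mono) auto
      also have "\<dots> = (LINT x|M. norm (z n x - Z x)) + (LINT x|M. \<bar>z n x - U x\<bar>)" using i by simp
      also have "\<dots> \<le> (LINT x|M. norm (z n x - Z x)) + ?d n" using zk[of n] by (simp add: Cn_def)
      finally show ?thesis .
    qed
    ultimately have "(LINT x|M. \<bar>Z x - U x\<bar>) \<le> 0 + 0" by (intro LIMSEQ_le_const) auto
    then show ?thesis by simp
  qed
  have "\<bar>(LINT x|M. G x (Z x)) - (LINT x|M. G x (U x))\<bar> \<le> c * (LINT x|M. \<bar>Z x - U x\<bar>)"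
    by (rule G_integral_diff[OF X_integrable(1)[OF XZ] U(1)])
  also have "\<dots> \<le> 0" using ZU c_nonneg by (simp add: mult_nonneg_nonpos)
  finally have "J Z K \<le> m" using mK unfolding J_def e_def by linarith
  then show ?thesis using that[OF XZ] m_le order_trans by blast
qed

lemma A_integrable:
  assumes "OL g" "OL k"
  shows "integrable M (\<lambda>x. A (g x) \<bullet> k x)"
proof (rule Bochner_Integration.integrable_bound)
  have "OL (\<lambda>x. norm (g x))" "OL (\<lambda>x. norm (k x))"
    by (rule OL_mono(1)[OF assms(1)], use OL_measurable[OF assms(1)] in simp, simp)
       (rule OL_mono(1)[OF assms(2)], use OL_measurable[OF assms(2)] in simp, simp)
  then have "OL (\<lambda>x. norm (g x) + norm (k x))" by (rule OL_add(1))
  then show "integrable M (\<lambda>x. P * \<Phi> (norm (norm (g x) + norm (k x))))" by (simp add: OL_def)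
  show "(\<lambda>x. A (g x) \<bullet> k x) \<in> borel_measurable M"
    by (rule borel_measurable_inner[OF
        measurable_compose[OF OL_measurable[OF assms(1)] borel_measurable_continuous_onI[OF A_continuous]] OL_measurable[OF assms(2)]])
  show "AE x in M. norm (A (g x) \<bullet> k x) \<le> norm (P * \<Phi> (norm (norm (g x) + norm (k x))))"
  proof (rule AE_I2)
    fix x
    have "\<bar>A (g x) \<bullet> k x\<bar> \<le> P * \<Phi> (norm (g x) + norm (k x))" by (rule A_bound)
    also have "\<dots> \<le> \<bar>P * \<Phi> (norm (g x) + norm (k x))\<bar>" by (rule abs_ge_self)
    finally show "norm (A (g x) \<bullet> k x) \<le> norm (P * \<Phi> (norm (norm (g x) + norm (k x))))" by simp
  qed
qed

lemma \<gamma>_integrable: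
  assumes "u \<in> borel_measurable M" "integrable M v" shows "integrable M (\<lambda>x. \<gamma> x (u x) * v x)"
proof (rule Bochner_Integration.integrable_bound[of M "\<lambda>x. c * v x"])
  show "(\<lambda>x. \<gamma> x (u x) * v x) \<in> borel_measurable M"
    using \<gamma>_measurable[OF assms(1)] assms(2) by auto
  show "AE x in M. norm (\<gamma> x (u x) * v x) \<le> norm (c * v x)"
    using \<gamma>_bound c_nonneg by (intro AE_I2) (auto simp: abs_mult intro!: mult_right_mono)
qed (use assms in simp)

text \<open>By convexity \<open>J (u + t v) - J u \<le> t (\<integral>A (\<nabla>u + t \<nabla>v) \<bullet> \<nabla>v - \<integral>\<gamma>(x, u) v)\<close>, so differentiability of \<open>J\<close> is not needed.\<close>

lemma euler_lagrange_le:
  assumes X: "X u g" and min: "\<And>v k. X v k \<Longrightarrow> J u g \<le> J v k" and V: "X v k"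
  shows "(LINT x|M. \<gamma> x (u x) * v x) \<le> (LINT x|M. A (g x) \<bullet> k x)"
proof -
  note O = X_OL(2)[OF X] X_OL(2)[OF V]
  note iu = X_integrable(1)[OF X] X_integrable(1)[OF V]
  have i\<gamma>: "integrable M (\<lambda>x. \<gamma> x (u x) * v x)" by (rule \<gamma>_integrable[OF OL_measurable[OF X_OL(1)[OF X]] iu(2)])
  define t where "t n = 1 / real (Suc n)" for n
  have t0: "t n > 0" "t n \<le> 1" for n by (auto simp: t_def)
  have tl: "t \<longlonglongrightarrow> 0" unfolding t_def by (rule LIMSEQ_Suc[OF lim_1_over_n])
  define gt where "gt n x = g x + t n *\<^sub>R k x" for n x
  have Xt: "X (\<lambda>x. 1 * u x + t n * v x) (\<lambda>x. 1 *\<^sub>R g x + t n *\<^sub>R k x)" for n by (rule X_linear_comb[OF X V])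
  have Ot: "OL (gt n)" for n using X_OL(2)[OF Xt[of n]] by (simp add: gt_def[abs_def])
  have le: "(LINT x|M. \<gamma> x (u x) * v x) \<le> (LINT x|M. A (gt n x) \<bullet> k x)" for n
  proof -
    have i: "integrable M (\<lambda>x. \<Phi> (norm (g x)))" "integrable M (\<lambda>x. \<Phi> (norm (gt n x)))" using O Ot by (auto simp: OL_def)
    note iA = A_integrable[OF Ot[of n] O(2)]
    have "J u g \<le> J (\<lambda>x. u x + t n * v x) (gt n)"
      using min[OF Xt[of n]] by (simp add: gt_def[abs_def])
    then have "modular g - (LINT x|M. G x (u x)) \<le> modular (gt n) - (LINT x|M. G x (u x + t n * v x))" by (simp add: J_def)
    \<comment> \<open>The subgradient is taken at the perturbed gradient and evaluated at g, which
      gives an upper bound for the perturbed modular.\<close>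
    moreover have "modular (gt n) \<le> modular g + (LINT x|M. t n * (A (gt n x) \<bullet> k x))"
    proof -
      have "modular (gt n) \<le> (LINT x|M. \<Phi> (norm (g x)) + t n * (A (gt n x) \<bullet> k x))"
        unfolding modular_def
      proof (rule integral_mono)
        show "\<Phi> (norm (gt n x)) \<le> \<Phi> (norm (g x)) + t n * (A (gt n x) \<bullet> k x)" for x
          using A_subgradient[of "gt n x" "g x"] by (simp add: gt_def)
      qed (use i iA in auto)
      then show ?thesis using i iA by (simp add: modular_def)
    qed
    moreover have "(LINT x|M. G x (u x)) + (LINT x|M. t n * (\<gamma> x (u x) * v x)) \<le> (LINT x|M. G x (u x + t n * v x))"
    proof -
      have "(LINT x|M. G x (u x) + t n * (\<gamma> x (u x) * v x)) \<le> (LINT x|M. G x (u x + t n * v x))"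
      proof (rule integral_mono)
        show "integrable M (\<lambda>x. G x (u x) + t n * (\<gamma> x (u x) * v x))" using G_integrable[OF iu(1)] i\<gamma> by simp
        show "integrable M (\<lambda>x. G x (u x + t n * v x))" using iu by (intro G_integrable) simp
        show "G x (u x) + t n * (\<gamma> x (u x) * v x) \<le> G x (u x + t n * v x)" if "x \<in> space M" for x
          using G_subgradient[of x "u x" "u x + t n * v x"] that by (simp add: mult_ac)
      qed
      then show ?thesis using G_integrable[OF iu(1)] i\<gamma> by simp
    qed
    ultimately have "t n * (LINT x|M. \<gamma> x (u x) * v x) \<le> t n * (LINT x|M. A (gt n x) \<bullet> k x)" by simp
    then show ?thesis using t0(1)[of n] by simp
  qed
  have "(\<lambda>n. LINT x|M. A (gt n x) \<bullet> k x) \<longlonglongrightarrow> (LINT x|M. A (g x) \<bullet> k x)"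
  \<comment> \<open>One k accounts for the perturbation, as t \<le> 1, and the other is the second
    argument of \<open>A_bound\<close>.\<close>
  proof (rule integral_dominated_convergence[where w="\<lambda>x. P * \<Phi> (norm (norm (g x) + norm (2 *\<^sub>R k x)))"])
    have O2: "OL (\<lambda>x. 2 *\<^sub>R k x)" by (rule OL_scale(1)[OF O(2)])
    have "OL (\<lambda>x. norm (g x))" "OL (\<lambda>x. norm (2 *\<^sub>R k x))"
      by (rule OL_mono(1)[OF O(1)], use OL_measurable[OF O(1)] in simp, simp)
         (rule OL_mono(1)[OF O2], use OL_measurable[OF O(2)] in simp, simp)
    then have "OL (\<lambda>x. norm (g x) + norm (2 *\<^sub>R k x))" by (rule OL_add(1))
    then show "integrable M (\<lambda>x. P * \<Phi> (norm (norm (g x) + norm (2 *\<^sub>R k x))))" by (simp add: OL_def)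
    show "(\<lambda>x. A (g x) \<bullet> k x) \<in> borel_measurable M" "(\<lambda>x. A (gt n x) \<bullet> k x) \<in> borel_measurable M" for n
      using A_integrable[OF O] A_integrable[OF Ot O(2)] by auto
    show "AE x in M. norm (A (gt n x) \<bullet> k x) \<le> P * \<Phi> (norm (norm (g x) + norm (2 *\<^sub>R k x)))" for n
    proof (rule AE_I2)
      fix x
      have "norm (A (gt n x) \<bullet> k x) \<le> P * \<Phi> (norm (gt n x) + norm (k x))" using A_bound[of "gt n x" "k x"] by simp
      also have "\<dots> \<le> P * \<Phi> (norm (g x) + norm (2 *\<^sub>R k x))"
      proof (intro mult_left_mono \<Phi>_mono)
        have "norm (t n *\<^sub>R k x) \<le> 1 * norm (k x)"
          using t0[of n] unfolding norm_scaleR by (intro mult_right_mono) auto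
        then show "norm (gt n x) + norm (k x) \<le> norm (g x) + norm (2 *\<^sub>R k x)"
          using norm_triangle_ineq[of "g x" "t n *\<^sub>R k x"] by (simp add: gt_def)
      qed (use P_gt in auto)
      finally show "norm (A (gt n x) \<bullet> k x) \<le> P * \<Phi> (norm (norm (g x) + norm (2 *\<^sub>R k x)))" by simp
    qed
    show "AE x in M. (\<lambda>n. A (gt n x) \<bullet> k x) \<longlonglongrightarrow> A (g x) \<bullet> k x"
    proof (rule AE_I2)
      fix x
      have "(\<lambda>n. gt n x) \<longlonglongrightarrow> g x + 0 *\<^sub>R k x" unfolding gt_def by (intro tendsto_intros tl)
      then have "(\<lambda>n. A (gt n x)) \<longlonglongrightarrow> A (g x)"
        by (intro continuous_on_tendsto_compose[OF A_continuous]) auto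
      then show "(\<lambda>n. A (gt n x) \<bullet> k x) \<longlonglongrightarrow> A (g x) \<bullet> k x" by (intro tendsto_intros)
    qed
  qed
  then show ?thesis using le by (intro LIMSEQ_le_const) auto
qed

lemma euler_lagrange:
  assumes X: "X u g" and min: "\<And>v k. X v k \<Longrightarrow> J u g \<le> J v k" and V: "X v k"
  shows "(LINT x|M. A (g x) \<bullet> k x) = (LINT x|M. \<gamma> x (u x) * v x)"
proof -
  have V': "X (\<lambda>x. - v x) (\<lambda>x. - k x)" using X_linear_comb[OF V V, of "-1" 0] by simp
  show ?thesis
    using euler_lagrange_le[OF X min V] euler_lagrange_le[OF X min V'] by simp
qed

text \<open>The barrier \<open>w(x) = \<omega>(x\<^sub>i)\<close> satisfies \<open>- div A(\<nabla>w) = 1\<close>; the competitor is \<open>u - cutoff (u - w)\<close>.\<close>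

lemma minimiser_below_barrier:
  fixes \<omega> \<omega>' :: "real \<Rightarrow> real"
  assumes X: "X u g" and min: "\<And>v k. X v k \<Longrightarrow> J u g \<le> J v k" and c: "c < 1"
    and \<omega>: "\<And>t. (\<omega> has_real_derivative \<omega>' t) (at t)" "continuous_on UNIV \<omega>'"
    and \<omega>1: "\<And>t. \<bar>t\<bar> \<le> radius \<Longrightarrow> \<omega> t \<ge> 1"
    and \<omega>\<phi>: "\<And>t. \<bar>t\<bar> \<le> radius \<Longrightarrow> \<omega>' t \<ge> 0" "\<And>t. \<bar>t\<bar> \<le> radius \<Longrightarrow> \<phi> (\<omega>' t) = radius - t"
  shows "AE x in M. u x \<le> \<omega> (x $ i)"
proof -
  let ?e = "axis i 1 :: real^'n"
  define h where "h x = cutoff (u x - \<omega> (x $ i))" for x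
  define \<theta> where "\<theta> x = cutoff' (u x - \<omega> (x $ i))" for x
  define W where "W x = \<omega>' (x $ i) *\<^sub>R ?e" for x :: "real^'n"
  define k where "k x = \<theta> x *\<^sub>R (g x - W x)" for x
  have Xh: "X h k"
    using X_cutoff[OF X \<omega> \<omega>1, of i] by (simp add: h_def[abs_def] k_def[abs_def] \<theta>_def W_def)
  have Xv: "X (\<lambda>x. 1 * u x + (-1) * h x) (\<lambda>x. 1 *\<^sub>R g x + (-1) *\<^sub>R k x)" by (rule X_linear_comb[OF X Xh])
  define v where "v x = g x - k x" for x
  have Ov: "OL v" using X_OL(2)[OF Xv] by (simp add: v_def[abs_def])
  have h0: "h x \<ge> 0" for x by (simp add: h_def cutoff_props)
  note ih = X_integrable(1)[OF Xh] and iu = X_integrable(1)[OF X]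
  \<comment> \<open>A(W) is an affine field of divergence -1. Integrating by parts against it turns
    \<integral>A(W) \<bullet> k into \<integral>h.\<close>
  have AW: "A (W x) = (radius - x $ i) *\<^sub>R ?e" if "x \<in> \<Omega>" for x
    using \<omega>\<phi>[OF component_bound[OF that, of i]] by (cases "\<omega>' (x $ i) = 0") (auto simp: A_def W_def)
  have lin: "gradient (\<lambda>x. radius * 1 + (-1) * x $ i) = (\<lambda>x :: real^'n. - ?e)" "C1 (\<lambda>x :: real^'n. radius * 1 + (-1) * x $ i)"
  proof -
    have "C1 (\<lambda>x :: real^'n. 1 :: real)" "gradient (\<lambda>x :: real^'n. 1 :: real) = (\<lambda>x. 0)"
      by (rule C1I[where g="\<lambda>x. 0"]; simp)+
    with C1_linear_comb[OF this(1) C1_component(1), of radius "-1" i]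
    show "gradient (\<lambda>x. radius * 1 + (-1) * x $ i) = (\<lambda>x :: real^'n. - ?e)" "C1 (\<lambda>x :: real^'n. radius * 1 + (-1) * x $ i)"
      by (simp_all add: C1_component(2))
  qed
  note ibp = X_integration_by_parts[OF Xh lin(2), of i]
  have ibp3: "(LINT x|M. h x) = (LINT x|M. k x $ i * (radius - x $ i))"
    using ibp(3) unfolding lin(1) by simp
  have ik: "integrable M (\<lambda>x. k x $ i * (radius - x $ i))" using ibp(2) by simp
  have i: "integrable M (\<lambda>x. \<Phi> (norm (g x)))" "integrable M (\<lambda>x. \<Phi> (norm (v x)))" using X_OL(2)[OF X] Ov by (auto simp: OL_def)
  have "modular v \<le> (LINT x|M. \<Phi> (norm (g x)) - k x $ i * (radius - x $ i))"
    unfolding modular_def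
  proof (rule integral_mono)
    show "integrable M (\<lambda>x. \<Phi> (norm (g x)) - k x $ i * (radius - x $ i))" using i ik by simp
    fix x assume "x \<in> space M"
    then have x: "x \<in> \<Omega>" by simp
    have \<theta>: "0 \<le> \<theta> x" "\<theta> x \<le> 1" by (auto simp: \<theta>_def cutoff'_range)
    \<comment> \<open>As \<open>cutoff'\<close> lies in [0, 1], the gradient of the competitor is a
      convex combination of g and W. Convexity followed by the subgradient inequality at W then
      produces the term A(W) \<bullet> k.\<close>
    have "v x = (1 - \<theta> x) *\<^sub>R g x + \<theta> x *\<^sub>R W x" by (simp add: v_def k_def algebra_simps)
    then have "norm (v x) \<le> (1 - \<theta> x) * norm (g x) + \<theta> x * norm (W x)"
      using norm_triangle_ineq[of "(1 - \<theta> x) *\<^sub>R g x" "\<theta> x *\<^sub>R W x"] \<theta> by simp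
    then have "\<Phi> (norm (v x)) \<le> \<Phi> ((1 - \<theta> x) * norm (g x) + \<theta> x * norm (W x))" by (intro \<Phi>_mono) auto
    also have "\<dots> \<le> (1 - \<theta> x) * \<Phi> (norm (g x)) + \<theta> x * \<Phi> (norm (W x))"
    proof -
      define s where "s = (1 - \<theta> x) * norm (g x) + \<theta> x * norm (W x)"
      have s: "s \<ge> 0" using \<theta> by (simp add: s_def)
      have "(1 - \<theta> x) * (\<Phi> s + \<phi> s * (norm (g x) - s)) + \<theta> x * (\<Phi> s + \<phi> s * (norm (W x) - s)) \<le>
          (1 - \<theta> x) * \<Phi> (norm (g x)) + \<theta> x * \<Phi> (norm (W x))"
        using \<theta> s by (intro add_mono mult_left_mono \<Phi>_tangent) auto
      moreover have "(1 - \<theta> x) * (\<Phi> s + \<phi> s * (norm (g x) - s)) + \<theta> x * (\<Phi> s + \<phi> s * (norm (W x) - s)) =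
          \<Phi> s + \<phi> s * ((1 - \<theta> x) * norm (g x) + \<theta> x * norm (W x) - s)" by (simp add: algebra_simps)
      ultimately show ?thesis by (simp add: s_def)
    qed
    also have "\<dots> \<le> \<Phi> (norm (g x)) - \<theta> x * (A (W x) \<bullet> (g x - W x))"
    proof -
      have "\<theta> x * (\<Phi> (norm (W x)) + A (W x) \<bullet> (g x - W x)) \<le> \<theta> x * \<Phi> (norm (g x))"
        by (intro mult_left_mono A_subgradient \<theta>)
      then show ?thesis by (simp add: algebra_simps)
    qed
    also have "\<theta> x * (A (W x) \<bullet> (g x - W x)) = k x $ i * (radius - x $ i)"
      unfolding AW[OF x] k_def by (simp add: inner_axis' mult_ac)
    finally show "\<Phi> (norm (v x)) \<le> \<Phi> (norm (g x)) - k x $ i * (radius - x $ i)" .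
  qed (rule i(2))
  also have "\<dots> = modular g - (LINT x|M. h x)" using i ik ibp3 by (simp add: modular_def)
  finally have m: "modular v \<le> modular g - (LINT x|M. h x)" .
  have "J u g \<le> J (\<lambda>x. u x - h x) v" using min[OF Xv] by (simp add: v_def[abs_def])
  then have "modular g - (LINT x|M. G x (u x)) \<le> modular v - (LINT x|M. G x (u x - h x))" by (simp add: J_def)
  \<comment> \<open>The competitor lowers the modular by at least \<integral>h and the G integral by
    at most c \<integral>h. With c < 1 minimality leaves only \<integral>h = 0.\<close>
  moreover have "(LINT x|M. G x (u x)) - (LINT x|M. G x (u x - h x)) \<le> c * (LINT x|M. h x)"
  proof -
    have iuh: "integrable M (\<lambda>x. u x - h x)" using iu ih by simp
    have "c * (LINT x|M. \<bar>u x - (u x - h x)\<bar>) = c * (LINT x|M. h x)" using h0 by simp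
    then show ?thesis using G_integral_diff[OF iu iuh] by linarith
  qed
  ultimately have "(1 - c) * (LINT x|M. h x) \<le> 0" using m by (simp add: algebra_simps)
  then have "(LINT x|M. h x) \<le> 0" using c by (simp add: mult_le_0_iff)
  moreover have "(LINT x|M. h x) \<ge> 0" using h0 by simp
  ultimately have "(LINT x|M. h x) = 0" by linarith
  then have "AE x in M. h x = 0" using ih h0 by (subst (asm) integral_nonneg_eq_0_iff_AE) auto
  then show ?thesis
  proof eventually_elim
    fix x assume "h x = 0"
    then have "\<not> u x - \<omega> (x $ i) > 0" using cutoff_props(3)[of "u x - \<omega> (x $ i)"] unfolding h_def by force
    then show "u x \<le> \<omega> (x $ i)" by simp
  qed
qed

end

section \<open>Weak gradients\<close>

lemma integrable_mult_compact_support: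
  fixes f \<eta> :: "real^'n::finite \<Rightarrow> real"
  assumes \<Omega>: "open \<Omega>" and K: "compact K" "K \<subseteq> \<Omega>" and f: "integrable (lebesgue_on K) f"
    and \<eta>: "continuous_on UNIV \<eta>" "\<And>x. x \<notin> K \<Longrightarrow> \<eta> x = 0"
  shows "integrable (lebesgue_on \<Omega>) (\<lambda>x. f x * \<eta> x)"
proof -
  have Ks: "K \<in> sets lebesgue" using K(1) by (simp add: borel_compact)
  have \<Omega>s: "\<Omega> \<in> sets lebesgue" using \<Omega> by (simp add: borel_open)
  have i: "integrable lebesgue (\<lambda>x. indicator K x *\<^sub>R f x)"
    using f Ks by (simp add: integrable_restrict_space)
  have "bounded (\<eta> ` K)"
    by (intro compact_imp_bounded compact_continuous_image continuous_on_subset[OF \<eta>(1)] K) auto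
  then obtain B where B: "\<And>x. x \<in> K \<Longrightarrow> norm (\<eta> x) \<le> B" unfolding bounded_iff by (metis imageI)
  have m\<eta>: "\<eta> \<in> borel_measurable lebesgue"
    using borel_measurable_continuous_onI[OF \<eta>(1)] by (intro measurable_completion) simp
  have "integrable lebesgue (\<lambda>x. (indicator K x *\<^sub>R f x) * \<eta> x)"
  proof (rule Bochner_Integration.integrable_bound[of _ "\<lambda>x. B * (indicator K x *\<^sub>R f x)"])
    show "(\<lambda>x. indicator K x *\<^sub>R f x * \<eta> x) \<in> borel_measurable lebesgue"
      by (rule borel_measurable_times[OF borel_measurable_integrable[OF i] m\<eta>])
    show "AE x in lebesgue. norm (indicator K x *\<^sub>R f x * \<eta> x) \<le> norm (B * (indicator K x *\<^sub>R f x))"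
    proof (rule AE_I2)
      fix x
      show "norm (indicator K x *\<^sub>R f x * \<eta> x) \<le> norm (B * (indicator K x *\<^sub>R f x))"
      proof (cases "x \<in> K")
        case True
        then have "\<bar>\<eta> x\<bar> \<le> \<bar>B\<bar>" using B[of x] by simp
        then have "\<bar>f x\<bar> * \<bar>\<eta> x\<bar> \<le> \<bar>f x\<bar> * \<bar>B\<bar>" by (intro mult_left_mono) auto
        then show ?thesis using True by (simp add: abs_mult mult.commute)
      qed simp
    qed
  qed (use i in simp)
  moreover have "(\<lambda>x. (indicator K x *\<^sub>R f x) * \<eta> x) = (\<lambda>x. indicator \<Omega> x *\<^sub>R (f x * \<eta> x))"
    using \<eta>(2) K(2) by (auto simp: fun_eq_iff indicator_def)
  ultimately show ?thesis using \<Omega>s by (simp add: integrable_restrict_space)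
qed

lemma has_weak_gradient_integrable:
  fixes u :: "real^'n::finite \<Rightarrow> real"
  assumes \<Omega>: "open \<Omega>" and g: "has_weak_gradient \<Omega> u g" and \<psi>: "test_function \<Omega> \<psi>"
  shows "integrable (lebesgue_on \<Omega>) (\<lambda>x. u x * partial_deriv i \<psi> x)" "integrable (lebesgue_on \<Omega>) (\<lambda>x. g x $ i * \<psi> x)"
proof -
  obtain K where K: "compact K" "K \<subseteq> \<Omega>" "\<And>x. x \<notin> K \<Longrightarrow> \<psi> x = 0" "\<And>x. x \<notin> K \<Longrightarrow> gradient \<psi> x = 0"
    by (rule test_function_support[OF \<psi>]) blast
  have C1: "C1 \<psi>" by (rule test_functionD(1)[OF \<psi>])
  have u: "integrable (lebesgue_on K) u" and gk: "integrable (lebesgue_on K) g"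
    using g K by (auto simp: has_weak_gradient_def)
  have pd: "partial_deriv i \<psi> = (\<lambda>x. gradient \<psi> x $ i)" by (simp add: gradient_def fun_eq_iff)
  show "integrable (lebesgue_on \<Omega>) (\<lambda>x. u x * partial_deriv i \<psi> x)"
    unfolding pd using C1 K(4) unfolding C1_def
    by (intro integrable_mult_compact_support[OF \<Omega> K(1,2) u] continuous_on_component) auto
  show "integrable (lebesgue_on \<Omega>) (\<lambda>x. g x $ i * \<psi> x)"
    using K(3) by (intro integrable_mult_compact_support[OF \<Omega> K(1,2) integrable_bounded_linear[OF bounded_linear_vec_nth gk]]
        C1_continuous[OF C1]) auto
qed

lemma has_weak_gradient_diff:
  assumes \<Omega>: "open \<Omega>" and g: "has_weak_gradient \<Omega> u g" and k: "has_weak_gradient \<Omega> v k"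
  shows "has_weak_gradient \<Omega> (\<lambda>x. u x - v x) (\<lambda>x. g x - k x)"
  unfolding has_weak_gradient_def
proof (intro conjI allI impI)
  fix K assume "compact K \<and> K \<subseteq> \<Omega>"
  then show "integrable (lebesgue_on K) (\<lambda>x. u x - v x)" "integrable (lebesgue_on K) (\<lambda>x. g x - k x)"
    using g k by (auto simp: has_weak_gradient_def)
next
  fix \<psi> i assume \<psi>: "test_function \<Omega> \<psi>"
  note 1 = has_weak_gradient_integrable[OF \<Omega> g \<psi>, of i] and 2 = has_weak_gradient_integrable[OF \<Omega> k \<psi>, of i]
  have "(LINT x|lebesgue_on \<Omega>. u x * partial_deriv i \<psi> x) = - (LINT x|lebesgue_on \<Omega>. g x $ i * \<psi> x)"
    "(LINT x|lebesgue_on \<Omega>. v x * partial_deriv i \<psi> x) = - (LINT x|lebesgue_on \<Omega>. k x $ i * \<psi> x)"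
    using g k \<psi> by (auto simp: has_weak_gradient_def)
  then show "(LINT x|lebesgue_on \<Omega>. (u x - v x) * partial_deriv i \<psi> x) = - (LINT x|lebesgue_on \<Omega>. (g x - k x) $ i * \<psi> x)"
    using 1 2 by (simp add: left_diff_distrib)
qed

lemma has_weak_gradient_unique:
  fixes u :: "real^'n::finite \<Rightarrow> real"
  assumes \<Omega>: "open \<Omega>" and g: "has_weak_gradient \<Omega> u g" and k: "has_weak_gradient \<Omega> u k"
  shows "AE x in lebesgue_on \<Omega>. g x = k x"
proof -
  have "AE x in lebesgue_on \<Omega>. (g x - k x) $ i = 0" for i
  proof (rule du_bois_reymond[OF \<Omega>])
    fix K assume K: "compact K" "K \<subseteq> \<Omega>"
    then have "integrable (lebesgue_on K) (\<lambda>x. g x - k x)" using g k by (auto simp: has_weak_gradient_def)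
    then show "integrable (lebesgue_on K) (\<lambda>x. (g x - k x) $ i)"
      by (rule integrable_bounded_linear[OF bounded_linear_vec_nth])
  next
    fix \<psi> assume \<psi>: "test_function \<Omega> \<psi>"
    note 1 = has_weak_gradient_integrable(2)[OF \<Omega> g \<psi>, of i] and 2 = has_weak_gradient_integrable(2)[OF \<Omega> k \<psi>, of i]
    have "(LINT x|lebesgue_on \<Omega>. u x * partial_deriv i \<psi> x) = - (LINT x|lebesgue_on \<Omega>. g x $ i * \<psi> x)"
      "(LINT x|lebesgue_on \<Omega>. u x * partial_deriv i \<psi> x) = - (LINT x|lebesgue_on \<Omega>. k x $ i * \<psi> x)"
      using g k \<psi> by (auto simp: has_weak_gradient_def)
    then show "(LINT x|lebesgue_on \<Omega>. (g x - k x) $ i * \<psi> x) = 0" using 1 2 by (simp add: left_diff_distrib)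
  qed
  then have "AE x in lebesgue_on \<Omega>. \<forall>i. (g x - k x) $ i = 0" by (simp add: AE_all_countable)
  then show ?thesis by eventually_elim (simp add: vec_eq_iff)
qed

section \<open>The Orlicz-Sobolev space\<close>

text \<open>Evenness of \<open>Phi a\<close> lets the Luxemburg norm ignore signs. The facts on
  \<open>inv (phi a)\<close> concern the complementary function, which enters both through the
  Orlicz norm and through the barrier.\<close>

locale orlicz_sobolev = orlicz_domain "phi a" "Phi a" p P \<Omega>
  for a :: "real \<Rightarrow> real" and p P :: real and \<Omega> :: "(real^'n::finite) set" +
  assumes Phi_even: "Phi a (- t) = Phi a t"
    and Phi_compl_deriv: "(Phi_compl a has_real_derivative inv (phi a) t) (at t)"
    and Phi_compl_0[simp]: "Phi_compl a 0 = 0"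
    and phi_inv[simp]: "phi a (inv (phi a) t) = t" and inv_phi[simp]: "inv (phi a) (phi a t) = t"
    and inv_cont: "continuous_on UNIV (inv (phi a))" and inv_mono: "s \<le> t \<Longrightarrow> inv (phi a) s \<le> inv (phi a) t"
begin

lemma Phi_abs: "Phi a t = Phi a \<bar>t\<bar>"
  using Phi_even[of t] by (simp add: abs_if)

lemma Phi_compl_cont: "continuous_on S (Phi_compl a)"
  by (meson DERIV_isCont Phi_compl_deriv continuous_at_imp_continuous_on)

lemma inv_0[simp]: "inv (phi a) 0 = 0"
  using inv_phi[of 0] by simp

lemma Phi_compl_mono: assumes "0 \<le> s" "s \<le> t" shows "Phi_compl a s \<le> Phi_compl a t"
proof (rule DERIV_nonneg_imp_nondecreasing[OF assms(2)])
  fix x assume "s \<le> x"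
  then have "inv (phi a) x \<ge> 0" using inv_mono[of 0 x] assms by simp
  then show "\<exists>y. (Phi_compl a has_real_derivative y) (at x) \<and> 0 \<le> y" using Phi_compl_deriv by blast
qed

text \<open>The constant \<open>P\<close> makes the inequality obvious at its critical point \<open>t = phi a s\<close>.\<close>

lemma young_inequality: assumes s: "s \<ge> 0" and t: "t \<ge> 0" shows "s * t \<le> P * Phi a s + Phi_compl a t"
proof (cases "s = 0")
  case True
  then show ?thesis using Phi_compl_mono[of 0 t] t by simp
next
  case False
  let ?H = "\<lambda>t. Phi_compl a t - s * t"
  have "?H (phi a s) \<le> ?H t"
  proof (rule minimum_by_derivative_sign[where H="?H" and s="phi a s" and t=t and H'="\<lambda>t. inv (phi a) t - s"])
    show "continuous_on {0..} ?H" by (intro continuous_on_diff Phi_compl_cont continuous_on_mult continuous_on_const continuous_on_id)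
    show "(?H has_real_derivative inv (phi a) t - s) (at t)" for t
      by (auto intro!: derivative_eq_intros Phi_compl_deriv)
    show "inv (phi a) t - s \<ge> 0" if "phi a s < t" for t using inv_mono[of "phi a s" t] that by simp
    show "inv (phi a) t - s \<le> 0" if "t < phi a s" for t using inv_mono[of t "phi a s"] that by simp
    show "phi a s \<ge> 0" by (rule \<phi>_nonneg[OF s])
  qed (rule t)
  moreover have "s * phi a s \<le> P * Phi a s" using P_ge[of s] False s by simp
  moreover have "Phi_compl a (phi a s) \<ge> 0" using Phi_compl_mono[of 0 "phi a s"] \<phi>_nonneg[OF s] by simp
  ultimately show ?thesis by linarith
qed

text \<open>Young's inequality bounds the pairing with every v in the modular unit ball by P times
  the modular of u plus 1, uniformly in v.\<close>

lemma OL_orlicz_space: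
  fixes u :: "real^'n \<Rightarrow> real"
  assumes "OL u" shows "u \<in> orlicz_space a \<Omega>"
proof -
  have "orlicz_norm a \<Omega> u \<le> ereal (P * modular u + 1)"
    unfolding orlicz_norm_def
  proof (rule SUP_least)
    fix v assume "v \<in> {v \<in> borel_measurable M. (\<integral>\<^sup>+x. ennreal (Phi_compl a \<bar>v x\<bar>) \<partial>M) \<le> 1 \<and> integrable M (\<lambda>x. u x * v x)}"
    then have v: "v \<in> borel_measurable M" "(\<integral>\<^sup>+x. ennreal (Phi_compl a \<bar>v x\<bar>) \<partial>M) \<le> 1" "integrable M (\<lambda>x. u x * v x)" by auto
    have c0: "Phi_compl a \<bar>v x\<bar> \<ge> 0" for x using Phi_compl_mono[of 0 "\<bar>v x\<bar>"] by simp
    have i: "integrable M (\<lambda>x. Phi_compl a \<bar>v x\<bar>)"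
    proof (rule integrableI_nonneg)
      show "(\<lambda>x. Phi_compl a \<bar>v x\<bar>) \<in> borel_measurable M"
        by (rule measurable_compose[OF _ borel_measurable_continuous_onI[OF Phi_compl_cont]]) (use v(1) in simp)
      show "(\<integral>\<^sup>+x. ennreal (Phi_compl a \<bar>v x\<bar>) \<partial>M) < \<infinity>" using v(2) by (simp add: le_less_trans[OF _ ennreal_one_less_top])
    qed (simp add: c0)
    have "ennreal (LINT x|M. Phi_compl a \<bar>v x\<bar>) \<le> ennreal 1"
      using v(2) nn_integral_eq_integral[OF i] c0 by simp
    then have l1: "(LINT x|M. Phi_compl a \<bar>v x\<bar>) \<le> 1" by (subst (asm) ennreal_le_iff) auto
    have iu: "integrable M (\<lambda>x. Phi a (norm (u x)))" using assms by (simp add: OL_def)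
    have "(LINT x|M. u x * v x) \<le> (LINT x|M. P * Phi a (norm (u x)) + Phi_compl a \<bar>v x\<bar>)"
    proof (rule integral_mono[OF v(3)])
      show "integrable M (\<lambda>x. P * Phi a (norm (u x)) + Phi_compl a \<bar>v x\<bar>)" using iu i by simp
      show "u x * v x \<le> P * Phi a (norm (u x)) + Phi_compl a \<bar>v x\<bar>" for x
        using young_inequality[of "\<bar>u x\<bar>" "\<bar>v x\<bar>"] abs_ge_self[of "u x * v x"] by (simp add: abs_mult)
    qed
    also have "\<dots> = P * modular u + (LINT x|M. Phi_compl a \<bar>v x\<bar>)" using iu i by (simp add: modular_def)
    finally show "ereal (LINT x|M. u x * v x) \<le> ereal (P * modular u + 1)" using l1 by simp
  qed
  then have "orlicz_norm a \<Omega> u < \<infinity>" by (rule le_less_trans) simp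
  then show ?thesis using OL_measurable[OF assms] by (simp add: orlicz_space_def)
qed

lemma luxemburg_nonneg: "luxemburg_norm a \<Omega> u \<ge> 0"
  unfolding luxemburg_norm_def by (rule INF_greatest) auto

lemma luxemburg_cong_AE:
  assumes "AE x in M. u x = v x" shows "luxemburg_norm a \<Omega> u = luxemburg_norm a \<Omega> v"
proof -
  have "(\<integral>\<^sup>+x. ennreal (Phi a (u x / k)) \<partial>M) = (\<integral>\<^sup>+x. ennreal (Phi a (v x / k)) \<partial>M)" for k
    using assms by (intro nn_integral_cong_AE) auto
  then show ?thesis by (simp add: luxemburg_norm_def)
qed

text \<open>For k \<le> 1 convexity gives \<Phi>(t) \<le> k \<Phi>(t/k), so an admissible k < e in
  the Luxemburg norm forces the modular below e. This is why e \<le> 1 is assumed.\<close>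

lemma luxemburg_imp_modular:
  fixes u :: "real^'n \<Rightarrow> real"
  assumes m: "u \<in> borel_measurable M" and l: "luxemburg_norm a \<Omega> u < ereal e" and e: "e \<le> 1"
  shows "OL u" "modular u < e"
proof -
  obtain k where k: "0 < k" "(\<integral>\<^sup>+x. ennreal (Phi a (u x / k)) \<partial>M) \<le> 1" "k < e"
    using l unfolding luxemburg_norm_def INF_less_iff by auto
  have abs: "Phi a (u x / k) = Phi a (norm (u x / k))" for x using Phi_abs[of "u x / k"] by simp
  have i: "integrable M (\<lambda>x. Phi a (norm (u x / k)))"
  proof (rule integrableI_nonneg)
    show "(\<lambda>x. Phi a (norm (u x / k))) \<in> borel_measurable M" by (rule \<Phi>_norm_measurable) (use m in simp)
    show "(\<integral>\<^sup>+x. ennreal (Phi a (norm (u x / k))) \<partial>M) < \<infinity>"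
      using k(2) unfolding abs by (simp add: le_less_trans[OF _ ennreal_one_less_top])
  qed (use \<Phi>_nonneg in simp)
  have "ennreal (LINT x|M. Phi a (norm (u x / k))) \<le> ennreal 1"
    using k(2) nn_integral_eq_integral[OF i] \<Phi>_nonneg unfolding abs by simp
  then have l1: "(LINT x|M. Phi a (norm (u x / k))) \<le> 1" by (subst (asm) ennreal_le_iff) auto
  have le: "Phi a (norm (u x)) \<le> k * Phi a (norm (u x / k))" for x
    using \<Phi>_contract[of k "norm (u x / k)"] k e by simp
  show "OL u"
    by (rule OL_dominated(1)[OF m, of "\<lambda>x. k * Phi a (norm (u x / k))"]) (use i le in auto)
  have "modular u \<le> (LINT x|M. k * Phi a (norm (u x / k)))"
    by (rule OL_dominated(2)[OF m]) (use i le in auto)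
  also have "\<dots> = k * (LINT x|M. Phi a (norm (u x / k)))" by simp
  also have "\<dots> \<le> k" using l1 k(1) by (simp add: mult_left_le)
  finally show "modular u < e" using k(3) by simp
qed

text \<open>The converse direction rests on the Delta_2 bound: the constant for scaling by 1/k
  measures how small the modular has to be.\<close>

lemma modular_imp_luxemburg:
  fixes u :: "real^'n \<Rightarrow> real"
  assumes u: "OL u" and k: "k > 0" and le: "(max 1 (1 / k)) powr P * modular u \<le> 1"
  shows "luxemburg_norm a \<Omega> u \<le> ereal k"
proof -
  have O: "OL (\<lambda>x. (1 / k) *\<^sub>R u x)" by (rule OL_scale(1)[OF u])
  have abs: "Phi a (u x / k) = Phi a (norm ((1 / k) *\<^sub>R u x))" for x using Phi_abs[of "u x / k"] k by simp
  have "(\<integral>\<^sup>+x. ennreal (Phi a (u x / k)) \<partial>M) = ennreal (modular (\<lambda>x. (1 / k) *\<^sub>R u x))"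
  proof -
    have "integrable M (\<lambda>x. Phi a (norm ((1 / k) *\<^sub>R u x)))" using O by (simp add: OL_def)
    then show ?thesis unfolding abs modular_def by (rule nn_integral_eq_integral[OF _ AE_I2[OF \<Phi>_norm_nonneg]])
  qed
  also have "\<dots> \<le> ennreal 1"
  proof (rule ennreal_leI)
    have "\<bar>1 / k\<bar> = 1 / k" using k by simp
    then show "modular (\<lambda>x. (1 / k) *\<^sub>R u x) \<le> 1" using OL_scale(2)[OF u, of "1 / k"] le by simp
  qed
  finally show ?thesis unfolding luxemburg_norm_def using k by (intro INF_lower) auto
qed

lemma weak_gradient_AE:
  assumes "has_weak_gradient \<Omega> u g"
  shows "has_weak_gradient \<Omega> u (weak_gradient \<Omega> u)" "AE x in M. weak_gradient \<Omega> u x = g x"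
proof -
  show "has_weak_gradient \<Omega> u (weak_gradient \<Omega> u)"
    unfolding weak_gradient_def by (rule someI[where P="has_weak_gradient \<Omega> u", OF assms])
  then show "AE x in M. weak_gradient \<Omega> u x = g x"
    by (rule has_weak_gradient_unique[OF \<Omega>_open _ assms])
qed

lemma X_has_weak_gradient:
  assumes "X u g" shows "has_weak_gradient \<Omega> u g"
  unfolding has_weak_gradient_def
proof (intro conjI allI impI)
  fix K assume K: "compact K \<and> K \<subseteq> \<Omega>"
  then have Ks: "K \<in> sets lebesgue" by (simp add: borel_compact)
  have sub: "integrable (lebesgue_on K) f" if "integrable M f" for f :: "real^'n \<Rightarrow> 'b::euclidean_space"
  proof -
    have "integrable lebesgue (\<lambda>x. indicator K x *\<^sub>R (indicator \<Omega> x *\<^sub>R f x))"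
      using that by (intro integrable_mult_indicator[OF Ks]) (simp add: integrable_restrict_space)
    moreover have "(\<lambda>x. indicator K x *\<^sub>R (indicator \<Omega> x *\<^sub>R f x)) = (\<lambda>x. indicator K x *\<^sub>R f x)"
      using K by (auto simp: fun_eq_iff indicator_def)
    ultimately show ?thesis using Ks by (simp add: integrable_restrict_space)
  qed
  show "integrable (lebesgue_on K) u" "integrable (lebesgue_on K) g"
    using sub X_integrable[OF assms] by blast+
next
  fix \<psi> i assume \<psi>: "test_function \<Omega> \<psi>"
  show "(LINT x|M. u x * partial_deriv i \<psi> x) = - (LINT x|M. g x $ i * \<psi> x)"
    using X_integration_by_parts(3)[OF assms test_functionD(1)[OF \<psi>], of i] by (simp add: gradient_def)
qed

lemma test_has_weak_gradient: "test_function \<Omega> \<psi> \<Longrightarrow> has_weak_gradient \<Omega> \<psi> (gradient \<psi>)"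
  by (rule X_has_weak_gradient[OF X_test])

lemma vector_measurable:
  fixes g :: "real^'n \<Rightarrow> real^'n"
  assumes "\<And>i. (\<lambda>x. g x $ i) \<in> borel_measurable N" shows "g \<in> borel_measurable N"
proof (subst borel_measurable_euclidean_space, rule ballI)
  fix b :: "real^'n" assume "b \<in> Basis"
  then obtain i where "b = axis i 1" by (auto simp: Basis_vec_def)
  then show "(\<lambda>x. g x \<bullet> b) \<in> borel_measurable N" using assms[of i] by (simp add: inner_axis)
qed

lemma X_imp_W01:
  assumes X: "X u g"
  shows "u \<in> W01_space a \<Omega>" "AE x in M. weak_gradient \<Omega> u x = g x"
proof -
  note w = weak_gradient_AE[OF X_has_weak_gradient[OF X]]
  show AEg: "AE x in M. weak_gradient \<Omega> u x = g x" by (rule w(2))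
  have gm: "g \<in> borel_measurable M" by (rule OL_measurable[OF X_OL(2)[OF X]])
  \<comment> \<open>The chosen representative agrees with g only almost everywhere. After extension
    by zero, completeness of Lebesgue measure makes it measurable.\<close>
  have wm: "weak_gradient \<Omega> u \<in> borel_measurable M"
  proof -
    have \<Omega>': "\<Omega> \<inter> space lebesgue \<in> sets lebesgue" by simp
    have "(\<lambda>x. indicator \<Omega> x *\<^sub>R g x) \<in> borel_measurable lebesgue"
      using gm unfolding borel_measurable_restrict_space_iff[OF \<Omega>'] .
    moreover have "AE x in lebesgue. indicator \<Omega> x *\<^sub>R g x = indicator \<Omega> x *\<^sub>R weak_gradient \<Omega> u x"
      using AEg unfolding AE_restrict_space_iff[OF \<Omega>'] by eventually_elim (auto simp: indicator_def)
    ultimately have "(\<lambda>x. indicator \<Omega> x *\<^sub>R weak_gradient \<Omega> u x) \<in> borel_measurable lebesgue"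
      by (rule borel_measurable_AE)
    then show ?thesis unfolding borel_measurable_restrict_space_iff[OF \<Omega>'] .
  qed
  have cO: "OL (\<lambda>x. weak_gradient \<Omega> u x $ i)" for i
  proof (rule OL_dominated(1)[where h="\<lambda>x. Phi a (norm (g x))"])
    show "(\<lambda>x. weak_gradient \<Omega> u x $ i) \<in> borel_measurable M"
      using wm by (rule measurable_compose) (intro borel_measurable_continuous_onI continuous_on_component continuous_on_id)
    show "integrable M (\<lambda>x. Phi a (norm (g x)))" using X_OL(2)[OF X] by (simp add: OL_def)
    show "AE x in M. Phi a (norm (weak_gradient \<Omega> u x $ i)) \<le> Phi a (norm (g x))"
      using AEg by eventually_elim (auto intro!: \<Phi>_mono component_le_norm_cart)
  qed
  have W1: "u \<in> W1_space a \<Omega>"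
    unfolding W1_space_def using OL_orlicz_space[OF X_OL(1)[OF X]] OL_orlicz_space[OF cO] w(1) by blast
  have "\<exists>\<psi>. test_function \<Omega> \<psi> \<and> W1_norm a \<Omega> (\<lambda>x. u x - \<psi> x) < ereal \<epsilon>" if \<epsilon>: "\<epsilon> > 0" for \<epsilon>
  proof -
    \<comment> \<open>The constant of \<open>modular_imp_luxemburg\<close> for k = \<epsilon>/3; two
      norms of that size stay strictly below \<epsilon>.\<close>
    let ?C = "(max 1 (1 / (\<epsilon> / 3))) powr P"
    have C: "?C > 0" by simp
    then have "1 / ?C > 0" by simp
    from X_approx[OF X this] obtain \<psi> where \<psi>: "test_function \<Omega> \<psi>" "modular (\<lambda>x. \<psi> x - u x) < 1 / ?C" "modular (\<lambda>x. gradient \<psi> x - g x) < 1 / ?C" by blast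
    have O: "OL (\<lambda>x. u x - \<psi> x)" "OL (\<lambda>x. g x - gradient \<psi> x)"
      using OL_diff X_OL[OF X] OL_test[OF \<psi>(1)] by blast+
    have On: "OL (\<lambda>x. norm (g x - gradient \<psi> x))"
      by (rule OL_mono(1)[OF O(2)]) (use OL_measurable[OF O(2)] in simp_all)
    have "?C * modular (\<lambda>x. u x - \<psi> x) \<le> ?C * (1 / ?C)"
      using \<psi>(2) modular_minus[of u \<psi>] by (intro mult_left_mono) auto
    then have l1: "luxemburg_norm a \<Omega> (\<lambda>x. u x - \<psi> x) \<le> ereal (\<epsilon> / 3)"
      using \<epsilon> C by (intro modular_imp_luxemburg[OF O(1)]) auto
    have "modular (\<lambda>x. norm (g x - gradient \<psi> x)) = modular (\<lambda>x. gradient \<psi> x - g x)"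
      by (simp add: modular_def norm_minus_commute)
    then have "?C * modular (\<lambda>x. norm (g x - gradient \<psi> x)) \<le> ?C * (1 / ?C)"
      using \<psi>(3) by (intro mult_left_mono) auto
    then have "luxemburg_norm a \<Omega> (\<lambda>x. norm (g x - gradient \<psi> x)) \<le> ereal (\<epsilon> / 3)"
      using \<epsilon> C by (intro modular_imp_luxemburg[OF On]) auto
    moreover have "luxemburg_norm a \<Omega> (\<lambda>x. norm (weak_gradient \<Omega> (\<lambda>x. u x - \<psi> x) x)) = luxemburg_norm a \<Omega> (\<lambda>x. norm (g x - gradient \<psi> x))"
    proof (rule luxemburg_cong_AE)
      show "AE x in M. norm (weak_gradient \<Omega> (\<lambda>x. u x - \<psi> x) x) = norm (g x - gradient \<psi> x)"
        using weak_gradient_AE(2)[OF has_weak_gradient_diff[OF \<Omega>_open X_has_weak_gradient[OF X] test_has_weak_gradient[OF \<psi>(1)]]]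
        by eventually_elim simp
    qed
    ultimately have "W1_norm a \<Omega> (\<lambda>x. u x - \<psi> x) \<le> ereal (\<epsilon> / 3) + ereal (\<epsilon> / 3)"
      unfolding W1_norm_def using l1 by (intro add_mono) auto
    also have "\<dots> < ereal \<epsilon>" using \<epsilon> by simp
    finally show ?thesis using \<psi>(1) by blast
  qed
  then show "u \<in> W01_space a \<Omega>" unfolding W01_space_def using W1 by blast
qed

lemma W01_imp_X:
  assumes u: "u \<in> W01_space a \<Omega>"
  shows "X u (weak_gradient \<Omega> u)"
proof -
  let ?g = "weak_gradient \<Omega> u"
  have W1: "u \<in> W1_space a \<Omega>" using u by (simp add: W01_space_def)
  have um: "u \<in> borel_measurable M" using W1 by (simp add: W1_space_def orlicz_space_def)
  have gm: "?g \<in> borel_measurable M"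
    using W1 by (intro vector_measurable) (simp add: W1_space_def orlicz_space_def)
  obtain g0 where "has_weak_gradient \<Omega> u g0" using W1 by (auto simp: W1_space_def)
  then have hg: "has_weak_gradient \<Omega> u ?g" by (rule weak_gradient_AE(1))
  have "\<forall>n. \<exists>\<psi>. test_function \<Omega> \<psi> \<and> OL (\<lambda>x. u x - \<psi> x) \<and> modular (\<lambda>x. u x - \<psi> x) < 1 / real (Suc n) \<and>
      OL (\<lambda>x. ?g x - gradient \<psi> x) \<and> modular (\<lambda>x. ?g x - gradient \<psi> x) < 1 / real (Suc n)"
  proof
    fix n
    let ?e = "1 / real (Suc n)"
    have e: "?e > 0" "?e \<le> 1" by simp_all
    obtain \<psi> where \<psi>: "test_function \<Omega> \<psi>" "W1_norm a \<Omega> (\<lambda>x. u x - \<psi> x) < ereal ?e"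
      using u e(1) unfolding W01_space_def by blast
    have pm: "\<psi> \<in> borel_measurable M" "gradient \<psi> \<in> borel_measurable M" using OL_measurable OL_test[OF \<psi>(1)] by blast+
    have l1: "luxemburg_norm a \<Omega> (\<lambda>x. u x - \<psi> x) < ereal ?e"
    proof (rule le_less_trans[OF _ \<psi>(2)])
      show "luxemburg_norm a \<Omega> (\<lambda>x. u x - \<psi> x) \<le> W1_norm a \<Omega> (\<lambda>x. u x - \<psi> x)"
        unfolding W1_norm_def using add_left_mono[OF luxemburg_nonneg] by (metis add.right_neutral)
    qed
    have l2: "luxemburg_norm a \<Omega> (\<lambda>x. norm (weak_gradient \<Omega> (\<lambda>x. u x - \<psi> x) x)) < ereal ?e"
    proof (rule le_less_trans[OF _ \<psi>(2)])
      show "luxemburg_norm a \<Omega> (\<lambda>x. norm (weak_gradient \<Omega> (\<lambda>x. u x - \<psi> x) x)) \<le> W1_norm a \<Omega> (\<lambda>x. u x - \<psi> x)"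
        unfolding W1_norm_def using add_right_mono[OF luxemburg_nonneg] by (metis add.left_neutral)
    qed
    have "luxemburg_norm a \<Omega> (\<lambda>x. norm (weak_gradient \<Omega> (\<lambda>x. u x - \<psi> x) x)) = luxemburg_norm a \<Omega> (\<lambda>x. norm (?g x - gradient \<psi> x))"
    proof (rule luxemburg_cong_AE)
      show "AE x in M. norm (weak_gradient \<Omega> (\<lambda>x. u x - \<psi> x) x) = norm (?g x - gradient \<psi> x)"
        using weak_gradient_AE(2)[OF has_weak_gradient_diff[OF \<Omega>_open hg test_has_weak_gradient[OF \<psi>(1)]]]
        by eventually_elim simp
    qed
    then have l3: "luxemburg_norm a \<Omega> (\<lambda>x. norm (?g x - gradient \<psi> x)) < ereal ?e" using l2 by simp
    have dm: "(\<lambda>x. u x - \<psi> x) \<in> borel_measurable M" "(\<lambda>x. ?g x - gradient \<psi> x) \<in> borel_measurable M"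
      by (intro borel_measurable_diff um gm pm)+
    have nm: "(\<lambda>x. norm (?g x - gradient \<psi> x)) \<in> borel_measurable M" by (rule measurable_compose[OF dm(2) borel_measurable_norm])
    note a1 = luxemburg_imp_modular[OF dm(1) l1 e(2)] and a2 = luxemburg_imp_modular[OF nm l3 e(2)]
    have "OL (\<lambda>x. ?g x - gradient \<psi> x)" by (rule OL_mono(1)[OF a2(1) dm(2)]) simp
    moreover have "modular (\<lambda>x. ?g x - gradient \<psi> x) < ?e" using a2(2) by (simp add: modular_def)
    ultimately show "\<exists>\<psi>. test_function \<Omega> \<psi> \<and> OL (\<lambda>x. u x - \<psi> x) \<and> modular (\<lambda>x. u x - \<psi> x) < ?e \<and>
      OL (\<lambda>x. ?g x - gradient \<psi> x) \<and> modular (\<lambda>x. ?g x - gradient \<psi> x) < ?e"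
      using \<psi>(1) a1 by blast
  qed
  from choice[OF this] obtain \<psi> where \<psi>: "\<And>n. test_function \<Omega> (\<psi> n)" "\<And>n. OL (\<lambda>x. u x - \<psi> n x)"
    "\<And>n. modular (\<lambda>x. u x - \<psi> n x) < 1 / real (Suc n)" "\<And>n. OL (\<lambda>x. ?g x - gradient (\<psi> n) x)"
    "\<And>n. modular (\<lambda>x. ?g x - gradient (\<psi> n) x) < 1 / real (Suc n)" by blast
  have "OL u" using OL_add(1)[OF \<psi>(2) OL_test(1)[OF \<psi>(1)], of 0 0] by simp
  moreover have "OL ?g" using OL_add(1)[OF \<psi>(4) OL_test(2)[OF \<psi>(1)], of 0 0] by simp
  moreover have lim: "f \<longlonglongrightarrow> 0" if "\<And>n. 0 \<le> f n" "\<And>n. f n < 1 / real (Suc n)" for f :: "nat \<Rightarrow> real"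
    by (rule tendsto_sandwich[OF _ _ tendsto_const LIMSEQ_Suc[OF lim_1_over_n]])
       (use that in \<open>auto simp: less_imp_le\<close>)
  moreover have "(\<lambda>n. modular (\<lambda>x. \<psi> n x - u x)) \<longlonglongrightarrow> 0"
    using \<psi>(3) modular_minus[of u] by (intro lim modular_nonneg) simp
  moreover have "(\<lambda>n. modular (\<lambda>x. gradient (\<psi> n) x - ?g x)) \<longlonglongrightarrow> 0"
    using \<psi>(5) modular_minus[of ?g] by (intro lim modular_nonneg) simp
  ultimately show ?thesis unfolding X_def using \<psi>(1) by blast
qed

end

section \<open>Consequences of the standing assumptions\<close>

lemma interval_primitive:
  fixes f :: "real \<Rightarrow> real"
  assumes "continuous_on UNIV f"
  shows "((\<lambda>t. LBINT s=ereal 0..ereal t. f s) has_real_derivative f t) (at t)"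
proof -
  \<comment> \<open>Both 0 and t are interior to this interval, so the derivative is two-sided, also
    for t \<le> 0.\<close>
  let ?b = "\<bar>t\<bar> + 1"
  have "((\<lambda>u. LBINT y=ereal 0..ereal u. f y) has_vector_derivative f t) (at t within {-?b..?b})"
    by (rule interval_integral_FTC2) (auto intro: continuous_on_subset[OF assms])
  moreover have "at t within {-?b..?b} = at t"
    by (rule at_within_interior) auto
  ultimately show ?thesis by (simp add: has_real_derivative_iff_has_vector_derivative)
qed

text \<open>The infimum of t \<phi>(t)/\<Phi>(t) serves as p, and any real number above the finite
  supremum as P. Positivity of \<open>Phi a\<close> on t > 0 allows the quotients to be
  cleared.\<close>

lemma standing_imp_orlicz_sobolev:
  fixes \<Omega> :: "(real^'n::finite) set"
  assumes st: "standing_assumptions a" and p: "1 < p_lower a" and \<Omega>: "open \<Omega>" "bounded \<Omega>"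
  obtains P where "orlicz_sobolev a (p_lower a) P \<Omega>"
proof -
  have odd: "phi a (- t) = - phi a t" for t using st by (simp add: standing_assumptions_def)
  have sm: "strict_mono (phi a)" using st by (simp add: standing_assumptions_def)
  obtain \<psi> where h: "homeomorphism UNIV UNIV (phi a) \<psi>" using st by (auto simp: standing_assumptions_def)
  have c: "continuous_on UNIV (phi a)" and c\<psi>: "continuous_on UNIV \<psi>" and i1: "\<psi> (phi a t) = t" and i2: "phi a (\<psi> t) = t" for t
    using h by (auto simp: homeomorphism_def)
  have inv: "inv (phi a) = \<psi>" by (rule inv_equality[OF i1 i2])
  have p0: "phi a 0 = 0" by (simp add: phi_def)
  have pos: "phi a t > 0" if "t > 0" for t using strict_monoD[OF sm that] p0 by simp
  have d: "(Phi a has_real_derivative phi a t) (at t)" for t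
    using interval_primitive[OF c, of t] by (simp add: Phi_def[abs_def])
  have P0: "Phi a 0 = 0" by (simp add: Phi_def)
  have Ppos: "Phi a t > 0" if t: "t > 0" for t
  proof -
    obtain z where z: "0 < z" "z < t" "Phi a t - Phi a 0 = (t - 0) * phi a z"
      using MVT2[of 0 t "Phi a" "phi a"] d t by blast
    then show ?thesis using pos[OF z(1)] t P0 by simp
  qed
  let ?r = "\<lambda>t. t * phi a t / Phi a t"
  have r0: "0 \<le> ?r t" if "t > 0" for t using pos[OF that] Ppos[OF that] that by simp
  have low: "p_lower a * Phi a t \<le> t * phi a t" if t: "t > 0" for t
  proof -
    have "bdd_below (?r ` {0<..})" using r0 by (intro bdd_belowI[of _ 0]) auto
    then have "p_lower a \<le> ?r t" unfolding p_lower_def using t by (intro cINF_lower) auto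
    then show ?thesis using Ppos[OF t] by (simp add: field_simps)
  qed
  have "(SUP t\<in>{0<..}. ereal (?r t)) < \<infinity>" using st by (simp add: standing_assumptions_def)
  then obtain P where P: "(SUP t\<in>{0<..}. ereal (?r t)) < ereal P" using less_PInf_Ex_of_nat by (metis ereal_dense2)
  have up: "t * phi a t \<le> P * Phi a t" if t: "t > 0" for t
  proof -
    have "ereal (?r t) \<le> (SUP t\<in>{0<..}. ereal (?r t))" using t by (intro SUP_upper) auto
    then have "?r t \<le> P" using P by (metis ereal_less_eq(3) less_imp_le order_trans)
    then show ?thesis using Ppos[OF t] by (simp add: field_simps)
  qed
  have even: "Phi a (- t) = Phi a t" for t
  proof -
    have "((\<lambda>t. Phi a (- t) - Phi a t) has_real_derivative 0) (at t)" for t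
      by (rule derivative_eq_intros DERIV_chain2[OF d] d refl)+ (simp add: odd)
    then have "\<forall>t. ((\<lambda>t. Phi a (- t) - Phi a t) has_real_derivative 0) (at t)" by blast
    from DERIV_isconst_all[OF this, of t 0] have "Phi a (- t) - Phi a t = Phi a (- 0) - Phi a 0" .
    then show ?thesis by simp
  qed
  have dc: "(Phi_compl a has_real_derivative inv (phi a) t) (at t)" for t
    using interval_primitive[OF c\<psi>, of t] by (simp add: Phi_compl_def[abs_def] inv)
  have mono: "\<psi> s \<le> \<psi> t" if "s \<le> t" for s t
    using that i2 strict_mono_less_eq[OF sm, of "\<psi> s" "\<psi> t"] by simp
  have "orlicz_sobolev a (p_lower a) P \<Omega>"
  proof
    show "phi a s \<le> phi a t" if "s \<le> t" for s t using that strict_mono_less_eq[OF sm] by simp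
    show "Phi_compl a 0 = 0" by (simp add: Phi_compl_def)
    show "phi a (inv (phi a) t) = t" "inv (phi a) (phi a t) = t" for t by (simp_all add: inv i1 i2)
    show "continuous_on UNIV (inv (phi a))" using c\<psi> by (simp add: inv)
    show "inv (phi a) s \<le> inv (phi a) t" if "s \<le> t" for s t using mono[OF that] by (simp add: inv)
  qed (fact d c p0 P0 pos p low up \<Omega> even dc)+
  then show ?thesis using that by blast
qed

section \<open>The truncated power nonlinearity\<close>

definition trunc_power :: "real \<Rightarrow> real \<Rightarrow> real \<Rightarrow> real" where
  "trunc_power m q s = sgn s * (min \<bar>s\<bar> m) powr (q - 1)"

text \<open>Beyond m the primitive \<bar>s\<bar>^q/q is continued by its tangent, so for q > 1 the
  function remains convex and grows only linearly.\<close>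

definition trunc_primitive :: "real \<Rightarrow> real \<Rightarrow> real \<Rightarrow> real" where
  "trunc_primitive m q s = (min \<bar>s\<bar> m) powr q / q + (min \<bar>s\<bar> m) powr (q - 1) * (\<bar>s\<bar> - min \<bar>s\<bar> m)"

lemma trunc_primitive_minus: "trunc_primitive m q (- s) = trunc_primitive m q s"
  by (simp add: trunc_primitive_def)

lemma power_tangent_line:
  fixes q r t :: real
  assumes "q > 1" "r \<ge> 0" "t \<ge> 0"
  shows "t powr q / q + t powr (q - 1) * (r - t) \<le> r powr q / q"
proof (cases "t = 0")
  case False
  then have "t powr q + q * t powr (q - 1) * (r - t) \<le> r powr q"
    using assms by (intro powr_above_tangent) auto
  then have "(t powr q + q * t powr (q - 1) * (r - t)) / q \<le> r powr q / q"
    using assms by (intro divide_right_mono) auto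
  then show ?thesis using assms by (simp add: add_divide_distrib)
qed (use assms in simp)

text \<open>For \<bar>r\<bar> > m the tangent at t is compared with the power up to m, and with the
  larger slope m^(q-1) from there on. Signs enter only through sgn(s) (r - s) \<le> \<bar>r\<bar> -
  \<bar>s\<bar>.\<close>

lemma trunc_primitive_tangent:
  assumes q: "q > 1" and m: "m \<ge> 0"
  shows "trunc_primitive m q s + trunc_power m q s * (r - s) \<le> trunc_primitive m q r"
proof -
  define t where "t = min \<bar>s\<bar> m"
  have t: "0 \<le> t" "t \<le> m" "t \<le> \<bar>s\<bar>" using m by (auto simp: t_def)
  have tangent: "t powr q / q + t powr (q - 1) * (\<bar>r\<bar> - t) \<le> trunc_primitive m q r"
  proof (cases "\<bar>r\<bar> \<le> m")
    case True
    then show ?thesis using power_tangent_line[OF q _ t(1), of "\<bar>r\<bar>"] by (simp add: trunc_primitive_def)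
  next
    case False
    have 1: "t powr q / q + t powr (q - 1) * (m - t) \<le> m powr q / q"
      by (rule power_tangent_line[OF q m t(1)])
    have "t powr (q - 1) \<le> m powr (q - 1)" using t q by (intro powr_mono2) auto
    then have "t powr (q - 1) * (\<bar>r\<bar> - m) \<le> m powr (q - 1) * (\<bar>r\<bar> - m)" using False by (intro mult_right_mono) auto
    moreover have "t powr (q - 1) * (\<bar>r\<bar> - t) = t powr (q - 1) * (m - t) + t powr (q - 1) * (\<bar>r\<bar> - m)" by (simp add: algebra_simps)
    moreover have "trunc_primitive m q r = m powr q / q + m powr (q - 1) * (\<bar>r\<bar> - m)" using False by (simp add: trunc_primitive_def)
    ultimately show ?thesis using 1 by linarith
  qed
  have "sgn s * (r - s) \<le> \<bar>r\<bar> - \<bar>s\<bar>" by (auto simp: sgn_if)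
  then have "t powr (q - 1) * (sgn s * (r - s)) \<le> t powr (q - 1) * (\<bar>r\<bar> - \<bar>s\<bar>)" by (intro mult_left_mono) auto
  moreover have "trunc_primitive m q s = t powr q / q + t powr (q - 1) * (\<bar>s\<bar> - t)" by (simp add: trunc_primitive_def t_def)
  moreover have "trunc_power m q s * (r - s) = t powr (q - 1) * (sgn s * (r - s))" by (simp add: trunc_power_def t_def mult_ac)
  moreover have "t powr (q - 1) * (\<bar>r\<bar> - t) = t powr (q - 1) * (\<bar>s\<bar> - t) + t powr (q - 1) * (\<bar>r\<bar> - \<bar>s\<bar>)" by (simp add: algebra_simps)
  ultimately show ?thesis using tangent by linarith
qed

text \<open>The exponent Q in place of q - 1 makes the bound uniform in x when q varies; m \<ge> 1
  allows the exponent to be raised.\<close>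

lemma trunc_power_bound:
  assumes "q > 1" "m \<ge> 1" "q \<le> Q" shows "\<bar>trunc_power m q s\<bar> \<le> m powr Q"
proof -
  have "\<bar>trunc_power m q s\<bar> \<le> (min \<bar>s\<bar> m) powr (q - 1)" by (auto simp: trunc_power_def abs_mult sgn_if)
  also have "\<dots> \<le> m powr (q - 1)" using assms by (intro powr_mono2) auto
  also have "\<dots> \<le> m powr Q" using assms by (intro powr_mono) auto
  finally show ?thesis .
qed

lemma trunc_power_small: "\<bar>s\<bar> \<le> m \<Longrightarrow> trunc_power m q s = \<bar>s\<bar> powr (q - 2) * s"
proof -
  assume s: "\<bar>s\<bar> \<le> m"
  have "\<bar>s\<bar> powr (q - 2) * s = sgn s * \<bar>s\<bar> powr (q - 1)" if "s \<noteq> 0"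
  proof -
    have "\<bar>s\<bar> powr (q - 1) = \<bar>s\<bar> powr (q - 2) * \<bar>s\<bar> powr 1" unfolding powr_add[symmetric] by (simp add: algebra_simps)
    then show ?thesis using that by (simp add: sgn_if abs_if)
  qed
  then show ?thesis using s by (cases "s = 0") (simp_all add: trunc_power_def)
qed

section \<open>The eigenvalue problem\<close>

lemma (in young) scaled_energy_negative:
  assumes E: "E \<ge> 0" and b: "b > 0" and q: "q < p"
  obtains t where "0 < t" "t \<le> 1" "t powr p * E < t powr q * b"
proof
  \<comment> \<open>This makes t^(p-q) at most b/(2(E+1)), hence t^(p-q) E < b; the summand 1 covers
    E = 0.\<close>
  define t where "t = min 1 ((b / (2 * (E + 1))) powr (1 / (p - q)))"
  have B: "b / (2 * (E + 1)) > 0" using E b by simp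
  have B': "(b / (2 * (E + 1))) powr (1 / (p - q)) > 0"
    unfolding powr_gt_zero using less_imp_neq[OF B] by (rule not_sym)
  show t: "0 < t" "t \<le> 1" using B' unfolding t_def by linarith+
  have "t powr (p - q) \<le> ((b / (2 * (E + 1))) powr (1 / (p - q))) powr (p - q)"
    using t q by (intro powr_mono2) (auto simp: t_def)
  also have "\<dots> = b / (2 * (E + 1))"
  proof -
    have "1 / (p - q) * (p - q) = 1" using q by simp
    then show ?thesis unfolding powr_powr using powr_one[OF less_imp_le[OF B]] by (simp only:)
  qed
  finally have "t powr (p - q) * E \<le> b / (2 * (E + 1)) * E" using E by (intro mult_right_mono)
  also have "\<dots> < b"
  proof -
    have "b * E < b * (2 * (E + 1))" using b E by (intro mult_strict_left_mono) auto
    then show ?thesis using E by (simp add: pos_divide_less_eq)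
  qed
  finally have "t powr q * (t powr (p - q) * E) < t powr q * b" using t by (intro mult_strict_left_mono) auto
  moreover have "t powr q * t powr (p - q) = t powr p" by (simp add: powr_add[symmetric])
  ultimately show "t powr p * E < t powr q * b" by (simp add: mult.assoc[symmetric])
qed

text \<open>\<open>Phi_compl a\<close> is the primitive of \<open>inv (phi a)\<close>, so the
  barrier is explicit. The constants give it the value 1 at -radius and the value m at
  radius.\<close>

lemma (in orlicz_sobolev) barrier_exists:
  obtains \<omega> \<omega>' m where "\<And>t. (\<omega> has_real_derivative \<omega>' t) (at t)" "continuous_on UNIV \<omega>'"
    "\<And>t. \<bar>t\<bar> \<le> radius \<Longrightarrow> 1 \<le> \<omega> t" "\<And>t. \<bar>t\<bar> \<le> radius \<Longrightarrow> \<omega> t \<le> m"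
    "\<And>t. \<bar>t\<bar> \<le> radius \<Longrightarrow> \<omega>' t \<ge> 0" "\<And>t. \<bar>t\<bar> \<le> radius \<Longrightarrow> phi a (\<omega>' t) = radius - t"
proof (rule that[of "\<lambda>t. 1 + Phi_compl a (2 * radius) - Phi_compl a (radius - t)" "\<lambda>t. inv (phi a) (radius - t)" "1 + Phi_compl a (2 * radius)"])
  show "((\<lambda>t. 1 + Phi_compl a (2 * radius) - Phi_compl a (radius - t)) has_real_derivative inv (phi a) (radius - t)) (at t)" for t
    by (auto intro!: derivative_eq_intros DERIV_chain2[OF Phi_compl_deriv])
  show "continuous_on UNIV (\<lambda>t. inv (phi a) (radius - t))"
    by (intro continuous_on_compose2[OF inv_cont] continuous_intros) auto
  fix t assume "\<bar>t\<bar> \<le> radius"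
  then have t: "0 \<le> radius - t" "radius - t \<le> 2 * radius" by auto
  show "1 \<le> 1 + Phi_compl a (2 * radius) - Phi_compl a (radius - t)" using Phi_compl_mono[OF t] by simp
  show "1 + Phi_compl a (2 * radius) - Phi_compl a (radius - t) \<le> 1 + Phi_compl a (2 * radius)"
    using Phi_compl_mono[OF order_refl t(1)] by simp
  show "inv (phi a) (radius - t) \<ge> 0" using inv_mono[OF t(1)] by simp
qed simp

text \<open>\<open>\<mu> * m powr Q < 1\<close> keeps the truncated right-hand side below that of
  the barrier equation. Since \<open>\<omega>\<close> \<le> m on the relevant range, a solution
  below the barrier does not feel the truncation at m.\<close>

locale power_eigenvalue = orlicz_sobolev a p P \<Omega>
  for a :: "real \<Rightarrow> real" and p P :: real and \<Omega> :: "(real^'n::finite) set" +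
  fixes q :: "real^'n \<Rightarrow> real" and Q m \<mu> :: real and \<omega> \<omega>' :: "real \<Rightarrow> real"
  assumes q_cont: "continuous_on \<Omega> q" and q_gt: "x \<in> \<Omega> \<Longrightarrow> 1 < q x" and q_le: "x \<in> \<Omega> \<Longrightarrow> q x \<le> Q"
    and q_small: "\<exists>x\<in>\<Omega>. q x < p"
    and m: "m \<ge> 1" and \<mu>: "\<mu> > 0" "\<mu> * m powr Q < 1"
    and \<omega>: "(\<omega> has_real_derivative \<omega>' t) (at t)" "continuous_on UNIV \<omega>'"
      "\<bar>t\<bar> \<le> radius \<Longrightarrow> 1 \<le> \<omega> t" "\<bar>t\<bar> \<le> radius \<Longrightarrow> \<omega> t \<le> m"
      "\<bar>t\<bar> \<le> radius \<Longrightarrow> \<omega>' t \<ge> 0" "\<bar>t\<bar> \<le> radius \<Longrightarrow> phi a (\<omega>' t) = radius - t"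
begin

lemma q_measurable: "q \<in> borel_measurable M"
  by (rule measurable_M_continuous[OF q_cont])

sublocale nonlinearity "phi a" "Phi a" p P \<Omega> "\<lambda>x s. \<mu> * trunc_primitive m (q x) s" "\<lambda>x s. \<mu> * trunc_power m (q x) s" "\<mu> * m powr Q"
proof
  fix u :: "real^'n \<Rightarrow> real" assume u: "u \<in> borel_measurable M"
  note [measurable] = u q_measurable
  show "(\<lambda>x. \<mu> * trunc_primitive m (q x) (u x)) \<in> borel_measurable M"
    unfolding trunc_primitive_def by measurable
  show "(\<lambda>x. \<mu> * trunc_power m (q x) (u x)) \<in> borel_measurable M"
    unfolding trunc_power_def by measurable
next
  fix x s r assume x: "x \<in> \<Omega>"
  have "\<mu> * (trunc_primitive m (q x) s + trunc_power m (q x) s * (r - s)) \<le> \<mu> * trunc_primitive m (q x) r"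
    using m \<mu>(1) by (intro mult_left_mono trunc_primitive_tangent q_gt[OF x]) auto
  then show "\<mu> * trunc_primitive m (q x) s + \<mu> * trunc_power m (q x) s * (r - s) \<le> \<mu> * trunc_primitive m (q x) r"
    by (simp add: distrib_left mult.assoc)
  show "\<bar>\<mu> * trunc_power m (q x) s\<bar> \<le> \<mu> * m powr Q"
    using trunc_power_bound[OF q_gt[OF x] m q_le[OF x], of s] \<mu>(1) by (simp add: abs_mult)
  show "\<mu> * trunc_primitive m (q x) 0 = 0"
    using m q_gt[OF x] by (simp add: trunc_primitive_def)
qed (use \<mu>(1) in simp)

lemma J_minus: "J (\<lambda>x. - u x) (\<lambda>x. - g x) = J u g"
  unfolding J_def modular_def by (simp add: trunc_primitive_minus)

lemma minimiser_bounded: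
  assumes X: "X u g" and min: "\<And>v k. X v k \<Longrightarrow> J u g \<le> J v k"
  shows "AE x in M. \<bar>u x\<bar> \<le> m"
proof -
  have X': "X (\<lambda>x. - u x) (\<lambda>x. - g x)" using X_linear_comb[OF X X, of "-1" 0] by simp
  \<comment> \<open>The functional is even, so the barrier also bounds - u. The coordinate
    \<open>undefined\<close> stands for an arbitrary one.\<close>
  have min': "J (\<lambda>x. - u x) (\<lambda>x. - g x) \<le> J v k" if "X v k" for v k using min[OF that] by (simp add: J_minus)
  note B = minimiser_below_barrier[OF _ _ \<mu>(2) \<omega>(1,2,3,5,6)]
  have 1: "AE x in M. u x \<le> \<omega> (x $ undefined)" by (rule B[OF X min])
  have 2: "AE x in M. - u x \<le> \<omega> (x $ undefined)" by (rule B[OF X' min'])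
  show ?thesis
    using 1 2 AE_space
  proof eventually_elim
    fix x assume "u x \<le> \<omega> (x $ undefined)" "- u x \<le> \<omega> (x $ undefined)" "x \<in> space M"
    then show "\<bar>u x\<bar> \<le> m" using \<omega>(4)[OF component_bound[of x undefined]] by simp
  qed
qed

text \<open>For t \<le> 1 the modular of a scaled bump is at most a multiple of t^p, while the G
  term is at least a multiple of t^q1 if the bump lives where q < q1. With q1 < p the second wins
  for small t.\<close>

lemma J_negative: "\<exists>v k. X v k \<and> J v k < 0"
proof -
  obtain x0 where x0: "x0 \<in> \<Omega>" "q x0 < p" using q_small by blast
  \<comment> \<open>Room on both sides: by continuity q stays below q1 near x0, and q1 is still
    below p.\<close>
  obtain q1 where q1: "q x0 < q1" "q1 < p" using dense[OF x0(2)] by blast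
  define U where "U = \<Omega> \<inter> q -` {..<q1}"
  have U: "open U" unfolding U_def by (rule continuous_open_preimage[OF q_cont \<Omega>_open open_lessThan])
  have x0U: "x0 \<in> U" using x0 q1 by (simp add: U_def)
  obtain l r where lr: "x0 \<in> box l r" "cbox l r \<subseteq> U"
    by (rule open_contains_cbox[OF U x0U]) blast
  obtain \<psi> where \<psi>: "\<And>n. test_function U (\<psi> n)" "\<And>n x. 0 \<le> \<psi> n x" "\<And>n x. \<psi> n x \<le> 1"
    "\<And>n x. x \<notin> cbox l r \<Longrightarrow> \<psi> n x = 0" "\<And>x. (\<lambda>n. \<psi> n x) \<longlonglongrightarrow> indicator (box l r) x"
    by (rule box_approximation[OF lr(2)]) blast
  have "\<forall>\<^sub>F n in sequentially. \<psi> n x0 > 0"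
    using \<psi>(5)[of x0] lr(1) by (intro order_tendstoD(1)) auto
  from eventually_happens'[OF sequentially_bot this] obtain n where n: "\<psi> n x0 > 0" by blast
  define \<eta> where "\<eta> = \<psi> n"
  have \<eta>01: "0 \<le> \<eta> x" "\<eta> x \<le> 1" for x using \<psi> by (simp_all add: \<eta>_def)
  have \<eta>U: "\<eta> x = 0" if "x \<notin> U" for x using \<psi>(4) lr(2) that unfolding \<eta>_def by blast
  have \<eta>t: "test_function \<Omega> \<eta>" using \<psi>(1)[of n] unfolding test_function_def U_def \<eta>_def by blast
  have C1: "C1 \<eta>" by (rule test_functionD(1)[OF \<eta>t])
  have \<eta>m: "\<eta> \<in> borel_measurable M" by (rule OL_measurable[OF OL_test(1)[OF \<eta>t]])
  define w where "w x = \<eta> x powr q x / q x" for x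
  have w0: "w x \<ge> 0" if "x \<in> \<Omega>" for x using q_gt[OF that] by (simp add: w_def)
  have wm: "w \<in> borel_measurable M"
    using \<eta>m q_measurable unfolding w_def[abs_def] by measurable
  have w1: "norm (w x) \<le> 1" if "x \<in> \<Omega>" for x
  proof -
    have "\<eta> x powr q x \<le> 1 powr q x" using \<eta>01 q_gt[OF that] by (intro powr_mono2) auto
    then show ?thesis using w0[OF that] q_gt[OF that] by (simp add: w_def field_simps)
  qed
  have iw: "integrable M w" by (rule integrable_M_bounded[OF wm w1])
  define b where "b = (LINT x|M. w x)"
  have b: "b > 0"
  proof -
    have b0: "b \<ge> 0" unfolding b_def using w0 by (intro integral_nonneg_AE AE_I2) simp
    \<comment> \<open>If w vanished almost everywhere, so would \<eta>. Its zero set is closed,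
      hence would contain all of \<open>\<Omega>\<close>, and x0 in particular.\<close>
    have "b \<noteq> 0"
    proof
      assume "b = 0"
      then have "AE x in M. w x = 0"
        using integral_nonneg_eq_0_iff_AE[OF iw AE_I2] w0 by (simp add: b_def)
      then have "AE x in M. x \<in> {x. \<eta> x = 0}"
        using AE_space by eventually_elim (use q_gt in \<open>force simp: w_def\<close>)
      then have "AE x\<in>\<Omega> in lebesgue. x \<in> {x. \<eta> x = 0}" by (subst (asm) AE_restrict_space_iff) auto
      moreover have "closed {x. \<eta> x = 0}"
        using C1_continuous[OF C1, of UNIV] by (intro closed_Collect_eq) (auto intro: continuous_intros)
      ultimately have "x0 \<in> {x. \<eta> x = 0}" using mem_closed_if_AE_lebesgue_open[OF \<Omega>_open] x0(1) by blast
      then show False using n by (simp add: \<eta>_def)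
    qed
    then show ?thesis using b0 by simp
  qed
  obtain t where t: "0 < t" "t \<le> 1" "t powr p * modular (gradient \<eta>) < t powr q1 * (\<mu> * b)"
    using scaled_energy_negative[OF modular_nonneg _ q1(2), of "\<mu> * b" "gradient \<eta>"] \<mu>(1) b by auto
  have X: "X (\<lambda>x. t * \<eta> x) (\<lambda>x. t *\<^sub>R gradient \<eta> x)"
    using X_linear_comb[OF X_test[OF \<eta>t] X_test[OF \<eta>t], of t 0] by simp
  have 1: "modular (\<lambda>x. t *\<^sub>R gradient \<eta> x) \<le> t powr p * modular (gradient \<eta>)"
  proof -
    have i: "integrable M (\<lambda>x. t powr p * Phi a (norm (gradient \<eta> x)))" using OL_test(2)[OF \<eta>t] by (simp add: OL_def)
    have "modular (\<lambda>x. t *\<^sub>R gradient \<eta> x) \<le> (LINT x|M. t powr p * Phi a (norm (gradient \<eta> x)))"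
      using \<Phi>_small[OF t(1,2)] t(1) by (intro OL_dominated(2)[OF OL_measurable[OF X_OL(2)[OF X]] i] AE_I2) simp
    then show ?thesis by (simp add: modular_def)
  qed
  have 2: "t powr q1 * (\<mu> * b) \<le> (LINT x|M. \<mu> * trunc_primitive m (q x) (t * \<eta> x))"
  proof -
    have "(LINT x|M. t powr q1 * (\<mu> * w x)) \<le> (LINT x|M. \<mu> * trunc_primitive m (q x) (t * \<eta> x))"
    proof (rule integral_mono)
      show "integrable M (\<lambda>x. t powr q1 * (\<mu> * w x))" using iw by simp
      show "integrable M (\<lambda>x. \<mu> * trunc_primitive m (q x) (t * \<eta> x))"
        by (rule G_integrable[OF X_integrable(1)[OF X]])
      fix x assume "x \<in> space M"
      then have x: "x \<in> \<Omega>" by simp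
      \<comment> \<open>The values stay below 1 \<le> m, where the truncated primitive is the pure
        power.\<close>
      have "0 \<le> t * \<eta> x" "t * \<eta> x \<le> 1" using \<eta>01[of x] t by (auto intro: mult_le_one)
      then have G: "trunc_primitive m (q x) (t * \<eta> x) = t powr q x * w x"
        using m t \<eta>01 by (simp add: trunc_primitive_def w_def powr_mult)
      \<comment> \<open>On U the exponent q x is the smaller one and t \<le> 1; outside U both sides
        vanish with \<eta>.\<close>
      have "t powr q1 * w x \<le> t powr q x * w x"
      proof (cases "x \<in> U")
        case True
        then have "t powr q1 \<le> t powr q x" using t by (intro powr_mono') (auto simp: U_def)
        then show ?thesis using w0[OF x] by (rule mult_right_mono)
      qed (simp add: w_def \<eta>U)
      then have "\<mu> * (t powr q1 * w x) \<le> \<mu> * (t powr q x * w x)" using \<mu>(1) by (intro mult_left_mono) auto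
      then show "t powr q1 * (\<mu> * w x) \<le> \<mu> * trunc_primitive m (q x) (t * \<eta> x)"
        unfolding G by (simp add: mult.left_commute)
    qed
    then show ?thesis by (simp add: b_def)
  qed
  have "J (\<lambda>x. t * \<eta> x) (\<lambda>x. t *\<^sub>R gradient \<eta> x) < 0" using 1 2 t(3) unfolding J_def by linarith
  then show ?thesis using X by blast
qed

lemma A_eq: "A \<xi> = a (norm \<xi>) *\<^sub>R \<xi>" for \<xi> :: "real^'n"
  by (cases "\<xi> = 0") (simp_all add: A_def phi_def)

lemma eigenvalue: "is_eigenvalue a q \<Omega> \<mu>"
proof -
  obtain u g where X: "X u g" and min: "\<And>v k. X v k \<Longrightarrow> J u g \<le> J v k" using minimiser_exists by blast
  let ?w = "weak_gradient \<Omega>"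
  note W = X_imp_W01[OF X]
  have bounded: "AE x in M. \<bar>u x\<bar> \<le> m" by (rule minimiser_bounded[OF X min])
  have nonzero: "\<not> (AE x in M. u x = 0)"
  proof
    assume z: "AE x in M. u x = 0"
    obtain v k where vk: "X v k" "J v k < 0" using J_negative by blast
    have "(LINT x|M. \<mu> * trunc_primitive m (q x) (u x)) = (LINT x|M. \<mu> * trunc_primitive m (q x) 0)"
    proof (rule integral_cong_AE)
      show "AE x in M. \<mu> * trunc_primitive m (q x) (u x) = \<mu> * trunc_primitive m (q x) 0" using z by eventually_elim simp
    qed (use G_measurable OL_measurable[OF X_OL(1)[OF X]] in auto)
    then have z0: "(LINT x|M. \<mu> * trunc_primitive m (q x) (u x)) = 0" unfolding integral_G_0 .
    have "J u g \<ge> 0" unfolding J_def z0 using modular_nonneg[of g] by simp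
    then show False using min[OF vk(1)] vk(2) by linarith
  qed
  have eq: "integrable M (\<lambda>x. (a (norm (?w u x)) *\<^sub>R ?w u x) \<bullet> ?w v x) \<and>
      integrable M (\<lambda>x. \<bar>u x\<bar> powr (q x - 2) * u x * v x) \<and>
      (LINT x|M. (a (norm (?w u x)) *\<^sub>R ?w u x) \<bullet> ?w v x) - \<mu> * (LINT x|M. \<bar>u x\<bar> powr (q x - 2) * u x * v x) = 0"
    if v: "v \<in> W01_space a \<Omega>" for v
  proof -
    \<comment> \<open>Two representatives of the gradient of u occur, g from the minimisation and
      the chosen \<open>weak_gradient\<close>. The definition of an eigenvalue speaks of the latter,
      the Euler-Lagrange equation of the former; they agree almost everywhere.\<close>
    have Xv: "X v (?w v)" by (rule W01_imp_X[OF v])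
    have Xu: "X u (?w u)" by (rule W01_imp_X[OF W(1)])
    note um = OL_measurable[OF X_OL(1)[OF X]] and vi = X_integrable(1)[OF Xv]
    have i1: "integrable M (\<lambda>x. (a (norm (?w u x)) *\<^sub>R ?w u x) \<bullet> ?w v x)"
      using A_integrable[OF X_OL(2)[OF Xu] X_OL(2)[OF Xv]] unfolding A_eq .
    have ig: "integrable M (\<lambda>x. A (g x) \<bullet> ?w v x)" by (rule A_integrable[OF X_OL(2)[OF X] X_OL(2)[OF Xv]])
    have i2: "integrable M (\<lambda>x. \<mu> * trunc_power m (q x) (u x) * v x)" by (rule \<gamma>_integrable[OF um vi])
    have qm: "(\<lambda>x. \<bar>u x\<bar> powr (q x - 2) * u x * v x) \<in> borel_measurable M"
      using um q_measurable borel_measurable_integrable[OF vi] by measurable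
    \<comment> \<open>Here the bound \<bar>u\<bar> \<le> m removes the truncation.\<close>
    have AE2: "AE x in M. \<mu> * trunc_power m (q x) (u x) * v x = \<mu> * (\<bar>u x\<bar> powr (q x - 2) * u x * v x)"
      using bounded by eventually_elim (simp add: trunc_power_small)
    have "integrable M (\<lambda>x. \<mu> * (\<bar>u x\<bar> powr (q x - 2) * u x * v x))"
      using i2 by (rule integrable_cong_AE_imp) (use qm AE2 in auto)
    then have i3: "integrable M (\<lambda>x. \<bar>u x\<bar> powr (q x - 2) * u x * v x)" using \<mu>(1) by simp
    have "(LINT x|M. (a (norm (?w u x)) *\<^sub>R ?w u x) \<bullet> ?w v x) = (LINT x|M. A (g x) \<bullet> ?w v x)"
    proof (rule integral_cong_AE)
      show "AE x in M. (a (norm (?w u x)) *\<^sub>R ?w u x) \<bullet> ?w v x = A (g x) \<bullet> ?w v x"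
        using W(2) by eventually_elim (simp add: A_eq)
    qed (use i1 ig in auto)
    also have "\<dots> = (LINT x|M. \<mu> * trunc_power m (q x) (u x) * v x)" by (rule euler_lagrange[OF X min Xv])
    also have "\<dots> = (LINT x|M. \<mu> * (\<bar>u x\<bar> powr (q x - 2) * u x * v x))"
      by (rule integral_cong_AE) (use i2 qm AE2 in auto)
    also have "\<dots> = \<mu> * (LINT x|M. \<bar>u x\<bar> powr (q x - 2) * u x * v x)" by simp
    finally show ?thesis using i1 i3 by simp
  qed
  show ?thesis unfolding is_eigenvalue_def using W(1) nonzero eq by blast
qed

end

theorem theorem1:
  fixes \<Omega> :: "(real^'n::finite) set" and a :: "real \<Rightarrow> real" and q :: "real^'n \<Rightarrow> real"
  assumes "CARD('n) \<ge> 3"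
    and "open \<Omega>" and "connected \<Omega>" and "\<Omega> \<noteq> {}" and "bounded \<Omega>" and "smooth_boundary \<Omega>"
    and "standing_assumptions a"
    and "continuous_on (closure \<Omega>) q" and "\<forall>x \<in> closure \<Omega>. q x > 0"
    and "\<exists>L. ((\<lambda>t. LBINT s=ereal t..ereal 1. sobolev_integrand CARD('n) a s) \<longlongrightarrow> L) (at_right 0)"
    and "filterlim (\<lambda>t. LBINT s=ereal 1..ereal t. sobolev_integrand CARD('n) a s) at_top at_top"
    and "1 < (INF x\<in>\<Omega>. q x)" and "(INF x\<in>\<Omega>. q x) < p_lower a"
    and "\<forall>k>0. ((\<lambda>t. \<bar>t\<bar> powr (SUP x\<in>\<Omega>. q x) / Phi_star CARD('n) a (k * t)) \<longlongrightarrow> 0) at_top"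
  shows "\<exists>\<mu>star>0. \<forall>\<mu>\<in>{0<..<\<mu>star}. is_eigenvalue a q \<Omega> \<mu>"
proof -
  \<comment> \<open>The two hypotheses on the infimum of q combine to p_0 > 1, the lower index bound
    that \<open>young\<close> demands.\<close>
  have "1 < p_lower a" using assms(12,13) by linarith
  then obtain P where "orlicz_sobolev a (p_lower a) P \<Omega>"
    using standing_imp_orlicz_sobolev[OF assms(7) _ assms(2,5)] by blast
  then interpret orlicz_sobolev a "p_lower a" P \<Omega> .
  have "compact (q ` closure \<Omega>)"
    using assms(5,8) by (intro compact_continuous_image) (auto simp: compact_closure)
  then have bq: "bounded (q ` closure \<Omega>)" by (rule compact_imp_bounded)
  then obtain Q where Q: "\<And>x. x \<in> \<Omega> \<Longrightarrow> q x \<le> Q"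
    unfolding bounded_iff using closure_subset[of \<Omega>] by (metis abs_le_D1 imageI real_norm_def subsetD)
  have bb: "bdd_below (q ` \<Omega>)"
    using bounded_imp_bdd_below[OF bounded_subset[OF bq image_mono[OF closure_subset]]] .
  have q1: "1 < q x" if "x \<in> \<Omega>" for x
    using assms(12) cINF_lower[OF bb that] by linarith
  \<comment> \<open>An infimum below p_0 yields a point where q is below p_0; around it the bump of
    \<open>J_negative\<close> is placed.\<close>
  have qs: "\<exists>x\<in>\<Omega>. q x < p_lower a"
    using assms(13) cINF_less_iff[OF assms(4) bb] by blast
  obtain \<omega> \<omega>' m where \<omega>: "\<And>t. (\<omega> has_real_derivative \<omega>' t) (at t)" "continuous_on UNIV \<omega>'"
    "\<And>t. \<bar>t\<bar> \<le> radius \<Longrightarrow> 1 \<le> \<omega> t" "\<And>t. \<bar>t\<bar> \<le> radius \<Longrightarrow> \<omega> t \<le> m"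
    "\<And>t. \<bar>t\<bar> \<le> radius \<Longrightarrow> \<omega>' t \<ge> 0" "\<And>t. \<bar>t\<bar> \<le> radius \<Longrightarrow> phi a (\<omega>' t) = radius - t"
    by (rule barrier_exists) blast
  have m: "m \<ge> 1" using \<omega>(3)[of 0] \<omega>(4)[of 0] radius(1) by simp
  have mQ: "m powr Q > 0" using m by simp
  show ?thesis
  proof (intro exI conjI ballI)
    \<comment> \<open>The barrier and its bound m were fixed before \<open>\<mu>\<close>, so one
      threshold serves the whole interval.\<close>
    show "1 / m powr Q > 0" using mQ by simp
    fix \<mu> assume \<mu>: "\<mu> \<in> {0<..<1 / m powr Q}"
    have "power_eigenvalue a (p_lower a) P \<Omega> q Q m \<mu> \<omega> \<omega>'"
    proof
      show "continuous_on \<Omega> q" by (rule continuous_on_subset[OF assms(8) closure_subset])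
      show "\<mu> * m powr Q < 1" using \<mu> mQ by (simp add: field_simps)
      show "\<mu> > 0" using \<mu> by simp
    qed (fact q1 Q qs m \<omega>)+
    then show "is_eigenvalue a q \<Omega> \<mu>" by (rule power_eigenvalue.eigenvalue)
  qed
qed

end
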